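(* Let $\mathscr{Z}=H\mathrm{mod}$ be the braided monoidal category of modules over a quasitriangular Hopf algebra $H$ over a field $k$, and let $B$ be an algebra in $\mathscr{Z}$. (1) Each braided Hochschild cohomology group $H^i_c(B)$ is itself an object in $\mathscr{Z}$. (2) The cohomology $H^\bullet_c(B)$ admits a graded ring structure (induced by the braided cup product) under which it is braided commutative. The two statements also hold for any relative cohomology $H^\bullet_{c,E}(B)$, where $E\subset B$ is a subalgebra in $\mathscr{Z}$.
   Context: $k$ is a field, $\otimes=\otimes_k$, $\Delta(h)=h_1\otimes h_2$ (Sweedler, sums suppressed). $H$ is a quasitriangular Hopf algebra with bijective antipode $S$ and $R$-matrix $R=r_j\otimes r^j$ (sum over $j$ suppressed; $R\Delta(h)=\Delta^{op}(h)R$, $(\Delta\otimes id)(R)=R_{13}R_{23}$, $(id\otimes\Delta)(R)=R_{13}R_{12}$). $\mathscr{Z}=H\mathrm{mod}$ (left modules, action denoted $\cdot$) has braiding $c_{M,N}(m\otimes n)=(r^j\cdot n)\otimes(r_j\cdot m)$. An algebra in $\mathscr{Z}$ is an $H$-module algebra; a subalgebra in $\mathscr{Z}$ is a unital subalgebra which is an $H$-submodule. For $M,N$ in $\mathscr{Z}$, $\underline{\mathrm{Hom}}(M,N)=\mathrm{Hom}_k(M,N)$ with $(h\cdot f)(m)=h_1\cdot f(S(h_2)\cdot m)$. Braided enveloping algebra: $B^{\underline{op}}$ is $B$ with product $b\cdot_{\underline{op}}b'=(r^j\cdot b')(r_j\cdot b)$, and $B^{\underline{e}}=B^{\underline{op}}\underline{\otimes}B$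 is $B\otimes B$ with product $(b\otimes c)(b'\otimes c')=\big(b\cdot_{\underline{op}}(r^j\cdot b')\big)\otimes\big((r_j\cdot c)c'\big)$. $B$ is a right $B^{\underline{e}}$-module by $a(b\otimes b')=(r^j\cdot b)(r_j\cdot a)b'$. $H^\bullet_c(B):=\mathrm{Ext}^\bullet_{\mathrm{mod}B^{\underline e}}(B,B)$. For a subalgebra $E\subset B$ in $\mathscr{Z}$, $\mathscr{B}ar^c_EB$ is the relative bar resolution $\cdots\to B\otimes_E B\otimes_E B\to B\otimes_E B\to 0$ with usual differential and right $B^{\underline e}$-action $(a\otimes x\otimes a')(b\otimes b')=(r^j\cdot b)\big(r_j\cdot(a\otimes x\otimes a')\big)b'$; $H^\bullet_{c,E}(B):=H^\bullet(\mathrm{Hom}_{\mathrm{mod}B^{\underline e}}(\mathscr{B}ar^c_EB,B))$. $\mathscr{Z}$-structure and product: restriction $F\mapsto F(1\otimes-\otimes 1)$ on the bar resolution ($E=k$) identifies $H^\bullet_c(B)$ with the cohomology of the complex $C^\bullet_c(B)$ in $\mathscr{Z}$, where $C^n_c(B)=\underline{\mathrm{Hom}}(B^{\otimes n},B)$ and, for $f$ of degree $n$, $(-1)^{n+1}d_c(f)(b_1\otimes\dots\otimes b_{n+1})=(r^j\cdot b_1)(r_j\cdot f)(b_2\otimes\dots\otimes b_{n+1})+\sum_{i=1}^n(-1)^if(b_1\otimes\dots\otimes b_ib_{i+1}\otimes\dots\otimes b_{n+1})+(-1)^{n+1}f(b_1\otimes\dots\otimes b_n)b_{n+1}$. It similarly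 identifies $H^\bullet_{c,E}(B)$ with the cohomology of the subcomplex $C^\bullet_{c,E}(B)\subset C^\bullet_c(B)$ of maps $f$ which factor through $B^{\otimes_E n}$ (through $E$, $k\to E\to B$, for $n=0$) such that the induced map $B^{\otimes_E n}\to B$ (resp. $E\to B$) satisfies $f(xw)=f(x)w$ and $f(wx)=(r^j\cdot w)(r_j\cdot f)(x)$ for $w\in E$. The braided cup product of $f$ of degree $m$ and $g$ of degree $n$ is $(f\cup g)(x\otimes y)=(-1)^{mn}f(r^j\cdot x)(r_j\cdot g)(y)$, $x\in B^{\otimes m}$, $y\in B^{\otimes n}$. A graded algebra $\Omega$ in $\mathscr{Z}$ is braided commutative if $\omega\omega'=(-1)^{|\omega||\omega'|}(r^j\cdot\omega')(r_j\cdot\omega)$ for all homogeneous $\omega,\omega'$. *)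

theory Defs
  imports Complex_Main "HOL-Library.Multiset" "HOL-Library.Function_Algebras" "HOL-Algebra.Module"
begin

text \<open>
  Conventions. Algebras over a field live on whole types of sort \<open>{ring, monoid_mult}\<close>, that is,
  unital associative rings in which \<open>1 = 0\<close> is allowed; the scalar multiplication is a
  record field. Modules and cohomology groups, which arise as submodules and quotients, use the
  carrier-based records of HOL-Algebra.
\<close>

section \<open>Algebras and tensor powers\<close>

record ('k, 'a) k_alg =
  scl :: "'k \<Rightarrow> 'a \<Rightarrow> 'a"

definition k_algebra :: "('k::field, 'a::{ring,monoid_mult}, 'z) k_alg_scheme \<Rightarrow> bool" where
  "k_algebra A \<longleftrightarrow> vector_space (scl A) \<and>
     (\<forall>c x y. scl A c x * y = scl A c (x * y) \<and> x * scl A c y = scl A c (x * y))"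

definition scalars :: "('k::field, 'a::{ring,monoid_mult}, 'z) k_alg_scheme \<Rightarrow> 'a set" where
  "scalars A = range (\<lambda>c. scl A c 1)"

text \<open>
  A formal sum of pure tensors \<open>a\<^sub>1 \<otimes> \<dots> \<otimes> a\<^sub>n\<close> is a multiset of lists of length \<open>n\<close>, with multiset
  union as addition. For \<open>n \<ge> 1\<close>, \<open>tens_rel E n\<close> is the congruence presenting \<open>A \<otimes>\<^sub>E \<dots> \<otimes>\<^sub>E A\<close>
  (\<open>n\<close> factors) as an abelian group, for a subring \<open>E\<close>; the tensor power over the ground field is
  obtained for \<open>E = scalars A\<close>. It is only used for \<open>n \<ge> 2\<close>.
\<close>

definition fsums :: "nat \<Rightarrow> 'a list multiset set" where
  "fsums n = {p. \<forall>xs \<in># p. length xs = n}"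

inductive_set tens_rel ::
  "'a::{ring,monoid_mult} set \<Rightarrow> nat \<Rightarrow> ('a list multiset \<times> 'a list multiset) set"
  for E :: "'a set" and n :: nat where
  refl: "p \<in> fsums n \<Longrightarrow> (p, p) \<in> tens_rel E n"
| sym: "(p, q) \<in> tens_rel E n \<Longrightarrow> (q, p) \<in> tens_rel E n"
| trans: "(p, q) \<in> tens_rel E n \<Longrightarrow> (q, r) \<in> tens_rel E n \<Longrightarrow> (p, r) \<in> tens_rel E n"
| cong: "(p, q) \<in> tens_rel E n \<Longrightarrow> r \<in> fsums n \<Longrightarrow> (p + r, q + r) \<in> tens_rel E n"
| additive: "length xs + 1 + length ys = n \<Longrightarrow>
    ({# xs @ (a + b) # ys #}, {# xs @ a # ys, xs @ b # ys #}) \<in> tens_rel E n"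
| zero: "length xs + 1 + length ys = n \<Longrightarrow> ({# xs @ 0 # ys #}, {#}) \<in> tens_rel E n"
| balanced: "e \<in> E \<Longrightarrow> length xs + 2 + length ys = n \<Longrightarrow>
    ({# xs @ (a * e) # b # ys #}, {# xs @ a # (e * b) # ys #}) \<in> tens_rel E n"

definition tens :: "'a::{ring,monoid_mult} set \<Rightarrow> nat \<Rightarrow> 'a list multiset set set" where
  "tens E n = fsums n // tens_rel E n"

definition tclass :: "'a::{ring,monoid_mult} set \<Rightarrow> nat \<Rightarrow> 'a list multiset \<Rightarrow> 'a list multiset set" where
  "tclass E n p = tens_rel E n `` {p}"

text \<open>Componentwise product of formal sums, i.e. the product of the algebra \<open>A\<^sup>\<otimes>\<^sup>n\<close>.\<close>

definition tmul :: "'a::{ring,monoid_mult} list multiset \<Rightarrow> 'a list multiset \<Rightarrow> 'a list multiset" where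
  "tmul p q = (\<Sum>xs\<in>#p. \<Sum>ys\<in>#q. {# map2 (*) xs ys #})"

section \<open>Quasitriangular Hopf algebras and their module algebras\<close>

text \<open>
  Sweedler notation is made literal: \<open>comult H h\<close> lists pairs \<open>(h\<^sub>1, h\<^sub>2)\<close> with
  \<open>\<Delta>(h) = \<Sum> h\<^sub>1 \<otimes> h\<^sub>2\<close>, and \<open>rmatrix H\<close> lists the pairs \<open>(r\<^sub>j, r\<^sup>j)\<close> with \<open>R = \<Sum> r\<^sub>j \<otimes> r\<^sup>j\<close>.
  These are chosen representatives; all axioms are equalities in tensor powers of \<open>H\<close>.
\<close>

record ('k, 'h) qt_hopf = "('k, 'h) k_alg" +
  comult :: "'h \<Rightarrow> ('h \<times> 'h) list"
  counit :: "'h \<Rightarrow> 'k"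
  antipode :: "'h \<Rightarrow> 'h"
  rmatrix :: "('h \<times> 'h) list"

abbreviation teq :: "('k::field, 'h::{ring,monoid_mult}, 'z) qt_hopf_scheme \<Rightarrow> nat \<Rightarrow>
    'h list multiset \<Rightarrow> 'h list multiset \<Rightarrow> bool" where
  "teq H n p q \<equiv> (p, q) \<in> tens_rel (scalars H) n"

definition \<Delta>t :: "('k::field, 'h::{ring,monoid_mult}, 'z) qt_hopf_scheme \<Rightarrow> 'h \<Rightarrow> 'h list multiset" where
  "\<Delta>t H h = (\<Sum>(a, b) \<leftarrow> comult H h. {# [a, b] #})"

definition Rt :: "('k::field, 'h::{ring,monoid_mult}, 'z) qt_hopf_scheme \<Rightarrow> 'h list multiset" where
  "Rt H = (\<Sum>(s, t) \<leftarrow> rmatrix H. {# [s, t] #})"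

definition R12 :: "('k::field, 'h::{ring,monoid_mult}, 'z) qt_hopf_scheme \<Rightarrow> 'h list multiset" where
  "R12 H = (\<Sum>(s, t) \<leftarrow> rmatrix H. {# [s, t, 1] #})"

definition R13 :: "('k::field, 'h::{ring,monoid_mult}, 'z) qt_hopf_scheme \<Rightarrow> 'h list multiset" where
  "R13 H = (\<Sum>(s, t) \<leftarrow> rmatrix H. {# [s, 1, t] #})"

definition R23 :: "('k::field, 'h::{ring,monoid_mult}, 'z) qt_hopf_scheme \<Rightarrow> 'h list multiset" where
  "R23 H = (\<Sum>(s, t) \<leftarrow> rmatrix H. {# [1, s, t] #})"

definition bialgebra :: "('k::field, 'h::{ring,monoid_mult}, 'z) qt_hopf_scheme \<Rightarrow> bool" where
  "bialgebra H \<longleftrightarrow> k_algebra H \<and>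
     (\<forall>g h. teq H 2 (\<Delta>t H (g + h)) (\<Delta>t H g + \<Delta>t H h)) \<and>
     (\<forall>c h. teq H 2 (\<Delta>t H (scl H c h)) (\<Sum>(a, b) \<leftarrow> comult H h. {# [scl H c a, b] #})) \<and>
     (\<forall>g h. teq H 2 (\<Delta>t H (g * h)) (tmul (\<Delta>t H g) (\<Delta>t H h))) \<and>
     teq H 2 (\<Delta>t H 1) {# [1, 1] #} \<and>
     (\<forall>h. teq H 3 (\<Sum>(a, b) \<leftarrow> comult H h. \<Sum>(c, d) \<leftarrow> comult H a. {# [c, d, b] #})
                  (\<Sum>(a, b) \<leftarrow> comult H h. \<Sum>(c, d) \<leftarrow> comult H b. {# [a, c, d] #})) \<and>
     (\<forall>g h. counit H (g + h) = counit H g + counit H h) \<and>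
     (\<forall>c h. counit H (scl H c h) = c * counit H h) \<and>
     (\<forall>g h. counit H (g * h) = counit H g * counit H h) \<and>
     counit H 1 = 1 \<and>
     (\<forall>h. (\<Sum>(a, b) \<leftarrow> comult H h. scl H (counit H a) b) = h) \<and>
     (\<forall>h. (\<Sum>(a, b) \<leftarrow> comult H h. scl H (counit H b) a) = h)"

definition hopf_algebra :: "('k::field, 'h::{ring,monoid_mult}, 'z) qt_hopf_scheme \<Rightarrow> bool" where
  "hopf_algebra H \<longleftrightarrow> bialgebra H \<and>
     (\<forall>g h. antipode H (g + h) = antipode H g + antipode H h) \<and>
     (\<forall>c h. antipode H (scl H c h) = scl H c (antipode H h)) \<and>
     (\<forall>h. (\<Sum>(a, b) \<leftarrow> comult H h. antipode H a * b) = scl H (counit H h) 1) \<and>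
     (\<forall>h. (\<Sum>(a, b) \<leftarrow> comult H h. a * antipode H b) = scl H (counit H h) 1)"

definition quasitriangular_hopf_algebra ::
    "('k::field, 'h::{ring,monoid_mult}, 'z) qt_hopf_scheme \<Rightarrow> bool" where
  "quasitriangular_hopf_algebra H \<longleftrightarrow> hopf_algebra H \<and>
     (\<exists>Q \<in> fsums 2. teq H 2 (tmul (Rt H) Q) {# [1, 1] #} \<and> teq H 2 (tmul Q (Rt H)) {# [1, 1] #}) \<and>
     (\<forall>h. teq H 2 (tmul (Rt H) (\<Delta>t H h))
                  (tmul (\<Sum>(a, b) \<leftarrow> comult H h. {# [b, a] #}) (Rt H))) \<and>
     teq H 3 (\<Sum>(s, t) \<leftarrow> rmatrix H. \<Sum>(a, b) \<leftarrow> comult H s. {# [a, b, t] #}) (tmul (R13 H) (R23 H)) \<and>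
     teq H 3 (\<Sum>(s, t) \<leftarrow> rmatrix H. \<Sum>(a, b) \<leftarrow> comult H t. {# [s, a, b] #}) (tmul (R13 H) (R12 H))"

record ('k, 'h, 'b) hmod_alg = "('k, 'b) k_alg" +
  act :: "'h \<Rightarrow> 'b \<Rightarrow> 'b"

text \<open>Algebras in the category of left \<open>H\<close>-modules.\<close>

definition module_algebra :: "('k::field, 'h::{ring,monoid_mult}) qt_hopf \<Rightarrow>
    ('k, 'h, 'b::{ring,monoid_mult}) hmod_alg \<Rightarrow> bool" where
  "module_algebra H B \<longleftrightarrow> k_algebra B \<and>
     (\<forall>g h x. act B (g + h) x = act B g x + act B h x) \<and>
     (\<forall>h x y. act B h (x + y) = act B h x + act B h y) \<and>
     (\<forall>c h x. act B (scl H c h) x = scl B c (act B h x)) \<and>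
     (\<forall>c h x. act B h (scl B c x) = scl B c (act B h x)) \<and>
     (\<forall>g h x. act B (g * h) x = act B g (act B h x)) \<and>
     (\<forall>x. act B 1 x = x) \<and>
     (\<forall>h. act B h 1 = scl B (counit H h) 1) \<and>
     (\<forall>h x y. act B h (x * y) = (\<Sum>(a, b) \<leftarrow> comult H h. act B a x * act B b y))"

definition subalgebra_in_Z :: "('k::field, 'h::{ring,monoid_mult}, 'b::{ring,monoid_mult}) hmod_alg \<Rightarrow>
    'b set \<Rightarrow> bool" where
  "subalgebra_in_Z B E \<longleftrightarrow> 1 \<in> E \<and> (\<forall>x\<in>E. \<forall>y\<in>E. x + y \<in> E \<and> x * y \<in> E) \<and>
     (\<forall>c. \<forall>x\<in>E. scl B c x \<in> E) \<and> (\<forall>h. \<forall>x\<in>E. act B h x \<in> E)"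

text \<open>
  The diagonal action \<open>h \<cdot> (x\<^sub>1 \<otimes> \<dots> \<otimes> x\<^sub>n) = h\<^sub>1 x\<^sub>1 \<otimes> \<dots> \<otimes> h\<^sub>n x\<^sub>n\<close> for \<open>n \<ge> 1\<close>
  (the value at the empty list is junk and unused).
\<close>

fun tact :: "('k::field, 'h::{ring,monoid_mult}) qt_hopf \<Rightarrow>
    ('k, 'h, 'b::{ring,monoid_mult}) hmod_alg \<Rightarrow> 'h \<Rightarrow> 'b list \<Rightarrow> 'b list multiset" where
  "tact H B h [] = {# [] #}"
| "tact H B h [x] = {# [act B h x] #}"
| "tact H B h (x # y # ys) =
     (\<Sum>(a, b) \<leftarrow> comult H h. image_mset ((#) (act B a x)) (tact H B b (y # ys)))"

section \<open>The braided enveloping algebra and its right modules\<close>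

text \<open>
  Right modules over a (not necessarily commutative) ring \<open>R\<close> are represented by the record
  \<^typ>\<open>('r, 'm) module\<close>, where \<open>r \<odot>\<^bsub>M\<^esub> x\<close> stands for \<open>x \<cdot> r\<close>. The multiplicative fields of the
  record are not used.
\<close>

definition right_module :: "'r ring \<Rightarrow> ('r, 'm) module \<Rightarrow> bool" where
  "right_module R M \<longleftrightarrow> abelian_group M \<and>
     (\<forall>r\<in>carrier R. \<forall>x\<in>carrier M. r \<odot>\<^bsub>M\<^esub> x \<in> carrier M) \<and>
     (\<forall>r\<in>carrier R. \<forall>x\<in>carrier M. \<forall>y\<in>carrier M.
        r \<odot>\<^bsub>M\<^esub> (x \<oplus>\<^bsub>M\<^esub> y) = r \<odot>\<^bsub>M\<^esub> x \<oplus>\<^bsub>M\<^esub> r \<odot>\<^bsub>M\<^esub> y) \<and>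
     (\<forall>r\<in>carrier R. \<forall>s\<in>carrier R. \<forall>x\<in>carrier M.
        (r \<oplus>\<^bsub>R\<^esub> s) \<odot>\<^bsub>M\<^esub> x = r \<odot>\<^bsub>M\<^esub> x \<oplus>\<^bsub>M\<^esub> s \<odot>\<^bsub>M\<^esub> x) \<and>
     (\<forall>r\<in>carrier R. \<forall>s\<in>carrier R. \<forall>x\<in>carrier M.
        (r \<otimes>\<^bsub>R\<^esub> s) \<odot>\<^bsub>M\<^esub> x = s \<odot>\<^bsub>M\<^esub> (r \<odot>\<^bsub>M\<^esub> x)) \<and>
     (\<forall>x\<in>carrier M. \<one>\<^bsub>R\<^esub> \<odot>\<^bsub>M\<^esub> x = x)"

definition right_hom :: "'r ring \<Rightarrow> ('r, 'm) module \<Rightarrow> ('r, 'n) module \<Rightarrow> ('m \<Rightarrow> 'n) set" where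
  "right_hom R M N = {f. f \<in> carrier M \<rightarrow> carrier N \<and>
     (\<forall>x\<in>carrier M. \<forall>y\<in>carrier M. f (x \<oplus>\<^bsub>M\<^esub> y) = f x \<oplus>\<^bsub>N\<^esub> f y) \<and>
     (\<forall>r\<in>carrier R. \<forall>x\<in>carrier M. f (r \<odot>\<^bsub>M\<^esub> x) = r \<odot>\<^bsub>N\<^esub> f x)}"

text \<open>
  \<open>M\<close> is projective if it is a direct summand of a free module; equivalently, the canonical
  surjection \<open>R\<^sup>(\<^sup>M\<^sup>) \<rightarrow> M\<close> has an \<open>R\<close>-linear section \<open>\<sigma>\<close>, \<open>\<sigma> x q\<close> being the \<open>q\<close>-th coordinate
  of \<open>\<sigma> x\<close>.
\<close>

definition projective_right_module :: "'r ring \<Rightarrow> ('r, 'm) module \<Rightarrow> bool" where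
  "projective_right_module R M \<longleftrightarrow> right_module R M \<and>
     (\<exists>\<sigma> :: 'm \<Rightarrow> 'm \<Rightarrow> 'r.
       (\<forall>x\<in>carrier M. \<forall>q\<in>carrier M. \<sigma> x q \<in> carrier R) \<and>
       (\<forall>x\<in>carrier M. finite {q \<in> carrier M. \<sigma> x q \<noteq> \<zero>\<^bsub>R\<^esub>}) \<and>
       (\<forall>x\<in>carrier M. \<forall>y\<in>carrier M. \<forall>q\<in>carrier M. \<sigma> (x \<oplus>\<^bsub>M\<^esub> y) q = \<sigma> x q \<oplus>\<^bsub>R\<^esub> \<sigma> y q) \<and>
       (\<forall>r\<in>carrier R. \<forall>x\<in>carrier M. \<forall>q\<in>carrier M. \<sigma> (r \<odot>\<^bsub>M\<^esub> x) q = \<sigma> x q \<otimes>\<^bsub>R\<^esub> r) \<and>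
       (\<forall>x\<in>carrier M. x = (\<Oplus>\<^bsub>M\<^esub>q\<in>{q \<in> carrier M. \<sigma> x q \<noteq> \<zero>\<^bsub>R\<^esub>}. \<sigma> x q \<odot>\<^bsub>M\<^esub> q)))"

text \<open>\<open>\<dots> \<rightarrow> P 1 \<rightarrow> P 0 \<rightarrow> M \<rightarrow> 0\<close> with differentials \<open>d n : P (n + 1) \<rightarrow> P n\<close> and augmentation \<open>\<eta>\<close>.\<close>

definition projective_resolution :: "'r ring \<Rightarrow> ('r, 'm) module \<Rightarrow> (nat \<Rightarrow> ('r, 'p) module) \<Rightarrow>
    (nat \<Rightarrow> 'p \<Rightarrow> 'p) \<Rightarrow> ('p \<Rightarrow> 'm) \<Rightarrow> bool" where
  "projective_resolution R M P d \<eta> \<longleftrightarrow>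
     (\<forall>n. projective_right_module R (P n)) \<and>
     (\<forall>n. d n \<in> right_hom R (P (Suc n)) (P n)) \<and>
     \<eta> \<in> right_hom R (P 0) M \<and>
     \<eta> ` carrier (P 0) = carrier M \<and>
     {x \<in> carrier (P 0). \<eta> x = \<zero>\<^bsub>M\<^esub>} = d 0 ` carrier (P 1) \<and>
     (\<forall>n. {x \<in> carrier (P (Suc n)). d n x = \<zero>\<^bsub>P n\<^esub>} = d (Suc n) ` carrier (P (Suc (Suc n))))"

definition op_mult :: "('k::field, 'h::{ring,monoid_mult}) qt_hopf \<Rightarrow>
    ('k, 'h, 'b::{ring,monoid_mult}) hmod_alg \<Rightarrow> 'b \<Rightarrow> 'b \<Rightarrow> 'b" where
  "op_mult H B b b' = (\<Sum>(s, t) \<leftarrow> rmatrix H. act B t b' * act B s b)"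

definition env_mult :: "('k::field, 'h::{ring,monoid_mult}) qt_hopf \<Rightarrow>
    ('k, 'h, 'b::{ring,monoid_mult}) hmod_alg \<Rightarrow> 'b list multiset \<Rightarrow> 'b list multiset \<Rightarrow> 'b list multiset" where
  "env_mult H B u v = (\<Sum>us\<in>#u. \<Sum>vs\<in>#v. \<Sum>(s, t) \<leftarrow> rmatrix H.
     {# [op_mult H B (us ! 0) (act B t (vs ! 0)), act B s (us ! 1) * vs ! 1] #})"

definition env_alg :: "('k::field, 'h::{ring,monoid_mult}) qt_hopf \<Rightarrow>
    ('k, 'h, 'b::{ring,monoid_mult}) hmod_alg \<Rightarrow> 'b list multiset set ring" where
  "env_alg H B = \<lparr>carrier = tens (scalars B) 2,
     mult = (\<lambda>X Y. \<Union>u\<in>X. \<Union>v\<in>Y. tclass (scalars B) 2 (env_mult H B u v)),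
     one = tclass (scalars B) 2 {# [1, 1] #},
     zero = tclass (scalars B) 2 {#},
     add = (\<lambda>X Y. \<Union>u\<in>X. \<Union>v\<in>Y. tclass (scalars B) 2 (u + v))\<rparr>"

text \<open>
  \<open>B\<close> as right module over its braided enveloping algebra. The value \<open>a \<cdot> u\<close> is the
  common value of the formula on all representatives of the class \<open>u\<close>.
\<close>

definition reg_mod :: "('k::field, 'h::{ring,monoid_mult}) qt_hopf \<Rightarrow>
    ('k, 'h, 'b::{ring,monoid_mult}) hmod_alg \<Rightarrow> ('b list multiset set, 'b) module" where
  "reg_mod H B = \<lparr>carrier = UNIV, mult = undefined, one = undefined, zero = 0, add = (+),
     smult = (\<lambda>U a. the_elem
       ((\<lambda>u. \<Sum>us\<in>#u. \<Sum>(s, t) \<leftarrow> rmatrix H. act B t (us ! 0) * act B s a * us ! 1) ` U))\<rparr>"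

section \<open>The relative bar resolution\<close>

definition lmult :: "'b::{ring,monoid_mult} \<Rightarrow> 'b list \<Rightarrow> 'b list" where
  "lmult b xs = (b * hd xs) # tl xs"

definition rmult :: "'b::{ring,monoid_mult} list \<Rightarrow> 'b \<Rightarrow> 'b list" where
  "rmult xs b = butlast xs @ [last xs * b]"

text \<open>\<open>contract i\<close> multiplies the adjacent entries with indices \<open>i\<close> and \<open>i + 1\<close>, counted from 0.\<close>

definition contract :: "nat \<Rightarrow> 'b::{ring,monoid_mult} list \<Rightarrow> 'b list" where
  "contract i xs = take i xs @ (xs ! i * xs ! Suc i) # drop (i + 2) xs"

definition signed :: "nat \<Rightarrow> 'a::ab_group_add \<Rightarrow> 'a" where
  "signed i x = (if even i then x else - x)"

definition bar_act :: "('k::field, 'h::{ring,monoid_mult}) qt_hopf \<Rightarrow>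
    ('k, 'h, 'b::{ring,monoid_mult}) hmod_alg \<Rightarrow> 'b list multiset \<Rightarrow> 'b list multiset \<Rightarrow> 'b list multiset" where
  "bar_act H B p u = (\<Sum>xs\<in>#p. \<Sum>us\<in>#u. \<Sum>(s, t) \<leftarrow> rmatrix H. \<Sum>ys\<in>#tact H B s xs.
     {# rmult (lmult (act B t (us ! 0)) ys) (us ! 1) #})"

text \<open>In degree \<open>n\<close> the bar resolution is the \<open>(n + 2)\<close>-nd tensor power of \<open>B\<close> over \<open>E\<close>.\<close>

definition bar :: "('k::field, 'h::{ring,monoid_mult}) qt_hopf \<Rightarrow>
    ('k, 'h, 'b::{ring,monoid_mult}) hmod_alg \<Rightarrow> 'b set \<Rightarrow> nat \<Rightarrow>
    ('b list multiset set, 'b list multiset set) module" where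
  "bar H B E n = \<lparr>carrier = tens E (n + 2), mult = undefined, one = undefined,
     zero = tclass E (n + 2) {#},
     add = (\<lambda>X Y. \<Union>p\<in>X. \<Union>q\<in>Y. tclass E (n + 2) (p + q)),
     smult = (\<lambda>U X. \<Union>u\<in>U. \<Union>p\<in>X. tclass E (n + 2) (bar_act H B p u))\<rparr>"

text \<open>The sign of each summand is absorbed into the first tensor factor.\<close>

definition bar_diff :: "'b::{ring,monoid_mult} set \<Rightarrow> nat \<Rightarrow> 'b list multiset set \<Rightarrow> 'b list multiset set" where
  "bar_diff E n X = (\<Union>p\<in>X. tclass E (n + 2)
     (\<Sum>xs\<in>#p. \<Sum>i\<le>Suc n. {# lmult (signed i 1) (contract i xs) #}))"

definition bar_aug :: "'b::{ring,monoid_mult} list multiset set \<Rightarrow> 'b" where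
  "bar_aug X = the_elem ((\<lambda>p. \<Sum>xs\<in>#p. xs ! 0 * xs ! 1) ` X)"

section \<open>Cohomology of cochain complexes\<close>

text \<open>Complexes in degrees \<open>0, 1, 2, \<dots>\<close> of subgroups of one additive group.\<close>

record 'c cochain_cx =
  cochains :: "nat \<Rightarrow> 'c set"
  cdiff :: "nat \<Rightarrow> 'c \<Rightarrow> 'c"

definition cocycles :: "'c::ab_group_add cochain_cx \<Rightarrow> nat \<Rightarrow> 'c set" where
  "cocycles K n = {f \<in> cochains K n. cdiff K n f = 0}"

definition coboundaries :: "'c::ab_group_add cochain_cx \<Rightarrow> nat \<Rightarrow> 'c set" where
  "coboundaries K n = (case n of 0 \<Rightarrow> {0} | Suc m \<Rightarrow> cdiff K m ` cochains K m)"

definition coh_rel :: "'c::ab_group_add cochain_cx \<Rightarrow> nat \<Rightarrow> ('c \<times> 'c) set" where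
  "coh_rel K n = {(f, g). f \<in> cocycles K n \<and> g \<in> cocycles K n \<and> f - g \<in> coboundaries K n}"

definition coh :: "'c::ab_group_add cochain_cx \<Rightarrow> nat \<Rightarrow> 'c set set" where
  "coh K n = cocycles K n // coh_rel K n"

definition coh_class :: "'c::ab_group_add cochain_cx \<Rightarrow> nat \<Rightarrow> 'c \<Rightarrow> 'c set" where
  "coh_class K n f = coh_rel K n `` {f}"

definition coh_map :: "'c::ab_group_add cochain_cx \<Rightarrow> nat \<Rightarrow> ('d \<Rightarrow> 'c) \<Rightarrow> 'd set \<Rightarrow> 'c set" where
  "coh_map K n \<theta> X = (\<Union>f\<in>X. coh_class K n (\<theta> f))"

text \<open>
  The complex \<open>Hom(P, B)\<close> of right module maps over the braided enveloping algebra, normalised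
  to vanish off the carrier. Its cohomology is \<open>Ext(B, B)\<close> if \<open>P\<close> is a projective resolution of
  \<open>B\<close>, and the relative cohomology if \<open>P\<close> is the relative bar resolution.
\<close>

definition Hom_cx :: "('k::field, 'h::{ring,monoid_mult}) qt_hopf \<Rightarrow>
    ('k, 'h, 'b::{ring,monoid_mult}) hmod_alg \<Rightarrow> (nat \<Rightarrow> ('b list multiset set, 'p) module) \<Rightarrow>
    (nat \<Rightarrow> 'p \<Rightarrow> 'p) \<Rightarrow> ('p \<Rightarrow> 'b) cochain_cx" where
  "Hom_cx H B P d = \<lparr>
     cochains = (\<lambda>n. {f \<in> right_hom (env_alg H B) (P n) (reg_mod H B). \<forall>x. x \<notin> carrier (P n) \<longrightarrow> f x = 0}),
     cdiff = (\<lambda>n f x. if x \<in> carrier (P (Suc n)) then f (d n x) else 0)\<rparr>"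

section \<open>The complexes of braided Hochschild cochains\<close>

text \<open>
  A linear map \<open>f : B\<^sup>\<otimes>\<^sup>n \<rightarrow> B\<close> is represented by the corresponding multilinear function on lists of
  length \<open>n\<close>, extended by zero to other lists; for \<open>n = 0\<close> it is the element \<open>f []\<close> of \<open>B\<close>.
\<close>

definition multilin :: "('k::field, 'h::{ring,monoid_mult}, 'b::{ring,monoid_mult}) hmod_alg \<Rightarrow> nat \<Rightarrow>
    ('b list \<Rightarrow> 'b) set" where
  "multilin B n = {f. (\<forall>xs. length xs \<noteq> n \<longrightarrow> f xs = 0) \<and>
     (\<forall>xs ys a b. length xs + 1 + length ys = n \<longrightarrow>
        f (xs @ (a + b) # ys) = f (xs @ a # ys) + f (xs @ b # ys)) \<and>
     (\<forall>xs ys c a. length xs + 1 + length ys = n \<longrightarrow>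
        f (xs @ scl B c a # ys) = scl B c (f (xs @ a # ys)))}"

text \<open>\<open>f (h \<cdot> xs)\<close>; the empty tensor spans the unit object \<open>k\<close>, on which \<open>H\<close> acts by the counit.\<close>

definition eval_act :: "('k::field, 'h::{ring,monoid_mult}) qt_hopf \<Rightarrow>
    ('k, 'h, 'b::{ring,monoid_mult}) hmod_alg \<Rightarrow> ('b list \<Rightarrow> 'b) \<Rightarrow> 'h \<Rightarrow> 'b list \<Rightarrow> 'b" where
  "eval_act H B f h xs =
     (if xs = [] then scl B (counit H h) (f []) else (\<Sum>ys\<in>#tact H B h xs. f ys))"

text \<open>The action \<open>(h \<cdot> f)(x) = h\<^sub>1 \<cdot> f(S(h\<^sub>2) \<cdot> x)\<close> on the inner Hom.\<close>

definition cochain_act :: "('k::field, 'h::{ring,monoid_mult}) qt_hopf \<Rightarrow>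
    ('k, 'h, 'b::{ring,monoid_mult}) hmod_alg \<Rightarrow> 'h \<Rightarrow> ('b list \<Rightarrow> 'b) \<Rightarrow> 'b list \<Rightarrow> 'b" where
  "cochain_act H B h f xs = (\<Sum>(a, b) \<leftarrow> comult H h. act B a (eval_act H B f (antipode H b) xs))"

definition dc :: "('k::field, 'h::{ring,monoid_mult}) qt_hopf \<Rightarrow>
    ('k, 'h, 'b::{ring,monoid_mult}) hmod_alg \<Rightarrow> nat \<Rightarrow> ('b list \<Rightarrow> 'b) \<Rightarrow> 'b list \<Rightarrow> 'b" where
  "dc H B n f xs = (if length xs = Suc n then
       signed (Suc n)
         ((\<Sum>(s, t) \<leftarrow> rmatrix H. act B t (hd xs) * cochain_act H B s f (tl xs))
          + (\<Sum>i=1..n. signed i (f (contract (i - 1) xs)))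
          + signed (Suc n) (f (butlast xs) * last xs))
     else 0)"

definition cup :: "('k::field, 'h::{ring,monoid_mult}) qt_hopf \<Rightarrow>
    ('k, 'h, 'b::{ring,monoid_mult}) hmod_alg \<Rightarrow> nat \<Rightarrow> nat \<Rightarrow>
    ('b list \<Rightarrow> 'b) \<Rightarrow> ('b list \<Rightarrow> 'b) \<Rightarrow> 'b list \<Rightarrow> 'b" where
  "cup H B m n f g xs = (if length xs = m + n then
       signed (m * n) (\<Sum>(s, t) \<leftarrow> rmatrix H.
         eval_act H B f t (take m xs) * cochain_act H B s g (drop m xs))
     else 0)"

definition unit_cochain :: "'b::{ring,monoid_mult} list \<Rightarrow> 'b" where
  "unit_cochain xs = (if xs = [] then 1 else 0)"

definition C_cx :: "('k::field, 'h::{ring,monoid_mult}) qt_hopf \<Rightarrow>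
    ('k, 'h, 'b::{ring,monoid_mult}) hmod_alg \<Rightarrow> ('b list \<Rightarrow> 'b) cochain_cx" where
  "C_cx H B = \<lparr>cochains = multilin B, cdiff = dc H B\<rparr>"

text \<open>
  Relative cochains. In degree 0 the induced map is a \<open>k\<close>-linear \<open>g : E \<rightarrow> B\<close> with \<open>g 1 = f []\<close>, and
  \<open>(r\<^sub>j \<cdot> g)(x)\<close> is written out; in positive degrees it suffices to test on pure tensors.
\<close>

definition rel_cochains :: "('k::field, 'h::{ring,monoid_mult}) qt_hopf \<Rightarrow>
    ('k, 'h, 'b::{ring,monoid_mult}) hmod_alg \<Rightarrow> 'b set \<Rightarrow> nat \<Rightarrow> ('b list \<Rightarrow> 'b) set" where
  "rel_cochains H B E n = {f \<in> multilin B n.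
     (if n = 0 then
        (\<exists>g. g 1 = f [] \<and>
           (\<forall>x\<in>E. \<forall>y\<in>E. g (x + y) = g x + g y) \<and> (\<forall>c. \<forall>x\<in>E. g (scl B c x) = scl B c (g x)) \<and>
           (\<forall>x\<in>E. \<forall>w\<in>E. g (x * w) = g x * w) \<and>
           (\<forall>x\<in>E. \<forall>w\<in>E. g (w * x) = (\<Sum>(s, t) \<leftarrow> rmatrix H. act B t w *
              (\<Sum>(a, b) \<leftarrow> comult H s. act B a (g (act B (antipode H b) x))))))
      else
        (\<forall>xs ys a b. \<forall>w\<in>E. length xs + 2 + length ys = n \<longrightarrow>
           f (xs @ (a * w) # b # ys) = f (xs @ a # (w * b) # ys)) \<and>
        (\<forall>xs. \<forall>w\<in>E. length xs = n \<longrightarrow> f (rmult xs w) = f xs * w) \<and>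
        (\<forall>xs. \<forall>w\<in>E. length xs = n \<longrightarrow>
           f (lmult w xs) = (\<Sum>(s, t) \<leftarrow> rmatrix H. act B t w * cochain_act H B s f xs)))}"

definition CE_cx :: "('k::field, 'h::{ring,monoid_mult}) qt_hopf \<Rightarrow>
    ('k, 'h, 'b::{ring,monoid_mult}) hmod_alg \<Rightarrow> 'b set \<Rightarrow> ('b list \<Rightarrow> 'b) cochain_cx" where
  "CE_cx H B E = \<lparr>cochains = rel_cochains H B E, cdiff = dc H B\<rparr>"

text \<open>The restriction \<open>F \<mapsto> F(1 \<otimes> - \<otimes> 1)\<close> on the bar resolution.\<close>

definition restrict_bar :: "'b::{ring,monoid_mult} set \<Rightarrow> nat \<Rightarrow>
    ('b list multiset set \<Rightarrow> 'b) \<Rightarrow> 'b list \<Rightarrow> 'b" where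
  "restrict_bar E n F xs = (if length xs = n then F (tclass E (n + 2) {# 1 # xs @ [1] #}) else 0)"

text \<open>
  Chain maps from the bar resolution over \<open>k\<close> to a resolution \<open>P\<close> of \<open>B\<close>, covering the identity.
  The induced map on \<open>Ext\<close> followed by restriction is the identification of \<open>Ext(B, B)\<close>,
  computed by \<open>P\<close>, with the cohomology of the braided Hochschild cochains.
\<close>

definition comparison :: "('k::field, 'h::{ring,monoid_mult}) qt_hopf \<Rightarrow>
    ('k, 'h, 'b::{ring,monoid_mult}) hmod_alg \<Rightarrow> (nat \<Rightarrow> ('b list multiset set, 'p) module) \<Rightarrow>
    (nat \<Rightarrow> 'p \<Rightarrow> 'p) \<Rightarrow> ('p \<Rightarrow> 'b) \<Rightarrow> (nat \<Rightarrow> 'b list multiset set \<Rightarrow> 'p) \<Rightarrow> bool" where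
  "comparison H B P d \<eta> \<phi> \<longleftrightarrow>
     (\<forall>n. \<phi> n \<in> right_hom (env_alg H B) (bar H B (scalars B) n) (P n)) \<and>
     (\<forall>n. \<forall>x \<in> carrier (bar H B (scalars B) (Suc n)).
        d n (\<phi> (Suc n) x) = \<phi> n (bar_diff (scalars B) n x)) \<and>
     (\<forall>x \<in> carrier (bar H B (scalars B) 0). \<eta> (\<phi> 0 x) = bar_aug x)"

section \<open>Graded algebras in the category of \<open>H\<close>-modules\<close>

text \<open>
  A carrier-based \<open>k\<close>-vector space with an action of \<open>H\<close>; here \<open>h \<odot>\<^bsub>M\<^esub> x\<close> is the left action and
  the multiplicative fields of the record are again unused.
\<close>

record ('k, 'h, 'x) zmod = "('h, 'x) module" +
  kscale :: "'k \<Rightarrow> 'x \<Rightarrow> 'x"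

definition Z_object :: "('k::field, 'h::{ring,monoid_mult}) qt_hopf \<Rightarrow> ('k, 'h, 'x) zmod \<Rightarrow> bool" where
  "Z_object H M \<longleftrightarrow> abelian_group M \<and>
     (\<forall>c. \<forall>x\<in>carrier M. kscale M c x \<in> carrier M) \<and>
     (\<forall>c. \<forall>x\<in>carrier M. \<forall>y\<in>carrier M. kscale M c (x \<oplus>\<^bsub>M\<^esub> y) = kscale M c x \<oplus>\<^bsub>M\<^esub> kscale M c y) \<and>
     (\<forall>c e. \<forall>x\<in>carrier M. kscale M (c + e) x = kscale M c x \<oplus>\<^bsub>M\<^esub> kscale M e x) \<and>
     (\<forall>c e. \<forall>x\<in>carrier M. kscale M (c * e) x = kscale M c (kscale M e x)) \<and>
     (\<forall>x\<in>carrier M. kscale M 1 x = x) \<and>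
     (\<forall>h. \<forall>x\<in>carrier M. h \<odot>\<^bsub>M\<^esub> x \<in> carrier M) \<and>
     (\<forall>h. \<forall>x\<in>carrier M. \<forall>y\<in>carrier M. h \<odot>\<^bsub>M\<^esub> (x \<oplus>\<^bsub>M\<^esub> y) = h \<odot>\<^bsub>M\<^esub> x \<oplus>\<^bsub>M\<^esub> h \<odot>\<^bsub>M\<^esub> y) \<and>
     (\<forall>g h. \<forall>x\<in>carrier M. (g + h) \<odot>\<^bsub>M\<^esub> x = g \<odot>\<^bsub>M\<^esub> x \<oplus>\<^bsub>M\<^esub> h \<odot>\<^bsub>M\<^esub> x) \<and>
     (\<forall>g h. \<forall>x\<in>carrier M. (g * h) \<odot>\<^bsub>M\<^esub> x = g \<odot>\<^bsub>M\<^esub> (h \<odot>\<^bsub>M\<^esub> x)) \<and>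
     (\<forall>x\<in>carrier M. 1 \<odot>\<^bsub>M\<^esub> x = x) \<and>
     (\<forall>c h. \<forall>x\<in>carrier M. scl H c h \<odot>\<^bsub>M\<^esub> x = kscale M c (h \<odot>\<^bsub>M\<^esub> x)) \<and>
     (\<forall>c h. \<forall>x\<in>carrier M. h \<odot>\<^bsub>M\<^esub> kscale M c x = kscale M c (h \<odot>\<^bsub>M\<^esub> x))"

definition list_sum :: "('x, 'z) ring_scheme \<Rightarrow> 'x list \<Rightarrow> 'x" where
  "list_sum M xs = foldr (add M) xs \<zero>\<^bsub>M\<^esub>"

definition graded_algebra :: "('k::field, 'h::{ring,monoid_mult}) qt_hopf \<Rightarrow> (nat \<Rightarrow> ('k, 'h, 'x) zmod) \<Rightarrow>
    (nat \<Rightarrow> nat \<Rightarrow> 'x \<Rightarrow> 'x \<Rightarrow> 'x) \<Rightarrow> 'x \<Rightarrow> bool" where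
  "graded_algebra H G mul u \<longleftrightarrow> (\<forall>n. Z_object H (G n)) \<and>
     (\<forall>m n. \<forall>x\<in>carrier (G m). \<forall>y\<in>carrier (G n). mul m n x y \<in> carrier (G (m + n))) \<and>
     (\<forall>m n. \<forall>x\<in>carrier (G m). \<forall>x'\<in>carrier (G m). \<forall>y\<in>carrier (G n).
        mul m n (x \<oplus>\<^bsub>G m\<^esub> x') y = mul m n x y \<oplus>\<^bsub>G (m + n)\<^esub> mul m n x' y) \<and>
     (\<forall>m n. \<forall>x\<in>carrier (G m). \<forall>y\<in>carrier (G n). \<forall>y'\<in>carrier (G n).
        mul m n x (y \<oplus>\<^bsub>G n\<^esub> y') = mul m n x y \<oplus>\<^bsub>G (m + n)\<^esub> mul m n x y') \<and>
     (\<forall>m n c. \<forall>x\<in>carrier (G m). \<forall>y\<in>carrier (G n).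
        mul m n (kscale (G m) c x) y = kscale (G (m + n)) c (mul m n x y) \<and>
        mul m n x (kscale (G n) c y) = kscale (G (m + n)) c (mul m n x y)) \<and>
     (\<forall>m n p. \<forall>x\<in>carrier (G m). \<forall>y\<in>carrier (G n). \<forall>z\<in>carrier (G p).
        mul (m + n) p (mul m n x y) z = mul m (n + p) x (mul n p y z)) \<and>
     u \<in> carrier (G 0) \<and>
     (\<forall>n. \<forall>x\<in>carrier (G n). mul 0 n u x = x \<and> mul n 0 x u = x) \<and>
     (\<forall>h. h \<odot>\<^bsub>G 0\<^esub> u = kscale (G 0) (counit H h) u) \<and>
     (\<forall>m n h. \<forall>x\<in>carrier (G m). \<forall>y\<in>carrier (G n). h \<odot>\<^bsub>G (m + n)\<^esub> mul m n x y =
        list_sum (G (m + n)) (map (\<lambda>(a, b). mul m n (a \<odot>\<^bsub>G m\<^esub> x) (b \<odot>\<^bsub>G n\<^esub> y)) (comult H h)))"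

definition braided_commutative :: "('k::field, 'h::{ring,monoid_mult}) qt_hopf \<Rightarrow>
    (nat \<Rightarrow> ('k, 'h, 'x) zmod) \<Rightarrow> (nat \<Rightarrow> nat \<Rightarrow> 'x \<Rightarrow> 'x \<Rightarrow> 'x) \<Rightarrow> bool" where
  "braided_commutative H G mul \<longleftrightarrow>
     (\<forall>m n. \<forall>x\<in>carrier (G m). \<forall>y\<in>carrier (G n). mul m n x y =
        (let z = list_sum (G (m + n)) (map (\<lambda>(s, t). mul n m (t \<odot>\<^bsub>G n\<^esub> y) (s \<odot>\<^bsub>G m\<^esub> x)) (rmatrix H))
         in if even (m * n) then z else \<ominus>\<^bsub>G (m + n)\<^esub> z))"

text \<open>Isomorphisms of \<open>H\<close>-modules in each degree, respecting products and units.\<close>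

definition graded_iso :: "(nat \<Rightarrow> ('k, 'h, 'x) zmod) \<Rightarrow> (nat \<Rightarrow> nat \<Rightarrow> 'x \<Rightarrow> 'x \<Rightarrow> 'x) \<Rightarrow> 'x \<Rightarrow>
    (nat \<Rightarrow> ('k, 'h, 'y) zmod) \<Rightarrow> (nat \<Rightarrow> nat \<Rightarrow> 'y \<Rightarrow> 'y \<Rightarrow> 'y) \<Rightarrow> 'y \<Rightarrow> (nat \<Rightarrow> 'x \<Rightarrow> 'y) \<Rightarrow> bool" where
  "graded_iso G mul u G' mul' u' \<Theta> \<longleftrightarrow>
     (\<forall>n. bij_betw (\<Theta> n) (carrier (G n)) (carrier (G' n))) \<and>
     (\<forall>n. \<forall>x\<in>carrier (G n). \<forall>y\<in>carrier (G n). \<Theta> n (x \<oplus>\<^bsub>G n\<^esub> y) = \<Theta> n x \<oplus>\<^bsub>G' n\<^esub> \<Theta> n y) \<and>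
     (\<forall>n c. \<forall>x\<in>carrier (G n). \<Theta> n (kscale (G n) c x) = kscale (G' n) c (\<Theta> n x)) \<and>
     (\<forall>n h. \<forall>x\<in>carrier (G n). \<Theta> n (h \<odot>\<^bsub>G n\<^esub> x) = h \<odot>\<^bsub>G' n\<^esub> \<Theta> n x) \<and>
     (\<forall>m n. \<forall>x\<in>carrier (G m). \<forall>y\<in>carrier (G n).
        \<Theta> (m + n) (mul m n x y) = mul' m n (\<Theta> m x) (\<Theta> n y)) \<and>
     \<Theta> 0 u = u'"

text \<open>
  The cohomology of a complex of \<open>B\<close>-valued functions with its own vector space structure and
  a given action of \<open>H\<close> on cohomology classes. Operations induced from cochains are unions of the
  classes obtained from all representatives, hence land in the carrier only if they are well defined.
\<close>

definition coh_obj :: "('k::field, 'h::{ring,monoid_mult}, 'b::{ring,monoid_mult}) hmod_alg \<Rightarrow>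
    ('y \<Rightarrow> 'b) cochain_cx \<Rightarrow> (nat \<Rightarrow> 'h \<Rightarrow> ('y \<Rightarrow> 'b) set \<Rightarrow> ('y \<Rightarrow> 'b) set) \<Rightarrow> nat \<Rightarrow>
    ('k, 'h, ('y \<Rightarrow> 'b) set) zmod" where
  "coh_obj B K hact n = \<lparr>carrier = coh K n, mult = undefined, one = undefined,
     zero = coh_class K n 0,
     add = (\<lambda>X Y. \<Union>f\<in>X. \<Union>g\<in>Y. coh_class K n (f + g)),
     smult = hact n,
     kscale = (\<lambda>c. coh_map K n (\<lambda>f x. scl B c (f x)))\<rparr>"

definition ind_act :: "('k::field, 'h::{ring,monoid_mult}) qt_hopf \<Rightarrow>
    ('k, 'h, 'b::{ring,monoid_mult}) hmod_alg \<Rightarrow> ('b list \<Rightarrow> 'b) cochain_cx \<Rightarrow>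
    nat \<Rightarrow> 'h \<Rightarrow> ('b list \<Rightarrow> 'b) set \<Rightarrow> ('b list \<Rightarrow> 'b) set" where
  "ind_act H B K n h = coh_map K n (cochain_act H B h)"

definition ind_cup :: "('k::field, 'h::{ring,monoid_mult}) qt_hopf \<Rightarrow>
    ('k, 'h, 'b::{ring,monoid_mult}) hmod_alg \<Rightarrow> ('b list \<Rightarrow> 'b) cochain_cx \<Rightarrow>
    nat \<Rightarrow> nat \<Rightarrow> ('b list \<Rightarrow> 'b) set \<Rightarrow> ('b list \<Rightarrow> 'b) set \<Rightarrow> ('b list \<Rightarrow> 'b) set" where
  "ind_cup H B K m n X Y = (\<Union>f\<in>X. \<Union>g\<in>Y. coh_class K (m + n) (cup H B m n f g))"

end

theory Submission
  imports Defs
begin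

text \<open>
  Restriction along \<open>1 \<otimes> - \<otimes> 1\<close> identifies \<open>Hom(Bar, B)\<close> with the relative cochains, which are the
  multilinear maps for which two neighbouring faces agree whenever the entry between them lies in \<open>E\<close>.
  Braided commutativity on cohomology is Gerstenhaber's argument: the braided insertions \<open>f \<circ>\<^sub>p g\<close>
  satisfy simplicial identities with the faces, so their alternating sum has as differential, up to sign
  and on cocycles, the difference between \<open>f \<union> g\<close> and the braided opposite product. Over the ground
  field the bar resolution is free, because \<open>b \<otimes> x \<otimes> b' = (1 \<otimes> S(r\<^sub>j) \<cdot> x \<otimes> 1) (r\<^sup>j \<cdot> b \<otimes> b')\<close>, and the
  structure is carried to any other projective resolution by homotopy uniqueness of comparison maps.
  Equalities in tensor powers over \<open>E\<close> are tested on balanced multilinear maps to \<open>B\<close>.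
\<close>

section \<open>Sums over the coproduct and the R-matrix\<close>

text \<open>Coproducts and the R-matrix are given by lists of representatives, so two expansions of
  an element agree only after evaluation on a multilinear function. Hence each computation carries a
  linearity check in every Sweedler leg, discharged by rule collections such as
  \<open>klins\<close>, and functions are transformed rather than tensors: the action and the
  differential of the bar resolution appear as their transposes \<open>gact\<close> and
  \<open>dG\<close>. The hexagon axioms compare a braiding past a product with two braidings; they
  give the face identities and associativity. Quasi-cocommutativity is naturality of the braiding;
  it makes faces and insertions equivariant. For relative cohomology the homotopy must itself be
  relative. With the relative condition stated by faces, the identities that move a face through an
  insertion also show that inserting relative cochains gives a relative cochain. A projective
  resolution P carries no action of H, so action and product on Ext are transported along a
  comparison map. Signs stay outside the calculus: \<open>D\<close> and \<open>cup0\<close> are the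
  differential and the product without their global signs.\<close>

lemma tens_rel_sum_eq:
  fixes g :: "'a::{ring,monoid_mult} list => 'x::ab_group_add"
  assumes "(p, q) \<in> tens_rel E n"
    and add: "\<And>xs ys a b. length xs + 1 + length ys = n ==>
      g (xs @ (a + b) # ys) = g (xs @ a # ys) + g (xs @ b # ys)"
    and bal: "\<And>xs ys a b e. e \<in> E ==> length xs + 2 + length ys = n ==>
      g (xs @ (a * e) # b # ys) = g (xs @ a # (e * b) # ys)"
  shows "(\<Sum>xs\<in>#p. g xs) = (\<Sum>xs\<in>#q. g xs)"
  using assms(1)
proof induction
  case (zero xs ys)
  then show ?case using add[of xs ys 0 0] by simp
qed (simp_all add: add bal)

text \<open>Sweedler sums and sums over the R-matrix both run over lists of pairs. With a curried
  summand, nested sums can be exchanged by rewriting and matched against the axioms by higher-order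
  unification.\<close>

definition psum :: "('x \<times> 'y) list => ('x => 'y => 'z::comm_monoid_add) => 'z" where
  "psum xs f = (\<Sum>(a, b) \<leftarrow> xs. f a b)"

lemma psum_Nil [simp]: "psum [] f = 0" by (simp add: psum_def)
lemma psum_Cons [simp]: "psum (x # xs) f = f (fst x) (snd x) + psum xs f"
  by (simp add: psum_def split_beta)
lemma psum_zero [simp]: "psum xs (\<lambda>a b. 0) = 0" by (induction xs) auto
lemma psum_add: "psum xs (\<lambda>a b. f a b + g a b) = psum xs f + psum xs g"
  by (induction xs) (auto simp: algebra_simps)
lemma psum_hom:
  "(\<And>x y. F (x + y) = F x + F y) ==> F 0 = 0 ==> F (psum xs f) = psum xs (\<lambda>a b. F (f a b))"
  by (induction xs) auto
lemma psum_ghom: fixes F :: "'a::ab_group_add => 'b::ab_group_add"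
  assumes "\<And>x y. F (x + y) = F x + F y" shows "F (psum xs f) = psum xs (\<lambda>a b. F (f a b))"
  using assms assms[of 0 0] by (intro psum_hom) auto
lemma psum_mult_left: "(c::'a::ring) * psum xs f = psum xs (\<lambda>a b. c * f a b)"
  by (rule psum_ghom) (simp add: distrib_left)
lemma psum_mult_right: "psum xs f * (c::'a::ring) = psum xs (\<lambda>a b. f a b * c)"
  by (rule psum_ghom[where F="\<lambda>x. x * c"]) (simp add: distrib_right)
lemma psum_swap: "psum xs (\<lambda>a b. psum ys (\<lambda>c d. f a b c d)) = psum ys (\<lambda>c d. psum xs (\<lambda>a b. f a b c d))"
  by (induction xs) (auto simp: psum_add)
lemma psum_cong: "(\<And>a b. (a, b) \<in> set xs ==> f a b = g a b) ==> psum xs f = psum xs g"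
  by (induction xs) auto
lemma psum_uminus: "- psum xs f = psum xs (\<lambda>a b. - (f a b :: 'a::ab_group_add))"
  by (rule psum_ghom) simp
lemma sum_mset_psum: "(\<Sum>x\<in>#psum xs f. g x) = psum xs (\<lambda>a b. \<Sum>x\<in>#f a b. g x)"
  by (rule psum_hom[where F="\<lambda>p. \<Sum>x\<in>#p. g x"]) auto

text \<open>Both scalar multiplications are parameters, so one notion serves maps between H, B and,
  with multiplication as scalar action, the field itself. Carriers are whole types, which leaves no
  membership conditions.\<close>

definition klin :: "('k => 'x::plus => 'x) => ('k => 'y::plus => 'y) => ('x => 'y) => bool" where
  "klin s1 s2 f \<longleftrightarrow> (\<forall>x y. f (x + y) = f x + f y) \<and> (\<forall>c x. f (s1 c x) = s2 c (f x))"

lemma klinI: "(\<And>x y. f (x + y) = f x + f y) ==> (\<And>c x. f (s1 c x) = s2 c (f x)) ==> klin s1 s2 f"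
  by (simp add: klin_def)
lemma klin_add: "klin s1 s2 f ==> f (x + y) = f x + f y" by (simp add: klin_def)
lemma klin_scale: "klin s1 s2 f ==> f (s1 c x) = s2 c (f x)" by (simp add: klin_def)
lemma klin_zero: fixes f :: "'x::ab_group_add => 'y::ab_group_add"
  shows "klin s1 s2 f ==> f 0 = 0" using klin_add[of s1 s2 f 0 0] by auto
lemma klin_psum: fixes f :: "'x::ab_group_add => 'y::ab_group_add"
  shows "klin s1 s2 f ==> f (psum xs g) = psum xs (\<lambda>a b. f (g a b))"
  by (rule psum_ghom) (rule klin_add)
lemma klin_id: "klin s s (\<lambda>x. x)" by (simp add: klin_def)
lemma klin_comp: "klin s2 s3 f ==> klin s1 s2 g ==> klin s1 s3 (\<lambda>x. f (g x))" by (simp add: klin_def)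
lemma klin_psumI:
  fixes f :: "'a => 'b => 'x::plus => 'y::ab_group_add"
  assumes v: "vector_space s2" and l: "\<And>a b. klin s1 s2 (f a b)"
  shows "klin s1 s2 (\<lambda>x. psum xs (\<lambda>a b. f a b x))"
proof (rule klinI)
  fix c x
  have "\<And>x y. s2 c (x + y) = s2 c x + s2 c y" using v by (simp add: vector_space_def)
  then show "psum xs (\<lambda>a b. f a b (s1 c x)) = s2 c (psum xs (\<lambda>a b. f a b x))"
    by (simp add: klin_scale[OF l] psum_ghom[of "s2 c"])
qed (simp add: klin_add[OF l] psum_add)
lemma klin_zeroI:
  assumes v: "vector_space s2"
  shows "klin s1 s2 (\<lambda>x. 0)"
proof -
  interpret vector_space s2 by fact
  show ?thesis by (auto simp: klin_def)
qed

locale qt_hopf_alg =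
  fixes H :: "('k::field, 'h::{ring,monoid_mult}) qt_hopf"
  assumes qt: "quasitriangular_hopf_algebra H"
begin

abbreviation "dsum h f \<equiv> psum (comult H h) f"
abbreviation "rsum f \<equiv> psum (rmatrix H) f"
abbreviation "S \<equiv> antipode H"
abbreviation "eps \<equiv> counit H"
abbreviation "hs \<equiv> scl H"
abbreviation "hlin sc f \<equiv> klin (scl H) sc f"

lemma hopf: "hopf_algebra H" using qt by (simp add: quasitriangular_hopf_algebra_def)
lemma bialg: "bialgebra H" using hopf by (simp add: hopf_algebra_def)
lemma kalg: "k_algebra H" using bialg by (simp add: bialgebra_def)
lemma vsH: "vector_space hs" using kalg by (simp add: k_algebra_def)
lemma hs_mult: "hs c x * y = hs c (x * y)" "x * hs c y = hs c (x * y)"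
  using kalg by (auto simp: k_algebra_def)

text \<open>The passage from an axiom, an equality in the tensor square of H, to a usable identity:
  a bilinear function has the same sum over both representatives. All Sweedler rules below
  instantiate this or its three-fold analogue.\<close>

lemma tens2: fixes f :: "'h => 'h => 'x::ab_group_add"
  assumes "teq H 2 p q" and l1: "\<And>b. hlin sc (\<lambda>a. f a b)" and l2: "\<And>a. hlin sc (\<lambda>b. f a b)"
  shows "(\<Sum>xs\<in>#p. f (xs!0) (xs!1)) = (\<Sum>xs\<in>#q. f (xs!0) (xs!1))"
proof (rule tens_rel_sum_eq[OF assms(1)])
  fix xs ys :: "'h list" and a b assume "length xs + 1 + length ys = 2"
  then show "f ((xs @ (a + b) # ys)!0) ((xs @ (a + b) # ys)!1) =
      f ((xs @ a # ys)!0) ((xs @ a # ys)!1) + f ((xs @ b # ys)!0) ((xs @ b # ys)!1)"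
    by (cases xs) (auto simp: klin_add[OF l1] klin_add[OF l2])
next
  fix xs ys :: "'h list" and a b e assume "e \<in> scalars H" "length xs + 2 + length ys = 2"
  then show "f ((xs @ (a * e) # b # ys)!0) ((xs @ (a * e) # b # ys)!1) =
      f ((xs @ a # (e * b) # ys)!0) ((xs @ a # (e * b) # ys)!1)"
    by (auto simp: scalars_def hs_mult klin_scale[OF l1] klin_scale[OF l2])
qed

lemma tens3: fixes f :: "'h => 'h => 'h => 'x::ab_group_add"
  assumes "teq H 3 p q" and l1: "\<And>b c. hlin sc (\<lambda>a. f a b c)" and l2: "\<And>a c. hlin sc (\<lambda>b. f a b c)"
   and l3: "\<And>a b. hlin sc (\<lambda>c. f a b c)"
  shows "(\<Sum>xs\<in>#p. f (xs!0) (xs!1) (xs!2)) = (\<Sum>xs\<in>#q. f (xs!0) (xs!1) (xs!2))"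
proof (rule tens_rel_sum_eq[OF assms(1)])
  fix xs ys :: "'h list" and a b assume "length xs + 1 + length ys = 3"
  then consider y z where "xs = []" "ys = [y,z]" | x y where "xs = [x]" "ys = [y]" | x y where "xs = [x,y]" "ys = []"
    by (cases xs; cases "tl xs"; cases ys; cases "tl ys") auto
  then show "f ((xs @ (a + b) # ys)!0) ((xs @ (a + b) # ys)!1) ((xs @ (a + b) # ys)!2) =
      f ((xs @ a # ys)!0) ((xs @ a # ys)!1) ((xs @ a # ys)!2) + f ((xs @ b # ys)!0) ((xs @ b # ys)!1)((xs @ b # ys)!2)"
    by cases (auto simp: klin_add[OF l1] klin_add[OF l2] klin_add[OF l3])
next
  fix xs ys :: "'h list" and a b e assume *: "e \<in> scalars H" "length xs + 2 + length ys = 3"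
  then consider y where "xs = []" "ys = [y]" | x where "xs = [x]" "ys = []"
    by (cases xs; cases ys) auto
  then show "f ((xs @ (a * e) # b # ys)!0) ((xs @ (a * e) # b # ys)!1) ((xs @ (a * e) # b # ys)!2) =
      f ((xs @ a # (e * b) # ys)!0) ((xs @ a # (e * b) # ys)!1) ((xs @ a # (e * b) # ys)!2)"
    using *(1) by cases (auto simp: scalars_def hs_mult klin_scale[OF l1] klin_scale[OF l2] klin_scale[OF l3])
qed

lemma tmul_eval: "(\<Sum>xs\<in>#tmul p q. g xs) = (\<Sum>xs\<in>#p. \<Sum>ys\<in>#q. g (map2 (*) xs ys))"
  unfolding tmul_def
proof (induction p)
  case (add x p)
  have "(\<Sum>xs\<in>#(\<Sum>ys\<in>#q. {#map2 (*) x ys#}). g xs) = (\<Sum>ys\<in>#q. g (map2 (*) x ys))" for x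
    by (induction q) auto
  with add show ?case by simp
qed simp

lemma dt_psum: "\<Delta>t H h = dsum h (\<lambda>a b. {#[a,b]#})" "Rt H = rsum (\<lambda>s t. {#[s,t]#})"
  "R12 H = rsum (\<lambda>s t. {#[s,t,1]#})" "R13 H = rsum (\<lambda>s t. {#[s,1,t]#})" "R23 H = rsum (\<lambda>s t. {#[1,s,t]#})"
  by (auto simp: psum_def \<Delta>t_def Rt_def R12_def R13_def R23_def)

lemma dsum_plus: fixes f :: "'h => 'h => 'x::ab_group_add"
  assumes "\<And>b. hlin sc (\<lambda>a. f a b)" "\<And>a. hlin sc (\<lambda>b. f a b)"
  shows "dsum (g + h) f = dsum g f + dsum h f"
proof -
  have "teq H 2 (\<Delta>t H (g + h)) (\<Delta>t H g + \<Delta>t H h)" using bialg by (simp add: bialgebra_def)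
  from tens2[OF this, of sc f] assms show ?thesis by (simp add: dt_psum sum_mset_psum)
qed

lemma dsum_scale: fixes f :: "'h => 'h => 'x::ab_group_add"
  assumes "vector_space sc" "\<And>b. hlin sc (\<lambda>a. f a b)" "\<And>a. hlin sc (\<lambda>b. f a b)"
  shows "dsum (hs c h) f = sc c (dsum h f)"
proof -
  have "teq H 2 (\<Delta>t H (hs c h)) (dsum h (\<lambda>a b. {#[hs c a, b]#}))" using bialg by (simp add: bialgebra_def psum_def)
  from tens2[OF this, of sc f] assms(2,3) have "dsum (hs c h) f = dsum h (\<lambda>a b. f (hs c a) b)"
    by (simp add: dt_psum sum_mset_psum)
  also have "\<dots> = dsum h (\<lambda>a b. sc c (f a b))" by (simp add: klin_scale[OF assms(2)])
  also have "\<dots> = sc c (dsum h f)"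
    using assms(1) by (intro psum_ghom[of "sc c", symmetric]) (simp add: vector_space_def)
  finally show ?thesis .
qed

lemma hlin_dsum: fixes f :: "'h => 'h => 'x::ab_group_add"
  assumes "vector_space sc" "\<And>b. hlin sc (\<lambda>a. f a b)" "\<And>a. hlin sc (\<lambda>b. f a b)"
  shows "hlin sc (\<lambda>h. dsum h f)"
  by (rule klinI) (rule dsum_plus[of sc] dsum_scale[of sc]; rule assms)+

lemma dsum_mult: fixes f :: "'h => 'h => 'x::ab_group_add"
  assumes "\<And>b. hlin sc (\<lambda>a. f a b)" "\<And>a. hlin sc (\<lambda>b. f a b)"
  shows "dsum (g * h) f = dsum g (\<lambda>a b. dsum h (\<lambda>c d. f (a * c) (b * d)))"
proof -
  have "teq H 2 (\<Delta>t H (g * h)) (tmul (\<Delta>t H g) (\<Delta>t H h))" using bialg by (simp add: bialgebra_def)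
  from tens2[OF this, of sc f] assms show ?thesis by (simp add: dt_psum sum_mset_psum tmul_eval)
qed

lemma dsum_one: fixes f :: "'h => 'h => 'x::ab_group_add"
  assumes "\<And>b. hlin sc (\<lambda>a. f a b)" "\<And>a. hlin sc (\<lambda>b. f a b)"
  shows "dsum 1 f = f 1 1"
proof -
  have "teq H 2 (\<Delta>t H 1) {#[1,1]#}" using bialg by (simp add: bialgebra_def)
  from tens2[OF this, of sc f] assms show ?thesis by (simp add: dt_psum sum_mset_psum)
qed

lemma dsum_assoc: fixes f :: "'h => 'h => 'h => 'x::ab_group_add"
  assumes "\<And>b c. hlin sc (\<lambda>a. f a b c)" "\<And>a c. hlin sc (\<lambda>b. f a b c)" "\<And>a b. hlin sc (\<lambda>c. f a b c)"
  shows "dsum h (\<lambda>a b. dsum a (\<lambda>c d. f c d b)) = dsum h (\<lambda>a b. dsum b (\<lambda>c d. f a c d))"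
proof -
  have "teq H 3 (dsum h (\<lambda>a b. dsum a (\<lambda>c d. {# [c, d, b] #}))) (dsum h (\<lambda>a b. dsum b (\<lambda>c d. {# [a, c, d] #})))"
    using bialg by (simp add: bialgebra_def psum_def)
  from tens3[OF this, of sc f] assms show ?thesis by (simp add: sum_mset_psum)
qed

lemma dsum_counit1: assumes "hlin sc f"
  shows "dsum h (\<lambda>a b. sc (eps a) (f b)) = (f h :: 'x::ab_group_add)"
proof -
  have "dsum h (\<lambda>a b. hs (eps a) b) = h" using bialg by (simp add: bialgebra_def psum_def)
  then show ?thesis by (metis (no_types, lifting) klin_psum[OF assms] klin_scale[OF assms] psum_cong)
qed

lemma dsum_counit2: assumes "hlin sc f"
  shows "dsum h (\<lambda>a b. sc (eps b) (f a)) = (f h :: 'x::ab_group_add)"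
proof -
  have "dsum h (\<lambda>a b. hs (eps b) a) = h" using bialg by (simp add: bialgebra_def psum_def)
  then show ?thesis by (metis (no_types, lifting) klin_psum[OF assms] klin_scale[OF assms] psum_cong)
qed

lemma dsum_antipode1: assumes "hlin sc f"
  shows "dsum h (\<lambda>a b. f (S a * b)) = (sc (eps h) (f 1) :: 'x::ab_group_add)"
proof -
  have "dsum h (\<lambda>a b. S a * b) = hs (eps h) 1" using hopf by (simp add: hopf_algebra_def psum_def)
  then show ?thesis by (metis (no_types, lifting) klin_psum[OF assms] klin_scale[OF assms] psum_cong)
qed

lemma dsum_antipode2: assumes "hlin sc f"
  shows "dsum h (\<lambda>a b. f (a * S b)) = (sc (eps h) (f 1) :: 'x::ab_group_add)"
proof -
  have "dsum h (\<lambda>a b. a * S b) = hs (eps h) 1" using hopf by (simp add: hopf_algebra_def psum_def)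
  then show ?thesis by (metis (no_types, lifting) klin_psum[OF assms] klin_scale[OF assms] psum_cong)
qed

lemma rsum_hex1: fixes f :: "'h => 'h => 'h => 'x::ab_group_add"
  assumes "\<And>b c. hlin sc (\<lambda>a. f a b c)" "\<And>a c. hlin sc (\<lambda>b. f a b c)" "\<And>a b. hlin sc (\<lambda>c. f a b c)"
  shows "rsum (\<lambda>s t. dsum s (\<lambda>a b. f a b t)) = rsum (\<lambda>s t. rsum (\<lambda>s' t'. f s s' (t * t')))"
proof -
  have "teq H 3 (rsum (\<lambda>s t. dsum s (\<lambda>a b. {# [a, b, t] #}))) (tmul (R13 H) (R23 H))"
    using qt by (simp add: quasitriangular_hopf_algebra_def psum_def)
  from tens3[OF this, of sc f] assms show ?thesis by (simp add: sum_mset_psum tmul_eval dt_psum)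
qed

text \<open>In R_13 R_12 the two copies of R share the first leg and the second copy supplies the
  middle leg, which is why \<open>t'\<close> stands before \<open>t\<close>.\<close>

lemma rsum_hex2: fixes f :: "'h => 'h => 'h => 'x::ab_group_add"
  assumes "\<And>b c. hlin sc (\<lambda>a. f a b c)" "\<And>a c. hlin sc (\<lambda>b. f a b c)" "\<And>a b. hlin sc (\<lambda>c. f a b c)"
  shows "rsum (\<lambda>s t. dsum t (\<lambda>a b. f s a b)) = rsum (\<lambda>s t. rsum (\<lambda>s' t'. f (s * s') t' t))"
proof -
  have "teq H 3 (rsum (\<lambda>s t. dsum t (\<lambda>a b. {# [s, a, b] #}))) (tmul (R13 H) (R12 H))"
    using qt by (simp add: quasitriangular_hopf_algebra_def psum_def)
  from tens3[OF this, of sc f] assms show ?thesis by (simp add: sum_mset_psum tmul_eval dt_psum)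
qed

lemma rsum_qcomm: fixes f :: "'h => 'h => 'x::ab_group_add"
  assumes "\<And>b. hlin sc (\<lambda>a. f a b)" "\<And>a. hlin sc (\<lambda>b. f a b)"
  shows "rsum (\<lambda>s t. dsum h (\<lambda>a b. f (s * a) (t * b))) = dsum h (\<lambda>a b. rsum (\<lambda>s t. f (b * s) (a * t)))"
proof -
  have "teq H 2 (tmul (Rt H) (\<Delta>t H h)) (tmul (dsum h (\<lambda>a b. {#[b,a]#})) (Rt H))"
    using qt by (simp add: quasitriangular_hopf_algebra_def psum_def)
  from tens2[OF this, of sc f] assms show ?thesis by (simp add: dt_psum sum_mset_psum tmul_eval)
qed

lemma hlin_mult: assumes "klin s hs f" shows "klin s hs (\<lambda>a. f a * y)" "klin s hs (\<lambda>a. y * f a)"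
  using assms by (auto simp: klin_def hs_mult algebra_simps)
lemma hlin_S: "klin s hs f ==> klin s hs (\<lambda>a. S (f a))"
  using hopf by (auto simp: klin_def hopf_algebra_def)

lemma eps_simps: "eps (g + h) = eps g + eps h" "eps (hs c h) = c * eps h" "eps (g * h) = eps g * eps h" "eps 1 = 1"
  using bialg by (simp_all add: bialgebra_def)

lemma hlin_eps: assumes "vector_space sc" "klin s hs f" shows "klin s sc (\<lambda>a. sc (eps (f a)) (x::'x::ab_group_add))"
proof -
  interpret vector_space sc by fact
  show ?thesis using assms(2) by (auto simp: klin_def eps_simps scale_left_distrib)
qed

lemma hlin_hs: assumes "klin s hs f" shows "klin s hs (\<lambda>a. hs c (f a))"
proof -
  interpret vector_space hs by (rule vsH)
  show ?thesis using assms by (auto simp: klin_def scale_right_distrib mult.commute)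
qed

lemmas hlin0 = klin_id hlin_mult hlin_S hlin_eps[OF vsH] hlin_hs

text \<open>The inverse of R is a formal sum rather than a list of pairs, so its two defining
  equations are offered in evaluated form, for all bilinear functions.\<close>

lemma R_inverse:
  obtains Q where "\<And>sc f. (\<And>b. hlin sc (\<lambda>a. f a b)) ==> (\<And>a. hlin sc (\<lambda>b. f a b)) ==>
     rsum (\<lambda>s t. \<Sum>xs\<in>#Q. f (s * xs!0) (t * xs!1)) = (f 1 1 :: 'x::ab_group_add)"
   "\<And>sc f. (\<And>b. hlin sc (\<lambda>a. f a b)) ==> (\<And>a. hlin sc (\<lambda>b. f a b)) ==>
     (\<Sum>xs\<in>#Q. rsum (\<lambda>s t. f (xs!0 * s) (xs!1 * t))) = (f 1 1 :: 'x::ab_group_add)"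
proof -
  obtain Q where Q: "Q \<in> fsums 2" "teq H 2 (tmul (Rt H) Q) {#[1,1]#}" "teq H 2 (tmul Q (Rt H)) {#[1,1]#}"
    using qt by (auto simp: quasitriangular_hopf_algebra_def)
  have l2: "\<And>xs::'h list. xs \<in># Q ==> length xs = 2" using Q(1) by (auto simp: fsums_def)
  have nth: "zip [s,t] ys ! 0 = (s, ys!0)" "zip [s,t] ys ! 1 = (t, ys!1)" "zip ys [s,t] ! 0 = (ys!0, s)" "zip ys [s,t] ! 1 = (ys!1, t)"
    if "length ys = 2" for s t and ys :: "'h list"
    using that by (auto simp: numeral_2_eq_2)
  show ?thesis
  proof (rule that)
    fix sc and f :: "'h => 'h => 'x"
    assume l: "\<And>b. hlin sc (\<lambda>a. f a b)" "\<And>a. hlin sc (\<lambda>b. f a b)"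
    have "rsum (\<lambda>s t. \<Sum>xs\<in>#Q. f (s * xs!0) (t * xs!1)) =
      rsum (\<lambda>s t. \<Sum>xs\<in>#Q. f (map2 (*) [s,t] xs ! 0) (map2 (*) [s,t] xs ! 1))"
      by (intro psum_cong arg_cong[of _ _ sum_mset] image_mset_cong) (simp add: l2 nth del: One_nat_def)
    also have "\<dots> = f 1 1"
      using tens2[OF Q(2), of sc f] l by (simp add: dt_psum sum_mset_psum tmul_eval)
    finally show "rsum (\<lambda>s t. \<Sum>xs\<in>#Q. f (s * xs!0) (t * xs!1)) = f 1 1" .
    have "(\<Sum>xs\<in>#Q. rsum (\<lambda>s t. f (xs!0 * s) (xs!1 * t))) =
      (\<Sum>xs\<in>#Q. rsum (\<lambda>s t. f (map2 (*) xs [s,t] ! 0) (map2 (*) xs [s,t] ! 1)))"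
      by (intro psum_cong arg_cong[of _ _ sum_mset] image_mset_cong) (simp add: l2 nth del: One_nat_def)
    also have "\<dots> = f 1 1"
      using tens2[OF Q(3), of sc f] l by (simp add: dt_psum sum_mset_psum tmul_eval)
    finally show "(\<Sum>xs\<in>#Q. rsum (\<lambda>s t. f (xs!0 * s) (xs!1 * t))) = f 1 1" .
  qed
qed

text \<open>Applying eps to the first two legs of the first hexagon makes e = (eps tensor id)(R)
  idempotent. It is invertible because R is, hence equal to 1. The inverse is carried along as the
  factors \<open>xs!0\<close>, \<open>xs!1\<close>.\<close>

lemma R_eps:
  "rsum (\<lambda>s t. hs (eps s) t) = 1" "rsum (\<lambda>s t. hs (eps t) s) = 1"
proof -
  interpret vector_space hs by (rule vsH)
  obtain Q where Q: "\<And>sc f. (\<And>b. hlin sc (\<lambda>a. f a b)) ==> (\<And>a. hlin sc (\<lambda>b. f a b)) ==>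
     rsum (\<lambda>s t. \<Sum>xs\<in>#Q. f (s * xs!0) (t * xs!1)) = (f 1 1 :: 'h)"
   "\<And>sc f. (\<And>b. hlin sc (\<lambda>a. f a b)) ==> (\<And>a. hlin sc (\<lambda>b. f a b)) ==>
     (\<Sum>xs\<in>#Q. rsum (\<lambda>s t. f (xs!0 * s) (xs!1 * t))) = (f 1 1 :: 'h)"
    by (rule R_inverse[where 'x='h]) blast
  have comm: "rsum (\<lambda>s t. \<Sum>xs\<in>#Q. f s t xs) = (\<Sum>xs\<in>#Q. rsum (\<lambda>s t. f s t xs))" for f :: "'h => 'h => 'h list => 'h"
    by (induction Q) (auto simp: psum_add)
  let ?e = "rsum (\<lambda>s t. hs (eps s) t)"
  define f where "f \<equiv> \<lambda>a b. hs (eps a) (?e * b)"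
  have lf: "\<And>b. hlin hs (\<lambda>a. f a b)" "\<And>a. hlin hs (\<lambda>b. f a b)"
    unfolding f_def by (intro hlin0)+
  have "?e = f 1 1" by (simp add: f_def eps_simps)
  also have "\<dots> = rsum (\<lambda>s t. \<Sum>xs\<in>#Q. f (s * xs!0) (t * xs!1))" by (rule Q(1)[OF lf, symmetric])
  also have "\<dots> = (\<Sum>xs\<in>#Q. rsum (\<lambda>s t. f (s * xs!0) (t * xs!1)))" by (rule comm)
  also have "\<dots> = (\<Sum>xs\<in>#Q. rsum (\<lambda>s t. hs (eps (s * xs!0)) (t * xs!1)))"
  proof (intro arg_cong[of _ _ sum_mset] image_mset_cong)
    fix xs
    have "rsum (\<lambda>s t. f (s * xs!0) (t * xs!1)) =
       rsum (\<lambda>s t. rsum (\<lambda>s' t'. hs (eps s) (hs (eps (s' * xs!0)) (t * t' * xs!1))))"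
      unfolding f_def
      by (subst psum_swap) (simp add: psum_mult_left psum_mult_right hs_mult mult.assoc
           psum_ghom[where F="hs c" for c, OF scale_right_distrib] mult.commute)
    also have "\<dots> = rsum (\<lambda>s t. dsum s (\<lambda>a b. hs (eps a) (hs (eps (b * xs!0)) (t * xs!1))))"
      by (rule rsum_hex1[where f="\<lambda>a b t. hs (eps a) (hs (eps (b * xs!0)) (t * xs!1))", symmetric, of hs]) (intro hlin0)+
    also have "\<dots> = rsum (\<lambda>s t. hs (eps (s * xs!0)) (t * xs!1))"
      by (intro psum_cong dsum_counit1[where sc=hs and f="\<lambda>b. hs (eps (b * xs!0)) (t * xs!1)" for t]) (intro hlin0)
    finally show "rsum (\<lambda>s t. f (s * xs!0) (t * xs!1)) = rsum (\<lambda>s t. hs (eps (s * xs!0)) (t * xs!1))" .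
  qed
  also have "\<dots> = rsum (\<lambda>s t. \<Sum>xs\<in>#Q. hs (eps (s * xs!0)) (t * xs!1))" by (rule comm[symmetric])
  also have "\<dots> = hs (eps 1) 1" by (rule Q(1)[of hs "\<lambda>a b. hs (eps a) b"]) (intro hlin0)+
  finally show "rsum (\<lambda>s t. hs (eps s) t) = 1" by (simp add: eps_simps)

  \<comment> \<open>The mirror image for the other leg, with the second hexagon and the other counit
    axiom.\<close>
  let ?e = "rsum (\<lambda>s t. hs (eps t) s)"
  define f where "f \<equiv> \<lambda>a b. hs (eps b) (?e * a)"
  have lf: "\<And>b. hlin hs (\<lambda>a. f a b)" "\<And>a. hlin hs (\<lambda>b. f a b)"
    unfolding f_def by (intro hlin0)+
  have "?e = f 1 1" by (simp add: f_def eps_simps)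
  also have "\<dots> = rsum (\<lambda>s t. \<Sum>xs\<in>#Q. f (s * xs!0) (t * xs!1))" by (rule Q(1)[OF lf, symmetric])
  also have "\<dots> = (\<Sum>xs\<in>#Q. rsum (\<lambda>s t. f (s * xs!0) (t * xs!1)))" by (rule comm)
  also have "\<dots> = (\<Sum>xs\<in>#Q. rsum (\<lambda>s t. hs (eps (t * xs!1)) (s * xs!0)))"
  proof (intro arg_cong[of _ _ sum_mset] image_mset_cong)
    fix xs
    have "rsum (\<lambda>s t. f (s * xs!0) (t * xs!1)) =
       rsum (\<lambda>s t. rsum (\<lambda>s' t'. hs (eps (t' * xs!1)) (hs (eps t) (s * s' * xs!0))))"
      unfolding f_def
      by (subst psum_swap) (simp add: psum_mult_left psum_mult_right hs_mult mult.assoc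
           psum_ghom[where F="hs c" for c, OF scale_right_distrib] mult.commute)
    also have "\<dots> = rsum (\<lambda>s t. dsum t (\<lambda>a b. hs (eps (a * xs!1)) (hs (eps b) (s * xs!0))))"
      by (rule rsum_hex2[where f="\<lambda>s a b. hs (eps (a * xs!1)) (hs (eps b) (s * xs!0))", symmetric, of hs]) (intro hlin0)+
    also have "\<dots> = rsum (\<lambda>s t. dsum t (\<lambda>a b. hs (eps b) (hs (eps (a * xs!1)) (s * xs!0))))"
      by (simp add: mult.commute)
    also have "\<dots> = rsum (\<lambda>s t. hs (eps (t * xs!1)) (s * xs!0))"
      by (intro psum_cong dsum_counit2[where sc=hs and f="\<lambda>b. hs (eps (b * xs!1)) (t * xs!0)" for t]) (intro hlin0)
    finally show "rsum (\<lambda>s t. f (s * xs!0) (t * xs!1)) = rsum (\<lambda>s t. hs (eps (t * xs!1)) (s * xs!0))" .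
  qed
  also have "\<dots> = rsum (\<lambda>s t. \<Sum>xs\<in>#Q. hs (eps (t * xs!1)) (s * xs!0))" by (rule comm[symmetric])
  also have "\<dots> = hs (eps 1) 1" by (rule Q(1)[of hs "\<lambda>a b. hs (eps b) a"]) (intro hlin0)+
  finally show "rsum (\<lambda>s t. hs (eps t) s) = 1" by (simp add: eps_simps)
qed

lemma rsum_eps1: assumes "hlin sc f"
  shows "rsum (\<lambda>s t. sc (eps s) (f t)) = (f 1 :: 'x::ab_group_add)"
  using R_eps(1) by (metis (no_types, lifting) klin_psum[OF assms] klin_scale[OF assms] psum_cong)

lemma rsum_eps2: assumes "hlin sc f"
  shows "rsum (\<lambda>s t. sc (eps t) (f s)) = (f 1 :: 'x::ab_group_add)"
  using R_eps(2) by (metis (no_types, lifting) klin_psum[OF assms] klin_scale[OF assms] psum_cong)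

section \<open>The antipode: counit, unit and products\<close>

lemma eps_S: "eps (S h) = eps h"
proof -
  have [simp]: "eps (psum xs f) = psum xs (\<lambda>a b. eps (f a b))" for xs :: "('h \<times> 'h) list" and f
    by (rule psum_ghom) (simp add: eps_simps)
  have "eps (dsum h (\<lambda>a b. S a * b)) = eps (hs (eps h) 1)" using hopf by (simp add: hopf_algebra_def psum_def)
  then have "eps h = dsum h (\<lambda>a b. eps b * eps (S a))" by (simp add: eps_simps mult.commute)
  also have "\<dots> = eps (S h)"
    using dsum_counit2[of "(*)" "\<lambda>h. eps (S h)" h] hopf by (simp add: klin_def hopf_algebra_def eps_simps)
  finally show ?thesis by simp
qed

lemma S_one: "S 1 = 1"
proof -
  have "dsum 1 (\<lambda>a b. S a * b) = hs (eps 1) 1" using hopf by (simp add: hopf_algebra_def psum_def)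
  also have "dsum 1 (\<lambda>a b. S a * b) = S 1 * 1" by (rule dsum_one[of hs]) (intro hlin0)+
  finally show ?thesis using vsH by (simp add: eps_simps vector_space_def)
qed

text \<open>Both sides are convolution inverses of the multiplication of H. Concretely, S(gh) is
  padded with the factor g_2 h_2 S(h_3) S(g_3), which is a counit; coassociativity then brings S(g_1
  h_1) next to g_2 h_2, where it collapses.\<close>

lemma S_mult: "S (g * h) = S h * S g"
proof -
  interpret vector_space hs by (rule vsH)
  have hs_psum: "hs c (psum xs f) = psum xs (\<lambda>a b. hs c (f a b))" for c and xs :: "('h \<times> 'h) list" and f
    by (rule psum_ghom) (rule scale_right_distrib)
  have l: "hlin hs (\<lambda>g. dsum h (\<lambda>c d. S (g * c) * y d))" for h y
    by (intro klin_psumI vsH hlin0)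
  have c1: "dsum h (\<lambda>c d. hs (eps c) (S d * S b)) = S h * S b" for b
    by (rule dsum_counit1[where sc=hs and f="\<lambda>d. S d * S b"]) (intro hlin0)
  have c2: "dsum h (\<lambda>c d. hs (eps d) (S (a * c))) = S (a * h)" for a
    by (rule dsum_counit2[where sc=hs and f="\<lambda>c. S (a * c)"]) (intro hlin0)
  have "S (g * h) = dsum g (\<lambda>a b. hs (eps b) (S (a * h)))"
    by (rule dsum_counit2[where sc=hs and f="\<lambda>a. S (a * h)", symmetric]) (intro hlin0)
  also have "\<dots> = dsum g (\<lambda>a b. hs (eps b) (dsum h (\<lambda>c d. hs (eps d) (S (a * c)))))"
    by (simp only: c2)
  also have "\<dots> = dsum g (\<lambda>a b. dsum h (\<lambda>c d. S (a * c) * hs (eps b) (hs (eps d) 1)))"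
    by (simp add: hs_psum hs_mult)
  also have "\<dots> = dsum g (\<lambda>a b. dsum h (\<lambda>c d. S (a * c) * dsum b (\<lambda>b b'. dsum d (\<lambda>d d'. b * d * S d' * S b'))))"
  proof (intro psum_cong, rule arg_cong[where f="\<lambda>x. y * x" for y])
    fix b d
    have "dsum b (\<lambda>b b'. dsum d (\<lambda>d d'. b * d * S d' * S b')) = dsum b (\<lambda>b b'. dsum d (\<lambda>d d'. b * (d * S d') * S b'))"
      by (simp add: mult.assoc)
    also have "\<dots> = dsum b (\<lambda>b b'. hs (eps d) (b * 1 * S b'))"
      by (intro psum_cong dsum_antipode2[where f="\<lambda>x. b * x * S b'" for b b']) (intro hlin0)
    also have "\<dots> = hs (eps b) (hs (eps d) 1)"
      using dsum_antipode2[OF hlin_hs[OF klin_id, of "eps d"], of b] by (simp add: mult.commute)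
    finally show "hs (eps b) (hs (eps d) 1) = dsum b (\<lambda>b b'. dsum d (\<lambda>d d'. b * d * S d' * S b'))" by simp
  qed
  also have "\<dots> = dsum g (\<lambda>a b. dsum b (\<lambda>b b'. dsum h (\<lambda>c d. dsum d (\<lambda>d d'. S (a * c) * (b * d) * (S d' * S b')))))"
    unfolding psum_mult_left psum_mult_right
    by (intro psum_cong, subst psum_swap[where ys="comult H h"], simp add: mult.assoc)
  also have "\<dots> = dsum g (\<lambda>a b. dsum b (\<lambda>b b'. dsum h (\<lambda>c d. dsum c (\<lambda>c c'. S (a * c) * (b * c') * (S d * S b')))))"
    by (rule psum_cong, rule psum_cong, rule dsum_assoc[where sc=hs and f="\<lambda>c d d'. S (a * c) * (b * d) * (S d' * S b')" for a b b', symmetric]) (intro hlin0)+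
  also have "\<dots> = dsum g (\<lambda>a b. dsum a (\<lambda>a a'. dsum h (\<lambda>c d. dsum c (\<lambda>c c'. S (a * c) * (a' * c') * (S d * S b)))))"
    by (intro dsum_assoc[where sc=hs and f="\<lambda>a b b'. dsum h (\<lambda>c d. dsum c (\<lambda>c c'. S (a * c) * (b * c') * (S d * S b')))", symmetric])
      (intro klin_psumI vsH hlin0)+
  also have "\<dots> = dsum g (\<lambda>a b. dsum h (\<lambda>c d. dsum (a * c) (\<lambda>x y. S x * y * (S d * S b))))"
  proof (intro psum_cong)
    fix a b
    have "dsum a (\<lambda>a a'. dsum h (\<lambda>c d. dsum c (\<lambda>c c'. S (a * c) * (a' * c') * (S d * S b)))) =
       dsum h (\<lambda>c d. dsum a (\<lambda>a a'. dsum c (\<lambda>c c'. S (a * c) * (a' * c') * (S d * S b))))"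
      by (rule psum_swap)
    also have "\<dots> = dsum h (\<lambda>c d. dsum (a * c) (\<lambda>x y. S x * y * (S d * S b)))"
      by (intro psum_cong dsum_mult[where sc=hs and f="\<lambda>x y. S x * y * (S d * S b)" for d, symmetric]) (intro hlin0)+
    finally show "dsum a (\<lambda>a a'. dsum h (\<lambda>c d. dsum c (\<lambda>c c'. S (a * c) * (a' * c') * (S d * S b)))) =
      dsum h (\<lambda>c d. dsum (a * c) (\<lambda>x y. S x * y * (S d * S b)))" .
  qed
  also have "\<dots> = dsum g (\<lambda>a b. dsum h (\<lambda>c d. hs (eps (a * c)) (1 * (S d * S b))))"
    by (intro psum_cong dsum_antipode1[where sc=hs and f="\<lambda>x. x * (S d * S b)" for d b]) (intro hlin0)
  also have "\<dots> = dsum g (\<lambda>a b. hs (eps a) (dsum h (\<lambda>c d. hs (eps c) (S d * S b))))"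
    by (simp add: hs_psum eps_simps)
  also have "\<dots> = S h * S g"
    by (simp only: c1, rule dsum_counit1[where sc=hs and f="\<lambda>b. S h * S b"]) (intro hlin0)
  finally show ?thesis .
qed

end

section \<open>Multilinear maps and the diagonal action\<close>

lemma contract_Suc: "contract (Suc i) (x # xs) = x # contract i xs"
  by (simp add: contract_def)
lemma contract_0: "contract 0 (x # y # xs) = (x * y) # xs"
  by (simp add: contract_def)
lemma length_contract: "Suc i < length xs ==> length (contract i xs) = length xs - 1"
  by (simp add: contract_def)
lemma contract_append1: "Suc i < length us ==> contract i (us @ vs) = contract i us @ vs"
  by (simp add: contract_def nth_append)
lemma contract_append2: "contract (length us + i) (us @ vs) = us @ contract i vs"
  by (simp add: contract_def nth_append)
lemma contract_mid: "contract (length us) (us @ a # b # vs) = us @ (a * b) # vs"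
  using contract_append2[of us 0 "a # b # vs"] by (simp add: contract_0)

locale braided_mod_alg = qt_hopf_alg H for H :: "('k::field, 'h::{ring,monoid_mult}) qt_hopf" +
  fixes B :: "('k, 'h, 'b::{ring,monoid_mult}) hmod_alg"
  assumes ma: "module_algebra H B"
begin

abbreviation "bs \<equiv> scl B"
abbreviation "ac \<equiv> act B"
abbreviation "A \<equiv> cochain_act H B"

lemma kalgB: "k_algebra B" using ma by (simp add: module_algebra_def)
lemma vsB: "vector_space bs" using kalgB by (simp add: k_algebra_def)
lemma bs_mult: "bs c x * y = bs c (x * y)" "x * bs c y = bs c (x * y)"
  using kalgB by (auto simp: k_algebra_def)
lemma act_mult: "ac (g * h) x = ac g (ac h x)" using ma by (simp add: module_algebra_def)
lemma act_one: "ac 1 x = x" using ma by (simp add: module_algebra_def)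
lemma act_unit: "ac h 1 = bs (eps h) 1" using ma by (simp add: module_algebra_def)
lemma act_prod: "ac h (x * y) = dsum h (\<lambda>a b. ac a x * ac b y)" using ma by (simp add: module_algebra_def psum_def)

sublocale VB: vector_space bs by (rule vsB)

lemma klin_act: "klin s bs \<psi> ==> klin s bs (\<lambda>x. ac a (\<psi> x))"
  using ma by (auto simp: module_algebra_def klin_def)
lemma klin_act_h: "klin s hs \<phi> ==> klin s bs (\<lambda>x. ac (\<phi> x) y)"
  using ma by (auto simp: module_algebra_def klin_def)
lemma klin_multB: "klin s bs \<psi> ==> klin s bs (\<lambda>x. \<psi> x * y)" "klin s bs \<psi> ==> klin s bs (\<lambda>x. y * \<psi> x)"
  by (auto simp: klin_def distrib_left distrib_right bs_mult)
lemma klin_bs: "klin s bs \<psi> ==> klin s bs (\<lambda>x. bs c (\<psi> x))"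
  by (auto simp: klin_def VB.scale_right_distrib mult.commute)

lemma act_zero [simp]: "ac a 0 = 0" using klin_zero[OF klin_act[OF klin_id, of a]] .
lemma act_psum: "ac h (psum xs f) = psum xs (\<lambda>a b. ac h (f a b))"
  by (rule klin_psum[OF klin_act[OF klin_id]])

text \<open>Linearity in every slot of lists of every length. A cochain vanishes off its own length,
  so this agrees with multilinearity there and removes length conditions from linearity
  goals.\<close>

definition ml :: "('b list => 'b) => bool" where
  "ml g \<longleftrightarrow> (\<forall>us vs. klin bs bs (\<lambda>a. g (us @ a # vs)))"

lemma multilin_iff: "f \<in> multilin B n \<longleftrightarrow> (\<forall>xs. length xs \<noteq> n \<longrightarrow> f xs = 0) \<and> ml f"
proof
  assume f: "f \<in> multilin B n"
  show "(\<forall>xs. length xs \<noteq> n \<longrightarrow> f xs = 0) \<and> ml f"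
    unfolding ml_def
  proof safe
    show "klin bs bs (\<lambda>a. f (us @ a # vs))" for us vs
      using f by (cases "length us + 1 + length vs = n") (auto simp: multilin_def intro!: klinI)
  qed (use f in \<open>auto simp: multilin_def\<close>)
qed (auto simp: multilin_def ml_def klin_def)

lemma multilin_ml: "f \<in> multilin B n ==> ml f" by (simp add: multilin_iff)
lemma multilin_len: "f \<in> multilin B n ==> length xs \<noteq> n ==> f xs = 0" by (simp add: multilin_iff)
lemma multilinI: "ml f ==> (\<And>xs. length xs \<noteq> n ==> f xs = 0) ==> f \<in> multilin B n" by (simp add: multilin_iff)

text \<open>Cochains given by a formula are guarded by a length test; this confines the linearity
  check to lists that pass it.\<close>

lemma ml_guardI:
  assumes "\<And>us vs. Suc (length us + length vs) = n ==> klin bs bs (\<lambda>a. f (us @ a # vs))"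
  shows "(\<lambda>xs. if length xs = n then f xs else 0) \<in> multilin B n"
proof (rule multilinI)
  show "ml (\<lambda>xs. if length xs = n then f xs else 0)" unfolding ml_def
  proof (intro allI)
    fix us vs show "klin bs bs (\<lambda>a. if length (us @ a # vs) = n then f (us @ a # vs) else 0)"
      using assms[of us vs] klin_zeroI[OF vsB] by (cases "Suc (length us + length vs) = n") auto
  qed
qed auto

text \<open>The numbered variants repeat this rule for the shapes of lists that remain after
  simplification with \<open>append\<close> and \<open>Cons\<close>, so that linearity goals are
  solved by resolution alone.\<close>

lemma ml_slot: "ml g ==> klin s bs \<psi> ==> klin s bs (\<lambda>x. g (us @ \<psi> x # vs))"
  unfolding ml_def using klin_comp[where f="\<lambda>a. g (us @ a # vs)"] by blast
lemma ml_slot0: "ml g ==> klin s bs \<psi> ==> klin s bs (\<lambda>x. g (\<psi> x # vs))"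
  using ml_slot[of g s \<psi> "[]"] by simp
lemma ml_slot1: "ml g ==> klin s bs \<psi> ==> klin s bs (\<lambda>x. g (y # \<psi> x # vs))"
  using ml_slot[of g s \<psi> "[y]"] by simp
lemma ml_slot2: "ml g ==> klin s bs \<psi> ==> klin s bs (\<lambda>x. g (y # us @ \<psi> x # vs))"
  using ml_slot[of g s \<psi> "y # us"] by simp
lemma ml_slot3: "ml g ==> klin s bs \<psi> ==> klin s bs (\<lambda>x. g (us @ y # \<psi> x # vs))"
  using ml_slot[of g s \<psi> "us @ [y]"] by simp
lemma ml_slot4: "ml g ==> klin s bs \<psi> ==> klin s bs (\<lambda>x. g (us @ y # us' @ \<psi> x # vs))"
  using ml_slot[of g s \<psi> "us @ y # us'"] by simp
lemma ml_slot5: "ml g ==> klin s bs \<psi> ==> klin s bs (\<lambda>x. g (us @ us' @ \<psi> x # vs))"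
  using ml_slot[of g s \<psi> "us @ us'"] by simp

lemma mlI: "(\<And>us vs. klin bs bs (\<lambda>a. g (us @ a # vs))) ==> ml g" by (simp add: ml_def)
lemma ml_klin: "ml g ==> klin bs bs L ==> ml (\<lambda>us. L (g us))"
  unfolding ml_def using klin_comp by blast
lemma ml_act: "ml g ==> ml (\<lambda>us. ac a (g us))" by (erule ml_klin) (intro klin_act klin_id)
lemma ml_multB: "ml g ==> ml (\<lambda>us. y * g us)" "ml g ==> ml (\<lambda>us. g us * y)"
  by (erule ml_klin, intro klin_multB klin_id)+
lemma ml_psum: "(\<And>a b. ml (g a b)) ==> ml (\<lambda>us. psum xs (\<lambda>a b. g a b us))"
  unfolding ml_def by (intro allI klin_psumI vsB) auto
lemma ml_prefix: "ml g ==> ml (\<lambda>us. g (zs @ us))"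
proof (rule mlI)
  fix us vs assume "ml g" from ml_slot[OF this klin_id, of "zs @ us" vs]
  show "klin bs bs (\<lambda>a. g (zs @ us @ a # vs))" by simp
qed
lemma ml_suffix: "ml g ==> ml (\<lambda>us. g (us @ zs))"
proof (rule mlI)
  fix us vs assume "ml g" from ml_slot[OF this klin_id, of us "vs @ zs"]
  show "klin bs bs (\<lambda>a. g ((us @ a # vs) @ zs))" by simp
qed
lemma ml_Cons: "ml g ==> ml (\<lambda>us. g (z # us))" using ml_prefix[of g "[z]"] by simp
lemma ml_mid: "ml g ==> ml (\<lambda>us. g (zs @ us @ ys))" using ml_prefix[OF ml_suffix[of g ys], of zs] by simp
lemma ml_mid2: "ml g ==> ml (\<lambda>us. g (zs @ z # us))" using ml_prefix[of g "zs @ [z]"] by simp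
lemma ml_mid3: "ml g ==> ml (\<lambda>us. g (zs @ z # us @ ys))" using ml_mid[of g "zs @ [z]" ys] by simp
lemma ml_mid4: "ml g ==> ml (\<lambda>us. g (zs @ zs' @ us))" using ml_prefix[of g "zs @ zs'"] by simp
lemma ml_mid5: "ml g ==> ml (\<lambda>us. g (z # us @ ys))" using ml_mid[of g "[z]" ys] by simp
lemma ml_mid6: "ml g ==> ml (\<lambda>us. g (z # zs @ us))" using ml_prefix[of g "z # zs"] by simp

text \<open>\<open>TA g h xs\<close> is \<open>g (h \<cdot> xs)\<close> for the diagonal action, with \<open>h\<close> acting on the empty tensor by
  the counit. Passing \<open>g\<close> through the recursion avoids formal sums of tensors.\<close>

primrec TA :: "('b list => 'b) => 'h => 'b list => 'b" where
  "TA g h [] = bs (eps h) (g [])"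
| "TA g h (x # xs) = dsum h (\<lambda>a b. TA (\<lambda>us. g (ac a x # us)) b xs)"

lemma klin_TA_param: "(\<And>us. klin s bs (\<lambda>x. G x us)) ==> klin s bs (\<lambda>x. TA (G x) a xs)"
proof (induction xs arbitrary: G a)
  case Nil then show ?case by (simp add: klin_bs)
next
  case (Cons y xs)
  show ?case unfolding TA.simps by (intro klin_psumI vsB Cons.IH Cons.prems)
qed

lemma TA_klin: "klin bs bs L ==> L (TA g h xs) = TA (\<lambda>us. L (g us)) h xs"
  by (induction xs arbitrary: g h) (simp_all add: klin_scale klin_psum)

lemma TA_mult_left: "y * TA g h xs = TA (\<lambda>us. y * g us) h xs"
  by (rule TA_klin) (intro klin_multB klin_id)
lemma TA_mult_right: "TA g h xs * y = TA (\<lambda>us. g us * y) h xs"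
  by (rule TA_klin[where L="\<lambda>x. x * y"]) (intro klin_multB klin_id)
lemma TA_act: "ac a (TA g h xs) = TA (\<lambda>us. ac a (g us)) h xs"
  by (rule TA_klin) (intro klin_act klin_id)

lemma TA_zero [simp]: "TA (\<lambda>us. 0) h xs = 0" by (induction xs arbitrary: h) auto
lemma TA_add: "TA (\<lambda>us. f us + g us) h xs = TA f h xs + TA g h xs"
  by (induction xs arbitrary: h f g) (auto simp: VB.scale_right_distrib psum_add)
lemma TA_psum: "TA (\<lambda>us. psum ys (\<lambda>a b. g a b us)) h xs = psum ys (\<lambda>a b. TA (g a b) h xs)"
  by (induction ys) (auto simp: TA_add)

lemma klin_TA_h: "ml g ==> hlin bs (\<lambda>h. TA g h xs)"
proof (induction xs arbitrary: g)
  case Nil then show ?case by (simp add: hlin_eps[OF vsB klin_id])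
next
  case (Cons x xs)
  show ?case unfolding TA.simps
    by (intro hlin_dsum vsB klin_TA_param Cons.IH ml_Cons[OF Cons.prems] ml_slot0[OF Cons.prems] klin_act_h klin_id)
qed

lemma klin_TA: "ml g ==> klin s hs \<phi> ==> klin s bs (\<lambda>x. TA g (\<phi> x) xs)"
  by (rule klin_comp[OF klin_TA_h])

lemma ml_TA_param: "(\<And>vs. ml (\<lambda>us. G us vs)) ==> ml (\<lambda>us. TA (G us) a xs)"
  unfolding ml_def by (intro allI klin_TA_param) auto

text \<open>The lists at which \<open>TA\<close> evaluates its function have the length of the given
  list and entries that are H-translates of its entries. Since E is stable under H, an entry in E
  stays in E; this is what lets the relative condition pass under the action.\<close>

lemma TA_cong:
  assumes "\<And>us. length us = length xs ==> (\<And>i. i < length xs ==> xs!i \<in> E ==> us!i \<in> E) ==> g us = g' us"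
   and E: "\<And>h x. x \<in> E ==> ac h x \<in> E"
  shows "TA g h xs = TA g' h xs"
  using assms(1)
proof (induction xs arbitrary: g g' h)
  case (Cons x xs)
  show ?case unfolding TA.simps
    by (intro psum_cong Cons.IH Cons.prems) (auto simp: nth_Cons E split: nat.split)
qed simp

lemma TA_cong_len: "(\<And>us. length us = length xs ==> g us = g' us) ==> TA g h xs = TA g' h xs"
  by (rule TA_cong[where E="{}"]) auto

lemmas klins = klin_id hlin_mult hlin_S hlin_hs klin_act klin_act_h klin_multB klin_bs klin_TA klin_TA_param
  klin_psumI[OF vsB] ml_slot0 ml_slot1 ml_slot2 ml_slot3 ml_slot4 ml_slot5 ml_slot
  ml_act ml_multB ml_psum ml_suffix ml_prefix ml_Cons ml_mid ml_mid2 ml_mid3 ml_mid4 ml_mid5 ml_mid6 ml_TA_param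

text \<open>The empty prefix is the counit axiom and each further entry is one use of
  coassociativity.\<close>

lemma TA_append: "ml g ==> TA g h (xs @ ys) = dsum h (\<lambda>a b. TA (\<lambda>us. TA (\<lambda>vs. g (us @ vs)) b ys) a xs)"
proof (induction xs arbitrary: g h)
  case Nil
  then show ?case using dsum_counit1[OF klin_TA_h[OF Nil], of h ys] by simp
next
  case (Cons x xs)
  have "TA g h ((x # xs) @ ys) = dsum h (\<lambda>a b. dsum b (\<lambda>c d. TA (\<lambda>us. TA (\<lambda>vs. g (ac a x # us @ vs)) d ys) c xs))"
    by (simp add: Cons.IH[OF ml_Cons[OF Cons.prems]])
  also have "\<dots> = dsum h (\<lambda>a b. dsum a (\<lambda>a c. TA (\<lambda>us. TA (\<lambda>vs. g (ac a x # us @ vs)) b ys) c xs))"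
    by (rule dsum_assoc[of bs, symmetric]) (intro klins Cons.prems)+
  finally show ?case by simp
qed

lemma ml_TA: assumes "ml g" shows "ml (\<lambda>xs. TA g h xs)"
proof (rule mlI)
  fix us vs
  have "TA g h (us @ a # vs) = dsum h (\<lambda>c b. TA (\<lambda>us. dsum b (\<lambda>d e. TA (\<lambda>vs. g (us @ ac d a # vs)) e vs)) c us)" for a
    by (simp add: TA_append[OF assms])
  then show "klin bs bs (\<lambda>a. TA g h (us @ a # vs))"
    by (simp only:) (intro klins assms)
qed

lemma TA_mult: "ml g ==> TA g (h * h') xs = TA (\<lambda>ys. TA g h ys) h' xs"
proof (induction xs arbitrary: g h h')
  case Nil then show ?case by (simp add: eps_simps mult.commute)
next
  case (Cons x xs)
  have "TA g (h * h') (x # xs) = dsum h (\<lambda>a b. dsum h' (\<lambda>c d. TA (\<lambda>us. g (ac (a * c) x # us)) (b * d) xs))"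
    unfolding TA.simps by (rule dsum_mult[of bs]) (intro klins Cons.prems)+
  also have "\<dots> = dsum h (\<lambda>a b. dsum h' (\<lambda>c d. TA (\<lambda>ys. TA (\<lambda>us. g (ac a (ac c x) # us)) b ys) d xs))"
    by (subst Cons.IH[OF ml_Cons[OF Cons.prems]]) (simp add: act_mult)
  also have "\<dots> = dsum h' (\<lambda>c d. dsum h (\<lambda>a b. TA (\<lambda>ys. TA (\<lambda>us. g (ac a (ac c x) # us)) b ys) d xs))"
    by (rule psum_swap)
  finally show ?case by (simp add: TA_psum)
qed

lemma TA_one: "ml g ==> TA g 1 xs = g xs"
proof (induction xs arbitrary: g)
  case Nil then show ?case by (simp add: eps_simps)
next
  case (Cons x xs)
  have "TA g 1 (x # xs) = TA (\<lambda>us. g (ac 1 x # us)) 1 xs"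
    unfolding TA.simps by (rule dsum_one[of bs]) (intro klins Cons.prems)+
  then show ?case by (simp add: Cons.IH[OF ml_Cons[OF Cons.prems]] act_one)
qed

text \<open>Multiplication in a module algebra is equivariant, so merging two neighbours commutes
  with the diagonal action.\<close>

lemma TA_contract: "ml g ==> Suc i < length xs ==> TA g h (contract i xs) = TA (\<lambda>ys. g (contract i ys)) h xs"
proof (induction i arbitrary: xs g h)
  case 0
  then obtain x y zs where xs: "xs = x # y # zs" by (cases xs; cases "tl xs") auto
  have "TA g h (contract 0 xs) = dsum h (\<lambda>a b. dsum a (\<lambda>c d. TA (\<lambda>us. g ((ac c x * ac d y) # us)) b zs))"
    unfolding xs contract_0 TA.simps act_prod
    by (intro psum_cong klin_psum[of bs bs]) (intro klins "0.prems")
  also have "\<dots> = dsum h (\<lambda>a b. dsum b (\<lambda>c d. TA (\<lambda>us. g ((ac a x * ac c y) # us)) d zs))"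
    by (rule dsum_assoc[of bs]) (intro klins "0.prems")+
  finally show ?case by (simp add: xs contract_0)
next
  case (Suc i)
  then obtain x ys where xs: "xs = x # ys" by (cases xs) auto
  show ?case using Suc.prems unfolding xs by (simp add: contract_Suc Suc.IH ml_Cons)
qed

text \<open>The trailing leg that \<open>TA\<close> leaves at the empty list is a counit, whereas
  \<open>tact\<close> stops at the last entry. The empty list is excluded because
  \<open>tact\<close> has a junk value there.\<close>

lemma TA_eq_tact: "ml g ==> xs \<noteq> [] ==> (\<Sum>ys\<in>#tact H B h xs. g ys) = TA g h xs"
proof (induction xs arbitrary: g h)
  case (Cons x xs)
  show ?case
  proof (cases xs)
    case Nil
    have "TA g h [x] = dsum h (\<lambda>a b. bs (eps b) (g [ac a x]))" by simp
    also have "\<dots> = g [ac h x]" by (rule dsum_counit2) (intro klins Cons.prems)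
    finally show ?thesis by (simp add: Nil)
  next
    case (Cons y ys)
    have "tact H B h (x # xs) = dsum h (\<lambda>a b. image_mset ((#) (ac a x)) (tact H B b xs))"
      by (simp add: Cons psum_def)
    then show ?thesis
      using Cons.IH[OF ml_Cons[OF Cons.prems(1)]] Cons by (simp add: sum_mset_psum image_mset.compositionality comp_def)
  qed
qed simp

section \<open>The action on the inner Hom\<close>

lemma eval_act_eq: "ml f ==> eval_act H B f h xs = TA f h xs"
  by (simp add: eval_act_def TA_eq_tact)

lemma A_fun: "ml f ==> A h f = (\<lambda>xs. dsum h (\<lambda>a b. ac a (TA f (S b) xs)))"
  by (rule ext) (simp add: cochain_act_def psum_def eval_act_eq)

lemma A_eq: "ml f ==> A h f xs = dsum h (\<lambda>a b. ac a (TA f (S b) xs))"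
  by (simp add: cochain_act_def psum_def eval_act_eq)

lemma klin_A: "ml f ==> klin s hs \<phi> ==> klin s bs (\<lambda>x. A (\<phi> x) f xs)"
  by (rule klin_comp[where f="\<lambda>h. A h f xs" and g=\<phi>], simp add: A_eq, rule hlin_dsum)
   (intro klins vsB | assumption)+

lemma ml_A: "ml f ==> ml (A h f)"
proof -
  assume "ml f"
  then have "A h f = (\<lambda>xs. dsum h (\<lambda>a b. ac a (TA f (S b) xs)))" by (auto simp: A_eq)
  moreover have "ml \<dots>" by (intro klins ml_TA) fact
  ultimately show ?thesis by simp
qed

lemma A_multilin: assumes "f \<in> multilin B n" shows "A h f \<in> multilin B n"
proof (rule multilinI)
  note m = multilin_ml[OF assms]
  show "ml (A h f)" by (rule ml_A[OF m])
  fix xs :: "'b list" assume "length xs \<noteq> n"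
  then have "TA f b xs = TA (\<lambda>us. 0) b xs" for b
    by (intro TA_cong_len) (simp add: multilin_len[OF assms])
  then show "A h f xs = 0" by (simp add: A_eq[OF m])
qed

lemma klin_A_param:
  assumes "\<And>x. ml (G x)" "\<And>us. klin s bs (\<lambda>x. G x us)"
  shows "klin s bs (\<lambda>x. A h (G x) xs)"
  unfolding A_eq[OF assms(1)] by (intro klins assms)

lemma A_one: "ml f ==> A 1 f xs = f xs"
  by (simp add: A_eq, subst dsum_one[of bs], (intro klins; assumption)+) (simp add: S_one TA_one act_one)

lemma A_mult: assumes f: "ml f" shows "A (g * h) f xs = A g (A h f) xs"
proof -
  have "A (g * h) f xs = dsum g (\<lambda>a b. dsum h (\<lambda>c d. ac (a * c) (TA f (S (b * d)) xs)))"
    unfolding A_eq[OF f] by (rule dsum_mult[of bs]) (intro klins f)+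
  also have "\<dots> = dsum g (\<lambda>a b. dsum h (\<lambda>c d. ac a (TA (\<lambda>ys. ac c (TA f (S d) ys)) (S b) xs)))"
    by (simp add: S_mult TA_mult[OF f] act_mult TA_act)
  also have "\<dots> = dsum g (\<lambda>a b. ac a (TA (\<lambda>ys. dsum h (\<lambda>c d. ac c (TA f (S d) ys))) (S b) xs))"
    by (simp add: TA_psum act_psum)
  also have "\<dots> = A g (A h f) xs"
    by (subst (1) A_eq[OF ml_A[OF f]]) (simp only: A_fun[OF f])
  finally show ?thesis .
qed

text \<open>The action on the inner Hom is the only one for which evaluation is equivariant.
  Equivariance of an operation on cochains is therefore checked through evaluation, and the antipode
  has to be handled only here and in \<open>act_eval\<close>.\<close>

lemma A_unique:
  assumes X: "\<And>xs. hlin bs (\<lambda>h. X h xs)" "\<And>h. ml (X h)" and f: "ml f"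
    and eq: "\<And>h ys. length ys = length xs ==> ac h (f ys) = dsum h (\<lambda>a b. TA (X a) b ys)"
  shows "A h f xs = X h xs"
proof -
  have "A h f xs = dsum h (\<lambda>a b. TA (\<lambda>ys. ac a (f ys)) (S b) xs)"
    by (simp add: A_eq[OF f] TA_act)
  also have "\<dots> = dsum h (\<lambda>a b. TA (\<lambda>ys. dsum a (\<lambda>c d. TA (X c) d ys)) (S b) xs)"
    by (intro psum_cong TA_cong_len) (simp add: eq)
  also have "\<dots> = dsum h (\<lambda>a b. dsum a (\<lambda>c d. TA (X c) (d * S b) xs))"
    by (simp add: TA_psum TA_mult[OF X(2)])
  also have "\<dots> = dsum h (\<lambda>a b. dsum b (\<lambda>c d. TA (X a) (c * S d) xs))"
    by (rule dsum_assoc[of bs]) (intro klins X)+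
  also have "\<dots> = dsum h (\<lambda>a b. bs (eps b) (TA (X a) 1 xs))"
    by (intro psum_cong dsum_antipode2) (intro klins X)
  also have "\<dots> = X h xs"
    unfolding TA_one[OF X(2)] by (rule dsum_counit2) (rule X)
  finally show ?thesis .
qed

text \<open>Evaluation is a morphism: after coassociativity the antipode inside the action on f
  meets the leg that acts on the arguments and cancels it.\<close>

lemma act_eval: assumes f: "ml f"
  shows "ac h (f xs) = dsum h (\<lambda>a b. TA (A a f) b xs)"
proof -
  have "dsum h (\<lambda>a b. TA (A a f) b xs) = dsum h (\<lambda>a b. TA (\<lambda>ys. dsum a (\<lambda>c d. ac c (TA f (S d) ys))) b xs)"
    by (simp only: A_fun[OF f])
  also have "\<dots> = dsum h (\<lambda>a b. dsum a (\<lambda>c d. ac c (TA f (S d * b) xs)))"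
    by (simp add: TA_psum TA_mult[OF f] TA_act[symmetric])
  also have "\<dots> = dsum h (\<lambda>a b. dsum b (\<lambda>c d. ac a (TA f (S c * d) xs)))"
    by (rule dsum_assoc[of bs]) (intro klins f)+
  also have "\<dots> = dsum h (\<lambda>a b. bs (eps b) (ac a (TA f 1 xs)))"
    by (intro psum_cong dsum_antipode1[where f="\<lambda>x. ac a (TA f x xs)" for a]) (intro klins f)
  also have "\<dots> = ac h (f xs)"
    unfolding TA_one[OF f] by (rule dsum_counit2) (intro klins)
  finally show ?thesis by simp
qed

end

section \<open>Faces and braided insertions\<close>

context qt_hopf_alg begin

text \<open>Naturality of the braiding in the form required for insertions. Coassociativity brings
  the two legs of h that meet the R-matrix next to each other, and R Delta(h) = Delta^op(h) R moves
  them to its other side. An abstract K of five arguments keeps the linearity checks to one per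
  slot.\<close>

lemma sweedler5:
  fixes K :: "'h => 'h => 'h => 'h => 'h => 'x::ab_group_add"
  assumes v: "vector_space sc" and
   K: "\<And>b c d e. hlin sc (\<lambda>a. K a b c d e)" "\<And>a c d e. hlin sc (\<lambda>b. K a b c d e)"
      "\<And>a b d e. hlin sc (\<lambda>c. K a b c d e)" "\<And>a b c e. hlin sc (\<lambda>d. K a b c d e)" "\<And>a b c d. hlin sc (\<lambda>e. K a b c d e)"
  shows "rsum (\<lambda>s t. dsum h (\<lambda>a b. dsum b (\<lambda>c d. dsum d (\<lambda>e e'. dsum e (\<lambda>i j. K a (i * s) j e' (c * t))))))
    = dsum h (\<lambda>a b. dsum a (\<lambda>a1 a2. dsum b (\<lambda>c d. dsum d (\<lambda>e e'. rsum (\<lambda>s t. K a1 (s * a2) e e' (t * c))))))"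
proof -
  have K2: "klin s hs x ==> klin s sc (\<lambda>a. K (x a) b c d e)" "klin s hs x ==> klin s sc (\<lambda>a. K b (x a) c d e)"
     "klin s hs x ==> klin s sc (\<lambda>a. K b c (x a) d e)" "klin s hs x ==> klin s sc (\<lambda>a. K b c d (x a) e)"
     "klin s hs x ==> klin s sc (\<lambda>a. K b c d e (x a))" for s and x :: "'h => 'h" and b c d e
    by (erule klin_comp[OF K(1)] klin_comp[OF K(2)] klin_comp[OF K(3)] klin_comp[OF K(4)] klin_comp[OF K(5)])+
  note l = klin_psumI[OF v] K2 klin_id hlin_mult hlin_dsum[OF v]
  have "rsum (\<lambda>s t. dsum h (\<lambda>a b. dsum b (\<lambda>c d. dsum d (\<lambda>e e'. dsum e (\<lambda>i j. K a (i * s) j e' (c * t)))))) =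
    rsum (\<lambda>s t. dsum h (\<lambda>a b. dsum b (\<lambda>c d. dsum d (\<lambda>i e. dsum e (\<lambda>j e'. K a (i * s) j e' (c * t))))))"
    by (rule psum_cong, rule psum_cong, rule psum_cong, rule dsum_assoc[of sc]) (intro l)+
  also have "\<dots> = rsum (\<lambda>s t. dsum h (\<lambda>a b. dsum b (\<lambda>x e. dsum x (\<lambda>c i. dsum e (\<lambda>j e'. K a (i * s) j e' (c * t))))))"
    by (rule psum_cong, rule psum_cong, rule dsum_assoc[of sc, symmetric]) (intro l)+
  also have "\<dots> = dsum h (\<lambda>a b. dsum b (\<lambda>x e. dsum x (\<lambda>c i. rsum (\<lambda>s t. dsum e (\<lambda>j e'. K a (i * s) j e' (c * t))))))"
    by (simp only: psum_swap[where xs="rmatrix H"])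
  also have "\<dots> = dsum h (\<lambda>a b. dsum b (\<lambda>x e. rsum (\<lambda>s t. dsum x (\<lambda>c i. dsum e (\<lambda>j e'. K a (s * c) j e' (t * i))))))"
    by (rule psum_cong, rule psum_cong, rule rsum_qcomm[of sc, symmetric]) (intro l)+
  also have "\<dots> = dsum h (\<lambda>a b. dsum b (\<lambda>x e. dsum x (\<lambda>c i. dsum e (\<lambda>j e'. rsum (\<lambda>s t. K a (s * c) j e' (t * i))))))"
    by (simp only: psum_swap[where xs="rmatrix H"])
  also have "\<dots> = dsum h (\<lambda>a b. dsum b (\<lambda>a2 b. dsum b (\<lambda>c d. dsum d (\<lambda>j e'. rsum (\<lambda>s t. K a (s * a2) j e' (t * c))))))"
    by (rule psum_cong, rule dsum_assoc[of sc]) (intro l)+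
  also have "\<dots> = dsum h (\<lambda>a b. dsum a (\<lambda>a1 a2. dsum b (\<lambda>c d. dsum d (\<lambda>e e'. rsum (\<lambda>s t. K a1 (s * a2) e e' (t * c))))))"
    by (rule dsum_assoc[of sc, symmetric]) (intro l)+
  finally show ?thesis .
qed

end

context braided_mod_alg begin

lemma TA_single: "ml g ==> TA g h [x] = g [ac h x]"
  using TA_eq_tact[of g "[x]" h] by simp

text \<open>The cofaces whose alternating sum is the braided Hochschild differential. Face 0 is
  braided left multiplication, the last face is right multiplication, and face i merges the entries
  with indices i - 1 and i.\<close>

definition face :: "nat => nat => ('b list => 'b) => 'b list => 'b" where
  "face n i f xs = (if length xs = Suc n then
     (if i = 0 then rsum (\<lambda>s t. ac t (hd xs) * A s f (tl xs))
      else if i \<le> n then f (contract (i - 1) xs) else f (butlast xs) * last xs) else 0)"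

text \<open>The braided insertion \<open>f \<circ>\<^sub>p g\<close>: \<open>f\<close> has \<open>m + 1\<close> arguments, \<open>g\<close> has \<open>n\<close> and is moved past the
  first \<open>p\<close> arguments of \<open>f\<close> by the braiding.\<close>

definition circ :: "nat => nat => nat => ('b list => 'b) => ('b list => 'b) => 'b list => 'b" where
  "circ m n p f g xs = (if length xs = m + n then
     rsum (\<lambda>s t. TA (\<lambda>us. f (us @ A s g (take n (drop p xs)) # drop (p + n) xs)) t (take p xs)) else 0)"

lemma circ_eval:
  "length us = p ==> length vs = n ==> length ws + p = m ==>
   circ m n p f g (us @ vs @ ws) = rsum (\<lambda>s t. TA (\<lambda>us. f (us @ A s g vs # ws)) t us)"
  by (simp add: circ_def)

lemma split3: assumes "length xs = m + n" "p \<le> m"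
  obtains us vs ws where "xs = us @ vs @ ws" "length us = p" "length vs = n" "length ws + p = m"
proof -
  have "xs = take p xs @ take n (drop p xs) @ drop (p + n) xs"
    by (metis add.commute append_take_drop_id drop_drop)
  then show ?thesis by (rule that) (use assms in auto)
qed

lemma circ_eqI:
  assumes "\<And>us vs ws. length us = p ==> length vs = n ==> length ws + p = m ==> F (us @ vs @ ws) = G (us @ vs @ ws)"
    and "\<And>xs. length xs \<noteq> m + n ==> F xs = G xs" "p \<le> m"
  shows "F = G"
proof
  fix xs show "F xs = G xs"
    by (cases "length xs = m + n") (use assms in \<open>auto elim!: split3[of xs m n p]\<close>)
qed

lemma face_0: "length xs = n ==> face n 0 f (x # xs) = rsum (\<lambda>s t. ac t x * A s f xs)"
  by (simp add: face_def)
lemma face_contract: "length xs = Suc n ==> i < n ==> face n (Suc i) f xs = f (contract i xs)"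
  by (simp add: face_def)
lemma face_last: "length xs = n ==> face n (Suc n) f (xs @ [x]) = f xs * x"
  by (simp add: face_def)
lemma face_len: "length xs \<noteq> Suc n ==> face n i f xs = 0" by (simp add: face_def)
lemma circ_len: "length xs \<noteq> m + n ==> circ m n p f g xs = 0" by (simp add: circ_def)

lemma face_multilin: assumes f: "f \<in> multilin B n" shows "face n i f \<in> multilin B (Suc n)"
proof -
  note m = multilin_ml[OF f]
  have "(\<lambda>xs. if length xs = Suc n then (if i = 0 then rsum (\<lambda>s t. ac t (hd xs) * A s f (tl xs))
      else if i \<le> n then f (contract (i - 1) xs) else f (butlast xs) * last xs) else 0) \<in> multilin B (Suc n)"
  proof (rule ml_guardI)
    fix us vs :: "'b list" assume len: "Suc (length us + length vs) = Suc n"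
    \<comment> \<open>The cases locate the varied entry: the first entry or a later one for face 0;
      before, left member of, right member of, or behind the merged pair for an inner face; any
      place for the last face.\<close>
    consider "i = 0" "us = []" | u us' where "i = 0" "us = u # us'" | "0 < i" "i \<le> n" "length us < i - 1"
      | "0 < i" "i \<le> n" "length us = i - 1" | "0 < i" "i \<le> n" "length us = i" | "0 < i" "i \<le> n" "i < length us" | "n < i"
    proof (cases "i = 0")
      case True then show thesis using that(1,2) by (cases us) auto
    next
      case False
      then have "length us < i - 1 \<or> length us = i - 1 \<or> length us = i \<or> i < length us" by linarith
      then show thesis using that(3-7) False by (metis not_le neq0_conv)
    qed
    then show "klin bs bs (\<lambda>a. if i = 0 then rsum (\<lambda>s t. ac t (hd (us @ a # vs)) * A s f (tl (us @ a # vs)))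
      else if i \<le> n then f (contract (i - 1) (us @ a # vs)) else f (butlast (us @ a # vs)) * last (us @ a # vs))"
    proof cases
      case 1 then show ?thesis by simp (intro klins)
    next
      case 2 then show ?thesis by simp (intro klins ml_A m)
    next
      case 3
      then obtain j where j: "i - 1 = length us + Suc j" using less_imp_Suc_add[OF 3(3)] by auto
      have "contract (i - 1) (us @ a # vs) = us @ a # contract j vs" for a
        unfolding j contract_append2 contract_Suc ..
      with 3 show ?thesis by simp (intro klins m)
    next
      case 4
      then obtain v vs' where "vs = v # vs'" using len by (cases vs) auto
      with 4 have "contract (i - 1) (us @ a # vs) = us @ (a * v) # vs'" for a
        using contract_mid[of us a v vs'] by simp
      with 4 show ?thesis by simp (intro klins m)
    next
      case 5
      then obtain us' u where u: "us = us' @ [u]" by (cases us rule: rev_cases) auto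
      with 5 have "contract (i - 1) (us @ a # vs) = us' @ (u * a) # vs" for a
        using contract_mid[of us' u a vs] by auto
      with 5 show ?thesis by simp (intro klins m)
    next
      case 6
      then have "contract (i - 1) (us @ a # vs) = contract (i - 1) us @ a # vs" for a
        by (intro contract_append1) auto
      with 6 show ?thesis by simp (intro klins m)
    next
      case 7
      then show ?thesis
      proof (cases vs rule: rev_cases)
        case Nil then show ?thesis using 7 by simp (intro klins m)
      next
        case (snoc vs' v)
        have "butlast (us @ a # vs) = us @ a # vs'" "last (us @ a # vs) = v" for a
          by (auto simp: snoc butlast_append)
        then show ?thesis using 7 by simp (intro klins m)
      qed
    qed
  qed
  moreover have "face n i f = (\<lambda>xs. if length xs = Suc n then (if i = 0 then rsum (\<lambda>s t. ac t (hd xs) * A s f (tl xs))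
      else if i \<le> n then f (contract (i - 1) xs) else f (butlast xs) * last xs) else 0)"
    by (auto simp: face_def)
  ultimately show ?thesis by simp
qed

lemma klin_TA_slot: "ml g ==> klin s bs \<psi> ==> klin s bs (\<lambda>x. TA g h (us @ \<psi> x # vs))"
  by (rule ml_slot[OF ml_TA])

lemma circ_multilin: assumes f: "f \<in> multilin B (Suc m)" and g: "g \<in> multilin B n" and p: "p \<le> m"
  shows "circ m n p f g \<in> multilin B (m + n)"
proof -
  note mf = multilin_ml[OF f] and mg = multilin_ml[OF g]
  have "(\<lambda>xs. if length xs = m + n then rsum (\<lambda>s t. TA (\<lambda>us. f (us @ A s g (take n (drop p xs)) # drop (p + n) xs)) t (take p xs)) else 0)
     \<in> multilin B (m + n)"
  proof (rule ml_guardI)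
    fix us vs :: "'b list" assume len: "Suc (length us + length vs) = m + n"
    \<comment> \<open>The varied entry lies among the arguments that g is moved past, inside the
      block fed to g, or behind that block.\<close>
    consider us' where "vs = us' @ drop (length us') vs" "length us + length us' + 1 = p"
      | u us' vs' where "us = u @ us'" "length u = p" "length us' + length vs' + 1 = n" "vs = vs' @ drop (length vs') vs"
      | u v w where "us = u @ v @ w" "length u = p" "length v = n"
    proof -
      have "length us < p \<or> (p \<le> length us \<and> length us < p + n) \<or> p + n \<le> length us" by auto
      then show thesis
      proof (elim disjE)
        assume "length us < p"
        then show thesis using len p by (intro that(1)[of "take (p - length us - 1) vs"]) auto
      next
        assume "p \<le> length us \<and> length us < p + n"
        then show thesis using len p by (intro that(2)[of "take p us" "drop p us" "take (n + p - length us - 1) vs"]) auto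
      next
        assume *: "p + n \<le> length us"
        have "us = take p us @ take n (drop p us) @ drop (p + n) us"
          by (metis add.commute append_take_drop_id drop_drop)
        then show thesis by (rule that(3)) (use * in auto)
      qed
    qed
    then show "klin bs bs (\<lambda>a. rsum (\<lambda>s t. TA (\<lambda>zs. f (zs @ A s g (take n (drop p (us @ a # vs))) # drop (p + n) (us @ a # vs))) t (take p (us @ a # vs))))"
    proof cases
      case 1
      have "take p (us @ a # vs) = us @ a # us'" "drop p (us @ a # vs) = drop (length us') vs"
         "drop (p + n) (us @ a # vs) = drop n (drop (length us') vs)" for a
        using 1 by (auto simp: add.commute simp flip: 1(2)) (metis append_eq_conv_conj)
      then show ?thesis by (simp only:) (intro klins mf klin_TA_slot)
    next
      case 2
      have "take p (us @ a # vs) = u" "take n (drop p (us @ a # vs)) = us' @ a # vs'"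
         "drop (p + n) (us @ a # vs) = drop (length vs') vs" for a
        using 2 by (auto simp flip: 2(2,3)) (metis append_eq_conv_conj)
      then show ?thesis by (simp only:) (intro klins mf ml_slot[OF ml_A] mg)
    next
      case 3
      have "take p (us @ a # vs) = u" "take n (drop p (us @ a # vs)) = v"
         "drop (p + n) (us @ a # vs) = w @ a # vs" for a
        using 3 by (auto)
      then show ?thesis by (simp only:) (intro klins mf)
    qed
  qed
  moreover have "circ m n p f g = (\<lambda>xs. if length xs = m + n then rsum (\<lambda>s t. TA (\<lambda>us. f (us @ A s g (take n (drop p xs)) # drop (p + n) xs)) t (take p xs)) else 0)"
    by (auto simp: circ_def)
  ultimately show ?thesis by simp
qed

section \<open>Equivariance of insertions and faces\<close>

lemma TA_insert: assumes F: "ml F"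
  shows "TA F b (us @ y # ws) = dsum b (\<lambda>c d. dsum d (\<lambda>e e'. TA (\<lambda>us. TA (\<lambda>ws. F (us @ ac e y # ws)) e' ws) c us))"
  by (simp add: TA_append[OF F] TA_psum)

lemma TA_append3: assumes F: "ml F"
  shows "TA F b (us @ vs @ ws) = dsum b (\<lambda>c d. dsum d (\<lambda>e e'. TA (\<lambda>us. TA (\<lambda>vs. TA (\<lambda>ws. F (us @ vs @ ws)) e' ws) e vs) c us))"
proof -
  have "TA (\<lambda>vs. F (us @ vs)) d (vs @ ws) = dsum d (\<lambda>e e'. TA (\<lambda>vs. TA (\<lambda>ws. F (us @ vs @ ws)) e' ws) e vs)" for us d
    by (rule TA_append) (intro ml_prefix F)
  then show ?thesis by (simp add: TA_append[OF F] TA_psum)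
qed

lemma hlin_circ: assumes f: "f \<in> multilin B (Suc m)" and g: "g \<in> multilin B n"
  shows "hlin bs (\<lambda>h. dsum h (\<lambda>a b. circ m n p (A a f) (A b g) xs))"
proof -
  note mf = multilin_ml[OF f] and mg = multilin_ml[OF g]
  show ?thesis
    by (cases "length xs = m + n") (simp_all add: circ_def klin_zeroI[OF vsB], intro hlin_dsum vsB klins klin_A ml_A mf mg klin_A_param)
qed

text \<open>An insertion is composed of evaluation and the braiding, which are morphisms, so it is
  itself a morphism from the tensor product of two inner Homs. By \<open>A_unique\<close> it
  suffices to compare evaluations, where \<open>act_eval\<close> applies to f and to the moved
  g.\<close>

lemma A_circ: assumes f: "f \<in> multilin B (Suc m)" and g: "g \<in> multilin B n" and p: "p \<le> m"
  shows "A h (circ m n p f g) xs = dsum h (\<lambda>a b. circ m n p (A a f) (A b g) xs)"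
proof -
  note mf = multilin_ml[OF f] and mg = multilin_ml[OF g]
  note mc = multilin_ml[OF circ_multilin[OF f g p]]
  have mX: "ml (\<lambda>xs. dsum h (\<lambda>a b. circ m n p (A a f) (A b g) xs))" for h
    by (intro ml_psum multilin_ml[OF circ_multilin] A_multilin f g p)
  show ?thesis
  proof (cases "length xs = m + n")
    case False
    then show ?thesis
      using multilin_len[OF A_multilin[OF circ_multilin[OF f g p]]] by (simp add: circ_len)
  next
    case True
    show ?thesis
    proof (rule A_unique[where X="\<lambda>h xs. dsum h (\<lambda>a b. circ m n p (A a f) (A b g) xs)", OF hlin_circ[OF f g] mX mc])
      fix h and ys :: "'b list" assume "length ys = length xs"
      with True have "length ys = m + n" by simp
      then obtain us vs ws where ys: "ys = us @ vs @ ws" "length us = p" "length vs = n" "length ws + p = m"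
        using p by (rule split3)
      \<comment> \<open>One slot for each leg of h: on f, on g, on the block of g, on the arguments
        behind it, and on those in front of it.\<close>
      define K where "K \<equiv> \<lambda>a b c d e. TA (\<lambda>us. TA (\<lambda>ws. A a f (us @ TA (A b g) c vs # ws)) d ws) e us"
      have lK: "\<And>b c d e. hlin bs (\<lambda>a. K a b c d e)" "\<And>a c d e. hlin bs (\<lambda>b. K a b c d e)"
      "\<And>a b d e. hlin bs (\<lambda>c. K a b c d e)" "\<And>a b c e. hlin bs (\<lambda>d. K a b c d e)" "\<And>a b c d. hlin bs (\<lambda>e. K a b c d e)"
        unfolding K_def by (intro klins mf ml_A mg klin_A)+
      have ev: "ac e (A s g vs) = dsum e (\<lambda>i j. TA (A (i * s) g) j vs)" for e s
        unfolding act_eval[OF ml_A[OF mg]] A_mult[OF mg] ..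
      have "ac h (circ m n p f g ys) = rsum (\<lambda>s t. TA (\<lambda>us. dsum h (\<lambda>a b. TA (A a f) b (us @ A s g vs # ws))) t us)"
        by (simp add: ys(1) circ_eval[OF ys(2-4)] act_psum TA_act act_eval[OF mf])
      also have "\<dots> = rsum (\<lambda>s t. dsum h (\<lambda>a b. dsum b (\<lambda>c d. dsum d (\<lambda>e e'. TA (\<lambda>us. TA (\<lambda>ws. A a f (us @ ac e (A s g vs) # ws)) e' ws) (c * t) us))))"
        by (subst TA_insert[OF ml_A[OF mf]]) (simp add: TA_psum TA_mult ml_TA_param ml_mid2 ml_suffix ml_A mf)
      also have "\<dots> = rsum (\<lambda>s t. dsum h (\<lambda>a b. dsum b (\<lambda>c d. dsum d (\<lambda>e e'. dsum e (\<lambda>i j. K a (i * s) j e' (c * t))))))"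
        unfolding K_def ev klin_psum[OF ml_slot[OF ml_A[OF mf] klin_id]] TA_psum ..
      also have "\<dots> = dsum h (\<lambda>a b. dsum a (\<lambda>a1 a2. dsum b (\<lambda>c d. dsum d (\<lambda>e e'. rsum (\<lambda>s t. K a1 (s * a2) e e' (t * c))))))"
        by (rule sweedler5[OF vsB lK])
      also have "\<dots> = dsum h (\<lambda>a b. dsum a (\<lambda>a1 a2. TA (circ m n p (A a1 f) (A a2 g)) b ys))"
      proof (intro psum_cong)
        fix a1 a2 b
        have "TA (circ m n p (A a1 f) (A a2 g)) b ys = dsum b (\<lambda>c d. dsum d (\<lambda>e e'. TA (\<lambda>us. TA (\<lambda>vs. TA (\<lambda>ws. circ m n p (A a1 f) (A a2 g) (us @ vs @ ws)) e' ws) e vs) c us))"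
          unfolding ys by (rule TA_append3) (intro multilin_ml[OF circ_multilin] A_multilin f g p)
        also have "\<dots> = dsum b (\<lambda>c d. dsum d (\<lambda>e e'. TA (\<lambda>us. TA (\<lambda>vs. TA (\<lambda>ws. rsum (\<lambda>s t. TA (\<lambda>us. A a1 f (us @ A s (A a2 g) vs # ws)) t us)) e' ws) e vs) c us))"
          by (intro psum_cong TA_cong_len) (simp add: ys circ_eval)
        also have "\<dots> = dsum b (\<lambda>c d. dsum d (\<lambda>e e'. rsum (\<lambda>s t. K a1 (s * a2) e e' (t * c))))"
        proof (intro psum_cong)
          fix c d e e'
          \<comment> \<open>Everything outside g is linear in the value of g, so the action on the
            block moves inside; the actions on the other two parts of the list commute.\<close>
          have sw: "TA (\<lambda>vs. TA (\<lambda>ws. TA (\<lambda>us. A a1 f (us @ A (s * a2) g vs # ws)) t us) e' ws) e vs =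
             TA (\<lambda>us. TA (\<lambda>ws. A a1 f (us @ TA (A (s * a2) g) e vs # ws)) e' ws) t us" for us s t
          proof -
            have 1: "TA (\<lambda>vs. TA (\<lambda>ws. TA (\<lambda>us. A a1 f (us @ A (s * a2) g vs # ws)) t us) e' ws) e vs
               = TA (\<lambda>ws. TA (\<lambda>us. A a1 f (us @ TA (A (s * a2) g) e vs # ws)) t us) e' ws"
              by (rule TA_klin[symmetric, where L="\<lambda>y. TA (\<lambda>ws. TA (\<lambda>us. A a1 f (us @ y # ws)) t us) e' ws"])
                 (intro klins ml_A mf)
            have 2: "TA (\<lambda>ws. TA (\<lambda>us. F us ws) t us) e' ws = TA (\<lambda>us. TA (\<lambda>ws. F us ws) e' ws) t us"
              for F :: "'b list => 'b list => 'b"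
              by (induction us arbitrary: F t) (simp_all add: TA_psum TA_klin[where L="bs c" for c, OF klin_bs[OF klin_id]])
            show ?thesis unfolding 1 by (rule 2)
          qed
          have "TA (\<lambda>us. TA (\<lambda>vs. TA (\<lambda>ws. rsum (\<lambda>s t. TA (\<lambda>us. A a1 f (us @ A s (A a2 g) vs # ws)) t us)) e' ws) e vs) c us
            = rsum (\<lambda>s t. TA (\<lambda>us. TA (\<lambda>us. TA (\<lambda>ws. A a1 f (us @ TA (A (s * a2) g) e vs # ws)) e' ws) t us) c us)"
            by (simp add: TA_psum A_mult[OF mg, symmetric] sw)
          also have "\<dots> = rsum (\<lambda>s t. K a1 (s * a2) e e' (t * c))"
            unfolding K_def
            by (intro psum_cong TA_mult[symmetric]) (intro klins ml_A mf)
          finally show "TA (\<lambda>us. TA (\<lambda>vs. TA (\<lambda>ws. rsum (\<lambda>s t. TA (\<lambda>us. A a1 f (us @ A s (A a2 g) vs # ws)) t us)) e' ws) e vs) c us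
            = rsum (\<lambda>s t. K a1 (s * a2) e e' (t * c))" .
        qed
        finally show "dsum b (\<lambda>c d. dsum d (\<lambda>e e'. rsum (\<lambda>s t. K a1 (s * a2) e e' (t * c)))) = TA (circ m n p (A a1 f) (A a2 g)) b ys" by simp
      qed
      also have "\<dots> = dsum h (\<lambda>a b. TA (\<lambda>xs. dsum a (\<lambda>a b. circ m n p (A a f) (A b g) xs)) b ys)"
        by (simp add: TA_psum)
      finally show "ac h (circ m n p f g ys) = dsum h (\<lambda>a b. TA (\<lambda>xs. dsum a (\<lambda>a b. circ m n p (A a f) (A b g) xs)) b ys)" .
    qed
  qed
qed

text \<open>Faces are built from multiplication and the braiding, so they are equivariant.
  Quasi-cocommutativity enters at face 0 only; the other faces use that B is a module
  algebra.\<close>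

lemma A_face: assumes f: "f \<in> multilin B n" shows "A h (face n i f) = face n i (A h f)"
proof
  fix xs
  note m = multilin_ml[OF f]
  note mF = multilin_ml[OF face_multilin[OF f]]
  show "A h (face n i f) xs = face n i (A h f) xs"
  proof (cases "length xs = Suc n")
    case False
    then show ?thesis using multilin_len[OF A_multilin[OF face_multilin[OF f]]] by (simp add: face_len)
  next
    case True
    show ?thesis
    proof (rule A_unique[where X="\<lambda>h. face n i (A h f)"])
      show "hlin bs (\<lambda>h. face n i (A h f) xs)" for xs
        by (cases "length xs = Suc n"; cases "i = 0"; cases "i \<le> n")
           (simp_all add: face_def klin_zeroI[OF vsB], (intro klins klin_A ml_A m klin_A_param)+)
      show "ml (face n i (A h f))" for h by (intro multilin_ml[OF face_multilin] A_multilin f)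
      show "ml (face n i f)" by (rule mF)
      fix h and ys :: "'b list" assume "length ys = length xs"
      then have len: "length ys = Suc n" using True by simp
      consider "i = 0" | j where "i = Suc j" "j < n" | "i > n" by (cases i) fastforce+
      then show "ac h (face n i f ys) = dsum h (\<lambda>a b. TA (face n i (A a f)) b ys)"
      proof cases
        case 1
        obtain y zs where ys: "ys = y # zs" and lz: "length zs = n" using len by (cases ys) auto
        have "ac h (face n i f ys) = rsum (\<lambda>s t. dsum h (\<lambda>a b. ac (a * t) y * dsum b (\<lambda>c d. TA (A (c * s) f) d zs)))"
          using lz by (simp add: ys 1 face_0 act_psum act_prod act_mult act_eval[OF ml_A[OF m]] A_mult[OF m])
             (simp add: A_mult[OF m, abs_def])
        also have "\<dots> = rsum (\<lambda>s t. dsum h (\<lambda>a b. dsum b (\<lambda>c d. ac (a * t) y * TA (A (c * s) f) d zs)))"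
          by (simp add: psum_mult_left)
        also have "\<dots> = rsum (\<lambda>s t. dsum h (\<lambda>a d. dsum a (\<lambda>a c. ac (a * t) y * TA (A (c * s) f) d zs)))"
          by (rule psum_cong, rule dsum_assoc[of bs, symmetric]) (intro klins m ml_A klin_A)+
        also have "\<dots> = dsum h (\<lambda>a d. dsum a (\<lambda>a c. rsum (\<lambda>s t. ac (a * t) y * TA (A (c * s) f) d zs)))"
          by (simp only: psum_swap[where xs="rmatrix H"])
        also have "\<dots> = dsum h (\<lambda>a d. rsum (\<lambda>s t. dsum a (\<lambda>a c. ac (t * c) y * TA (A (s * a) f) d zs)))"
          by (rule psum_cong, rule rsum_qcomm[of bs, symmetric]) (intro klins m ml_A klin_A)+
        also have "\<dots> = dsum h (\<lambda>a d. dsum a (\<lambda>a c. rsum (\<lambda>s t. ac (t * c) y * TA (A (s * a) f) d zs)))"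
          by (simp only: psum_swap[where xs="rmatrix H"])
        also have "\<dots> = dsum h (\<lambda>a b. dsum b (\<lambda>c d. rsum (\<lambda>s t. ac (t * c) y * TA (A (s * a) f) d zs)))"
          by (rule dsum_assoc[of bs]) (intro klins m ml_A klin_A)+
        also have "\<dots> = dsum h (\<lambda>a b. dsum b (\<lambda>c d. TA (\<lambda>us. rsum (\<lambda>s t. ac t (ac c y) * A s (A a f) us)) d zs))"
          by (simp add: TA_psum act_mult TA_mult_left A_mult[OF m, abs_def])
        also have "\<dots> = dsum h (\<lambda>a b. TA (face n i (A a f)) b ys)"
          unfolding ys TA.simps 1
          by (intro psum_cong TA_cong_len) (simp add: face_0 lz)
        finally show ?thesis .
      next
        case 2
        have "ac h (face n i f ys) = dsum h (\<lambda>a b. TA (A a f) b (contract j ys))"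
          using 2 by (simp add: face_contract len act_eval[OF m])
        also have "\<dots> = dsum h (\<lambda>a b. TA (\<lambda>ys. A a f (contract j ys)) b ys)"
          using 2 len by (simp add: TA_contract ml_A m)
        also have "\<dots> = dsum h (\<lambda>a b. TA (face n i (A a f)) b ys)"
          using 2 len by (intro psum_cong TA_cong_len) (simp add: face_contract)
        finally show ?thesis .
      next
        case 3
        obtain zs y where ys: "ys = zs @ [y]" and lz: "length zs = n" using len by (cases ys rule: rev_cases) auto
        have fl: "face n i F (us @ [x]) = F us * x" if "length us = n" for F us x
          using 3 that by (simp add: face_def)
        have "ac h (face n i f ys) = dsum h (\<lambda>a b. dsum a (\<lambda>a c. TA (A a f) c zs) * ac b y)"
          by (simp add: ys fl lz act_prod act_eval[OF m])
        also have "\<dots> = dsum h (\<lambda>a b. dsum a (\<lambda>a c. TA (A a f) c zs * ac b y))"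
          by (simp add: psum_mult_right)
        also have "\<dots> = dsum h (\<lambda>a b. dsum b (\<lambda>c d. TA (A a f) c zs * ac d y))"
          by (rule dsum_assoc[of bs]) (intro klins m ml_A klin_A)+
        also have "\<dots> = dsum h (\<lambda>a b. dsum b (\<lambda>c d. TA (\<lambda>us. face n i (A a f) (us @ [ac d y])) c zs))"
          by (intro psum_cong) (simp add: TA_mult_right lz fl cong: TA_cong_len)
        also have "\<dots> = dsum h (\<lambda>a b. TA (face n i (A a f)) b ys)"
          unfolding ys by (subst TA_append) (simp_all add: TA_single ml_prefix multilin_ml[OF face_multilin[OF A_multilin[OF f]]] del: TA.simps)
        finally show ?thesis .
      qed
    qed
  qed
qed

end

lemma signed_add: "signed i (x + y) = signed i x + signed i y" by (simp add: signed_def)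
lemma signed_diff: "signed i (x - y) = signed i x - signed i y" by (simp add: signed_def)
lemma signed_signed: "signed i (signed j x) = signed (i + j) x" by (simp add: signed_def)
lemma signed_zero [simp]: "signed i 0 = 0" by (simp add: signed_def)
lemma signed_Suc: "signed (Suc i) x = - signed i x" by (simp add: signed_def)
lemma signed_minus: "signed i (- x) = - signed i x" by (simp add: signed_def)
lemma signed_0 [simp]: "signed 0 x = x" by (simp add: signed_def)
lemma signed_sum: "signed i (sum f I) = (\<Sum>x\<in>I. signed i (f x))" by (simp add: signed_def sum_negf)
lemma signed_parity: "even i = even j ==> signed i x = signed j x" by (simp add: signed_def)
lemma signed_self [simp]: "signed i (signed i x) = x" by (simp add: signed_def)
lemma signed_eq_iff: "signed i x = y \<longleftrightarrow> x = signed i y" by (auto simp: signed_def)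
lemma signed_apply: "signed i f x = signed i (f x :: 'a::ab_group_add)" by (simp add: signed_def)
lemma sum_fun_apply: "(\<Sum>i\<in>I. F i) x = (\<Sum>i\<in>I. F i x)" by (induction I rule: infinite_finite_induct) auto
lemma psum_signed: "psum xs (\<lambda>a b. signed i (f a b)) = signed i (psum xs f)"
  by (simp add: signed_def psum_uminus)

lemma psum_rev3: "psum xs (\<lambda>a b. psum ys (\<lambda>c d. psum zs (\<lambda>e f. F e f c d a b)))
  = psum zs (\<lambda>e f. psum ys (\<lambda>c d. psum xs (\<lambda>a b. F e f c d a b)))"
proof -
  have "psum xs (\<lambda>a b. psum ys (\<lambda>c d. psum zs (\<lambda>e f. F e f c d a b)))
    = psum ys (\<lambda>c d. psum xs (\<lambda>a b. psum zs (\<lambda>e f. F e f c d a b)))" by (rule psum_swap)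
  also have "\<dots> = psum ys (\<lambda>c d. psum zs (\<lambda>e f. psum xs (\<lambda>a b. F e f c d a b)))"
    by (rule psum_cong, rule psum_swap)
  also have "\<dots> = psum zs (\<lambda>e f. psum ys (\<lambda>c d. psum xs (\<lambda>a b. F e f c d a b)))" by (rule psum_swap)
  finally show ?thesis .
qed

section \<open>Simplicial identities between faces and insertions\<close>

context braided_mod_alg begin

text \<open>Left multiplication by b moves past f and g together, so the first hexagon splits its
  braiding in two. After reordering the three R-sums, the second hexagon joins the braiding of g
  past b with its braiding past the other p arguments, which gives an insertion at position p +
  1.\<close>

lemma circ_face_0: assumes f: "f \<in> multilin B (Suc m)" and g: "g \<in> multilin B n" and p: "p \<le> m"
  shows "face (m + n) 0 (circ m n p f g) = circ (Suc m) n (Suc p) (face (Suc m) 0 f) g"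
proof (rule circ_eqI[where p="Suc p" and m="Suc m" and n=n])
  note mf = multilin_ml[OF f] and mg = multilin_ml[OF g]
  fix us vs ws :: "'b list" assume len: "length us = Suc p" "length vs = n" "length ws + Suc p = Suc m"
  then obtain b us' where us: "us = b # us'" and len': "length us' = p" "length ws + p = m" by (cases us) auto
  have "face (m + n) 0 (circ m n p f g) (us @ vs @ ws) = rsum (\<lambda>s t. ac t b * A s (circ m n p f g) (us' @ vs @ ws))"
    unfolding us append_Cons by (rule face_0) (use len' len in simp)
  also have "\<dots> = rsum (\<lambda>s t. dsum s (\<lambda>a c. rsum (\<lambda>s' t'. ac t b * TA (\<lambda>us. A a f (us @ A (s' * c) g vs # ws)) t' us')))"
    by (simp add: A_circ[OF f g p] circ_eval len' len psum_mult_left A_mult[OF mg])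
  also have "\<dots> = rsum (\<lambda>s t. rsum (\<lambda>s2 t2. rsum (\<lambda>s' t'. ac (t * t2) b * TA (\<lambda>us. A s f (us @ A (s' * s2) g vs # ws)) t' us')))"
    by (rule rsum_hex1[of bs]) (intro klins klin_A ml_A mf mg)+
  also have "\<dots> = rsum (\<lambda>s t. rsum (\<lambda>s' t'. rsum (\<lambda>s'' t''. ac (t'' * t') b * TA (\<lambda>us. A s'' f (us @ A (s * s') g vs # ws)) t us')))"
    by (rule psum_rev3)
  also have "\<dots> = rsum (\<lambda>s t. dsum t (\<lambda>a c. rsum (\<lambda>s'' t''. ac (t'' * a) b * TA (\<lambda>us. A s'' f (us @ A s g vs # ws)) c us')))"
    by (rule rsum_hex2[of bs, symmetric]) (intro klins klin_A ml_A mf mg)+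
  also have "\<dots> = rsum (\<lambda>s t. dsum t (\<lambda>a c. TA (\<lambda>us. rsum (\<lambda>s'' t''. ac t'' (ac a b) * A s'' f (us @ A s g vs # ws))) c us'))"
    by (simp add: TA_psum TA_mult_left act_mult)
  also have "\<dots> = rsum (\<lambda>s t. dsum t (\<lambda>a c. TA (\<lambda>us. face (Suc m) 0 f (ac a b # us @ A s g vs # ws)) c us'))"
    by (intro psum_cong TA_cong_len face_0[symmetric]) (use len' in simp)
  also have "\<dots> = circ (Suc m) n (Suc p) (face (Suc m) 0 f) g (us @ vs @ ws)"
    using circ_eval[OF len] by (simp add: us)
  finally show "face (m + n) 0 (circ m n p f g) (us @ vs @ ws) = circ (Suc m) n (Suc p) (face (Suc m) 0 f) g (us @ vs @ ws)" .
qed (use p in \<open>auto simp: face_len circ_len\<close>)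

lemma circ_face_left: assumes f: "f \<in> multilin B (Suc m)" and g: "g \<in> multilin B n" and p: "i \<le> p" "p \<le> m"
  shows "face (m + n) i (circ m n p f g) = circ (Suc m) n (Suc p) (face (Suc m) i f) g"
proof (cases i)
  case 0 then show ?thesis using circ_face_0[OF f g p(2)] by simp
next
  case (Suc j)
  note mf = multilin_ml[OF f] and mg = multilin_ml[OF g]
  show ?thesis
  proof (rule circ_eqI[where p="Suc p" and m="Suc m" and n=n])
    fix us vs ws :: "'b list" assume len: "length us = Suc p" "length vs = n" "length ws + Suc p = Suc m"
    have "face (m + n) i (circ m n p f g) (us @ vs @ ws) = circ m n p f g (contract j us @ vs @ ws)"
      using len p by (simp add: Suc face_contract contract_append1)
    also have "\<dots> = rsum (\<lambda>s t. TA (\<lambda>us. f (us @ A s g vs # ws)) t (contract j us))"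
      by (rule circ_eval) (use len p in \<open>simp_all add: Suc length_contract\<close>)
    also have "\<dots> = rsum (\<lambda>s t. TA (\<lambda>us. f (contract j us @ A s g vs # ws)) t us)"
      by (intro psum_cong TA_contract ml_suffix mf) (use len p in \<open>simp add: Suc\<close>)
    also have "\<dots> = rsum (\<lambda>s t. TA (\<lambda>us. face (Suc m) i f (us @ A s g vs # ws)) t us)"
      by (intro psum_cong TA_cong_len) (use len p in \<open>simp add: Suc face_contract contract_append1\<close>)
    also have "\<dots> = circ (Suc m) n (Suc p) (face (Suc m) i f) g (us @ vs @ ws)"
      by (rule circ_eval[symmetric]) (use len in auto)
    finally show "face (m + n) i (circ m n p f g) (us @ vs @ ws) = circ (Suc m) n (Suc p) (face (Suc m) i f) g (us @ vs @ ws)" .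
  qed (use p in \<open>auto simp: face_len circ_len\<close>)
qed

lemma circ_face_mid: assumes f: "f \<in> multilin B (Suc m)" and g: "g \<in> multilin B n" and p: "p \<le> m" "1 \<le> j" "j \<le> n"
  shows "face (m + n) (p + j) (circ m n p f g) = circ m (Suc n) p f (face n j g)"
proof (rule circ_eqI[where p=p and m=m and n="Suc n"])
  obtain k where j: "j = Suc k" using p by (cases j) auto
  fix us vs ws :: "'b list" assume len: "length us = p" "length vs = Suc n" "length ws + p = m"
  have "face (m + n) (p + j) (circ m n p f g) (us @ vs @ ws) = circ m n p f g (contract (p + k) (us @ vs @ ws))"
    using len p unfolding j add_Suc_right by (intro face_contract) auto
  also have "contract (p + k) (us @ vs @ ws) = us @ contract k vs @ ws"
    using len p by (simp add: contract_append2 contract_append1 j flip: len(1))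
  also have "circ m n p f g \<dots> = rsum (\<lambda>s t. TA (\<lambda>us. f (us @ A s g (contract k vs) # ws)) t us)"
    by (rule circ_eval) (use len p j in \<open>simp_all add: length_contract\<close>)
  also have "\<dots> = rsum (\<lambda>s t. TA (\<lambda>us. f (us @ A s (face n j g) vs # ws)) t us)"
    using len p by (simp add: A_face[OF g] j face_contract)
  also have "\<dots> = circ m (Suc n) p f (face n j g) (us @ vs @ ws)"
    by (rule circ_eval[symmetric]) (use len in auto)
  finally show "face (m + n) (p + j) (circ m n p f g) (us @ vs @ ws) = circ m (Suc n) p f (face n j g) (us @ vs @ ws)" .
qed (use p in \<open>auto simp: face_len circ_len\<close>)

text \<open>Behind the block the n arguments of g count as a single argument of f. This accounts for
  face k + n on one side and face k + 1 on the other; k = m + 1 is the last face.\<close>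

lemma circ_face_right: assumes f: "f \<in> multilin B (Suc m)" and g: "g \<in> multilin B n" and p: "p \<le> m" "p < k" "k \<le> Suc m"
  shows "face (m + n) (k + n) (circ m n p f g) = circ (Suc m) n p (face (Suc m) (Suc k) f) g"
proof (rule circ_eqI[where p=p and m="Suc m" and n=n])
  fix us vs ws :: "'b list" assume len: "length us = p" "length vs = n" "length ws + p = Suc m"
  show "face (m + n) (k + n) (circ m n p f g) (us @ vs @ ws) = circ (Suc m) n p (face (Suc m) (Suc k) f) g (us @ vs @ ws)"
  proof (cases "k = Suc m")
    case True
    obtain ws' w where ws: "ws = ws' @ [w]" using len p by (cases ws rule: rev_cases) auto
    have "face (m + n) (k + n) (circ m n p f g) ((us @ vs @ ws') @ [w]) = circ m n p f g (us @ vs @ ws') * w"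
      unfolding True add_Suc by (rule face_last) (use len ws in simp)
    also have "\<dots> = rsum (\<lambda>s t. TA (\<lambda>us. f (us @ A s g vs # ws') * w) t us)"
      using len ws by (simp add: circ_eval psum_mult_right TA_mult_right)
    also have "\<dots> = rsum (\<lambda>s t. TA (\<lambda>us. face (Suc m) (Suc k) f ((us @ A s g vs # ws') @ [w])) t us)"
      unfolding True by (intro psum_cong TA_cong_len face_last[symmetric]) (use len ws in simp)
    also have "\<dots> = circ (Suc m) n p (face (Suc m) (Suc k) f) g (us @ vs @ ws)"
      using circ_eval[OF len] by (simp add: ws)
    finally show ?thesis by (simp add: ws)
  next
    case False
    obtain j where k: "k = Suc (p + j)" using p(2) less_imp_Suc_add by auto
    have "face (m + n) (k + n) (circ m n p f g) (us @ vs @ ws) = circ m n p f g (contract (p + n + j) (us @ vs @ ws))"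
      using face_contract[of "us @ vs @ ws" "m + n" "p + n + j"] len p False by (simp add: k algebra_simps)
    also have "contract (p + n + j) (us @ vs @ ws) = us @ vs @ contract j ws"
      using contract_append2[of "us @ vs" j ws] len by simp
    also have "circ m n p f g \<dots> = rsum (\<lambda>s t. TA (\<lambda>us. f (us @ A s g vs # contract j ws)) t us)"
      by (rule circ_eval) (use len p False k in \<open>simp_all add: length_contract\<close>)
    also have "\<dots> = rsum (\<lambda>s t. TA (\<lambda>us. face (Suc m) (Suc k) f (us @ A s g vs # ws)) t us)"
    proof (intro psum_cong TA_cong_len)
      fix us' :: "'b list" and s assume "length us' = length us"
      then show "f (us' @ A s g vs # contract j ws) = face (Suc m) (Suc k) f (us' @ A s g vs # ws)"
        using len p False k contract_append2[of us' "Suc j" "A s g vs # ws"] by (simp add: face_contract contract_Suc)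
    qed
    also have "\<dots> = circ (Suc m) n p (face (Suc m) (Suc k) f) g (us @ vs @ ws)"
      by (rule circ_eval[symmetric]) (use len in auto)
    finally show ?thesis .
  qed
qed (use p in \<open>auto simp: face_len circ_len\<close>)

text \<open>Face 0 of g multiplies the first entry of the block into the value of g. If that entry
  is counted among those in front of g, the same product is formed by the face of f that merges
  positions p and p + 1; the second hexagon merges the two braidings of g.\<close>

lemma circ_arg_face_0: assumes f: "f \<in> multilin B (Suc m)" and g: "g \<in> multilin B n" and p: "p \<le> m"
  shows "circ m (Suc n) p f (face n 0 g) = circ (Suc m) n (Suc p) (face (Suc m) (Suc p) f) g"
proof (rule circ_eqI[where p=p and m=m and n="Suc n"])
  note mf = multilin_ml[OF f] and mg = multilin_ml[OF g]
  fix us vs ws :: "'b list" assume len: "length us = p" "length vs = Suc n" "length ws + p = m"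
  then obtain b vs' where vs: "vs = b # vs'" and len': "length vs' = n" by (cases vs) auto
  have "circ m (Suc n) p f (face n 0 g) (us @ vs @ ws) = rsum (\<lambda>s t. TA (\<lambda>us. f (us @ A s (face n 0 g) vs # ws)) t us)"
    by (rule circ_eval) (use len in auto)
  also have "\<dots> = rsum (\<lambda>s t. TA (\<lambda>us. f (us @ rsum (\<lambda>s' t'. ac t' b * A (s' * s) g vs') # ws)) t us)"
    by (simp add: A_face[OF g] vs face_0 len' A_mult[OF mg])
  also have "\<dots> = rsum (\<lambda>s t. rsum (\<lambda>s' t'. TA (\<lambda>us. f (us @ (ac t' b * A (s' * s) g vs') # ws)) t us))"
    by (simp add: klin_psum[OF ml_slot[OF mf klin_id]] TA_psum)
  also have "\<dots> = rsum (\<lambda>s' t'. rsum (\<lambda>s t. TA (\<lambda>us. f (us @ (ac t' b * A (s' * s) g vs') # ws)) t us))"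
    by (rule psum_swap)
  also have "\<dots> = rsum (\<lambda>s t. dsum t (\<lambda>a c. TA (\<lambda>us. f (us @ (ac c b * A s g vs') # ws)) a us))"
    by (rule rsum_hex2[of bs, symmetric]) (intro klins klin_A ml_A mf mg)+
  also have "\<dots> = rsum (\<lambda>s t. dsum t (\<lambda>a c. TA (\<lambda>us. face (Suc m) (Suc p) f (us @ ac c b # A s g vs' # ws)) a us))"
  proof (intro psum_cong TA_cong_len)
    fix us' :: "'b list" and s c assume "length us' = length us"
    then show "f (us' @ (ac c b * A s g vs') # ws) = face (Suc m) (Suc p) f (us' @ ac c b # A s g vs' # ws)"
      using len p contract_mid[of us' "ac c b" "A s g vs'" ws] by (simp add: face_contract)
  qed
  also have "\<dots> = rsum (\<lambda>s t. TA (\<lambda>us. face (Suc m) (Suc p) f (us @ A s g vs' # ws)) t (us @ [b]))"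
    by (subst TA_append)
      (simp_all add: TA_single ml_prefix ml_suffix multilin_ml[OF face_multilin[OF f]] TA_psum TA_single[OF ml_mid] del: TA.simps)
  also have "\<dots> = circ (Suc m) n (Suc p) (face (Suc m) (Suc p) f) g (us @ vs @ ws)"
    using circ_eval[of "us @ [b]" "Suc p" vs' n ws "Suc m"] len len' by (simp add: vs)
  finally show "circ m (Suc n) p f (face n 0 g) (us @ vs @ ws) = circ (Suc m) n (Suc p) (face (Suc m) (Suc p) f) g (us @ vs @ ws)" .
qed (use p in \<open>auto simp: circ_len\<close>)

lemma circ_arg_face_last: assumes f: "f \<in> multilin B (Suc m)" and g: "g \<in> multilin B n" and p: "p \<le> m"
  shows "circ m (Suc n) p f (face n (Suc n) g) = circ (Suc m) n p (face (Suc m) (Suc p) f) g"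
proof (rule circ_eqI[where p=p and m=m and n="Suc n"])
  fix us vs ws :: "'b list" assume len: "length us = p" "length vs = Suc n" "length ws + p = m"
  then obtain b vs' where vs: "vs = vs' @ [b]" and len': "length vs' = n" by (cases vs rule: rev_cases) auto
  have "circ m (Suc n) p f (face n (Suc n) g) (us @ vs @ ws) = rsum (\<lambda>s t. TA (\<lambda>us. f (us @ A s (face n (Suc n) g) vs # ws)) t us)"
    by (rule circ_eval) (use len in auto)
  also have "\<dots> = rsum (\<lambda>s t. TA (\<lambda>us. face (Suc m) (Suc p) f (us @ A s g vs' # b # ws)) t us)"
  proof (intro psum_cong TA_cong_len)
    fix us' :: "'b list" and s assume "length us' = length us"
    then show "f (us' @ A s (face n (Suc n) g) vs # ws) = face (Suc m) (Suc p) f (us' @ A s g vs' # b # ws)"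
      using len len' p contract_mid[of us' "A s g vs'" b ws] by (simp add: face_contract A_face[OF g] vs face_last)
  qed
  also have "\<dots> = circ (Suc m) n p (face (Suc m) (Suc p) f) g (us @ vs @ ws)"
    using circ_eval[of us p vs' n "b # ws" "Suc m"] len len' by (simp add: vs)
  finally show "circ m (Suc n) p f (face n (Suc n) g) (us @ vs @ ws) = circ (Suc m) n p (face (Suc m) (Suc p) f) g (us @ vs @ ws)" .
qed (use p in \<open>auto simp: circ_len\<close>)

text \<open>Right multiplication by the last entry involves no braiding and commutes with the
  remaining faces up to reindexing; for the neighbouring face this is associativity. It is singled
  out because \<open>cup0\<close> is defined by the last face.\<close>

lemma face_face_last: assumes f: "f \<in> multilin B n" and i: "i \<le> Suc n"
  shows "face (Suc n) i (face n (Suc n) f) = face (Suc n) (Suc (Suc n)) (face n i f)"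
proof
  fix xs :: "'b list"
  consider "length xs \<noteq> Suc (Suc n)" | us x y where "xs = us @ [x, y]" "length us = n"
  proof (cases xs rule: rev_cases)
    case (snoc ys y)
    then show ?thesis using that by (cases ys rule: rev_cases) auto
  qed (use that in auto)
  then show "face (Suc n) i (face n (Suc n) f) xs = face (Suc n) (Suc (Suc n)) (face n i f) xs"
  proof cases
    case 2
    have R: "face (Suc n) (Suc (Suc n)) F xs = F (us @ [x]) * y" for F
      using face_last[of "us @ [x]" "Suc n" F y] 2 by simp
    consider "i = 0" | j where "i = Suc j" "j < n" | "i = Suc n" using i by (cases i) (auto simp: less_Suc_eq_le le_less)
    then show ?thesis
    proof cases
      case 1
      obtain z zs where z: "us @ [x] = z # zs" by (cases "us @ [x]") auto
      moreover have "length zs = n" using arg_cong[OF z, of length] 2 by simp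
      moreover from z have "xs = z # zs @ [y]" using 2 by (metis append.assoc append_Cons append_Nil)
      ultimately show ?thesis
        unfolding R 1 z by (simp add: face_0 A_face[OF f] face_last psum_mult_right mult.assoc)
    next
      case (2 j)
      have "Suc j < length (us @ [x])" using 2 \<open>length us = n\<close> by simp
      then have "contract j xs = contract j (us @ [x]) @ [y]" and "length (contract j (us @ [x])) = n"
        using contract_append1[of j "us @ [x]" "[y]"] length_contract[of j "us @ [x]"] \<open>xs = us @ [x, y]\<close> \<open>length us = n\<close> by simp_all
      then show ?thesis
        unfolding R using 2 \<open>xs = us @ [x, y]\<close> \<open>length us = n\<close> by (simp add: face_contract face_last)
    next
      case 3
      then show ?thesis
        unfolding R using 2 contract_mid[of us x y "[]"]
        by (simp add: face_contract face_last mult.assoc)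
    qed
  qed (simp add: face_len)
qed

text \<open>The map sending x and y to f(x)y is the last face of f. Inserting g in its last place
  gives the unsigned cup product, so its laws become instances of those for insertions.\<close>

definition cup0 :: "nat => nat => ('b list => 'b) => ('b list => 'b) => 'b list => 'b" where
  "cup0 m n f g = circ m n m (face m (Suc m) f) g"

lemma cup0_eval: assumes f: "f \<in> multilin B m" and "length us = m" "length vs = n"
  shows "cup0 m n f g (us @ vs) = rsum (\<lambda>s t. TA f t us * A s g vs)"
proof -
  have "cup0 m n f g (us @ vs) = rsum (\<lambda>s t. TA (\<lambda>us. face m (Suc m) f (us @ [A s g vs])) t us)"
    using circ_eval[of us m vs n "[]" m] assms by (simp add: cup0_def)
  also have "\<dots> = rsum (\<lambda>s t. TA (\<lambda>us. f us * A s g vs) t us)"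
    by (intro psum_cong TA_cong_len face_last) (use assms in auto)
  finally show ?thesis by (simp add: TA_mult_right)
qed

lemma cup0_len: "length xs \<noteq> m + n ==> cup0 m n f g xs = 0" by (simp add: cup0_def circ_len)

lemma cup_eq: assumes f: "f \<in> multilin B m" shows "cup H B m n f g = signed (m * n) (cup0 m n f g)"
proof
  fix xs show "cup H B m n f g xs = signed (m * n) (cup0 m n f g) xs"
  proof (cases "length xs = m + n")
    case True
    then show ?thesis
      using cup0_eval[OF f, of "take m xs" "drop m xs" n g]
      by (simp add: cup_def signed_apply eval_act_eq[OF multilin_ml[OF f]] psum_def)
  qed (simp add: cup_def cup0_len signed_apply)
qed

lemma cup0_multilin: assumes "f \<in> multilin B m" "g \<in> multilin B n" shows "cup0 m n f g \<in> multilin B (m + n)"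
  unfolding cup0_def by (intro circ_multilin face_multilin assms) simp

lemma cup0_face_left: assumes f: "f \<in> multilin B m" and g: "g \<in> multilin B n" and i: "i \<le> m"
  shows "face (m + n) i (cup0 m n f g) = cup0 (Suc m) n (face m i f) g"
  unfolding cup0_def using circ_face_left[OF face_multilin[OF f] g i] face_face_last[OF f, of i] i by simp

lemma cup0_face_right: assumes f: "f \<in> multilin B m" and g: "g \<in> multilin B n" and j: "1 \<le> j" "j \<le> Suc n"
  shows "face (m + n) (m + j) (cup0 m n f g) = cup0 m (Suc n) f (face n j g)"
proof (cases "j = Suc n")
  case True
  show ?thesis
    using circ_face_right[OF face_multilin[OF f] g, of m "Suc m"] circ_arg_face_last[OF face_multilin[OF f] g, of m]
    unfolding cup0_def True by (simp add: face_face_last[OF f])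
qed (use circ_face_mid[OF face_multilin[OF f] g, of m j] j in \<open>simp add: cup0_def\<close>)

lemma cup0_arg_face_0: assumes f: "f \<in> multilin B m" and g: "g \<in> multilin B n"
  shows "cup0 m (Suc n) f (face n 0 g) = cup0 (Suc m) n (face m (Suc m) f) g"
  using circ_arg_face_0[OF face_multilin[OF f] g, of m] unfolding cup0_def by (simp add: face_face_last[OF f])

text \<open>In first position g is moved past nothing and the R-sum of the insertion collapses by
  the counit. What is left is the value of g braided past f; \<open>act_eval\<close> spreads the
  action over g and its arguments, and the second hexagon separates the braiding of the two cochains
  from the one inside \<open>cup0\<close>. The result is the braided opposite product.\<close>

lemma circ_first: assumes f: "f \<in> multilin B (m)" and g: "g \<in> multilin B n"
  shows "circ (m) n 0 (face (m) 0 f) g = (\<lambda>xs. rsum (\<lambda>s t. cup0 n (m) (A t g) (A s f) xs))"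
proof (rule circ_eqI[where p=0 and m="m" and n=n])
  note mf = multilin_ml[OF f] and mg = multilin_ml[OF g]
  fix us vs ws :: "'b list" assume "length us = 0" and len: "length vs = n" "length ws + 0 = m"
  then have us: "us = []" by simp
  have "circ (m) n 0 (face (m) 0 f) g (us @ vs @ ws) = rsum (\<lambda>s t. bs (eps t) (face (m) 0 f (A s g vs # ws)))"
    using circ_eval[of us 0 vs n ws "m"] len by (simp add: us)
  also have "\<dots> = face (m) 0 f (g vs # ws)"
    by (subst rsum_eps2[of bs "\<lambda>s. face (m) 0 f (A s g vs # ws)"]) (intro klins klin_A mg multilin_ml[OF face_multilin[OF f]], simp add: A_one[OF mg])
  also have "\<dots> = rsum (\<lambda>s t. dsum t (\<lambda>a c. TA (A a g) c vs * A s f ws))"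
    using len by (simp add: face_0 act_eval[OF mg] psum_mult_right)
  also have "\<dots> = rsum (\<lambda>s t. rsum (\<lambda>s' t'. TA (A t' g) t vs * A (s * s') f ws))"
    by (rule rsum_hex2[of bs]) (intro klins klin_A ml_A mf mg)+
  also have "\<dots> = rsum (\<lambda>s' t'. rsum (\<lambda>s t. TA (A t' g) t vs * A (s * s') f ws))"
    by (rule psum_swap)
  also have "\<dots> = rsum (\<lambda>s t. cup0 n (m) (A t g) (A s f) (us @ vs @ ws))"
    using len by (simp add: us cup0_eval[OF A_multilin[OF g]] A_mult[OF mf])
  finally show "circ (m) n 0 (face (m) 0 f) g (us @ vs @ ws) = rsum (\<lambda>s t. cup0 n (m) (A t g) (A s f) (us @ vs @ ws))" .
qed (auto simp: circ_len cup0_len add.commute)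

end

section \<open>Subgroups, additive maps and signs\<close>

definition addsub :: "'a::ab_group_add set => bool" where
  "addsub S \<longleftrightarrow> 0 \<in> S \<and> (\<forall>x\<in>S. \<forall>y\<in>S. x - y \<in> S)"

lemma addsubD: assumes "addsub S"
  shows "0 \<in> S" "x \<in> S ==> y \<in> S ==> x - y \<in> S" "x \<in> S ==> - x \<in> S" "x \<in> S ==> y \<in> S ==> x + y \<in> S"
    "x \<in> S ==> signed i x \<in> S"
proof -
  show 1: "0 \<in> S" and 2: "\<And>x y. x \<in> S ==> y \<in> S ==> x - y \<in> S" using assms by (auto simp: addsub_def)
  show 3: "\<And>x. x \<in> S ==> - x \<in> S" using 2[OF 1] by simp
  then show "\<And>x y. x \<in> S ==> y \<in> S ==> x + y \<in> S" using 2 by (metis diff_minus_eq_add)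
  show "\<And>x i. x \<in> S ==> signed i x \<in> S" using 3 by (simp add: signed_def)
qed

lemma addsub_sum: "addsub S ==> (\<And>i. i \<in> I ==> f i \<in> S) ==> sum f I \<in> S"
  by (induction I rule: infinite_finite_induct) (auto simp: addsubD)
lemma addsub_psum: "addsub S ==> (\<And>a b. f a b \<in> S) ==> psum xs f \<in> S"
  by (induction xs) (auto simp: addsubD)

text \<open>Additivity is required on a subgroup only, because the differential, the action and
  products in the right argument are shown additive for multilinear functions and not for all
  functions on lists.\<close>

definition addhom :: "'a::ab_group_add set => ('a => 'b::ab_group_add) => bool" where
  "addhom S F \<longleftrightarrow> addsub S \<and> (\<forall>x\<in>S. \<forall>y\<in>S. F (x + y) = F x + F y)"

lemma addhom_sum:
  assumes "addhom S F"
  shows "F 0 = 0" "x \<in> S ==> F (- x) = - F x" "x \<in> S ==> F (signed i x) = signed i (F x)"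
    "x \<in> S ==> y \<in> S ==> F (x - y) = F x - F y"
    "(\<And>i. i \<in> I ==> f i \<in> S) ==> F (\<Sum>i\<in>I. signed (k i) (f i)) = (\<Sum>i\<in>I. signed (k i) (F (f i)))"
    "(\<And>a b. h a b \<in> S) ==> F (psum xs h) = psum xs (\<lambda>a b. F (h a b))"
proof -
  have S: "addsub S" and F: "\<And>x y. x \<in> S ==> y \<in> S ==> F (x + y) = F x + F y"
    using assms by (auto simp: addhom_def)
  show 0: "F 0 = 0" using F[of 0 0] addsubD(1)[OF S] by simp
  show 1: "\<And>x. x \<in> S ==> F (- x) = - F x"
    using F[of _ "- _"] 0 addsubD(3)[OF S] by (metis add.right_inverse eq_neg_iff_add_eq_0 neg_eq_iff_add_eq_0)
  show 2: "\<And>x i. x \<in> S ==> F (signed i x) = signed i (F x)" using 1 by (simp add: signed_def)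
  show "\<And>x y. x \<in> S ==> y \<in> S ==> F (x - y) = F x - F y"
    using F 1 addsubD(3)[OF S] by (metis add_uminus_conv_diff)
  show "(\<And>i. i \<in> I ==> f i \<in> S) ==> F (\<Sum>i\<in>I. signed (k i) (f i)) = (\<Sum>i\<in>I. signed (k i) (F (f i)))"
    by (induction I rule: infinite_finite_induct) (auto simp: 0 2 F addsubD[OF S] addsub_sum[OF S])
  show "(\<And>a b. h a b \<in> S) ==> F (psum xs h) = psum xs (\<lambda>a b. F (h a b))"
    by (induction xs) (auto simp: 0 F addsub_psum[OF S])
qed

lemma sum_atMost_split0: fixes n :: nat shows "(\<Sum>j\<le>n. f j) = f 0 + (\<Sum>j=1..n. f j :: 'a::comm_monoid_add)"
  by (simp add: atMost_atLeast0 sum.atLeast_Suc_atMost)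

text \<open>For inner indices \<open>L (Suc p)\<close> occurs twice, in the terms p and p + 1, with
  signs differing by the factor (-1)^(2n+1) = -1. Only the two ends survive.\<close>

lemma signed_telescope:
  "(\<Sum>p\<le>k. signed (p * Suc n) (L (Suc p) + signed n (L p))) = signed (k * Suc n) (L (Suc k)) + signed n (L 0 :: 'a::ab_group_add)"
proof (induction k)
  case (Suc k)
  have "signed (Suc k * Suc n) (signed n (L (Suc k))) = - signed (k * Suc n) (L (Suc k))"
    unfolding signed_signed signed_Suc[symmetric] by (rule signed_parity) auto
  with Suc show ?case by (simp add: signed_add del: mult_Suc mult_Suc_right)
qed simp

lemma psum_fun_apply: "psum xs f z = psum xs (\<lambda>a b. f a b z)" by (induction xs) auto

section \<open>Linearity, unit and associativity of the unsigned cup product, and the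
  differential\<close>

context braided_mod_alg begin

lemma addsub_ml: "addsub {f. ml f}"
proof -
  have "ml (f - g)" if "ml f" "ml g" for f g
    unfolding ml_def fun_diff_def using that[unfolded ml_def] by (auto simp: klin_def VB.scale_right_diff_distrib)
  moreover have "ml 0" unfolding ml_def zero_fun_def by (simp add: klin_zeroI[OF vsB])
  ultimately show ?thesis by (auto simp: addsub_def)
qed

lemma addsub_multilin: "addsub (multilin B n)"
  using addsub_ml by (auto simp: addsub_def multilin_iff)

lemma bs_multilin: "f \<in> multilin B n ==> (\<lambda>xs. bs c (f xs)) \<in> multilin B n"
  by (auto simp: multilin_iff intro!: ml_klin[where L="bs c"] klin_bs klin_id)

lemma A_add: assumes "ml f" "ml g" shows "A h (f + g) = A h f + A h g"
proof -
  have m: "ml (f + g)" using addsubD(4)[OF addsub_ml, of f g] assms by simp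
  show ?thesis unfolding A_fun[OF m] A_fun[OF assms(1)] A_fun[OF assms(2)]
    by (auto simp: plus_fun_def TA_add klin_add[OF klin_act[OF klin_id]] psum_add)
qed

lemma A_bs: assumes "ml f" shows "A h (\<lambda>xs. bs c (f xs)) = (\<lambda>xs. bs c (A h f xs))"
proof -
  have m: "ml (\<lambda>xs. bs c (f xs))" by (rule ml_klin[OF assms]) (intro klin_bs klin_id)
  show ?thesis unfolding A_fun[OF m] A_fun[OF assms]
    by (simp add: TA_klin[symmetric, where L="bs c", OF klin_bs[OF klin_id]] klin_scale[OF klin_act[OF klin_id]]
        klin_psum[OF klin_bs[OF klin_id]])
qed

lemma A_addhom: "addhom {f. ml f} (A h)" by (simp add: addhom_def addsub_ml A_add)
lemmas A_hom = addhom_sum[OF A_addhom, unfolded mem_Collect_eq]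

lemma A_zero: "A h 0 = 0" by (rule A_hom)

lemma A_plus_left: "ml f ==> A (g + h) f = A g f + A h f"
  using klin_add[OF klin_A[OF _ klin_id]] by fastforce
lemma A_hs_left: "ml f ==> A (hs c h) f = (\<lambda>xs. bs c (A h f xs))"
  using klin_scale[OF klin_A[OF _ klin_id]] by fastforce

lemma face_add: "ml f ==> ml g ==> face n i (f + g) = face n i f + face n i g"
  by (auto simp: face_def A_add distrib_left distrib_right psum_add)

lemma face_bs: "ml f ==> face n i (\<lambda>xs. bs c (f xs)) = (\<lambda>xs. bs c (face n i f xs))"
  by (auto simp: face_def A_bs bs_mult klin_psum[OF klin_bs[OF klin_id]])

lemma circ_add_left: "circ m n p (f + f') g = circ m n p f g + circ m n p f' g"
  by (auto simp: circ_def TA_add psum_add)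

lemma circ_add_right: "ml f ==> ml g ==> ml g' ==> circ m n p f (g + g') = circ m n p f g + circ m n p f g'"
  by (auto simp: circ_def A_add klin_add[OF ml_slot[OF _ klin_id]] TA_add psum_add)

lemma addsub_UNIV: "addsub UNIV" by (simp add: addsub_def)

lemma circ_left_addhom: "addhom UNIV (\<lambda>f. circ m n p f g)" by (simp add: addhom_def addsub_UNIV circ_add_left)
lemmas circ_left_hom = addhom_sum[OF circ_left_addhom, simplified]

lemma circ_right_hom:
  assumes f: "ml f"
  shows "circ m n p f 0 = 0"
    "(\<And>i. i \<in> I ==> ml (G i)) ==> circ m n p f (\<Sum>i\<in>I. signed (k i) (G i)) = (\<Sum>i\<in>I. signed (k i) (circ m n p f (G i)))"
    "ml g ==> circ m n p f (signed i g) = signed i (circ m n p f g)"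
proof -
  have h: "addhom {f. ml f} (\<lambda>g. circ m n p f g)" for m n p by (simp add: addhom_def addsub_ml circ_add_right f)
  note a = addhom_sum[OF h, unfolded mem_Collect_eq]
  show "circ m n p f 0 = 0" by (rule a)
  show "(\<And>i. i \<in> I ==> ml (G i)) ==> circ m n p f (\<Sum>i\<in>I. signed (k i) (G i)) = (\<Sum>i\<in>I. signed (k i) (circ m n p f (G i)))"
    by (rule a)
  show "ml g ==> circ m n p f (signed i g) = signed i (circ m n p f g)" by (rule a)
qed

lemma cup0_add_left: "ml f ==> ml f' ==> cup0 m n (f + f') g = cup0 m n f g + cup0 m n f' g"
  by (simp add: cup0_def face_add circ_add_left)

lemma cup0_add_right: "f \<in> multilin B m ==> ml g ==> ml g' ==> cup0 m n f (g + g') = cup0 m n f g + cup0 m n f g'"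
  by (simp add: cup0_def circ_add_right multilin_ml[OF face_multilin])

lemma cup0_left_addhom: "addhom {f. ml f} (\<lambda>f. cup0 m n f g)" by (simp add: addhom_def addsub_ml cup0_add_left)
lemmas cup0_left_hom = addhom_sum[OF cup0_left_addhom, unfolded mem_Collect_eq]

lemma cup0_right_hom:
  assumes f: "f \<in> multilin B m"
  shows "cup0 m n f 0 = 0"
    "(\<And>i. i \<in> I ==> ml (G i)) ==> cup0 m n f (\<Sum>i\<in>I. signed (k i) (G i)) = (\<Sum>i\<in>I. signed (k i) (cup0 m n f (G i)))"
    "ml g ==> cup0 m n f (signed i g) = signed i (cup0 m n f g)"
proof -
  have h: "addhom {f. ml f} (\<lambda>g. cup0 m n f g)" for n by (simp add: addhom_def addsub_ml cup0_add_right[OF f])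
  note a = addhom_sum[OF h, unfolded mem_Collect_eq]
  show "cup0 m n f 0 = 0" by (rule a)
  show "(\<And>i. i \<in> I ==> ml (G i)) ==> cup0 m n f (\<Sum>i\<in>I. signed (k i) (G i)) = (\<Sum>i\<in>I. signed (k i) (cup0 m n f (G i)))"
    by (rule a)
  show "ml g ==> cup0 m n f (signed i g) = signed i (cup0 m n f g)" by (rule a)
qed

lemma circ_bs_left: "circ m n p (\<lambda>xs. bs c (f xs)) g = (\<lambda>xs. bs c (circ m n p f g xs))"
  by (auto simp: circ_def TA_klin[symmetric, where L="bs c", OF klin_bs[OF klin_id]] klin_psum[OF klin_bs[OF klin_id]])
lemma circ_bs_right: "ml f ==> ml g ==> circ m n p f (\<lambda>xs. bs c (g xs)) = (\<lambda>xs. bs c (circ m n p f g xs))"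
  by (auto simp: circ_def A_bs klin_scale[OF ml_slot[OF _ klin_id]] TA_klin[symmetric, where L="bs c", OF klin_bs[OF klin_id]] klin_psum[OF klin_bs[OF klin_id]])
lemma cup0_bs_left: "ml f ==> cup0 m n (\<lambda>xs. bs c (f xs)) g = (\<lambda>xs. bs c (cup0 m n f g xs))"
  by (simp add: cup0_def face_bs circ_bs_left)
lemma cup0_bs_right: "f \<in> multilin B m ==> ml g ==> cup0 m n f (\<lambda>xs. bs c (g xs)) = (\<lambda>xs. bs c (cup0 m n f g xs))"
  by (simp add: cup0_def circ_bs_right multilin_ml[OF face_multilin])

lemma A_cup0: assumes "f \<in> multilin B m" "g \<in> multilin B n"
  shows "A h (cup0 m n f g) = dsum h (\<lambda>a b. cup0 m n (A a f) (A b g))"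
  by (rule ext) (simp add: cup0_def A_circ face_multilin A_face assms psum_fun_apply)

lemma A_deg0: "ml f ==> A h f [] = ac h (f [])"
  unfolding A_eq using dsum_counit2[of bs "\<lambda>a. ac a (f [])" h]
  by (simp add: klin_scale[OF klin_act[OF klin_id]] eps_S klin_act_h klin_id)

lemma unit_multilin: "unit_cochain \<in> multilin B 0"
  by (rule multilinI) (auto simp: unit_cochain_def ml_def klin_zeroI[OF vsB])

lemma A_unit: "A h unit_cochain = (\<lambda>xs. bs (eps h) (unit_cochain xs))"
proof
  fix xs show "A h unit_cochain xs = bs (eps h) (unit_cochain xs)"
    using multilin_len[OF A_multilin[OF unit_multilin]] A_deg0[OF multilin_ml[OF unit_multilin]]
    by (cases xs) (auto simp: unit_cochain_def act_unit)
qed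

lemma cup0_unit_left: assumes f: "f \<in> multilin B n" shows "cup0 0 n unit_cochain f = f"
proof
  note m = multilin_ml[OF f]
  fix xs show "cup0 0 n unit_cochain f xs = f xs"
  proof (cases "length xs = n")
    case True
    then have "cup0 0 n unit_cochain f xs = rsum (\<lambda>s t. bs (eps t) (A s f xs))"
      using cup0_eval[OF unit_multilin, of "[]" xs n f] by (simp add: unit_cochain_def bs_mult)
    also have "\<dots> = A 1 f xs" by (rule rsum_eps2) (intro klin_A m klin_id)
    finally show ?thesis by (simp add: A_one[OF m])
  qed (use multilin_len[OF f] in \<open>simp add: cup0_len\<close>)
qed

lemma cup0_unit_right: assumes f: "f \<in> multilin B n" shows "cup0 n 0 f unit_cochain = f"
proof
  note m = multilin_ml[OF f]
  fix xs show "cup0 n 0 f unit_cochain xs = f xs"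
  proof (cases "length xs = n")
    case True
    then have "cup0 n 0 f unit_cochain xs = rsum (\<lambda>s t. bs (eps s) (TA f t xs))"
      using cup0_eval[OF f, of xs "[]" 0 unit_cochain] by (simp add: A_unit unit_cochain_def bs_mult)
    also have "\<dots> = TA f 1 xs" by (rule rsum_eps1) (intro klins m)
    finally show ?thesis by (simp add: TA_one[OF m])
  qed (use multilin_len[OF f] in \<open>simp add: cup0_len\<close>)
qed

text \<open>Moving h past the arguments of f and of g splits by the second hexagon; moving the
  product of g and h past the arguments of f splits by the first. Both lead to the same three R-sums
  up to their order.\<close>

lemma cup0_assoc: assumes f: "f \<in> multilin B m" and g: "g \<in> multilin B n" and h: "h \<in> multilin B p"
  shows "cup0 (m + n) p (cup0 m n f g) h = cup0 m (n + p) f (cup0 n p g h)"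
proof
  note mf = multilin_ml[OF f] and mg = multilin_ml[OF g] and mh = multilin_ml[OF h]
  fix xs show "cup0 (m + n) p (cup0 m n f g) h xs = cup0 m (n + p) f (cup0 n p g h) xs"
  proof (cases "length xs = m + n + p")
    case True
    define us where "us = take m xs" define vs where "vs = take n (drop m xs)" define ws where "ws = drop n (drop m xs)"
    have xs: "xs = us @ vs @ ws" and len: "length us = m" "length vs = n" "length ws = p"
      using True by (auto simp: us_def vs_def ws_def simp del: drop_drop)
    have "cup0 (m + n) p (cup0 m n f g) h xs = rsum (\<lambda>s t. TA (cup0 m n f g) t (us @ vs) * A s h ws)"
      using cup0_eval[OF cup0_multilin[OF f g], of "us @ vs" ws p h] len by (simp add: xs)
    also have "\<dots> = rsum (\<lambda>s t. dsum t (\<lambda>a c. TA (\<lambda>us. TA (\<lambda>vs. cup0 m n f g (us @ vs)) c vs) a us * A s h ws))"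
      by (simp add: TA_append multilin_ml[OF cup0_multilin[OF f g]] psum_mult_right)
    also have "\<dots> = rsum (\<lambda>s t. dsum t (\<lambda>a c. TA (\<lambda>us. TA (\<lambda>vs. rsum (\<lambda>s t. TA f t us * A s g vs)) c vs) a us * A s h ws))"
      using len by (intro psum_cong arg_cong[where f="\<lambda>x. x * A s h ws" for s] TA_cong_len) (simp add: cup0_eval[OF f])
    also have "\<dots> = rsum (\<lambda>s t. dsum t (\<lambda>a c. rsum (\<lambda>s' t'. TA f (t' * a) us * TA (A s' g) c vs * A s h ws)))"
      by (simp add: TA_psum TA_mult_left[symmetric] TA_mult_right[symmetric] TA_mult[OF mf] psum_mult_right)
    also have "\<dots> = rsum (\<lambda>s t. rsum (\<lambda>s' t'. rsum (\<lambda>s'' t''. TA f (t'' * t') us * TA (A s'' g) t vs * A (s * s') h ws)))"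
      by (rule rsum_hex2[of bs]) (intro klins klin_A ml_A mf mg mh)+
    also have "\<dots> = rsum (\<lambda>s t. rsum (\<lambda>s2 t2. rsum (\<lambda>s' t'. TA f (t * t2) us * TA (A s g) t' vs * A (s' * s2) h ws)))"
      by (rule psum_rev3)
    also have "\<dots> = rsum (\<lambda>s t. dsum s (\<lambda>a c. rsum (\<lambda>s' t'. TA f t us * TA (A a g) t' vs * A (s' * c) h ws)))"
      by (rule rsum_hex1[of bs, symmetric]) (intro klins klin_A ml_A mf mg mh)+
    also have "\<dots> = rsum (\<lambda>s t. TA f t us * A s (cup0 n p g h) (vs @ ws))"
      by (simp add: A_cup0[OF g h] psum_fun_apply cup0_eval[OF A_multilin[OF g]] len A_mult[OF mh] psum_mult_left mult.assoc)
    also have "\<dots> = cup0 m (n + p) f (cup0 n p g h) xs"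
      using cup0_eval[OF f, of us "vs @ ws" "n + p"] len by (simp add: xs)
    finally show ?thesis .
  qed (simp add: cup0_len add.assoc)
qed

text \<open>The alternating sum of faces without the global sign (-1)^(n+1) of \<open>dc\<close>.
  The sign changes neither kernels nor images.\<close>

definition D :: "nat => ('b list => 'b) => 'b list => 'b" where
  "D n f = (\<Sum>i\<le>Suc n. signed i (face n i f))"

lemma dc_eq: "dc H B n f = signed (Suc n) (D n f)"
proof
  fix xs show "dc H B n f xs = signed (Suc n) (D n f) xs"
  proof (cases "length xs = Suc n")
    case True
    have "D n f xs = (\<Sum>i\<le>n. signed i (face n i f xs)) + signed (Suc n) (f (butlast xs) * last xs)"
      using True by (simp add: D_def sum_fun_apply signed_apply) (simp add: face_def)
    also have "(\<Sum>i\<le>n. signed i (face n i f xs)) = face n 0 f xs + (\<Sum>i=1..n. signed i (face n i f xs))"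
      by (simp add: atMost_atLeast0 sum.atLeast_Suc_atMost)
    also have "(\<Sum>i=1..n. signed i (face n i f xs)) = (\<Sum>i=1..n. signed i (f (contract (i - 1) xs)))"
      using True by (intro sum.cong) (auto simp: face_def)
    finally show ?thesis using True by (simp add: dc_def signed_apply face_def psum_def)
  qed (simp add: dc_def signed_apply D_def sum_fun_apply face_len)
qed

lemma D_add: "ml f ==> ml g ==> D n (f + g) = D n f + D n g"
  by (simp add: D_def face_add signed_add sum.distrib)

lemma D_addhom: "addhom {f. ml f} (D n)" by (simp add: addhom_def addsub_ml D_add)
lemmas D_hom = addhom_sum[OF D_addhom, unfolded mem_Collect_eq]

lemma bs_signed: "bs c (signed i x) = signed i (bs c x)" by (simp add: signed_def VB.scale_minus_right)

lemma D_bs: "ml f ==> D n (\<lambda>xs. bs c (f xs)) = (\<lambda>xs. bs c (D n f xs))"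
  unfolding fun_eq_iff D_def sum_fun_apply signed_apply by (simp only: face_bs VB.scale_sum_right bs_signed) simp

lemma A_D: assumes "f \<in> multilin B n" shows "A h (D n f) = D n (A h f)"
  unfolding D_def using assms multilin_ml[OF face_multilin[OF assms]]
  by (simp add: A_hom(5) A_face del: sum.atMost_Suc)

text \<open>Faces up to m act on f and the later ones on g. Completing the two partial sums to
  differentials adds the last face of f and face 0 of g; these produce the same term
  \<open>?X\<close> with opposite signs.\<close>

lemma D_cup0: assumes f: "f \<in> multilin B m" and g: "g \<in> multilin B n"
  shows "D (m + n) (cup0 m n f g) = cup0 (Suc m) n (D m f) g + signed m (cup0 m (Suc n) f (D n g))"
proof -
  note mf = multilin_ml[OF f] and mg = multilin_ml[OF g]
  note mff = multilin_ml[OF face_multilin[OF f]] and mgg = multilin_ml[OF face_multilin[OF g]]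
  let ?X = "cup0 (Suc m) n (face m (Suc m) f) g"
  have "D (m + n) (cup0 m n f g) = (\<Sum>i\<le>m. signed i (face (m + n) i (cup0 m n f g)))
      + (\<Sum>i=Suc m..m + Suc n. signed i (face (m + n) i (cup0 m n f g)))"
    unfolding D_def add_Suc_right[symmetric] by (rule sum_up_index_split)
  also have "(\<Sum>i\<le>m. signed i (face (m + n) i (cup0 m n f g))) = (\<Sum>i\<le>m. signed i (cup0 (Suc m) n (face m i f) g))"
    by (intro sum.cong) (simp_all add: cup0_face_left[OF f g])
  also have "\<dots> = cup0 (Suc m) n (D m f) g - signed (Suc m) ?X"
    by (simp add: D_def cup0_left_hom mff del: sum.atMost_Suc) (simp)
  also have "(\<Sum>i=Suc m..m + Suc n. signed i (face (m + n) i (cup0 m n f g)))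
     = (\<Sum>j=1..Suc n. signed (m + j) (face (m + n) (m + j) (cup0 m n f g)))"
    using sum.shift_bounds_cl_nat_ivl[of "\<lambda>i. signed i (face (m + n) i (cup0 m n f g))" 1 m "Suc n"] by (simp add: add.commute)
  also have "\<dots> = signed m (\<Sum>j=1..Suc n. signed j (cup0 m (Suc n) f (face n j g)))"
    unfolding signed_sum signed_signed by (intro sum.cong) (simp_all add: cup0_face_right[OF f g])
  also have "(\<Sum>j=1..Suc n. signed j (cup0 m (Suc n) f (face n j g))) = cup0 m (Suc n) f (D n g) - cup0 m (Suc n) f (face n 0 g)"
  proof -
    have "cup0 m (Suc n) f (D n g) = (\<Sum>j\<le>Suc n. signed j (cup0 m (Suc n) f (face n j g)))"
      unfolding D_def by (rule cup0_right_hom(2)[OF f mgg])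
    then show ?thesis unfolding sum_atMost_split0[of _ "Suc n"] by simp
  qed
  also have "cup0 m (Suc n) f (face n 0 g) = ?X" by (rule cup0_arg_face_0[OF f g])
  finally show ?thesis by (simp add: fun_eq_iff signed_apply signed_diff signed_Suc)
qed

text \<open>\<open>L q\<close> is the part of the differential of f up to face q, with g inserted at
  q. The faces of the insertion act in front of g, inside it, or behind it. The outer faces of g
  supply the terms \<open>?X\<close> and \<open>?Y\<close> missing from the front and back parts;
  the front completes to \<open>L (Suc p)\<close>, and the back is \<open>- L p\<close> up to sign
  because f is a cocycle.\<close>

lemma D_circ: assumes f: "f \<in> multilin B (Suc m)" and g: "g \<in> multilin B n" and p: "p \<le> m"
  and Df: "D (Suc m) f = 0" and Dg: "D n g = 0"
  defines "L \<equiv> \<lambda>q. \<Sum>i\<le>q. signed i (circ (Suc m) n q (face (Suc m) i f) g)"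
  shows "D (m + n) (circ m n p f g) = L (Suc p) + signed n (L p)"
proof -
  note mf = multilin_ml[OF f] and mg = multilin_ml[OF g]
  note mff = multilin_ml[OF face_multilin[OF f]] and mgg = multilin_ml[OF face_multilin[OF g]]
  let ?C = "\<lambda>i. signed i (face (m + n) i (circ m n p f g))"
  let ?X = "circ (Suc m) n (Suc p) (face (Suc m) (Suc p) f) g" and ?Y = "circ (Suc m) n p (face (Suc m) (Suc p) f) g"
  obtain r where r: "m = p + r" using p le_Suc_ex by blast
  \<comment> \<open>The complement of \<open>L p\<close> in the vanishing sum over all faces of f,
    hence \<open>- L p\<close>.\<close>
  define U where "U = (\<Sum>k=Suc p..Suc (Suc m). signed k (circ (Suc m) n p (face (Suc m) k f) g))"
  have "L p + U = circ (Suc m) n p (D (Suc m) f) g"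
  proof -
    have e: "Suc (Suc m) = p + Suc (Suc r)" by (simp add: r)
    show ?thesis unfolding L_def U_def D_def circ_left_hom e by (rule sum_up_index_split[symmetric])
  qed
  then have U: "U = - L p" by (simp add: Df circ_left_hom eq_neg_iff_add_eq_0 add.commute)
  have "D (m + n) (circ m n p f g) = (\<Sum>i\<le>p. ?C i) + (\<Sum>i=Suc p..p + n. ?C i) + (\<Sum>i=Suc (p+n)..p + n + Suc r. ?C i)"
    unfolding D_def using sum_up_index_split[of ?C p "n + Suc r"] sum.ub_add_nat[of "Suc p" "p + n" ?C "Suc r"]
    by (simp add: r add.commute add.left_commute add.assoc)
  also have "(\<Sum>i\<le>p. ?C i) = (\<Sum>i\<le>p. signed i (circ (Suc m) n (Suc p) (face (Suc m) i f) g))"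
    by (intro sum.cong) (use p in \<open>simp_all add: circ_face_left[OF f g]\<close>)
  also have "\<dots> = L (Suc p) - signed (Suc p) ?X" by (simp add: L_def)
  also have "(\<Sum>i=Suc p..p + n. ?C i) = (\<Sum>j=1..n. ?C (p + j))"
    using sum.shift_bounds_cl_nat_ivl[of ?C 1 p n] by (simp add: add.commute)
  also have "\<dots> = signed p (\<Sum>j=1..n. signed j (circ m (Suc n) p f (face n j g)))"
    unfolding signed_sum signed_signed by (intro sum.cong) (use p in \<open>simp_all add: circ_face_mid[OF f g]\<close>)
  also have "(\<Sum>j=1..n. signed j (circ m (Suc n) p f (face n j g))) = circ m (Suc n) p f (D n g)
     - circ m (Suc n) p f (face n 0 g) - signed (Suc n) (circ m (Suc n) p f (face n (Suc n) g))"
  proof -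
    have "circ m (Suc n) p f (D n g) = (\<Sum>j\<le>Suc n. signed j (circ m (Suc n) p f (face n j g)))"
      unfolding D_def by (rule circ_right_hom(2)[OF mf mgg])
    then show ?thesis unfolding sum.atMost_Suc sum_atMost_split0[of _ n] by simp
  qed
  \<comment> \<open>The sum over all faces of g vanishes, so the inner faces amount to minus the two
    outer ones, which can be rewritten as faces of f.\<close>
  also have "\<dots> = - ?X - signed (Suc n) ?Y"
    using p by (simp add: Dg circ_right_hom[OF mf] circ_arg_face_0[OF f g] circ_arg_face_last[OF f g])
  also have "(\<Sum>i=Suc (p+n)..p + n + Suc r. ?C i) = (\<Sum>k=Suc p..Suc m. ?C (k + n))"
    using sum.shift_bounds_cl_nat_ivl[of ?C "Suc p" n "Suc m"] by (simp add: r add.commute add.left_commute)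
  also have "\<dots> = (\<Sum>k=Suc p..Suc m. signed (n + 1) (signed (Suc k) (circ (Suc m) n p (face (Suc m) (Suc k) f) g)))"
    unfolding signed_signed by (intro sum.cong) (use p in \<open>auto simp: circ_face_right[OF f g] intro!: signed_parity\<close>)
  also have "\<dots> = signed (n + 1) (\<Sum>k=Suc (Suc p)..Suc (Suc m). signed k (circ (Suc m) n p (face (Suc m) k f) g))"
    unfolding signed_sum[symmetric] by (simp only: sum.shift_bounds_cl_Suc_ivl)
  also have "(\<Sum>k=Suc (Suc p)..Suc (Suc m). signed k (circ (Suc m) n p (face (Suc m) k f) g)) = U - signed (Suc p) ?Y"
    unfolding U_def using p by (simp add: sum.atLeast_Suc_atMost del: sum.cl_ivl_Suc)
  finally show ?thesis
    by (simp add: fun_eq_iff U signed_apply signed_diff signed_Suc signed_minus signed_signed add.commute)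
qed

text \<open>The signs (-1)^(p(n+1)) in h are those that make the formula of \<open>D_circ\<close>
  telescope. The upper end gives the product of f and g, and the lower end, face 0 with g inserted
  in front, gives the braided opposite product by \<open>circ_first\<close>.\<close>

lemma cup0_commute: assumes f: "f \<in> multilin B (Suc m)" and g: "g \<in> multilin B n"
  and Df: "D (Suc m) f = 0" and Dg: "D n g = 0"
  defines "h \<equiv> \<Sum>p\<le>m. signed (p * Suc n) (circ m n p f g)"
  shows "cup0 (Suc m) n f g - signed (Suc m * n) (rsum (\<lambda>s t. cup0 n (Suc m) (A t g) (A s f))) = signed (Suc (m * n)) (D (m + n) h)"
proof -
  note mf = multilin_ml[OF f] and mg = multilin_ml[OF g]
  define L where "L = (\<lambda>q. \<Sum>i\<le>q. signed i (circ (Suc m) n q (face (Suc m) i f) g))"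
  have mC: "p \<le> m ==> ml (circ m n p f g)" for p using multilin_ml[OF circ_multilin[OF f g]] .
  have "D (m + n) h = (\<Sum>p\<le>m. signed (p * Suc n) (D (m + n) (circ m n p f g)))"
    unfolding h_def by (rule D_hom) (simp add: mC)
  also have "\<dots> = (\<Sum>p\<le>m. signed (p * Suc n) (L (Suc p) + signed n (L p)))"
    unfolding L_def by (intro sum.cong refl arg_cong[where f="signed _"] D_circ[OF f g _ Df Dg]) auto
  also have "\<dots> = signed (m * Suc n) (L (Suc m)) + signed n (L 0)" by (rule signed_telescope)
  also have "L 0 = rsum (\<lambda>s t. cup0 n (Suc m) (A t g) (A s f))"
    unfolding L_def by (simp add: circ_first[OF f g]) (simp add: fun_eq_iff psum_fun_apply)
  \<comment> \<open>The only face missing from this sum is the last one, and that term is the cup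
    product by definition.\<close>
  also have "L (Suc m) = signed (Suc m) (cup0 (Suc m) n f g)"
  proof -
    have "L (Suc m) + signed (Suc (Suc m)) (cup0 (Suc m) n f g) = circ (Suc m) n (Suc m) (D (Suc m) f) g"
      unfolding L_def D_def circ_left_hom cup0_def by simp
    then show ?thesis by (simp add: Df circ_left_hom signed_Suc eq_neg_iff_add_eq_0)
  qed
  finally have *: "D (m + n) h = signed (m * Suc n + Suc m) (cup0 (Suc m) n f g) + signed n (rsum (\<lambda>s t. cup0 n (Suc m) (A t g) (A s f)))"
    by (simp add: fun_eq_iff signed_apply signed_signed)
  have "signed (m * Suc n + Suc m) (cup0 (Suc m) n f g) = signed (Suc (m * n)) (cup0 (Suc m) n f g)"
    by (rule signed_parity) auto
  then have **: "D (m + n) h = signed (Suc (m * n)) (cup0 (Suc m) n f g) + signed n (rsum (\<lambda>s t. cup0 n (Suc m) (A t g) (A s f)))"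
    using * by simp
  have "signed (Suc (m * n)) (signed n W) = - signed (Suc m * n) W" for W :: "'b list => 'b"
    unfolding signed_signed signed_Suc[symmetric] by (rule signed_parity) auto
  then show ?thesis by (simp add: ** signed_add)
qed

end

section \<open>Relative cochains\<close>

locale rel_alg = braided_mod_alg H B
  for H :: "('k::field, 'h::{ring,monoid_mult}) qt_hopf" and B :: "('k, 'h, 'b::{ring,monoid_mult}) hmod_alg" +
  fixes E :: "'b set"
  assumes sub: "subalgebra_in_Z B E"
begin

lemma E_one: "1 \<in> E" and E_mult: "x \<in> E ==> y \<in> E ==> x * y \<in> E" and E_act: "x \<in> E ==> ac h x \<in> E"
  and E_bs: "x \<in> E ==> bs c x \<in> E" and E_add: "x \<in> E ==> y \<in> E ==> x + y \<in> E"
  using sub by (auto simp: subalgebra_in_Z_def)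

text \<open>The conditions of \<^const>\<open>rel_cochains\<close> say uniformly that two neighbouring faces agree when the
  argument merged with its left or right neighbour lies in \<open>E\<close>.\<close>

definition RC :: "nat => ('b list => 'b) set" where
  "RC n = {f \<in> multilin B n. \<forall>i\<le>n. \<forall>xs. length xs = Suc n \<longrightarrow> xs ! i \<in> E \<longrightarrow> face n i f xs = face n (Suc i) f xs}"

lemma RC_multilin: "f \<in> RC n ==> f \<in> multilin B n" by (simp add: RC_def)
lemma RC_face: "f \<in> RC n ==> i \<le> n ==> length xs = Suc n ==> xs ! i \<in> E ==> face n i f xs = face n (Suc i) f xs"
  by (simp add: RC_def)

lemma TA_cong_E:
  assumes "\<And>us. length us = length xs ==> (\<And>i. i < length xs ==> xs!i \<in> E ==> us!i \<in> E) ==> g us = g' us"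
  shows "TA g h xs = TA g' h xs"
  using assms by (rule TA_cong[where E=E]) (auto intro: E_act)

lemma RC_A: assumes f: "f \<in> RC n" shows "A h f \<in> RC n"
  unfolding RC_def
proof (safe intro!: A_multilin RC_multilin[OF f])
  fix i and xs :: "'b list" assume i: "i \<le> n" "length xs = Suc n" "xs ! i \<in> E"
  note m = multilin_ml[OF face_multilin[OF RC_multilin[OF f]]]
  have "A h (face n i f) xs = A h (face n (Suc i) f) xs"
    unfolding A_eq[OF m]
    by (intro psum_cong arg_cong[where f="ac _"] TA_cong_E RC_face[OF f]) (use i in auto)
  then show "face n i (A h f) xs = face n (Suc i) (A h f) xs" by (simp add: A_face[OF RC_multilin[OF f]])
qed

lemma face_diff: "ml f ==> ml g ==> face n i (f - g) = face n i f - face n i g"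
proof -
  have "addhom {f. ml f} (face n i)" by (simp add: addhom_def addsub_ml face_add)
  from addhom_sum(4)[OF this] show "ml f ==> ml g ==> face n i (f - g) = face n i f - face n i g" by simp
qed

lemma RC_addsub: "addsub (RC n)"
proof -
  have "f - g \<in> RC n" if "f \<in> RC n" "g \<in> RC n" for f g
    using that addsubD(2)[OF addsub_multilin] by (auto simp: RC_def face_diff multilin_ml)
  moreover have "0 \<in> RC n"
  proof -
    have "face n i 0 = 0" for i using face_diff[of 0 0 n i] addsubD(1)[OF addsub_ml] by simp
    then show ?thesis using addsubD(1)[OF addsub_multilin] by (simp add: RC_def)
  qed
  ultimately show ?thesis by (simp add: addsub_def)
qed

lemma RC_bs: "f \<in> RC n ==> (\<lambda>xs. bs c (f xs)) \<in> RC n"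
  by (auto simp: RC_def bs_multilin face_bs multilin_ml)

text \<open>The list passed to the face of f consists of translated entries, the value of g at
  position p, and the untouched entries behind. Entry k thus comes from index k in front of g and
  from index k - 1 + n behind it, where n entries have become one.\<close>

lemma circ_rel_left:
  assumes f: "f \<in> RC m" and p: "p \<le> m" "k \<le> m" and X: "length X = m + n"
    and k: "k < p \<and> X ! k \<in> E \<or> p < k \<and> X ! (k - 1 + n) \<in> E"
  shows "circ m n p (face m k f) g X = circ m n p (face m (Suc k) f) g X"
proof -
  obtain us vs ws where Xs: "X = us @ vs @ ws" and len: "length us = p" "length vs = n" "length ws + p = m"
    using X p(1) by (rule split3)
  have "TA (\<lambda>us. face m k f (us @ y # ws)) t us = TA (\<lambda>us. face m (Suc k) f (us @ y # ws)) t us" for y t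
  proof (rule TA_cong_E)
    fix us' assume us': "length us' = length us" "\<And>i. i < length us ==> us ! i \<in> E ==> us' ! i \<in> E"
    have "(us' @ y # ws) ! k \<in> E"
    proof (cases "k < p")
      case True then show ?thesis using k us' len by (auto simp: Xs nth_append)
    next
      case False
      with k obtain j where j: "k = Suc (p + j)" using less_imp_Suc_add by auto
      with k have "X ! (p + n + j) \<in> E" by (simp add: add.commute add.left_commute)
      moreover have "(p + (n + j)) - p - n = j" by simp
      ultimately have "ws ! j \<in> E" using len by (simp add: Xs nth_append)
      moreover have "(us' @ y # ws) ! k = ws ! j" using us'(1) len by (simp add: j nth_append)
      ultimately show ?thesis by simp
    qed
    then show "face m k f (us' @ y # ws) = face m (Suc k) f (us' @ y # ws)"
      using RC_face[OF f p(2)] us' len by simp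
  qed
  then show ?thesis by (simp add: Xs circ_eval[OF len])
qed

lemma circ_rel_right:
  assumes g: "g \<in> RC n" and p: "p \<le> m" "j \<le> n" and X: "length X = m + Suc n" "X ! (p + j) \<in> E"
  shows "circ m (Suc n) p f (face n j g) X = circ m (Suc n) p f (face n (Suc j) g) X"
proof -
  obtain us vs ws where Xs: "X = us @ vs @ ws" and len: "length us = p" "length vs = Suc n" "length ws + p = m"
    using X(1) p(1) by (rule split3)
  have "vs ! j \<in> E" using X(2) len p by (simp add: Xs nth_append)
  then have "A s (face n j g) vs = A s (face n (Suc j) g) vs" for s
    using RC_face[OF RC_A[OF g] p(2) len(2)] by (simp add: A_face[OF RC_multilin[OF g]])
  then show ?thesis by (simp add: Xs circ_eval[OF len])
qed

text \<open>Each pair of neighbouring faces of the insertion is rewritten by the simplicial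
  identities as neighbouring faces of f or of g at the same entry of E. At the two borders of the
  block the outer faces of g mediate between the descriptions.\<close>

lemma RC_circ: assumes f: "f \<in> RC (Suc m)" and g: "g \<in> RC n" and p: "p \<le> m"
  shows "circ m n p f g \<in> RC (m + n)"
  unfolding RC_def
proof (safe intro!: circ_multilin RC_multilin[OF f] RC_multilin[OF g] p)
  note mf = RC_multilin[OF f] and mg = RC_multilin[OF g]
  fix i and X :: "'b list" assume i: "i \<le> m + n" and X: "length X = Suc (m + n)" "X ! i \<in> E"
  let ?C = "circ m n p f g"
  note left = circ_face_left[OF mf mg _ p] and mid = circ_face_mid[OF mf mg p] and right = circ_face_right[OF mf mg p]
  \<comment> \<open>The right border of the block. It is isolated because for n = 0 the left border
    reaches it directly.\<close>
  have last: "circ m (Suc n) p f (face n (Suc n) g) X = face (m + n) (Suc (p + n)) ?C X" if "i = p + n"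
  proof -
    have "circ m (Suc n) p f (face n (Suc n) g) X = circ (Suc m) n p (face (Suc m) (Suc p) f) g X"
      by (simp add: circ_arg_face_last[OF mf mg p])
    also have "\<dots> = circ (Suc m) n p (face (Suc m) (Suc (Suc p)) f) g X"
      by (rule circ_rel_left[OF f]) (use p X that in auto)
    also have "\<dots> = face (m + n) (Suc (p + n)) ?C X" using right[of "Suc p"] p by simp
    finally show ?thesis .
  qed
  consider "i < p" | "i = p" | "p < i" "i < p + n" | "p < i" "i = p + n" | "p + n < i" by linarith
  then show "face (m + n) i ?C X = face (m + n) (Suc i) ?C X"
  proof cases
    case 1
    have "circ (Suc m) n (Suc p) (face (Suc m) i f) g X = circ (Suc m) n (Suc p) (face (Suc m) (Suc i) f) g X"
      by (rule circ_rel_left[OF f]) (use 1 p X in auto)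
    with 1 show ?thesis using left[of i] left[of "Suc i"] by simp
  next
    case 2
    have "face (m + n) i ?C X = circ (Suc m) n (Suc p) (face (Suc m) i f) g X"
      using left[of i] 2 by simp
    also have "\<dots> = circ (Suc m) n (Suc p) (face (Suc m) (Suc p) f) g X"
      unfolding 2 by (rule circ_rel_left[OF f]) (use 2 p X in auto)
    also have "\<dots> = circ m (Suc n) p f (face n 0 g) X" by (simp add: circ_arg_face_0[OF mf mg p])
    also have "\<dots> = circ m (Suc n) p f (face n (Suc 0) g) X"
      by (rule circ_rel_right[OF g]) (use 2 p X in auto)
    also have "\<dots> = face (m + n) (Suc i) ?C X"
    \<comment> \<open>For n = 0 there are no inner faces: face 1 of g is already its last face, so
      the chain crosses the insertion in one step.\<close>
    proof (cases "n = 0")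
      case True
      then show ?thesis using last 2 by simp
    qed (use mid[of 1] 2 in simp)
    finally show ?thesis .
  next
    case 3
    have "circ m (Suc n) p f (face n (i - p) g) X = circ m (Suc n) p f (face n (Suc (i - p)) g) X"
      by (rule circ_rel_right[OF g]) (use 3 p X in auto)
    with 3 show ?thesis using mid[of "i - p"] mid[of "Suc (i - p)"] by simp
  next
    case 4
    have "circ m (Suc n) p f (face n n g) X = circ m (Suc n) p f (face n (Suc n) g) X"
      by (rule circ_rel_right[OF g]) (use 4 p X in auto)
    with 4 show ?thesis using mid[of n] last by simp
  next
    case 5
    have "circ (Suc m) n p (face (Suc m) (Suc (i - n)) f) g X = circ (Suc m) n p (face (Suc m) (Suc (Suc (i - n))) f) g X"
      by (rule circ_rel_left[OF f]) (use 5 p X i in auto)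
    moreover have "face (m + n) i ?C = circ (Suc m) n p (face (Suc m) (Suc (i - n)) f) g" using right[of "i - n"] 5 i by simp
    moreover have "face (m + n) (Suc i) ?C = circ (Suc m) n p (face (Suc m) (Suc (Suc (i - n))) f) g"
      using right[of "Suc i - n"] 5 i by (simp add: Suc_diff_le)
    ultimately show ?thesis by simp
  qed
qed

lemma cup0_rel_left:
  assumes f: "f \<in> RC m" and g: "g \<in> RC n" and k: "k \<le> m" and X: "length X = Suc m + n" "X ! k \<in> E"
  shows "cup0 (Suc m) n (face m k f) g X = cup0 (Suc m) n (face m (Suc k) f) g X"
proof -
  define us where "us = take (Suc m) X" define vs where "vs = drop (Suc m) X"
  have Xs: "X = us @ vs" and len: "length us = Suc m" "length vs = n" using X by (auto simp: us_def vs_def)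
  have "us ! k \<in> E" using X k by (simp add: us_def)
  then have "TA (face m k f) t us = TA (face m (Suc k) f) t us" for t
    by (intro TA_cong_E RC_face[OF f k]) (use len k in auto)
  then show ?thesis by (simp add: Xs cup0_eval face_multilin RC_multilin[OF f] len)
qed

lemma RC_cup0: assumes f: "f \<in> RC m" and g: "g \<in> RC n"
  shows "cup0 m n f g \<in> RC (m + n)"
  unfolding RC_def
proof (safe intro!: cup0_multilin RC_multilin[OF f] RC_multilin[OF g])
  note mf = RC_multilin[OF f] and mg = RC_multilin[OF g]
  fix i and X :: "'b list" assume i: "i \<le> m + n" and X: "length X = Suc (m + n)" "X ! i \<in> E"
  note left = cup0_face_left[OF mf mg] and right = cup0_face_right[OF mf mg]
  have R: "cup0 m (Suc n) f (face n j g) X = cup0 m (Suc n) f (face n (Suc j) g) X" if "i = m + j" for j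
    unfolding cup0_def by (rule circ_rel_right[OF g]) (use that i X in auto)
  show "face (m + n) i (cup0 m n f g) X = face (m + n) (Suc i) (cup0 m n f g) X"
  proof (cases i m rule: linorder_cases)
    case less
    then show ?thesis using cup0_rel_left[OF f g, of i X] left[of i] left[of "Suc i"] X by simp
  next
    case equal
    then show ?thesis using cup0_rel_left[OF f g, of i X] left[of i] right[of 1] R[of 0] X
      by (simp add: cup0_arg_face_0[OF mf mg])
  next
    case greater
    then show ?thesis using R[of "i - m"] right[of "i - m"] right[of "Suc (i - m)"] i by simp
  qed
qed

lemma RC_unit: "unit_cochain \<in> RC 0"
proof -
  have "face 0 0 unit_cochain xs = face 0 (Suc 0) unit_cochain xs" if l: "length xs = Suc 0" for xs :: "'b list"
  proof -
    obtain w where xs: "xs = [w]" using l by (cases xs) auto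
    have "face 0 0 unit_cochain xs = rsum (\<lambda>s t. bs (eps s) (ac t w))"
      using face_0[of "[]" 0 unit_cochain w] by (simp add: xs A_unit unit_cochain_def bs_mult)
    also have "\<dots> = ac 1 w" by (rule rsum_eps1) (intro klins)
    finally show ?thesis using face_last[of "[]" 0 unit_cochain w] by (simp add: xs act_one unit_cochain_def)
  qed
  then show ?thesis by (simp add: RC_def unit_multilin)
qed

text \<open>The formula describes the braided centraliser of E in B.\<close>

lemma RC_0: "f \<in> RC 0 \<longleftrightarrow> f \<in> multilin B 0 \<and> (\<forall>w\<in>E. rsum (\<lambda>s t. ac t w * ac s (f [])) = f [] * w)"
proof (cases "f \<in> multilin B 0")
  case True
  have "face 0 0 f [w] = rsum (\<lambda>s t. ac t w * ac s (f []))" "face 0 (Suc 0) f [w] = f [] * w" for w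
    using face_0[of "[]" 0 f w] face_last[of "[]" 0 f w] by (simp_all add: A_deg0[OF multilin_ml[OF True]])
  moreover have "f \<in> RC 0 \<longleftrightarrow> (\<forall>w\<in>E. face 0 0 f [w] = face 0 (Suc 0) f [w])"
  proof
    assume f: "f \<in> RC 0"
    show "\<forall>w\<in>E. face 0 0 f [w] = face 0 (Suc 0) f [w]"
      by (intro ballI RC_face[OF f]) auto
  next
    assume *: "\<forall>w\<in>E. face 0 0 f [w] = face 0 (Suc 0) f [w]"
    have "face 0 0 f xs = face 0 (Suc 0) f xs" if l: "length xs = Suc 0" "xs ! 0 \<in> E" for xs
      using l * by (cases xs) auto
    then show "f \<in> RC 0" using True by (simp add: RC_def)
  qed
  ultimately show ?thesis using True by simp
qed (simp add: RC_def)

text \<open>A map from E to B that respects right multiplication sends x to g(1)x, so its value at 1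
  is the only datum. Braided left linearity says that this value centralises E.\<close>

lemma RC_0_eq: "RC 0 = rel_cochains H B E 0"
proof (intro Set.set_eqI iffI)
  fix f assume "f \<in> RC 0"
  then have f: "f \<in> multilin B 0" and c: "\<And>w. w \<in> E ==> rsum (\<lambda>s t. ac t w * ac s (f [])) = f [] * w"
    by (auto simp: RC_0)
  have "f [] * (w * x) = rsum (\<lambda>s t. ac t w * dsum s (\<lambda>a b. ac a (f [] * ac (S b) x)))" if "w \<in> E" for w x
  proof -
    \<comment> \<open>Acting on the map \<open>x \<mapsto> f [] * x\<close> amounts to acting on its
      constant factor: the antipode undoes the action on x.\<close>
    have "dsum s (\<lambda>a b. ac a (f [] * ac (S b) x)) = ac s (f []) * x" for s
    proof -
      have "dsum s (\<lambda>a b. ac a (f [] * ac (S b) x)) = dsum s (\<lambda>a b. dsum a (\<lambda>c d. ac c (f []) * ac (d * S b) x))"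
        by (simp add: act_prod act_mult)
      also have "\<dots> = dsum s (\<lambda>a b. dsum b (\<lambda>c d. ac a (f []) * ac (c * S d) x))"
        by (rule dsum_assoc[of bs]) (intro klins)+
      also have "\<dots> = dsum s (\<lambda>a b. bs (eps b) (ac a (f []) * ac 1 x))"
        by (intro psum_cong dsum_antipode2) (intro klins)
      also have "\<dots> = ac s (f []) * ac 1 x" by (rule dsum_counit2) (intro klins)
      finally show ?thesis by (simp add: act_one)
    qed
    then show ?thesis using c[OF that] by (simp add: mult.assoc[symmetric] psum_mult_right[symmetric])
  qed
  then show "f \<in> rel_cochains H B E 0" using f
    by (auto simp: rel_cochains_def distrib_left bs_mult mult.assoc psum_def intro!: exI[of _ "\<lambda>x. f [] * x"])
next
  fix f assume "f \<in> rel_cochains H B E 0"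
  then obtain g where f: "f \<in> multilin B 0" and g1: "g 1 = f []" and gs: "\<And>c x. x \<in> E ==> g (bs c x) = bs c (g x)"
    and gr: "\<And>x w. x \<in> E ==> w \<in> E ==> g (x * w) = g x * w"
    and gl: "\<And>x w. x \<in> E ==> w \<in> E ==> g (w * x) = rsum (\<lambda>s t. ac t w * dsum s (\<lambda>a b. ac a (g (ac (S b) x))))"
    by (auto simp: rel_cochains_def psum_def)
  have "f [] * w = rsum (\<lambda>s t. ac t w * ac s (f []))" if w: "w \<in> E" for w
  proof -
    have "f [] * w = g (w * 1)" using gr[OF E_one w] g1 by simp
    also have "\<dots> = rsum (\<lambda>s t. ac t w * dsum s (\<lambda>a b. bs (eps b) (ac a (f []))))"
      unfolding gl[OF E_one w] by (simp add: act_unit gs[OF E_one] g1 eps_S klin_scale[OF klin_act[OF klin_id]])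
    also have "\<dots> = rsum (\<lambda>s t. ac t w * ac s (f []))"
      by (subst dsum_counit2[of bs]) (intro klins, simp)
    finally show ?thesis .
  qed
  then show "f \<in> RC 0" using f by (simp add: RC_0)
qed

text \<open>The element w of E becomes a list entry of its own. Equality of the two faces next to it
  reads as balancing, right linearity or braided left linearity, according to whether w is an
  interior, the last or the first entry.\<close>

lemma RC_eq: "RC n = rel_cochains H B E n"
proof (cases "n = 0")
  case True then show ?thesis using RC_0_eq by simp
next
  case False
  then obtain m where n: "n = Suc m" by (cases n) auto
  show ?thesis
  proof (intro Set.set_eqI iffI)
    fix f assume f: "f \<in> RC n"
    note F = RC_face[OF f]
    have 1: "f (xs @ (a * w) # b # ys) = f (xs @ a # (w * b) # ys)" if "w \<in> E" "length xs + 2 + length ys = n" for xs ys a b w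
    proof -
      let ?X = "xs @ a # w # b # ys"
      have c: "contract (length xs) ?X = xs @ (a * w) # b # ys" "contract (Suc (length xs)) ?X = xs @ a # (w * b) # ys"
        using contract_mid[of xs a w "b # ys"] contract_mid[of "xs @ [a]" w b ys] by simp_all
      have "face n (Suc (length xs)) f ?X = face n (Suc (Suc (length xs))) f ?X"
        by (rule F) (use that in \<open>auto simp: nth_append\<close>)
      then show ?thesis using that c by (simp add: face_contract)
    qed
    have 2: "f (rmult xs w) = f xs * w" if w: "w \<in> E" and l: "length xs = n" for xs w
    proof -
      obtain ys y where xs: "xs = ys @ [y]" and y: "length ys = m" using l n by (cases xs rule: rev_cases) auto
      have "face n n f (xs @ [w]) = face n (Suc n) f (xs @ [w])"
        by (rule F) (use w l in \<open>auto simp: nth_append\<close>)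
      then show ?thesis using l contract_mid[of ys y w "[]"] face_last[of xs n f w] y
        by (simp add: n face_contract rmult_def xs)
    qed
    have 3: "f (lmult w xs) = rsum (\<lambda>s t. ac t w * A s f xs)" if w: "w \<in> E" and l: "length xs = n" for xs w
    proof -
      obtain y ys where xs: "xs = y # ys" using l n by (cases xs) auto
      have "face n 0 f (w # xs) = face n (Suc 0) f (w # xs)"
        by (rule F) (use w l in auto)
      then show ?thesis using l by (simp add: n face_contract face_0 lmult_def xs contract_0)
    qed
    show "f \<in> rel_cochains H B E n" using False RC_multilin[OF f] 1 2 3 by (auto simp: rel_cochains_def psum_def)
  next
    fix f assume f0: "f \<in> rel_cochains H B E n"
    then have f: "f \<in> multilin B n"
      and 1: "\<And>xs ys a b w. w \<in> E ==> length xs + 2 + length ys = n ==> f (xs @ (a * w) # b # ys) = f (xs @ a # (w * b) # ys)"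
      and 2: "\<And>xs w. w \<in> E ==> length xs = n ==> f (rmult xs w) = f xs * w"
      and 3: "\<And>xs w. w \<in> E ==> length xs = n ==> f (lmult w xs) = rsum (\<lambda>s t. ac t w * A s f xs)"
      using False by (simp_all add: rel_cochains_def psum_def)
    show "f \<in> RC n" unfolding RC_def
    proof (safe intro!: f)
      fix i and X :: "'b list" assume i: "i \<le> n" and X: "length X = Suc n" "X ! i \<in> E"
      define us where "us = take i X" define w where "w = X ! i" define vs where "vs = drop (Suc i) X"
      have Xs: "X = us @ w # vs" unfolding us_def w_def vs_def using i X by (intro id_take_nth_drop) simp
      have len: "length us = i" "length vs = n - i" and w: "w \<in> E" using i X by (auto simp: us_def vs_def w_def)
      consider "i = 0" | "0 < i" "i < n" | "0 < i" "i = n" using i by linarith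
      then show "face n i f X = face n (Suc i) f X"
      proof cases
        case 1
        then obtain v vs' where "vs = v # vs'" using len n by (cases vs) auto
        then show ?thesis using 3[OF w, of vs] len 1 n by (simp add: Xs face_0 face_contract contract_0 lmult_def)
      next
        case 2
        obtain us' a where us: "us = us' @ [a]" using len 2 by (cases us rule: rev_cases) auto
        obtain b vs' where vs: "vs = b # vs'" using len 2 by (cases vs) auto
        have i': "i = Suc (length us')" using len us by simp
        have c: "contract (length us') X = us' @ (a * w) # b # vs'" "contract i X = us' @ a # (w * b) # vs'"
          using contract_mid[of us' a w vs] contract_mid[of us w b vs'] len by (simp_all add: Xs us vs)
        have "face n i f X = f (contract (length us') X)" unfolding i' by (rule face_contract) (use X 2 i' in auto)
        moreover have "face n (Suc i) f X = f (contract i X)" by (rule face_contract) (use X 2 in auto)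
        ultimately show ?thesis using 1[OF w, of us' vs' a b] len us vs 2 by (simp add: c)
      next
        case 3
        obtain us' a where us: "us = us' @ [a]" using len 3 by (cases us rule: rev_cases) auto
        have vs: "vs = []" using len 3 by simp
        have i': "i = Suc (length us')" using len us by simp
        have c: "contract (length us') X = us' @ [a * w]"
          using contract_mid[of us' a w vs] by (simp add: Xs us vs)
        have "face n i f X = f (contract (length us') X)" unfolding i' by (rule face_contract) (use X 3 i' in auto)
        moreover have "face n (Suc i) f X = f us * w" using face_last[of us n f w] len 3 by (simp add: Xs vs)
        ultimately show ?thesis using 2[OF w, of us] len 3 by (simp add: c us rmult_def)
      qed
    qed
  qed
qed

end

section \<open>The absolute case as the relative case over the ground field\<close>

context braided_mod_alg begin

lemma subalgebra_scalars: "subalgebra_in_Z B (scalars B)"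
  unfolding subalgebra_in_Z_def
proof (intro conjI ballI allI)
  show "1 \<in> scalars B" unfolding scalars_def by (rule range_eqI[of _ _ 1]) simp
  fix x y assume "x \<in> scalars B" "y \<in> scalars B"
  then obtain c d where x: "x = bs c 1" and y: "y = bs d 1" by (auto simp: scalars_def)
  show "x + y \<in> scalars B" unfolding scalars_def x y
    by (rule range_eqI[of _ _ "c + d"]) (simp add: VB.scale_left_distrib)
  show "x * y \<in> scalars B" unfolding scalars_def x y
    by (rule range_eqI[of _ _ "c * d"]) (simp add: bs_mult mult.commute)
next
  fix c x assume "x \<in> scalars B"
  then obtain d where x: "x = bs d 1" by (auto simp: scalars_def)
  show "bs c x \<in> scalars B" unfolding scalars_def x by (rule range_eqI[of _ _ "c * d"]) simp
next
  fix h x assume "x \<in> scalars B"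
  then obtain d where x: "x = bs d 1" by (auto simp: scalars_def)
  show "ac h x \<in> scalars B" unfolding scalars_def x
    by (rule range_eqI[of _ _ "d * eps h"]) (simp add: klin_scale[OF klin_act[OF klin_id]] act_unit)
qed

sublocale sc: rel_alg H B "scalars B" by unfold_locales (rule subalgebra_scalars)

text \<open>By multilinearity the scalar entry may be taken to be 1, and both neighbouring faces
  simply delete an entry 1. For face 0 this uses (id tensor eps)(R) = 1.\<close>

lemma RC_scalars: "sc.RC n = multilin B n"
proof (intro Set.set_eqI iffI)
  fix f assume f: "f \<in> multilin B n"
  note m = multilin_ml[OF f]
  show "f \<in> sc.RC n" unfolding sc.RC_def
  proof (safe intro!: f)
    fix i and X :: "'b list" assume i: "i \<le> n" and X: "length X = Suc n" "X ! i \<in> scalars B"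
    define us where "us = take i X" define vs where "vs = drop (Suc i) X"
    obtain c where c: "X ! i = bs c 1" using X by (auto simp: scalars_def)
    have Xs: "X = us @ bs c 1 # vs" unfolding us_def vs_def c[symmetric] using i X by (intro id_take_nth_drop) simp
    have len: "length us = i" "length vs = n - i" using i X by (auto simp: us_def vs_def)
    have "face n j f (us @ bs c 1 # vs) = bs c (face n j f (us @ 1 # vs))" for j
      by (rule klin_scale[OF ml_slot[OF multilin_ml[OF face_multilin[OF f]] klin_id]])
    moreover have "face n j f (us @ 1 # vs) = f (us @ vs)" if "j = i \<or> j = Suc i" for j
    proof -
      have left: "face n i f (us @ 1 # vs) = f (us @ vs)"
      proof (cases us rule: rev_cases)
        case Nil
        have "rsum (\<lambda>s t. ac t 1 * A s f vs) = A 1 f vs"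
          by (simp add: act_unit bs_mult) (rule rsum_eps2, intro klin_A m klin_id)
        then show ?thesis using Nil len by (simp add: face_0 A_one[OF m])
      next
        case (snoc us' a)
        then show ?thesis using len i contract_mid[of us' a 1 vs] face_contract[of "us @ 1 # vs" n "length us'" f] by simp
      qed
      have right: "face n (Suc i) f (us @ 1 # vs) = f (us @ vs)"
      proof (cases vs)
        case Nil
        then show ?thesis using len i face_last[of us n f 1] by simp
      next
        case (Cons b vs')
        then show ?thesis using len i contract_mid[of us 1 b vs'] face_contract[of "us @ 1 # vs" n i f] by simp
      qed
      show ?thesis using that left right by auto
    qed
    ultimately show "face n i f X = face n (Suc i) f X" by (simp add: Xs)
  qed
qed (simp add: sc.RC_def)

lemma C_cx_eq: "C_cx H B = CE_cx H B (scalars B)"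
  unfolding C_cx_def CE_cx_def sc.RC_eq[symmetric, abs_def] RC_scalars[abs_def] ..

end

section \<open>Cohomology of complexes of functions\<close>

text \<open>All complexes here consist of B-valued functions with pointwise scalars, on lists for
  the cochains and on module elements for Hom complexes, so one locale covers both.\<close>

locale fun_complex = vector_space s for s :: "'k::field => 'b::ab_group_add => 'b" +
  fixes K :: "('y => 'b) cochain_cx"
  assumes cochains_addsub: "addsub (cochains K n)"
    and cochains_scale: "f \<in> cochains K n ==> (\<lambda>x. s c (f x)) \<in> cochains K n"
    and cdiff_add: "f \<in> cochains K n ==> g \<in> cochains K n ==> cdiff K n (f + g) = cdiff K n f + cdiff K n g"
    and cdiff_scale: "f \<in> cochains K n ==> cdiff K n (\<lambda>x. s c (f x)) = (\<lambda>x. s c (cdiff K n f x))"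
begin

lemma cdiff_addhom: "addhom (cochains K n) (cdiff K n)"
  by (simp add: addhom_def cochains_addsub cdiff_add)
lemmas cdiff_hom = addhom_sum[OF cdiff_addhom]

lemma cocycles_addsub: "addsub (cocycles K n)"
  unfolding addsub_def cocycles_def
  using addsubD[OF cochains_addsub] by (auto simp: cdiff_hom)

lemma cocycles_scale: "f \<in> cocycles K n ==> (\<lambda>x. s c (f x)) \<in> cocycles K n"
  by (simp add: cocycles_def cochains_scale cdiff_scale fun_eq_iff)

lemma coboundaries_addsub: "addsub (coboundaries K n)"
proof (cases n)
  case (Suc m)
  have "0 \<in> cdiff K m ` cochains K m"
    using addsubD(1)[OF cochains_addsub] by (rule image_eqI[rotated]) (simp add: cdiff_hom)
  moreover have "cdiff K m f - cdiff K m g \<in> cdiff K m ` cochains K m" if "f \<in> cochains K m" "g \<in> cochains K m" for f g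
    using that by (intro image_eqI[of _ _ "f - g"]) (auto simp: cdiff_hom addsubD[OF cochains_addsub])
  ultimately show ?thesis using Suc by (auto simp: coboundaries_def addsub_def)
qed (simp add: coboundaries_def addsub_def)

lemma coboundaries_scale: "f \<in> coboundaries K n ==> (\<lambda>x. s c (f x)) \<in> coboundaries K n"
proof (cases n)
  case (Suc m)
  assume "f \<in> coboundaries K n"
  then obtain g where "g \<in> cochains K m" "f = cdiff K m g" using Suc by (auto simp: coboundaries_def)
  then show ?thesis using Suc
    by (auto simp: coboundaries_def cdiff_scale[symmetric] intro!: imageI cochains_scale)
qed (auto simp: coboundaries_def fun_eq_iff)

lemma coboundaryI: "g \<in> cochains K m ==> cdiff K m g \<in> coboundaries K (Suc m)"
  by (simp add: coboundaries_def)

lemma class_iff: "f \<in> cocycles K n ==> g \<in> coh_class K n f \<longleftrightarrow> g \<in> cocycles K n \<and> f - g \<in> coboundaries K n"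
  by (simp add: coh_class_def coh_rel_def)

lemma class_eq_iff: assumes f: "f \<in> cocycles K n" and g: "g \<in> cocycles K n"
  shows "coh_class K n f = coh_class K n g \<longleftrightarrow> f - g \<in> coboundaries K n"
proof
  assume "coh_class K n f = coh_class K n g"
  then have "g \<in> coh_class K n f" using g addsubD(1)[OF coboundaries_addsub] by (simp add: class_iff)
  then show "f - g \<in> coboundaries K n" using f by (simp add: class_iff)
next
  assume *: "f - g \<in> coboundaries K n"
  note b = addsubD[OF coboundaries_addsub[of n]]
  have "f - h \<in> coboundaries K n \<longleftrightarrow> g - h \<in> coboundaries K n" for h
  proof
    assume "f - h \<in> coboundaries K n"
    from b(2)[OF this *] show "g - h \<in> coboundaries K n" by simp
  next
    assume "g - h \<in> coboundaries K n"
    from b(4)[OF * this] show "f - h \<in> coboundaries K n" by (simp only: diff_add_cancel add_diff_eq)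
  qed
  then show "coh_class K n f = coh_class K n g" by (intro Set.set_eqI) (simp only: class_iff[OF f] class_iff[OF g])
qed

lemma coh_eq: "coh K n = coh_class K n ` cocycles K n"
  unfolding coh_def quotient_def coh_class_def by (rule UNION_singleton_eq_range)

lemma cohE: assumes "X \<in> coh K n" obtains f where "f \<in> cocycles K n" "X = coh_class K n f"
  using assms by (auto simp: coh_eq)

lemma class_in_coh: "f \<in> cocycles K n ==> coh_class K n f \<in> coh K n"
  by (auto simp: coh_eq)

lemma class_self: "f \<in> cocycles K n ==> f \<in> coh_class K n f"
  using addsubD(1)[OF coboundaries_addsub] by (simp add: class_iff)

text \<open>Operations on classes are defined as unions over all representatives. Such a union is a
  single class once the value is independent of the representative.\<close>

lemma UN_class:
  assumes "f \<in> cocycles K n" "\<And>g. g \<in> cocycles K n ==> f - g \<in> coboundaries K n ==> T g = T f"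
  shows "(\<Union>g\<in>coh_class K n f. T g) = T f"
proof (rule SUP_eq_const)
  show "coh_class K n f \<noteq> {}" using class_self[OF assms(1)] by blast
  show "T g = T f" if "g \<in> coh_class K n f" for g
    using that unfolding class_iff[OF assms(1)] by (intro assms(2)) auto
qed

lemma coh_map_class:
  assumes "f \<in> cocycles K n" "\<And>g. g \<in> cocycles K n ==> f - g \<in> coboundaries K n ==> coh_class K' m (\<theta> g) = coh_class K' m (\<theta> f)"
  shows "coh_map K' m \<theta> (coh_class K n f) = coh_class K' m (\<theta> f)"
  unfolding coh_map_def by (rule UN_class[where T="\<lambda>f. coh_class K' m (\<theta> f)", OF assms])

lemma add_class: assumes f: "f \<in> cocycles K n" and g: "g \<in> cocycles K n"
  shows "(\<Union>f\<in>coh_class K n f. \<Union>g\<in>coh_class K n g. coh_class K n (f + g)) = coh_class K n (f + g)"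
proof -
  note c = addsubD[OF cocycles_addsub] and b = addsubD[OF coboundaries_addsub[of n]]
  have "(\<Union>g'\<in>coh_class K n g. coh_class K n (f' + g')) = coh_class K n (f' + g)" if f': "f' \<in> cocycles K n" for f'
  proof (rule UN_class[OF g])
    fix g' assume g': "g' \<in> cocycles K n" and d: "g - g' \<in> coboundaries K n"
    have "(f' + g') - (f' + g) \<in> coboundaries K n" using b(3)[OF d] by simp
    then show "coh_class K n (f' + g') = coh_class K n (f' + g)"
      by (simp only: class_eq_iff[OF c(4)[OF f' g'] c(4)[OF f' g]])
  qed
  then have "(\<Union>f'\<in>coh_class K n f. \<Union>g\<in>coh_class K n g. coh_class K n (f' + g)) = (\<Union>f'\<in>coh_class K n f. coh_class K n (f' + g))"
    using f by (intro SUP_cong) (simp_all only: class_iff)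
  also have "\<dots> = coh_class K n (f + g)"
  proof (rule UN_class[OF f])
    fix f' assume f': "f' \<in> cocycles K n" and d: "f - f' \<in> coboundaries K n"
    have "(f' + g) - (f + g) \<in> coboundaries K n" using b(3)[OF d] by simp
    then show "coh_class K n (f' + g) = coh_class K n (f + g)"
      by (simp only: class_eq_iff[OF c(4)[OF f' g] c(4)[OF f g]])
  qed
  finally show ?thesis .
qed

end

locale mod_alg_complex = braided_mod_alg H B + fun_complex "scl B" K
  for H :: "('k::field, 'h::{ring,monoid_mult}) qt_hopf" and B :: "('k, 'h, 'b::{ring,monoid_mult}) hmod_alg"
  and K :: "('y => 'b) cochain_cx"
begin

abbreviation "cob hact n \<equiv> coh_obj B K hact n"

lemma cob_simps:
  "carrier (cob hact n) = coh K n" "zero (cob hact n) = coh_class K n 0"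
  "h \<odot>\<^bsub>cob hact n\<^esub> X = hact n h X"
  by (auto simp: coh_obj_def)

lemma cob_add: "f \<in> cocycles K n ==> g \<in> cocycles K n ==>
   coh_class K n f \<oplus>\<^bsub>cob hact n\<^esub> coh_class K n g = coh_class K n (f + g)"
  by (simp add: coh_obj_def add_class)

lemma cob_scale: "f \<in> cocycles K n ==> kscale (cob hact n) c (coh_class K n f) = coh_class K n (\<lambda>x. bs c (f x))"
  unfolding coh_obj_def zmod.simps
proof (rule coh_map_class)
  fix g assume f: "f \<in> cocycles K n" and g: "g \<in> cocycles K n" and d: "f - g \<in> coboundaries K n"
  have "(\<lambda>x. bs c (g x)) - (\<lambda>x. bs c (f x)) = (\<lambda>x. bs c (- (f - g) x))"
    by (simp add: fun_eq_iff VB.scale_right_diff_distrib)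
  also have "\<dots> \<in> coboundaries K n"
    using coboundaries_scale[OF addsubD(3)[OF coboundaries_addsub d]] by simp
  finally show "coh_class K n (\<lambda>x. bs c (g x)) = coh_class K n (\<lambda>x. bs c (f x))"
    using f g by (subst class_eq_iff) (auto intro: cocycles_scale)
qed

lemma cob_abelian: "abelian_group (cob hact n)"
proof (rule abelian_groupI)
  note c = addsubD[OF cocycles_addsub]
  fix X assume "X \<in> carrier (cob hact n)"
  then obtain f where f: "f \<in> cocycles K n" and X: "X = coh_class K n f" by (auto simp: cob_simps elim: cohE)
  show "\<zero>\<^bsub>cob hact n\<^esub> \<oplus>\<^bsub>cob hact n\<^esub> X = X" using f c by (simp add: X cob_simps cob_add)
  show "\<exists>y\<in>carrier (cob hact n). y \<oplus>\<^bsub>cob hact n\<^esub> X = \<zero>\<^bsub>cob hact n\<^esub>"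
    using f c by (intro bexI[of _ "coh_class K n (- f)"]) (simp_all add: X cob_simps cob_add class_in_coh)
  fix Y assume "Y \<in> carrier (cob hact n)"
  then obtain g where g: "g \<in> cocycles K n" and Y: "Y = coh_class K n g" by (auto simp: cob_simps elim: cohE)
  show "X \<oplus>\<^bsub>cob hact n\<^esub> Y \<in> carrier (cob hact n)" using f g c by (simp add: X Y cob_simps cob_add class_in_coh)
  show "X \<oplus>\<^bsub>cob hact n\<^esub> Y = Y \<oplus>\<^bsub>cob hact n\<^esub> X" using f g c by (simp add: X Y cob_add add.commute)
  fix Z assume "Z \<in> carrier (cob hact n)"
  then obtain h where h: "h \<in> cocycles K n" and Z: "Z = coh_class K n h" by (auto simp: cob_simps elim: cohE)
  show "(X \<oplus>\<^bsub>cob hact n\<^esub> Y) \<oplus>\<^bsub>cob hact n\<^esub> Z = X \<oplus>\<^bsub>cob hact n\<^esub> (Y \<oplus>\<^bsub>cob hact n\<^esub> Z)"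
    using f g h c by (simp add: X Y Z cob_add add.assoc)
next
  show "\<zero>\<^bsub>cob hact n\<^esub> \<in> carrier (cob hact n)" using addsubD(1)[OF cocycles_addsub] by (simp add: cob_simps class_in_coh)
qed

lemma cob_uminus: assumes f: "f \<in> cocycles K n" shows "\<ominus>\<^bsub>cob hact n\<^esub> coh_class K n f = coh_class K n (- f)"
proof -
  interpret abelian_group "cob hact n" by (rule cob_abelian)
  note c = addsubD[OF cocycles_addsub]
  show ?thesis by (rule minus_equality) (use f c in \<open>auto simp: cob_add cob_simps class_in_coh\<close>)
qed

lemma cob_list_sum: "(\<And>a b. f a b \<in> cocycles K n) ==>
  list_sum (cob hact n) (map (\<lambda>(a, b). coh_class K n (f a b)) xs) = coh_class K n (psum xs f)"
proof (induction xs)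
  case Nil then show ?case by (simp add: list_sum_def cob_simps zero_fun_def)
next
  case (Cons x xs)
  then show ?case by (cases x) (simp add: list_sum_def cob_add addsub_psum[OF cocycles_addsub] plus_fun_def)
qed

lemma Z_objectI:
  assumes hact: "\<And>h f. f \<in> cocycles K n ==> hact n h (coh_class K n f) = coh_class K n (\<alpha> h f)"
    and \<alpha>: "\<And>h f. f \<in> cocycles K n ==> \<alpha> h f \<in> cocycles K n"
    and add: "\<And>h f g. f \<in> cocycles K n ==> g \<in> cocycles K n ==> \<alpha> h (f + g) = \<alpha> h f + \<alpha> h g"
    and hadd: "\<And>h h' f. f \<in> cocycles K n ==> \<alpha> (h + h') f = \<alpha> h f + \<alpha> h' f"
    and hmult: "\<And>h h' f. f \<in> cocycles K n ==> \<alpha> (h * h') f = \<alpha> h (\<alpha> h' f)"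
    and one: "\<And>f. f \<in> cocycles K n ==> \<alpha> 1 f = f"
    and sc: "\<And>h c f. f \<in> cocycles K n ==> \<alpha> (hs c h) f = (\<lambda>x. bs c (\<alpha> h f x))"
       "\<And>h c f. f \<in> cocycles K n ==> \<alpha> h (\<lambda>x. bs c (f x)) = (\<lambda>x. bs c (\<alpha> h f x))"
  shows "Z_object H (cob hact n)"
proof -
  note c = addsubD[OF cocycles_addsub]
  have ex: "\<And>X. X \<in> carrier (cob hact n) ==> \<exists>f\<in>cocycles K n. X = coh_class K n f" by (auto simp: cob_simps elim: cohE)
  note r = cob_simps cob_add cob_scale hact \<alpha> add hadd hmult one sc c class_in_coh cocycles_scale
  have p: "(\<lambda>x. bs c ((f + g) x)) = (\<lambda>x. bs c (f x)) + (\<lambda>x. bs c (g x))"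
     "(\<lambda>x. bs (c + e) (f x)) = (\<lambda>x. bs c (f x)) + (\<lambda>x. bs e (f x))" for c e and f g :: "'y => 'b"
    by (auto simp: VB.scale_right_distrib VB.scale_left_distrib)
  show ?thesis unfolding Z_object_def
  proof (intro conjI allI ballI cob_abelian; (drule ex)+; elim bexE; hypsubst)
  qed (simp_all add: r p del: plus_fun_apply)
qed

end

section \<open>Cohomology of the relative cochains\<close>

context rel_alg begin

abbreviation "CE \<equiv> CE_cx H B E"

lemma CE_simps: "cochains CE n = RC n" "cdiff CE n = dc H B n" by (auto simp: CE_cx_def RC_eq)

lemma dc_add: "ml f ==> ml g ==> dc H B n (f + g) = dc H B n f + dc H B n g"
  unfolding dc_eq D_add by (rule signed_add)
lemma dc_bs: "ml f ==> dc H B n (\<lambda>x. bs c (f x)) = (\<lambda>x. bs c (dc H B n f x))"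
  unfolding dc_eq by (simp add: D_bs fun_eq_iff signed_apply bs_signed)

lemmas RC_ml = multilin_ml[OF RC_multilin]

sublocale mod_alg_complex H B CE
  by unfold_locales (simp_all add: CE_simps RC_addsub RC_bs dc_add dc_bs RC_ml)

lemma cocyclesD: "f \<in> cocycles CE n ==> f \<in> RC n" "f \<in> cocycles CE n ==> D n f = 0"
  by (auto simp: cocycles_def CE_simps dc_eq signed_eq_iff)
lemma cocyclesI: "f \<in> RC n ==> D n f = 0 ==> f \<in> cocycles CE n"
  by (auto simp: cocycles_def CE_simps dc_eq)
text \<open>The sign of \<open>dc\<close> is moved into the primitive, so that later arguments meet
  \<open>D\<close> only.\<close>

lemma coboundaryE: assumes "f \<in> coboundaries CE n"
  obtains "n = 0" "f = 0" | m g where "n = Suc m" "g \<in> RC m" "f = D m g"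
proof (cases n)
  case 0 then show ?thesis using assms that by (simp add: coboundaries_def)
next
  case (Suc m)
  then obtain g where "g \<in> RC m" "f = dc H B m g" using assms by (auto simp: coboundaries_def CE_simps)
  then have "f = D m (signed (Suc m) g)" "signed (Suc m) g \<in> RC m"
    by (simp_all add: dc_eq D_hom RC_ml addsubD[OF RC_addsub])
  then show ?thesis using that Suc by blast
qed
lemma D_coboundary: assumes "g \<in> RC m" shows "D m g \<in> coboundaries CE (Suc m)"
proof -
  have "D m g = cdiff CE m (signed (Suc m) g)" by (simp add: CE_simps dc_eq D_hom RC_ml[OF assms])
  then show ?thesis using coboundaryI[of "signed (Suc m) g" m] assms by (simp add: CE_simps addsubD[OF RC_addsub])
qed

lemma A_cocycle: "f \<in> cocycles CE n ==> A h f \<in> cocycles CE n"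
  by (rule cocyclesI) (use cocyclesD[of f n] in \<open>auto simp: RC_A A_D[symmetric] RC_multilin A_zero\<close>)

lemma A_coboundary: "f \<in> coboundaries CE n ==> A h f \<in> coboundaries CE n"
  by (erule coboundaryE) (simp_all add: A_zero addsubD[OF coboundaries_addsub] A_D RC_multilin D_coboundary RC_A)

lemma ind_act_class: assumes f: "f \<in> cocycles CE n"
  shows "ind_act H B CE n h (coh_class CE n f) = coh_class CE n (A h f)"
  unfolding ind_act_def
proof (rule coh_map_class[OF f])
  fix g assume g: "g \<in> cocycles CE n" and d: "f - g \<in> coboundaries CE n"
  have "A h (g - f) = A h g - A h f" by (rule A_hom(4)[OF RC_ml RC_ml, OF cocyclesD(1) cocyclesD(1), OF g f])
  moreover have "g - f \<in> coboundaries CE n" using addsubD(3)[OF coboundaries_addsub d] by simp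
  ultimately have "A h g - A h f \<in> coboundaries CE n" using A_coboundary by metis
  then show "coh_class CE n (A h g) = coh_class CE n (A h f)"
    by (simp only: class_eq_iff[OF A_cocycle[OF g] A_cocycle[OF f]])
qed

lemma cup_RC: "f \<in> RC m ==> g \<in> RC n ==> cup H B m n f g \<in> RC (m + n)"
  by (simp add: cup_eq RC_multilin addsubD[OF RC_addsub] RC_cup0)

lemma D_cup: assumes f: "f \<in> multilin B m" and g: "g \<in> multilin B n"
  shows "D (m + n) (cup H B m n f g) = signed (m * n) (cup0 (Suc m) n (D m f) g + signed m (cup0 m (Suc n) f (D n g)))"
  by (simp only: cup_eq[OF f] D_hom multilin_ml[OF cup0_multilin[OF f g]] D_cup0[OF f g])

lemma cup_cocycle: assumes f: "f \<in> cocycles CE m" and g: "g \<in> cocycles CE n"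
  shows "cup H B m n f g \<in> cocycles CE (m + n)"
  using cocyclesD[OF f] cocyclesD[OF g]
  by (intro cocyclesI cup_RC) (simp_all add: D_cup RC_multilin cup0_left_hom cup0_right_hom del: plus_fun_apply)

lemma cup_coboundary_left: assumes f: "f \<in> coboundaries CE m" and g: "g \<in> cocycles CE n"
  shows "cup0 m n f g \<in> coboundaries CE (m + n)"
  using f
proof (cases rule: coboundaryE)
  case 1
  then show ?thesis using addsubD(1)[OF coboundaries_addsub] by (simp add: cup0_left_hom)
next
  case (2 l f')
  have "cup0 m n f g = D (l + n) (cup0 l n f' g)"
    using D_cup0[of f' l g n] cocyclesD[OF g] 2 by (simp add: RC_multilin cup0_right_hom)
  then show ?thesis using D_coboundary[OF RC_cup0[OF 2(2)], of g n] cocyclesD[OF g] 2(1) by simp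
qed

lemma cup_coboundary_right: assumes f: "f \<in> cocycles CE m" and g: "g \<in> coboundaries CE n"
  shows "cup0 m n f g \<in> coboundaries CE (m + n)"
  using g
proof (cases rule: coboundaryE)
  case 1
  then show ?thesis using addsubD(1)[OF coboundaries_addsub] cocyclesD(1)[OF f] by (simp add: cup0_right_hom RC_multilin)
next
  case (2 l g')
  note f' = cocyclesD[OF f]
  have "signed m (cup0 m n f g) = D (m + l) (cup0 m l f g')"
    using D_cup0[of f m g' l] f' 2 by (simp add: RC_multilin cup0_left_hom)
  also have "\<dots> \<in> coboundaries CE (m + n)" using D_coboundary[OF RC_cup0[OF f'(1) 2(2)]] 2(1) by simp
  finally have "signed m (signed m (cup0 m n f g)) \<in> coboundaries CE (m + n)" by (rule addsubD(5)[OF coboundaries_addsub])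
  then show ?thesis by simp
qed

lemma cup_class_cong:
  assumes f: "f \<in> cocycles CE m" "f' \<in> cocycles CE m" "f - f' \<in> coboundaries CE m"
    and g: "g \<in> cocycles CE n" "g' \<in> cocycles CE n" "g - g' \<in> coboundaries CE n"
  shows "coh_class CE (m + n) (cup H B m n f g) = coh_class CE (m + n) (cup H B m n f' g')"
proof -
  note mm = cocyclesD(1)[THEN RC_multilin]
  note m = mm[THEN multilin_ml]
  have 1: "cup0 m n (f - f') g = cup0 m n f g - cup0 m n f' g"
    by (rule cup0_left_hom) (use f m in auto)
  have 2: "cup0 m n f' (g - g') = cup0 m n f' g - cup0 m n f' g'"
    using cup0_add_right[OF mm[OF f(2)], of "g - g'" g'] m[OF g(1)] m[OF g(2)] addsubD(2)[OF addsub_ml] by (simp add: algebra_simps)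
  have "cup H B m n f g - cup H B m n f' g' = signed (m * n) (cup0 m n (f - f') g + cup0 m n f' (g - g'))"
    using f by (simp add: cup_eq mm 1 2 signed_diff[symmetric])
  also have "\<dots> \<in> coboundaries CE (m + n)"
    by (intro addsubD[OF coboundaries_addsub] cup_coboundary_left cup_coboundary_right f g)
  finally show ?thesis using f g by (simp add: class_eq_iff cup_cocycle)
qed

lemma ind_cup_class: assumes f: "f \<in> cocycles CE m" and g: "g \<in> cocycles CE n"
  shows "ind_cup H B CE m n (coh_class CE m f) (coh_class CE n g) = coh_class CE (m + n) (cup H B m n f g)"
proof -
  have "ind_cup H B CE m n (coh_class CE m f) (coh_class CE n g) = (\<Union>f'\<in>coh_class CE m f. coh_class CE (m + n) (cup H B m n f' g))"
    unfolding ind_cup_def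
  proof (rule SUP_cong[OF HOL.refl])
    fix f' assume "f' \<in> coh_class CE m f"
    then have f': "f' \<in> cocycles CE m" using f by (simp add: class_iff)
    show "(\<Union>g\<in>coh_class CE n g. coh_class CE (m + n) (cup H B m n f' g)) = coh_class CE (m + n) (cup H B m n f' g)"
    proof (rule UN_class[OF g])
      fix g' assume g': "g' \<in> cocycles CE n" and d: "g - g' \<in> coboundaries CE n"
      show "coh_class CE (m + n) (cup H B m n f' g') = coh_class CE (m + n) (cup H B m n f' g)"
        by (rule cup_class_cong[symmetric, OF f' f' _ g g' d]) (simp add: addsubD(1)[OF coboundaries_addsub])
    qed
  qed
  also have "\<dots> = coh_class CE (m + n) (cup H B m n f g)"
  proof (rule UN_class[OF f])
    fix f' assume f': "f' \<in> cocycles CE m" and d: "f - f' \<in> coboundaries CE m"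
    show "coh_class CE (m + n) (cup H B m n f' g) = coh_class CE (m + n) (cup H B m n f g)"
      by (rule cup_class_cong[symmetric, OF f f' d g g]) (simp add: addsubD(1)[OF coboundaries_addsub])
  qed
  finally show ?thesis .
qed

abbreviation "HCE \<equiv> coh_obj B CE (ind_act H B CE)"

lemma A_A: "ml f ==> A (g * h) f = A g (A h f)" by (rule ext) (rule A_mult)

lemma HCE_Z: "Z_object H (HCE n)"
  by (rule Z_objectI[where \<alpha>=A, OF ind_act_class A_cocycle])
     (use RC_ml[OF cocyclesD(1)] in \<open>auto simp: A_add A_plus_left A_A A_one A_hs_left A_bs fun_eq_iff simp del: plus_fun_apply\<close>)

lemma cup_assoc: assumes "f \<in> multilin B m" "g \<in> multilin B n" "h \<in> multilin B p"
  shows "cup H B (m + n) p (cup H B m n f g) h = cup H B m (n + p) f (cup H B n p g h)"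
proof -
  have "cup H B (m + n) p (cup H B m n f g) h = signed ((m + n) * p + m * n) (cup0 (m + n) p (cup0 m n f g) h)"
    using assms by (simp add: cup_eq cup0_multilin addsubD[OF addsub_multilin] cup0_left_hom multilin_ml[OF cup0_multilin] signed_signed)
  also have "\<dots> = signed (m * (n + p) + n * p) (cup0 m (n + p) f (cup0 n p g h))"
    unfolding cup0_assoc[OF assms] by (rule signed_parity) (simp add: algebra_simps)
  also have "\<dots> = cup H B m (n + p) f (cup H B n p g h)"
    using assms by (simp add: cup_eq cup0_right_hom multilin_ml[OF cup0_multilin] signed_signed)
  finally show ?thesis .
qed

lemma A_cup: assumes "f \<in> multilin B m" "g \<in> multilin B n"
  shows "A h (cup H B m n f g) = dsum h (\<lambda>a b. cup H B m n (A a f) (A b g))"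
  using assms by (simp add: cup_eq A_multilin A_hom(3) multilin_ml[OF cup0_multilin] A_cup0 psum_signed)

lemma unit_cocycle: "unit_cochain \<in> cocycles CE 0"
proof (rule cocyclesI[OF RC_unit])
  have "face 0 0 unit_cochain xs = face 0 (Suc 0) unit_cochain xs" for xs :: "'b list"
  proof (cases "length xs = Suc 0")
    case True
    then obtain w where xs: "xs = [w]" by (cases xs) auto
    have "unit_cochain \<in> sc.RC 0" by (rule sc.RC_unit)
    have "face 0 0 unit_cochain xs = rsum (\<lambda>s t. bs (eps s) (ac t w))"
      using face_0[of "[]" 0 unit_cochain w] by (simp add: xs A_unit unit_cochain_def bs_mult)
    also have "\<dots> = ac 1 w" by (rule rsum_eps1) (intro klins)
    finally show ?thesis using face_last[of "[]" 0 unit_cochain w] by (simp add: xs act_one unit_cochain_def)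
  qed (simp add: face_len)
  then show "D 0 unit_cochain = 0" by (simp add: D_def signed_def fun_eq_iff)
qed

lemma HCE_graded: "graded_algebra H HCE (ind_cup H B CE) (coh_class CE 0 unit_cochain)"
proof -
  note c = addsubD[OF cocycles_addsub]
  have ex: "\<And>X n. X \<in> carrier (HCE n) ==> \<exists>f\<in>cocycles CE n. X = coh_class CE n f" by (auto simp: cob_simps elim: cohE)
  note mm = cocyclesD(1)[THEN RC_multilin]
  note m = mm[THEN multilin_ml]
  have cup_add1: "cup H B m n (f + f') g = cup H B m n f g + cup H B m n f' g" if "f \<in> cocycles CE m" "f' \<in> cocycles CE m" for f f' g m n
    using that by (simp add: cup_eq mm c cup0_add_left m signed_add del: plus_fun_apply)
  have cup_add2: "cup H B m n f (g + g') = cup H B m n f g + cup H B m n f g'" if "f \<in> cocycles CE m" "g \<in> cocycles CE n" "g' \<in> cocycles CE n" for f g g' m n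
    using that mm[of f m] by (simp add: cup_eq cup0_add_right m signed_add del: plus_fun_apply)
  have cup_bs1: "cup H B m n (\<lambda>x. bs c (f x)) g = (\<lambda>x. bs c (cup H B m n f g x))" if "f \<in> cocycles CE m" for f g m n c
    using mm[OF that] bs_multilin[of f m c] by (simp add: cup_eq cup0_bs_left multilin_ml fun_eq_iff signed_apply bs_signed)
  have cup_bs2: "cup H B m n f (\<lambda>x. bs c (g x)) = (\<lambda>x. bs c (cup H B m n f g x))" if "f \<in> cocycles CE m" "g \<in> cocycles CE n" for f g m n c
    using mm[OF that(1)] m[OF that(2)] by (simp add: cup_eq cup0_bs_right fun_eq_iff signed_apply bs_signed)
  show ?thesis unfolding graded_algebra_def
  proof (intro conjI allI ballI HCE_Z; ((drule ex)+)?; (elim bexE)?; hypsubst?)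
    fix h m n f g assume f: "f \<in> cocycles CE m" and g: "g \<in> cocycles CE n"
    have "list_sum (HCE (m + n)) (map (\<lambda>(a, b). ind_cup H B CE m n (a \<odot>\<^bsub>HCE m\<^esub> coh_class CE m f) (b \<odot>\<^bsub>HCE n\<^esub> coh_class CE n g)) (comult H h))
       = coh_class CE (m + n) (dsum h (\<lambda>a b. cup H B m n (A a f) (A b g)))"
      using cob_list_sum[of "\<lambda>a b. cup H B m n (A a f) (A b g)" "m + n" "ind_act H B CE" "comult H h"] f g
      by (simp add: cob_simps ind_act_class ind_cup_class A_cocycle cup_cocycle)
    then show "h \<odot>\<^bsub>HCE (m + n)\<^esub> ind_cup H B CE m n (coh_class CE m f) (coh_class CE n g) =
         list_sum (HCE (m + n)) (map (\<lambda>(a, b). ind_cup H B CE m n (a \<odot>\<^bsub>HCE m\<^esub> coh_class CE m f) (b \<odot>\<^bsub>HCE n\<^esub> coh_class CE n g)) (comult H h))"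
      using f g by (simp add: cob_simps ind_act_class ind_cup_class cup_cocycle A_cup mm)
  next
    fix m n p f g h assume f: "f \<in> cocycles CE m" and g: "g \<in> cocycles CE n" and h: "h \<in> cocycles CE p"
    show "ind_cup H B CE (m + n) p (ind_cup H B CE m n (coh_class CE m f) (coh_class CE n g)) (coh_class CE p h) =
       ind_cup H B CE m (n + p) (coh_class CE m f) (ind_cup H B CE n p (coh_class CE n g) (coh_class CE p h))"
      using f g h ind_cup_class[of f m "cup H B n p g h" "n + p"] ind_cup_class[of "cup H B m n f g" "m + n" h p]
      by (simp add: ind_cup_class cup_cocycle cup_assoc mm add.assoc)
  next
    fix n f assume f: "f \<in> cocycles CE n"
    show "ind_cup H B CE 0 n (coh_class CE 0 unit_cochain) (coh_class CE n f) = coh_class CE n f"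
      using ind_cup_class[OF unit_cocycle f] mm[OF f] by (simp add: cup_eq unit_multilin cup0_unit_left)
    show "ind_cup H B CE n 0 (coh_class CE n f) (coh_class CE 0 unit_cochain) = coh_class CE n f"
      using ind_cup_class[OF f unit_cocycle] mm[OF f] by (simp add: cup_eq cup0_unit_right)
  next
    show "coh_class CE 0 unit_cochain \<in> carrier (HCE 0)" by (simp add: cob_simps class_in_coh unit_cocycle)
    fix h show "h \<odot>\<^bsub>HCE 0\<^esub> coh_class CE 0 unit_cochain = kscale (HCE 0) (eps h) (coh_class CE 0 unit_cochain)"
      by (simp add: cob_simps cob_scale ind_act_class unit_cocycle A_unit)
  qed (simp_all add: cob_simps cob_add cob_scale ind_cup_class cup_cocycle class_in_coh c cocycles_scale
       cup_add1 cup_add2 cup_bs1 cup_bs2 del: plus_fun_apply)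
qed

lemma cup_commute: assumes f: "f \<in> cocycles CE m" and g: "g \<in> cocycles CE n"
  shows "cup H B m n f g - signed (m * n) (rsum (\<lambda>s t. cup H B n m (A t g) (A s f))) \<in> coboundaries CE (m + n)"
proof -
  note f' = cocyclesD[OF f] and g' = cocyclesD[OF g]
  note mf = RC_multilin[OF f'(1)] and mg = RC_multilin[OF g'(1)]
  have "cup0 m n f g - signed (m * n) (rsum (\<lambda>s t. cup0 n m (A t g) (A s f))) \<in> coboundaries CE (m + n)"
  proof (cases m)
    \<comment> \<open>In degree 0 there is nothing to insert into. The cocycle condition says that
      the two faces of f agree, and the two products are equal as cochains.\<close>
    case 0
    have "face 0 0 f = face 0 (Suc 0) f" using f'(2) by (simp add: 0 D_def signed_def)
    then have "cup0 m n f g = circ m n 0 (face m 0 f) g" by (simp add: 0 cup0_def)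
    then have "cup0 m n f g = rsum (\<lambda>s t. cup0 n m (A t g) (A s f))"
      using circ_first[OF mf mg] by (simp add: fun_eq_iff psum_fun_apply)
    then show ?thesis using addsubD(1)[OF coboundaries_addsub] by (simp add: 0)
  next
    case (Suc l)
    \<comment> \<open>The homotopy of \<open>cup0_commute\<close>; \<open>RC_circ\<close> keeps it
      inside the relative complex.\<close>
    define h where "h = (\<Sum>p\<le>l. signed (p * Suc n) (circ l n p f g))"
    have "h \<in> RC (l + n)"
      unfolding h_def by (intro addsub_sum RC_addsub addsubD(5)[OF RC_addsub] RC_circ g'(1)) (use f'(1) Suc in auto)
    then have "signed (Suc (l * n)) (D (l + n) h) \<in> coboundaries CE (m + n)"
      using D_coboundary addsubD(5)[OF coboundaries_addsub] by (simp add: Suc)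
    then show ?thesis using cup0_commute[of f l g n] mf mg f'(2) g'(2) by (simp add: Suc h_def)
  qed
  from addsubD(5)[OF coboundaries_addsub this, of "m * n"] show ?thesis
    by (simp add: cup_eq mf A_multilin[OF mg] psum_signed signed_diff mult.commute)
qed

lemma HCE_commutative: "braided_commutative H HCE (ind_cup H B CE)"
  unfolding braided_commutative_def
proof (intro allI ballI)
  note c = addsubD[OF cocycles_addsub]
  fix m n X Y assume "X \<in> carrier (HCE m)" "Y \<in> carrier (HCE n)"
  then obtain f g where f: "f \<in> cocycles CE m" and X: "X = coh_class CE m f" and g: "g \<in> cocycles CE n" and Y: "Y = coh_class CE n g"
    by (auto simp: cob_simps elim!: cohE)
  let ?r = "rsum (\<lambda>s t. cup H B n m (A t g) (A s f))"
  have cr: "cup H B n m (A t g) (A s f) \<in> cocycles CE (m + n)" for s t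
    using cup_cocycle[OF A_cocycle[OF g] A_cocycle[OF f]] by (simp add: add.commute)
  have z: "list_sum (HCE (m + n)) (map (\<lambda>(s, t). ind_cup H B CE n m (t \<odot>\<^bsub>HCE n\<^esub> Y) (s \<odot>\<^bsub>HCE m\<^esub> X)) (rmatrix H)) = coh_class CE (m + n) ?r"
    using cob_list_sum[of "\<lambda>s t. cup H B n m (A t g) (A s f)" "m + n" "ind_act H B CE" "rmatrix H", OF cr] f g
    by (simp add: X Y cob_simps ind_act_class ind_cup_class A_cocycle add.commute)
  have "?r \<in> cocycles CE (m + n)" by (rule addsub_psum[OF cocycles_addsub cr])
  then have "coh_class CE (m + n) (cup H B m n f g) = coh_class CE (m + n) (signed (m * n) ?r)"
    using cup_commute[OF f g] by (simp add: class_eq_iff cup_cocycle f g c)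
  moreover have "coh_class CE (m + n) (signed (m * n) ?r) = (if even (m * n) then coh_class CE (m + n) ?r else \<ominus>\<^bsub>HCE (m + n)\<^esub> coh_class CE (m + n) ?r)"
    using \<open>?r \<in> _\<close> by (simp add: signed_def cob_uminus)
  ultimately show "ind_cup H B CE m n X Y =
      (let z = list_sum (HCE (m + n)) (map (\<lambda>(s, t). ind_cup H B CE n m (t \<odot>\<^bsub>HCE n\<^esub> Y) (s \<odot>\<^bsub>HCE m\<^esub> X)) (rmatrix H))
         in if even (m * n) then z else \<ominus>\<^bsub>HCE (m + n)\<^esub> z)"
    unfolding z Let_def by (simp add: X Y ind_cup_class f g)
qed

end

text \<open>The vector space structure on cohomology is given in advance and the bijections have to
  respect it. Action, product and unit are then pulled back along them, and every law is verified
  after applying the injective map \<Theta>.\<close>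

lemma (in mod_alg_complex) transport_structure:
  fixes G' :: "nat => ('k, 'h, 'z) zmod"
  assumes gr: "graded_algebra H G' mul' u'" and bc: "braided_commutative H G' mul'"
    and bij: "\<And>n. bij_betw (\<Theta> n) (coh K n) (carrier (G' n))"
    and add: "\<And>n f g. f \<in> cocycles K n ==> g \<in> cocycles K n ==>
      \<Theta> n (coh_class K n (f + g)) = \<Theta> n (coh_class K n f) \<oplus>\<^bsub>G' n\<^esub> \<Theta> n (coh_class K n g)"
    and scale: "\<And>n c f. f \<in> cocycles K n ==>
      \<Theta> n (coh_class K n (\<lambda>x. bs c (f x))) = kscale (G' n) c (\<Theta> n (coh_class K n f))"
  shows "\<exists>hact mul u. (\<forall>i. Z_object H (cob hact i)) \<and> graded_algebra H (cob hact) mul u \<and>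
    braided_commutative H (cob hact) mul \<and> graded_iso (cob hact) mul u G' mul' u' \<Theta>"
proof -
  define \<Psi> where "\<Psi> n = inv_into (coh K n) (\<Theta> n)" for n
  define hact where "hact n h X = \<Psi> n (h \<odot>\<^bsub>G' n\<^esub> \<Theta> n X)" for n h X
  define mul where "mul m n X Y = \<Psi> (m + n) (mul' m n (\<Theta> m X) (\<Theta> n Y))" for m n X Y
  define u where "u = \<Psi> 0 u'"
  let ?G = "cob hact"
  have T\<Psi>: "Y \<in> carrier (G' n) ==> \<Theta> n (\<Psi> n Y) = Y" and \<Psi>C: "Y \<in> carrier (G' n) ==> \<Psi> n Y \<in> carrier (?G n)" for n Y
    using bij[of n] unfolding \<Psi>_def cob_simps bij_betw_def by (auto simp: f_inv_into_f inv_into_into)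
  have TC: "X \<in> carrier (?G n) ==> \<Theta> n X \<in> carrier (G' n)" for n X
    using bij[of n] by (auto simp: cob_simps bij_betw_def)
  have eqI: "X \<in> carrier (?G n) ==> Y \<in> carrier (?G n) ==> \<Theta> n X = \<Theta> n Y ==> X = Y" for n X Y
    using bij[of n] by (auto simp: cob_simps bij_betw_def inj_on_def)
  have Z': "Z_object H (G' n)" for n using gr by (simp add: graded_algebra_def)
  have abG': "abelian_group (G' n)" for n using Z'[of n] by (simp add: Z_object_def)
  have addC: "X \<oplus>\<^bsub>?G n\<^esub> Y \<in> carrier (?G n)" if "X \<in> carrier (?G n)" "Y \<in> carrier (?G n)" for n X Y
    using cob_abelian[of hact n] that by (simp add: abelian_group_def abelian_monoid.a_closed)
  have addT: "\<Theta> n (X \<oplus>\<^bsub>?G n\<^esub> Y) = \<Theta> n X \<oplus>\<^bsub>G' n\<^esub> \<Theta> n Y" if "X \<in> carrier (?G n)" "Y \<in> carrier (?G n)" for n X Y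
    using that by (auto simp: cob_simps cob_add add elim!: cohE)
  have scC: "kscale (?G n) c X \<in> carrier (?G n)" if "X \<in> carrier (?G n)" for n c X
    using that by (auto simp: cob_simps cob_scale class_in_coh cocycles_scale elim!: cohE)
  have scT: "\<Theta> n (kscale (?G n) c X) = kscale (G' n) c (\<Theta> n X)" if "X \<in> carrier (?G n)" for n c X
    using that by (auto simp: cob_simps cob_scale scale elim!: cohE)
  have zC: "\<zero>\<^bsub>?G n\<^esub> \<in> carrier (?G n)" for n
    using cob_abelian[of hact n] by (simp add: abelian_group_def abelian_monoid.zero_closed)
  have zT: "\<Theta> n \<zero>\<^bsub>?G n\<^esub> = \<zero>\<^bsub>G' n\<^esub>" for n
  proof -
    interpret G: abelian_group "?G n" by (rule cob_abelian)
    interpret G': abelian_group "G' n" by (rule abG')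
    have "\<Theta> n \<zero>\<^bsub>?G n\<^esub> \<oplus>\<^bsub>G' n\<^esub> \<Theta> n \<zero>\<^bsub>?G n\<^esub> = \<Theta> n \<zero>\<^bsub>?G n\<^esub>"
      using addT[OF zC[of n] zC[of n]] by simp
    then show ?thesis using G'.add.l_cancel_one'[OF TC[OF zC] TC[OF zC]] by metis
  qed
  have umC: "\<ominus>\<^bsub>?G n\<^esub> X \<in> carrier (?G n)" if "X \<in> carrier (?G n)" for n X
    using cob_abelian[of hact n] that by (simp add: abelian_group.a_inv_closed)
  have umT: "\<Theta> n (\<ominus>\<^bsub>?G n\<^esub> X) = \<ominus>\<^bsub>G' n\<^esub> \<Theta> n X" if X: "X \<in> carrier (?G n)" for n X
  proof -
    interpret G: abelian_group "?G n" by (rule cob_abelian)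
    interpret G': abelian_group "G' n" by (rule abG')
    have "\<Theta> n (\<ominus>\<^bsub>?G n\<^esub> X) \<oplus>\<^bsub>G' n\<^esub> \<Theta> n X = \<zero>\<^bsub>G' n\<^esub>"
      using addT[OF umC[OF X] X] X by (simp add: G.l_neg zT)
    then show ?thesis using G'.minus_equality TC[OF X] TC[OF umC[OF X]] by metis
  qed
  note Z'd = Z'[unfolded Z_object_def]
  have hC': "Y \<in> carrier (G' n) ==> h \<odot>\<^bsub>G' n\<^esub> Y \<in> carrier (G' n)" for n h Y using Z'd[of n] by (elim conjE) blast
  have hC: "h \<odot>\<^bsub>?G n\<^esub> X \<in> carrier (?G n)" if "X \<in> carrier (?G n)" for n h X
    using \<Psi>C[OF hC'[OF TC[OF that]]] by (simp add: cob_simps hact_def)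
  have hT: "\<Theta> n (h \<odot>\<^bsub>?G n\<^esub> X) = h \<odot>\<^bsub>G' n\<^esub> \<Theta> n X" if "X \<in> carrier (?G n)" for n h X
    using T\<Psi>[OF hC'[OF TC[OF that]]] by (simp add: cob_simps hact_def)
  note grd = gr[unfolded graded_algebra_def, THEN conjunct2]
  note gr2 = grd[THEN conjunct1, rule_format]
  note gr3 = grd[THEN conjunct2, THEN conjunct1, rule_format]
  note gr4 = grd[THEN conjunct2, THEN conjunct2, THEN conjunct1, rule_format]
  note gr5 = grd[THEN conjunct2, THEN conjunct2, THEN conjunct2, THEN conjunct1, rule_format]
  note gr6 = grd[THEN conjunct2, THEN conjunct2, THEN conjunct2, THEN conjunct2, THEN conjunct1, rule_format]
  note gr7 = grd[THEN conjunct2, THEN conjunct2, THEN conjunct2, THEN conjunct2, THEN conjunct2, THEN conjunct1, rule_format]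
  note gr8 = grd[THEN conjunct2, THEN conjunct2, THEN conjunct2, THEN conjunct2, THEN conjunct2, THEN conjunct2, THEN conjunct1, rule_format]
  note gr9 = grd[THEN conjunct2, THEN conjunct2, THEN conjunct2, THEN conjunct2, THEN conjunct2, THEN conjunct2, THEN conjunct2, THEN conjunct1, rule_format]
  note gr10 = grd[THEN conjunct2, THEN conjunct2, THEN conjunct2, THEN conjunct2, THEN conjunct2, THEN conjunct2, THEN conjunct2, THEN conjunct2, rule_format]
  have mC': "X \<in> carrier (G' m) ==> Y \<in> carrier (G' n) ==> mul' m n X Y \<in> carrier (G' (m + n))" for m n X Y
    by (rule gr2)
  have mC: "mul m n X Y \<in> carrier (?G (m + n))" if "X \<in> carrier (?G m)" "Y \<in> carrier (?G n)" for m n X Y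
    unfolding mul_def using that by (intro \<Psi>C mC' TC)
  have mT: "\<Theta> (m + n) (mul m n X Y) = mul' m n (\<Theta> m X) (\<Theta> n Y)" if "X \<in> carrier (?G m)" "Y \<in> carrier (?G n)" for m n X Y
    unfolding mul_def using that by (intro T\<Psi> mC' TC)
  have uC': "u' \<in> carrier (G' 0)" by (rule gr7)
  have uC: "u \<in> carrier (?G 0)" and uT: "\<Theta> 0 u = u'" unfolding u_def using uC' by (auto intro: \<Psi>C T\<Psi>)
  have lC: "set xs \<subseteq> carrier (?G n) ==> list_sum (?G n) xs \<in> carrier (?G n)"
    and lT: "set xs \<subseteq> carrier (?G n) ==> \<Theta> n (list_sum (?G n) xs) = list_sum (G' n) (map (\<Theta> n) xs)" for xs n
    by (induction xs) (auto simp: list_sum_def zC zT addC addT)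
  note C = addC scC hC mC uC TC umC zC and T = addT scT hT mT uT umT
  have Z: "Z_object H (?G n)" for n
    unfolding Z_object_def
  proof (intro conjI allI ballI cob_abelian; (rule eqI[of _ n])?)
  qed (simp_all add: C T, insert Z'd[of n], simp_all add: C T)
  have graded: "graded_algebra H ?G mul u"
    unfolding graded_algebra_def
  proof (intro conjI allI ballI Z)
    fix m n p X Y W assume c: "X \<in> carrier (?G m)" "Y \<in> carrier (?G n)" "W \<in> carrier (?G p)"
    have "mul' (m + n) p (mul' m n (\<Theta> m X) (\<Theta> n Y)) (\<Theta> p W) = mul' m (n + p) (\<Theta> m X) (mul' n p (\<Theta> n Y) (\<Theta> p W))"
      using c TC by (auto intro: gr6)
    then have "\<Theta> (m + n + p) (mul (m + n) p (mul m n X Y) W) = \<Theta> (m + (n + p)) (mul m (n + p) X (mul n p Y W))"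
      using c by (simp only: T C)
    moreover have "mul m (n + p) X (mul n p Y W) \<in> carrier (?G (m + n + p))" using mC[OF c(1) mC[OF c(2,3)]] by (simp add: add.assoc)
    ultimately show "mul (m + n) p (mul m n X Y) W = mul m (n + p) X (mul n p Y W)"
      using mC[OF mC[OF c(1,2)] c(3)] by (intro eqI[of _ "m + n + p"]) (simp_all add: add.assoc)
  next
    fix m n h X Y assume c: "X \<in> carrier (?G m)" "Y \<in> carrier (?G n)"
    have s: "set (map (\<lambda>(a, b). mul m n (a \<odot>\<^bsub>?G m\<^esub> X) (b \<odot>\<^bsub>?G n\<^esub> Y)) (comult H h)) \<subseteq> carrier (?G (m + n))"
      using c by (auto intro!: C)
    show "h \<odot>\<^bsub>?G (m + n)\<^esub> mul m n X Y = list_sum (?G (m + n)) (map (\<lambda>(a, b). mul m n (a \<odot>\<^bsub>?G m\<^esub> X) (b \<odot>\<^bsub>?G n\<^esub> Y)) (comult H h))"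
    proof (rule eqI[OF hC[OF mC[OF c]] lC[OF s]])
      have "h \<odot>\<^bsub>G' (m + n)\<^esub> mul' m n (\<Theta> m X) (\<Theta> n Y) = list_sum (G' (m + n)) (map (\<lambda>(a, b). mul' m n (a \<odot>\<^bsub>G' m\<^esub> \<Theta> m X) (b \<odot>\<^bsub>G' n\<^esub> \<Theta> n Y)) (comult H h))"
        using c TC by (auto intro: gr10)
      then show "\<Theta> (m + n) (h \<odot>\<^bsub>?G (m + n)\<^esub> mul m n X Y) = \<Theta> (m + n) (list_sum (?G (m + n)) (map (\<lambda>(a, b). mul m n (a \<odot>\<^bsub>?G m\<^esub> X) (b \<odot>\<^bsub>?G n\<^esub> Y)) (comult H h)))"
        unfolding lT[OF s] using c by (simp add: T C comp_def split_beta')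
    qed
  next
    fix n X assume c: "X \<in> carrier (?G n)"
    have "mul' 0 n u' (\<Theta> n X) = \<Theta> n X" "mul' n 0 (\<Theta> n X) u' = \<Theta> n X" using gr8[OF TC[OF c]] by auto
    then show "mul 0 n u X = X" "mul n 0 X u = X"
      using c mT[OF uC c] mT[OF c uC] mC[OF uC c] mC[OF c uC] by - (rule eqI[of _ n]; simp add: uT)+
  next
    fix h
    have "h \<odot>\<^bsub>G' 0\<^esub> u' = kscale (G' 0) (eps h) u'" by (rule gr9)
    then show "h \<odot>\<^bsub>?G 0\<^esub> u = kscale (?G 0) (eps h) u" by (intro eqI[of _ 0]) (simp_all add: C T)
  next
    fix m n c X Y assume c: "X \<in> carrier (?G m)" "Y \<in> carrier (?G n)"
    have "mul' m n (kscale (G' m) c (\<Theta> m X)) (\<Theta> n Y) = kscale (G' (m + n)) c (mul' m n (\<Theta> m X) (\<Theta> n Y))"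
      "mul' m n (\<Theta> m X) (kscale (G' n) c (\<Theta> n Y)) = kscale (G' (m + n)) c (mul' m n (\<Theta> m X) (\<Theta> n Y))"
      using gr5[OF TC[OF c(1)] TC[OF c(2)]] by auto
    then show "mul m n (kscale (?G m) c X) Y = kscale (?G (m + n)) c (mul m n X Y)"
      "mul m n X (kscale (?G n) c Y) = kscale (?G (m + n)) c (mul m n X Y)"
      using c by - (rule eqI[of _ "m + n"]; simp add: C T)+
  next
    fix m n X X' Y assume c: "X \<in> carrier (?G m)" "X' \<in> carrier (?G m)" "Y \<in> carrier (?G n)"
    have "mul' m n (\<Theta> m X \<oplus>\<^bsub>G' m\<^esub> \<Theta> m X') (\<Theta> n Y) = mul' m n (\<Theta> m X) (\<Theta> n Y) \<oplus>\<^bsub>G' (m + n)\<^esub> mul' m n (\<Theta> m X') (\<Theta> n Y)"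
      using c TC by (auto intro: gr3)
    then show "mul m n (X \<oplus>\<^bsub>?G m\<^esub> X') Y = mul m n X Y \<oplus>\<^bsub>?G (m + n)\<^esub> mul m n X' Y"
      using c by - (rule eqI[of _ "m + n"]; simp add: C T)+
  next
    fix m n X Y Y' assume c: "X \<in> carrier (?G m)" "Y \<in> carrier (?G n)" "Y' \<in> carrier (?G n)"
    have "mul' m n (\<Theta> m X) (\<Theta> n Y \<oplus>\<^bsub>G' n\<^esub> \<Theta> n Y') = mul' m n (\<Theta> m X) (\<Theta> n Y) \<oplus>\<^bsub>G' (m + n)\<^esub> mul' m n (\<Theta> m X) (\<Theta> n Y')"
      using c TC by (auto intro: gr4)
    then show "mul m n X (Y \<oplus>\<^bsub>?G n\<^esub> Y') = mul m n X Y \<oplus>\<^bsub>?G (m + n)\<^esub> mul m n X Y'"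
      using c by - (rule eqI[of _ "m + n"]; simp add: C T)+
  qed (simp_all add: C)
  have comm: "braided_commutative H ?G mul"
    unfolding braided_commutative_def Let_def
  proof (intro allI ballI)
    fix m n X Y assume c: "X \<in> carrier (?G m)" "Y \<in> carrier (?G n)"
    let ?l = "map (\<lambda>(s, t). mul n m (t \<odot>\<^bsub>?G n\<^esub> Y) (s \<odot>\<^bsub>?G m\<^esub> X)) (rmatrix H)"
    have nm: "mul n m Y' X' \<in> carrier (?G (m + n))" "\<Theta> (m + n) (mul n m Y' X') = mul' n m (\<Theta> n Y') (\<Theta> m X')"
      if "Y' \<in> carrier (?G n)" "X' \<in> carrier (?G m)" for X' Y'
      using mC[OF that] mT[OF that] by (simp_all add: add.commute)
    have s: "set ?l \<subseteq> carrier (?G (m + n))" using c by (auto intro!: nm C)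
    have l: "\<Theta> (m + n) (list_sum (?G (m + n)) ?l) =
        list_sum (G' (m + n)) (map (\<lambda>(s, t). mul' n m (t \<odot>\<^bsub>G' n\<^esub> \<Theta> n Y) (s \<odot>\<^bsub>G' m\<^esub> \<Theta> m X)) (rmatrix H))"
      unfolding lT[OF s] using c by (simp add: T C nm comp_def split_beta')
    have "mul' m n (\<Theta> m X) (\<Theta> n Y) = (let z = list_sum (G' (m + n)) (map (\<lambda>(s, t). mul' n m (t \<odot>\<^bsub>G' n\<^esub> \<Theta> n Y) (s \<odot>\<^bsub>G' m\<^esub> \<Theta> m X)) (rmatrix H))
         in if even (m * n) then z else \<ominus>\<^bsub>G' (m + n)\<^esub> z)"
      using bc c TC unfolding braided_commutative_def by blast
    then have "\<Theta> (m + n) (mul m n X Y) = \<Theta> (m + n) (if even (m * n) then list_sum (?G (m + n)) ?l else \<ominus>\<^bsub>?G (m + n)\<^esub> list_sum (?G (m + n)) ?l)"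
      unfolding l[symmetric] Let_def using c lC[OF s] by (simp add: T C)
    then show "mul m n X Y = (if even (m * n) then list_sum (?G (m + n)) ?l else \<ominus>\<^bsub>?G (m + n)\<^esub> list_sum (?G (m + n)) ?l)"
      using c by (intro eqI[of _ "m + n"]) (simp_all add: C lC[OF s])
  qed
  have "graded_iso ?G mul u G' mul' u' \<Theta>"
    unfolding graded_iso_def using bij by (auto simp: cob_simps(1)[of hact, symmetric] T)
  then show ?thesis using Z graded comm by blast
qed

section \<open>Tensor powers\<close>

abbreviation ev :: "('x => 'y::comm_monoid_add) => 'x multiset => 'y" where
  "ev g p \<equiv> (\<Sum>xs\<in>#p. g xs)"

lemma fsums_simps [simp]: "{#} \<in> fsums n" "p + q \<in> fsums n \<longleftrightarrow> p \<in> fsums n \<and> q \<in> fsums n"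
  "{#xs#} \<in> fsums n \<longleftrightarrow> length xs = n" "add_mset xs p \<in> fsums n \<longleftrightarrow> length xs = n \<and> p \<in> fsums n"
  by (auto simp: fsums_def)

lemma mset_pair: "{#x#} + {#y#} = {#x, y#}" by (rule multiset_eqI) simp

lemma fsums_sum_mset: "(\<And>x. x \<in># M ==> f x \<in> fsums n) ==> (\<Sum>x\<in>#M. f x) \<in> fsums n"
  by (induction M) auto
lemma fsums_psum: "(\<And>a b. f a b \<in> fsums n) ==> psum xs f \<in> fsums n"
  by (induction xs) auto
lemma fsums_sum: "(\<And>x. x \<in> I ==> f x \<in> fsums n) ==> sum f I \<in> fsums n"
  by (induction I rule: infinite_finite_induct) auto

lemma tens_rel_fsums: "(p, q) \<in> tens_rel E n ==> p \<in> fsums n \<and> q \<in> fsums n"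
  by (induction rule: tens_rel.induct) auto

lemma equiv_tens_rel: "equiv (fsums n) (tens_rel E n)"
proof (rule equivI)
  show "tens_rel E n \<subseteq> fsums n \<times> fsums n" by (auto dest!: tens_rel_fsums)
  show "refl_on (fsums n) (tens_rel E n)" by (rule refl_onI) (rule tens_rel.refl)
  show "sym (tens_rel E n)" by (rule symI) (rule tens_rel.sym)
  show "trans (tens_rel E n)" by (rule transI) (rule tens_rel.trans)
qed

lemma tclass_mem: "q \<in> tclass E n p \<longleftrightarrow> (p, q) \<in> tens_rel E n" by (simp add: tclass_def)
lemma tclass_eq: "(p, q) \<in> tens_rel E n ==> tclass E n p = tclass E n q"
  unfolding tclass_def by (rule equiv_class_eq[OF equiv_tens_rel])
lemma tclass_eq_iff: "p \<in> fsums n ==> q \<in> fsums n ==> tclass E n p = tclass E n q \<longleftrightarrow> (p, q) \<in> tens_rel E n"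
  unfolding tclass_def by (rule eq_equiv_class_iff[OF equiv_tens_rel])
lemma tens_eq: "tens E n = tclass E n ` fsums n"
  unfolding tens_def quotient_def tclass_def by (rule UNION_singleton_eq_range)
lemma tclass_in_tens: "p \<in> fsums n ==> tclass E n p \<in> tens E n" by (simp add: tens_eq)
lemma tensE: assumes "X \<in> tens E n" obtains p where "p \<in> fsums n" "X = tclass E n p"
  using assms by (auto simp: tens_eq)

lemma UN_tclass:
  assumes "p \<in> fsums n" "\<And>q. (p, q) \<in> tens_rel E n ==> T q = T p"
  shows "(\<Union>q\<in>tclass E n p. T q) = T p"
proof (rule SUP_eq_const)
  have "p \<in> tclass E n p" by (simp add: tclass_mem tens_rel.refl assms(1))
  then show "tclass E n p \<noteq> {}" by blast
qed (simp only: tclass_mem assms(2))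

lemma the_elem_tclass:
  assumes "p \<in> fsums n" "\<And>q. (p, q) \<in> tens_rel E n ==> T q = T p"
  shows "the_elem (T ` tclass E n p) = T p"
proof -
  have "T ` tclass E n p = {T p}"
  proof (intro subset_antisym subsetI)
    fix y assume "y \<in> T ` tclass E n p"
    then obtain q where "y = T q" "(p, q) \<in> tens_rel E n" by (auto simp: tclass_mem)
    then show "y \<in> {T p}" using assms(2) by simp
  next
    fix y assume "y \<in> {T p}"
    moreover have "p \<in> tclass E n p" by (simp add: tclass_mem tens_rel.refl assms(1))
    ultimately show "y \<in> T ` tclass E n p" by simp
  qed
  then show ?thesis by simp
qed

lemma tens_rel_add:
  assumes "(p, q) \<in> tens_rel E n" "(p', q') \<in> tens_rel E n"
  shows "(p + p', q + q') \<in> tens_rel E n"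
proof -
  have "(p + p', q + p') \<in> tens_rel E n"
    by (rule tens_rel.cong[OF assms(1)]) (use tens_rel_fsums[OF assms(2)] in simp)
  moreover have "(p' + q, q' + q) \<in> tens_rel E n"
    by (rule tens_rel.cong[OF assms(2)]) (use tens_rel_fsums[OF assms(1)] in simp)
  ultimately show ?thesis by (simp add: add.commute[of q] tens_rel.trans)
qed

lemma tens_rel_sum:
  assumes "\<And>x. x \<in> I ==> (f x, g x) \<in> tens_rel E n"
  shows "(sum f I, sum g I) \<in> tens_rel E n"
  using assms by (induction I rule: infinite_finite_induct) (simp_all add: tens_rel_add tens_rel.refl)

text \<open>Formal sums have no negatives. Negating the first factor of each tensor provides an
  additive inverse modulo the congruence; it requires at least one factor, hence the lengths
  \<open>Suc n\<close>.\<close>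

definition tneg :: "'a::{ring,monoid_mult} list multiset => 'a list multiset" where
  "tneg p = image_mset (\<lambda>xs. (- hd xs) # tl xs) p"

lemma tneg_fsums: "p \<in> fsums (Suc n) ==> tneg p \<in> fsums (Suc n)"
  by (auto simp: tneg_def fsums_def)

lemma tneg_cancel: "p \<in> fsums (Suc n) ==> (p + tneg p, {#}) \<in> tens_rel E (Suc n)"
proof (induction p)
  case (add xs p)
  then obtain x ys where xs: "xs = x # ys" "length ys = n" by (cases xs) auto
  have "({#[] @ (x + - x) # ys#}, {#[] @ x # ys, [] @ (- x) # ys#}) \<in> tens_rel E (Suc n)"
    by (rule tens_rel.additive) (simp add: xs)
  moreover have "({#[] @ 0 # ys#}, {#}) \<in> tens_rel E (Suc n)"
    by (rule tens_rel.zero) (simp add: xs)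
  ultimately have 1: "({#x # ys, (- x) # ys#}, {#}) \<in> tens_rel E (Suc n)"
    unfolding append_Nil right_minus by (rule tens_rel.trans[OF tens_rel.sym])
  have "p \<in> fsums (Suc n)" using add.prems by simp
  from tens_rel_add[OF 1 add.IH[OF this]] have "({#x # ys, (- x) # ys#} + (p + tneg p), {#}) \<in> tens_rel E (Suc n)" by simp
  moreover have "add_mset xs p + tneg (add_mset xs p) = {#x # ys, (- x) # ys#} + (p + tneg p)"
    by (rule multiset_eqI) (simp add: xs tneg_def)
  ultimately show ?case by (simp only:)
qed (simp add: tneg_def tens_rel.refl)

text \<open>The congruence lives on a monoid, where cancellation is no axiom; it follows by adding
  the inverse of r on both sides.\<close>

lemma tens_rel_cancel:
  assumes "(p + r, q + r) \<in> tens_rel E (Suc n)" shows "(p, q) \<in> tens_rel E (Suc n)"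
proof -
  have f: "p \<in> fsums (Suc n)" "q \<in> fsums (Suc n)" "r \<in> fsums (Suc n)" using tens_rel_fsums[OF assms] by auto
  have *: "(s + (r + tneg r), s) \<in> tens_rel E (Suc n)" if "s \<in> fsums (Suc n)" for s
    using tens_rel_add[OF tens_rel.refl[OF that] tneg_cancel[OF f(3)]] by simp
  have "(p + (r + tneg r), q + (r + tneg r)) \<in> tens_rel E (Suc n)"
    using tens_rel.cong[OF assms tneg_fsums[OF f(3)]] by (simp add: add.assoc)
  then show ?thesis using *[OF f(1)] *[OF f(2)] by (meson tens_rel.sym tens_rel.trans)
qed

section \<open>Coordinates of tensors over the ground field\<close>

context braided_mod_alg begin

definition Bas :: "'b set" where "Bas = VB.extend_basis {}"

lemma Bas: "VB.independent Bas" "x \<in> VB.span Bas"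
  by (simp_all add: Bas_def VB.independent_extend_basis VB.span_extend_basis VB.independent_empty)

abbreviation "rep \<equiv> VB.representation Bas"

lemma rep_sum: assumes "finite F" "{b. rep x b \<noteq> 0} \<subseteq> F" shows "(\<Sum>b\<in>F. bs (rep x b) b) = x"
proof -
  have "(\<Sum>b\<in>F. bs (rep x b) b) = (\<Sum>b | rep x b \<noteq> 0. bs (rep x b) b)"
    using assms by (intro sum.mono_neutral_right) auto
  then show ?thesis using VB.sum_nonzero_representation_eq[OF Bas] by simp
qed

lemma rep_finite: "finite {b. rep x b \<noteq> 0}" by (rule VB.finite_representation)

lemma rep_klin: "klin bs (*) (\<lambda>x. rep x b)"
  by (rule klinI) (simp_all add: VB.representation_add[OF Bas(1) Bas(2) Bas(2)] VB.representation_scale[OF Bas])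

fun coef :: "'b list => 'b list => 'k" where
  "coef [] [] = 1"
| "coef (b # \<beta>) (y # ys) = rep y b * coef \<beta> ys"
| "coef _ _ = 0"

lemma coef_klin: "klin bs (*) (\<lambda>a. coef \<beta> (us @ a # vs))"
proof (induction us arbitrary: \<beta>)
  case Nil
  show ?case by (cases \<beta>) (use rep_klin in \<open>auto simp: klin_def algebra_simps\<close>)
next
  case (Cons u us)
  show ?case by (cases \<beta>) (use Cons in \<open>auto simp: klin_def algebra_simps\<close>)
qed

text \<open>The coordinates of a tensor with respect to a basis of \<open>B\<close> in all factors but the first.\<close>

definition Gb :: "'b list => 'b list => 'b" where
  "Gb \<beta> xs = (if length xs = Suc (length \<beta>) then bs (coef \<beta> (tl xs)) (hd xs) else 0)"

lemma Gb_multilin: "Gb \<beta> \<in> multilin B (Suc (length \<beta>))"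
proof -
  have "(\<lambda>xs. if length xs = Suc (length \<beta>) then bs (coef \<beta> (tl xs)) (hd xs) else 0) \<in> multilin B (Suc (length \<beta>))"
  proof (rule ml_guardI)
    fix us vs :: "'b list"
    show "klin bs bs (\<lambda>a. bs (coef \<beta> (tl (us @ a # vs))) (hd (us @ a # vs)))"
    proof (cases us)
      case Nil then show ?thesis by simp (intro klins)
    next
      case (Cons u us')
      then show ?thesis using coef_klin[of \<beta> us' vs] by (auto simp: klin_def VB.scale_left_distrib)
    qed
  qed
  then show ?thesis by (simp add: Gb_def[abs_def])
qed

lemma ev_add_slot: assumes "ml g" shows "g (xs @ (a + b) # ys) = g (xs @ a # ys) + g (xs @ b # ys)"
  using klin_add[OF ml_slot[OF assms klin_id]] .
text \<open>The congruence balances neighbours only, so a scalar travels to a distant factor one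
  position at a time.\<close>

lemma tens_rel_scale_move:
  assumes "scalars B \<subseteq> E" "length zs + 1 + length pre + 1 + length ys = n"
  shows "({#zs @ u # pre @ bs c b # ys#}, {#zs @ bs c u # pre @ b # ys#}) \<in> tens_rel E n"
  using assms(2)
proof (induction pre arbitrary: zs u)
  have e: "bs c 1 \<in> E" using assms(1) by (auto simp: scalars_def)
  have step: "({#zs @ u # bs c v # ys#}, {#zs @ bs c u # v # ys#}) \<in> tens_rel E n" if "length zs + 2 + length ys = n" for zs u v ys
    using tens_rel.sym[OF tens_rel.balanced[OF e that, of u v]] by (simp add: bs_mult)
  {
    case Nil
    then show ?case using step[of zs ys u b] by simp
  next
    case (Cons v pre)
    have "({#(zs @ [u]) @ v # pre @ bs c b # ys#}, {#(zs @ [u]) @ bs c v # pre @ b # ys#}) \<in> tens_rel E n"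
      by (rule Cons.IH) (use Cons.prems in simp)
    moreover have "({#zs @ u # bs c v # pre @ b # ys#}, {#zs @ bs c u # v # pre @ b # ys#}) \<in> tens_rel E n"
      by (rule step) (use Cons.prems in simp)
    ultimately show ?case by (auto intro: tens_rel.trans)
  }
qed

lemma tens_rel_sum_slot:
  assumes "length xs + 1 + length ys = n" "finite F"
  shows "({#xs @ (\<Sum>b\<in>F. f b) # ys#}, (\<Sum>b\<in>F. {#xs @ f b # ys#})) \<in> tens_rel E n"
  using assms(2)
proof (induction F)
  case empty then show ?case using tens_rel.zero[OF assms(1)] by simp
next
  case (insert b F)
  have "({#xs @ (f b + sum f F) # ys#}, {#xs @ f b # ys#} + {#xs @ sum f F # ys#}) \<in> tens_rel E n"
    using tens_rel.additive[OF assms(1), of "f b" "sum f F" E] by (simp add: add_mset_commute)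
  moreover have "({#xs @ f b # ys#} + {#xs @ sum f F # ys#}, {#xs @ f b # ys#} + (\<Sum>b\<in>F. {#xs @ f b # ys#})) \<in> tens_rel E n"
    by (rule tens_rel_add[OF tens_rel.refl insert.IH]) (use assms in simp)
  ultimately show ?case using insert(1,2) by (auto intro: tens_rel.trans)
qed

abbreviation "Lists F n \<equiv> {\<beta>. set \<beta> \<subseteq> F \<and> length \<beta> = n}"

lemma sum_Lists_Suc: assumes "finite F" shows "(\<Sum>\<beta>\<in>Lists F (Suc n). f \<beta>) = (\<Sum>b\<in>F. \<Sum>\<beta>\<in>Lists F n. f (b # \<beta>) :: 'x::comm_monoid_add)"
proof -
  have "(\<Sum>b\<in>F. \<Sum>\<beta>\<in>Lists F n. f (b # \<beta>)) = (\<Sum>(b, \<beta>)\<in>F \<times> Lists F n. f (b # \<beta>))"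
    by (simp add: sum.cartesian_product)
  also have "\<dots> = (\<Sum>\<beta>\<in>Lists F (Suc n). f \<beta>)"
    by (rule sum.reindex_bij_witness[where i="\<lambda>\<beta>. (hd \<beta>, tl \<beta>)" and j="\<lambda>(b, \<beta>). b # \<beta>"])
       (auto simp: length_Suc_conv)
  finally show ?thesis by simp
qed

text \<open>All factors but the first are expanded in the basis and their coordinates are collected
  in the first factor. That factor remains an arbitrary element of B, which makes the coordinates
  B-valued.\<close>

lemma tens_rel_expand:
  assumes E: "scalars B \<subseteq> E" and F: "finite F" and sup: "\<And>y b. y \<in> set ys ==> rep y b \<noteq> 0 ==> b \<in> F"
    and n: "1 + length pre + length ys = n"
  shows "({#u # pre @ ys#}, (\<Sum>\<beta>\<in>Lists F (length ys). {#bs (coef \<beta> ys) u # pre @ \<beta>#})) \<in> tens_rel E n"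
  using sup n
proof (induction ys arbitrary: u pre)
  case Nil
  have "Lists F 0 = {[]}" by auto
  then show ?case using Nil by (simp add: tens_rel.refl)
next
  case (Cons y ys)
  have y: "(\<Sum>b\<in>F. bs (rep y b) b) = y" using Cons.prems(1)[of y] by (intro rep_sum F) auto
  have "({#(u # pre) @ (\<Sum>b\<in>F. bs (rep y b) b) # ys#}, (\<Sum>b\<in>F. {#(u # pre) @ bs (rep y b) b # ys#})) \<in> tens_rel E n"
    by (rule tens_rel_sum_slot[OF _ F]) (use Cons.prems in simp)
  then have 1: "({#u # pre @ y # ys#}, (\<Sum>b\<in>F. {#u # pre @ bs (rep y b) b # ys#})) \<in> tens_rel E n"
    by (simp add: y)
  have 2: "((\<Sum>b\<in>F. {#u # pre @ bs (rep y b) b # ys#}), (\<Sum>b\<in>F. {#bs (rep y b) u # pre @ b # ys#})) \<in> tens_rel E n"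
    by (rule tens_rel_sum) (use tens_rel_scale_move[OF E, of "[]" pre ys n] Cons.prems(2) in simp)
  have 3: "((\<Sum>b\<in>F. {#bs (rep y b) u # pre @ b # ys#}), (\<Sum>b\<in>F. \<Sum>\<beta>\<in>Lists F (length ys). {#bs (coef \<beta> ys) (bs (rep y b) u) # (pre @ [b]) @ \<beta>#})) \<in> tens_rel E n"
  proof (rule tens_rel_sum)
    fix b
    have "({#bs (rep y b) u # (pre @ [b]) @ ys#}, (\<Sum>\<beta>\<in>Lists F (length ys). {#bs (coef \<beta> ys) (bs (rep y b) u) # (pre @ [b]) @ \<beta>#})) \<in> tens_rel E n"
      by (rule Cons.IH) (use Cons.prems in auto)
    then show "({#bs (rep y b) u # pre @ b # ys#}, (\<Sum>\<beta>\<in>Lists F (length ys). {#bs (coef \<beta> ys) (bs (rep y b) u) # (pre @ [b]) @ \<beta>#})) \<in> tens_rel E n"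
      by simp
  qed
  have 4: "(\<Sum>b\<in>F. \<Sum>\<beta>\<in>Lists F (length ys). {#bs (coef \<beta> ys) (bs (rep y b) u) # (pre @ [b]) @ \<beta>#}) =
     (\<Sum>\<beta>\<in>Lists F (length (y # ys)). {#bs (coef \<beta> (y # ys)) u # pre @ \<beta>#})"
    unfolding list.size add_Suc_right add_0_right sum_Lists_Suc[OF F] by (simp add: mult.commute)
  show ?case using tens_rel.trans[OF 1 tens_rel.trans[OF 2 3]] unfolding 4 .
qed

text \<open>Summing the expansions and adding first factors over the same index list gives a normal
  form depending on the coordinates alone. F may be any finite set containing the support, so that
  two formal sums can share it.\<close>

lemma tens_rel_normal:
  assumes E: "scalars B \<subseteq> E" and F: "finite F" and p: "p \<in> fsums (Suc n)"
    and sup: "\<And>xs y b. xs \<in># p ==> y \<in> set xs ==> rep y b \<noteq> 0 ==> b \<in> F"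
  shows "(p, (\<Sum>\<beta>\<in>Lists F n. {#ev (Gb \<beta>) p # \<beta>#})) \<in> tens_rel E (Suc n)"
  using p sup
proof (induction p)
  case empty
  have "((\<Sum>\<beta>\<in>Lists F n. {#0 # \<beta>#}), (\<Sum>\<beta>\<in>Lists F n. {#})) \<in> tens_rel E (Suc n)"
    by (rule tens_rel_sum) (use tens_rel.zero[of "[]"] in auto)
  then show ?case by (auto intro: tens_rel.sym)
next
  case (add xs p)
  then obtain x ys where xs: "xs = x # ys" "length ys = n" by (cases xs) auto
  have "({#x # [] @ ys#}, (\<Sum>\<beta>\<in>Lists F (length ys). {#bs (coef \<beta> ys) x # [] @ \<beta>#})) \<in> tens_rel E (Suc n)"
    by (rule tens_rel_expand[OF E F]) (use add.prems(2)[of xs] xs in auto)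
  then have 1: "({#xs#}, (\<Sum>\<beta>\<in>Lists F n. {#bs (coef \<beta> ys) x # \<beta>#})) \<in> tens_rel E (Suc n)" by (simp add: xs)
  have 2: "(\<Sum>\<beta>\<in>Lists F n. {#bs (coef \<beta> ys) x # \<beta>#}) = (\<Sum>\<beta>\<in>Lists F n. {#Gb \<beta> xs # \<beta>#})"
    by (intro sum.cong) (auto simp: Gb_def xs)
  have 3: "(p, (\<Sum>\<beta>\<in>Lists F n. {#ev (Gb \<beta>) p # \<beta>#})) \<in> tens_rel E (Suc n)"
    by (rule add.IH) (use add.prems in auto)
  have A: "({#xs#} + p, (\<Sum>\<beta>\<in>Lists F n. {#Gb \<beta> xs # \<beta>#} + {#ev (Gb \<beta>) p # \<beta>#})) \<in> tens_rel E (Suc n)"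
    using tens_rel_add[OF 1[unfolded 2] 3] by (simp only: sum.distrib)
  have B: "((\<Sum>\<beta>\<in>Lists F n. {#Gb \<beta> xs # \<beta>#} + {#ev (Gb \<beta>) p # \<beta>#}), (\<Sum>\<beta>\<in>Lists F n. {#(Gb \<beta> xs + ev (Gb \<beta>) p) # \<beta>#})) \<in> tens_rel E (Suc n)"
  proof (rule tens_rel_sum)
    fix \<beta> assume "\<beta> \<in> Lists F n"
    then have "({#[] @ (Gb \<beta> xs + ev (Gb \<beta>) p) # \<beta>#}, {#[] @ Gb \<beta> xs # \<beta>, [] @ ev (Gb \<beta>) p # \<beta>#}) \<in> tens_rel E (Suc n)"
      by (intro tens_rel.additive) simp
    then show "({#Gb \<beta> xs # \<beta>#} + {#ev (Gb \<beta>) p # \<beta>#}, {#(Gb \<beta> xs + ev (Gb \<beta>) p) # \<beta>#}) \<in> tens_rel E (Suc n)"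
      unfolding mset_pair append_Nil by (rule tens_rel.sym)
  qed
  have e: "add_mset xs p = {#xs#} + p" by simp
  show ?case
    unfolding e image_mset_union sum_mset.union image_mset_single sum_mset.singleton by (rule tens_rel.trans[OF A B])
qed

definition supp :: "'b list multiset => 'b set" where
  "supp p = (\<Union>xs\<in>set_mset p. \<Union>y\<in>set xs. {b. rep y b \<noteq> 0})"
lemma supp_finite: "finite (supp p)" unfolding supp_def by (intro finite_UN_I finite_set_mset finite_set rep_finite)

text \<open>With the joint support as index set both sides have the same normal form. Moving scalars
  is allowed over any E that contains them, so the conclusion holds over E.\<close>

lemma tens_rel_coords:
  assumes E: "scalars B \<subseteq> E" and p: "p \<in> fsums (Suc n)" and q: "q \<in> fsums (Suc n)"
    and eq: "\<And>\<beta>. ev (Gb \<beta>) p = ev (Gb \<beta>) q"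
  shows "(p, q) \<in> tens_rel E (Suc n)"
proof -
  let ?F = "supp p \<union> supp q"
  have F: "finite ?F" by (simp add: supp_finite)
  have "(p, (\<Sum>\<beta>\<in>Lists ?F n. {#ev (Gb \<beta>) p # \<beta>#})) \<in> tens_rel E (Suc n)"
    by (rule tens_rel_normal[OF E F p]) (auto simp: supp_def)
  moreover have "(q, (\<Sum>\<beta>\<in>Lists ?F n. {#ev (Gb \<beta>) q # \<beta>#})) \<in> tens_rel E (Suc n)"
    by (rule tens_rel_normal[OF E F q]) (auto simp: supp_def)
  ultimately show ?thesis unfolding eq by (meson tens_rel.sym tens_rel.trans)
qed

end

section \<open>Separating tensors over E by balanced maps\<close>

context rel_alg begin

lemma scalars_E: "scalars B \<subseteq> E" using E_bs[OF E_one] by (auto simp: scalars_def)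

definition BE :: "nat => ('b list => 'b) set" where
  "BE n = {G \<in> multilin B n. \<forall>xs a e b ys. e \<in> E \<longrightarrow> length xs + 2 + length ys = n \<longrightarrow>
     G (xs @ (a * e) # b # ys) = G (xs @ a # (e * b) # ys)}"

lemma BE_multilin: "G \<in> BE n ==> G \<in> multilin B n" by (simp add: BE_def)
lemma BE_bal: "G \<in> BE n ==> e \<in> E ==> G (xs @ (a * e) # b # ys) = G (xs @ a # (e * b) # ys)"
  by (cases "length xs + 2 + length ys = n") (auto simp: BE_def multilin_len)
lemma ev_BE: assumes "G \<in> BE n" "(p, q) \<in> tens_rel E n" shows "ev G p = ev G q"
  by (rule tens_rel_sum_eq[OF assms(2)]) (simp_all add: ev_add_slot[OF multilin_ml[OF BE_multilin[OF assms(1)]]] BE_bal[OF assms(1)])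

text \<open>A model of the tensor power over the ground field inside the functions from index lists
  to B. Unlike formal sums, these functions form a vector space, on which linear maps can be
  extended from independent sets.\<close>

definition iota :: "'b list multiset => 'b list => 'b" where "iota p = (\<lambda>\<beta>. ev (Gb \<beta>) p)"

lemma iota_add: "iota (p + q) = iota p + iota q" by (auto simp: iota_def)
definition tscale :: "'k => 'b list multiset => 'b list multiset" where
  "tscale c p = image_mset (\<lambda>xs. bs c (hd xs) # tl xs) p"

lemma tscale_rel: "(p, q) \<in> tens_rel E (Suc n) ==> (tscale c p, tscale c q) \<in> tens_rel E (Suc n)"
proof (induction rule: tens_rel.induct)
  case (refl p)
  then show ?case by (intro tens_rel.refl) (auto simp: tscale_def fsums_def)
next
  case (cong p q r)
  then have "tscale c r \<in> fsums (Suc n)" by (auto simp: tscale_def fsums_def)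
  then show ?case using tens_rel.cong[OF cong.IH] by (simp add: tscale_def)
next
  case (additive xs ys a b)
  then show ?case using tens_rel.additive[of "[]" ys "Suc n" "bs c a" "bs c b" E]
      tens_rel.additive[of "bs c (hd xs) # tl xs" ys "Suc n" a b E]
    by (cases xs) (auto simp: tscale_def VB.scale_right_distrib)
next
  case (zero xs ys)
  then show ?case using tens_rel.zero[of "[]" ys "Suc n" E] tens_rel.zero[of "bs c (hd xs) # tl xs" ys "Suc n" E]
    by (cases xs) (auto simp: tscale_def)
next
  case (balanced e xs ys a b)
  then show ?case using tens_rel.balanced[of e E "[]" ys "Suc n" "bs c a" b]
      tens_rel.balanced[of e E "bs c (hd xs) # tl xs" ys "Suc n" a b]
    by (cases xs) (auto simp: tscale_def bs_mult)
qed (auto intro: tens_rel.sym tens_rel.trans)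

lemma iota_tscale: "p \<in> fsums (Suc n) ==> iota (tscale c p) = (\<lambda>\<beta>. bs c (iota p \<beta>))"
proof (induction p)
  case empty then show ?case by (simp add: iota_def tscale_def)
next
  case (add xs p)
  then obtain x ys where "xs = x # ys" by (cases xs) auto
  then have "Gb \<beta> (bs c (hd xs) # tl xs) = bs c (Gb \<beta> xs)" for \<beta>
    by (simp add: Gb_def mult.commute)
  with add show ?case by (simp add: iota_def tscale_def fun_eq_iff VB.scale_right_distrib)
qed

text \<open>Balanced multilinear maps to \<open>B\<close> separate the elements of a tensor power over \<open>E\<close>, since they
  include all linear maps to \<open>B\<close> on it.\<close>

lemma tens_rel_separate:
  assumes p: "p \<in> fsums (Suc n)" and q: "q \<in> fsums (Suc n)"
    and eq: "\<And>G. G \<in> BE (Suc n) ==> ev G p = ev G q"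
  shows "(p, q) \<in> tens_rel E (Suc n)"
proof (rule ccontr)
  assume neg: "(p, q) \<notin> tens_rel E (Suc n)"
  define fs where "fs = (\<lambda>(c::'k) (f::'b list => 'b) x. bs c (f x))"
  interpret VF: vector_space fs
    by unfold_locales (auto simp: fs_def VB.scale_right_distrib VB.scale_left_distrib)
  interpret VP: vector_space_pair fs bs ..
  \<comment> \<open>In the model, passing from the ground field to E is passing to the quotient by
    W.\<close>
  define W where "W = {iota r - iota r' | r r'. (r, r') \<in> tens_rel E (Suc n)}"
  define v where "v = iota p - iota q"
  have sW: "VF.subspace W"
  proof (rule VF.subspaceI)
    show "0 \<in> W" unfolding W_def
      by (rule CollectI, rule exI[of _ "{#}"], rule exI[of _ "{#}"]) (simp add: tens_rel.refl)
    fix x y assume "x \<in> W" "y \<in> W"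
    then obtain r r' s s' where "x = iota r - iota r'" "y = iota s - iota s'" "(r, r') \<in> tens_rel E (Suc n)" "(s, s') \<in> tens_rel E (Suc n)"
      by (auto simp: W_def)
    moreover have "iota r - iota r' + (iota s - iota s') = iota (r + s) - iota (r' + s')" by (simp add: iota_add fun_eq_iff)
    ultimately show "x + y \<in> W" unfolding W_def using tens_rel_add by blast
  next
    fix c x assume "x \<in> W"
    then obtain r r' where x: "x = iota r - iota r'" and r: "(r, r') \<in> tens_rel E (Suc n)" by (auto simp: W_def)
    have "fs c x = iota (tscale c r) - iota (tscale c r')"
      unfolding x iota_tscale[OF conjunct1[OF tens_rel_fsums[OF r]]] iota_tscale[OF conjunct2[OF tens_rel_fsums[OF r]]]
      by (simp add: fs_def fun_eq_iff VB.scale_right_diff_distrib)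
    then show "fs c x \<in> W" unfolding W_def using tscale_rel[OF r] by blast
  qed
  \<comment> \<open>Membership in W makes the coordinates of \<open>p + r'\<close> and
    \<open>q + r\<close> equal. Replacing r by the related \<open>r'\<close> and cancelling then
    relates p to q.\<close>
  have vW: "v \<notin> W"
  proof
    assume "v \<in> W"
    then obtain r r' where e: "iota p - iota q = iota r - iota r'" and r: "(r, r') \<in> tens_rel E (Suc n)" by (auto simp: W_def v_def)
    have ev: "ev (Gb \<beta>) (p + r') = ev (Gb \<beta>) (q + r)" for \<beta>
      using fun_cong[OF e, of \<beta>] by (simp add: iota_def algebra_simps)
    have 1: "(p + r', q + r) \<in> tens_rel E (Suc n)"
      using p q tens_rel_fsums[OF r] by (intro tens_rel_coords[OF scalars_E _ _ ev]) simp_all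
    have 2: "(q + r, q + r') \<in> tens_rel E (Suc n)" by (intro tens_rel_add tens_rel.refl q r)
    show False using tens_rel_cancel[OF tens_rel.trans[OF 1 2]] neg by simp
  qed
  \<comment> \<open>A linear map to B that is 1 at v separates only if 1 differs from 0. In the zero
    ring, v would be 0 and lie in W.\<close>
  have ne: "(1::'b) \<noteq> 0"
  proof
    assume "(1::'b) = 0"
    then have z: "x = 0" for x :: 'b by (metis mult_1 mult_zero_left)
    have "v = 0"
    proof
      fix x show "v x = 0 x" using z[of "v x"] by simp
    qed
    then show False using vW VF.subspace_0[OF sW] by simp
  qed
  \<comment> \<open>A basis of W together with v is independent, so some linear L vanishes on W and
    sends v to 1. Composed with \<open>iota\<close> it becomes the balanced map that contradicts
    \<open>eq\<close>.\<close>
  obtain K where K: "K \<subseteq> W" "VF.independent K" "W \<subseteq> VF.span K" by (rule VF.maximal_independent_subset)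
  have "VF.span K = W" using K sW by (meson VF.span_minimal subset_antisym)
  then have "VF.independent (insert v K)" using K vW by (simp add: VF.independent_insert)
  then obtain L where L: "Vector_Spaces.linear fs bs L" and Lv: "\<forall>x\<in>insert v K. L x = (if x = v then 1 else 0)"
    using VP.linear_independent_extend[of "insert v K" "\<lambda>x. if x = v then 1 else 0"] by blast
  interpret L: Vector_Spaces.linear fs bs L by (rule L)
  have LK: "L x = 0" if "x \<in> W" for x
  proof (rule VP.linear_eq_0_on_span[OF L, of K x])
    show "L b = 0" if "b \<in> K" for b
    proof -
      have "b \<noteq> v" using that vW K(1) by auto
      then show ?thesis using Lv that by simp
    qed
  qed (use that \<open>VF.span K = W\<close> in simp)
  define G where "G xs = (if length xs = Suc n then L (iota {#xs#}) else 0)" for xs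
  have ml1: "iota {#us @ (a + b) # vs#} = iota {#us @ a # vs#} + iota {#us @ b # vs#}"
    "iota {#us @ bs c a # vs#} = fs c (iota {#us @ a # vs#})" for us vs a b c
    by (auto simp: iota_def fs_def klin_add[OF ml_slot[OF multilin_ml[OF Gb_multilin] klin_id]]
        klin_scale[OF ml_slot[OF multilin_ml[OF Gb_multilin] klin_id]])
  have "G \<in> multilin B (Suc n)"
    unfolding multilin_def G_def by (auto simp: ml1 L.add L.scale)
  moreover have "G (xs @ (a * e) # b # ys) = G (xs @ a # (e * b) # ys)" if e: "e \<in> E" and l: "length xs + 2 + length ys = Suc n" for xs a e b ys
  proof -
    have "iota {#xs @ (a * e) # b # ys#} - iota {#xs @ a # (e * b) # ys#} \<in> W"
      unfolding W_def by (rule CollectI, rule exI, rule exI, rule conjI[OF HOL.refl tens_rel.balanced[OF e l]])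
    from LK[OF this] have "L (iota {#xs @ (a * e) # b # ys#}) = L (iota {#xs @ a # (e * b) # ys#})"
      by (simp only: L.diff right_minus_eq)
    then show ?thesis by (simp add: G_def)
  qed
  ultimately have "G \<in> BE (Suc n)" by (simp add: BE_def)
  from eq[OF this] have "ev G p = ev G q" .
  moreover have "ev G r = L (iota r)" if "r \<in> fsums (Suc n)" for r
    using that
  proof (induction r)
    case (add xs r)
    have "iota (add_mset xs r) = iota {#xs#} + iota r" using iota_add[of "{#xs#}" r] by simp
    then have "L (iota (add_mset xs r)) = L (iota {#xs#}) + L (iota r)" by (simp only: L.add)
    moreover have "G xs = L (iota {#xs#})" using add.prems by (simp add: G_def)
    ultimately show ?case using add by simp
  next
    case empty
    have "iota {#} = 0" by (auto simp: iota_def)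
    then show ?case by (simp only: L.zero) simp
  qed
  ultimately have "L v = 0" using p q by (simp add: v_def L.diff)
  then show False using Lv ne by simp
qed

end

section \<open>The relative bar resolution\<close>

lemma contract_contract: "i \<le> j ==> j + 2 < length Z ==> contract j (contract i Z) = contract i (contract (Suc j) Z)"
proof (induction i arbitrary: j Z)
  case 0
  then obtain x y zs where Z: "Z = x # y # zs" by (cases Z; cases "tl Z") auto
  show ?case
  proof (cases j)
    case 0
    then obtain z zs' where "zs = z # zs'" using "0.prems" Z by (cases zs) auto
    then show ?thesis by (simp add: Z 0 contract_0 contract_Suc mult.assoc)
  next
    case (Suc k)
    then show ?thesis by (simp add: Z contract_0 contract_Suc)
  qed
next
  case (Suc i)
  then obtain x zs where Z: "Z = x # zs" by (cases Z) auto
  obtain k where j: "j = Suc k" using Suc.prems by (cases j) auto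
  show ?case using Suc by (simp add: Z j contract_Suc)
qed

lemma lmult_contract: "Suc i < length ys ==> lmult c (contract i ys) = contract i (lmult c ys)"
proof -
  assume l: "Suc i < length ys"
  then obtain x y zs where "ys = x # y # zs" by (cases ys; cases "tl ys") auto
  then show ?thesis by (cases i) (simp_all add: contract_0 contract_Suc lmult_def mult.assoc)
qed

lemma rmult_contract: assumes l: "Suc i < length ys" shows "rmult (contract i ys) c = contract i (rmult ys c)"
proof -
  obtain zs w where ys: "ys = zs @ [w]" using l by (cases ys rule: rev_cases) auto
  show ?thesis
  proof (cases "Suc i < length zs")
    case True
    then show ?thesis by (simp add: ys contract_append1 rmult_def)
  next
    case False
    then obtain zs' v where zs: "zs = zs' @ [v]" and i: "i = length zs'" using l ys by (cases zs rule: rev_cases) auto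
    show ?thesis using contract_mid[of zs' v w "[]"] contract_mid[of zs' v "w * c" "[]"]
      by (simp add: ys zs i rmult_def butlast_append mult.assoc)
  qed
qed

lemma length_lmult: "ys \<noteq> [] ==> length (lmult c ys) = length ys" by (cases ys) (auto simp: lmult_def)
lemma length_rmult: "ys \<noteq> [] ==> length (rmult ys c) = length ys" by (cases ys rule: rev_cases) (auto simp: rmult_def)

abbreviation (input) lr :: "'b::{ring,monoid_mult} => 'b => 'b list => 'b list" where
  "lr c c' ys \<equiv> rmult (lmult c ys) c'"

lemma lr_eq: "lr c c' (b # z @ [b']) = (c * b) # z @ [b' * c']"
  by (simp add: lmult_def rmult_def butlast_append)

lemma lr_contract: "Suc i < length ys ==> lr c c' (contract i ys) = contract i (lr c c' ys)"
proof -
  assume l: "Suc i < length ys"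
  then have "length (lmult c ys) = length ys" by (intro length_lmult) auto
  with l show ?thesis by (simp add: lmult_contract rmult_contract)
qed

lemma length_lr: "ys \<noteq> [] ==> length (lr c c' ys) = length ys"
  by (subst length_rmult) (auto simp: length_lmult lmult_def)

lemma list2E: assumes "length xs = Suc (Suc n)" obtains b z b' where "xs = b # z @ [b']" "length z = n"
proof -
  obtain b ys where "xs = b # ys" "length ys = Suc n" using assms by (cases xs) auto
  then show ?thesis using that by (cases ys rule: rev_cases) auto
qed

lemma ev_sum_mset: "ev G (\<Sum>x\<in>#M. f x) = (\<Sum>x\<in>#M. ev G (f x))" by (induction M) auto
lemma ev_sum: "ev G (\<Sum>x\<in>I. f x) = (\<Sum>x\<in>I. ev G (f x))" by (induction I rule: infinite_finite_induct) auto

lemma ev_cong: "p \<in> fsums n ==> (\<And>xs. length xs = n ==> F xs = G xs) ==> ev F p = ev G p"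
  by (intro arg_cong[where f=sum_mset] image_mset_cong) (auto simp: fsums_def)

context braided_mod_alg begin

text \<open>H acts on 1 by the counit, so on a tensor with outer factors 1 only the inner factors
  move.\<close>

lemma TA_units: assumes g: "ml g" shows "TA g h (1 # z @ [1]) = TA (\<lambda>z. g (1 # z @ [1])) h z"
proof -
  have "TA g h (1 # z @ [1]) = dsum h (\<lambda>a b. TA (\<lambda>us. bs (eps a) (g (1 # us))) b (z @ [1]))"
    by (simp add: act_unit klin_scale[OF ml_slot0[OF g klin_id]])
  also have "\<dots> = dsum h (\<lambda>a b. bs (eps a) (TA (\<lambda>us. g (1 # us)) b (z @ [1])))"
    by (simp add: TA_klin[symmetric, where L="bs c" for c, OF klin_bs[OF klin_id]])
  also have "\<dots> = TA (\<lambda>us. g (1 # us)) h (z @ [1])" by (rule dsum_counit1) (intro klins g)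
  also have "\<dots> = dsum h (\<lambda>a b. TA (\<lambda>us. TA (\<lambda>vs. g (1 # us @ vs)) b [1]) a z)"
    by (rule TA_append) (intro ml_Cons g)
  also have "\<dots> = dsum h (\<lambda>a b. TA (\<lambda>us. bs (eps b) (g (1 # us @ [1]))) a z)"
    by (simp add: TA_single ml_mid6 g act_unit klin_scale[OF ml_slot2[OF g klin_id]] del: TA.simps)
  also have "\<dots> = dsum h (\<lambda>a b. bs (eps b) (TA (\<lambda>us. g (1 # us @ [1])) a z))"
    by (simp add: TA_klin[symmetric, where L="bs c" for c, OF klin_bs[OF klin_id]])
  also have "\<dots> = TA (\<lambda>us. g (1 # us @ [1])) h z" by (rule dsum_counit2) (intro klins g)
  finally show ?thesis .
qed

lemma tact_length: "ys \<in># tact H B h xs ==> length ys = length xs"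
proof (induction xs arbitrary: h ys)
  case (Cons x xs)
  show ?case
  proof (cases xs)
    case Nil then show ?thesis using Cons.prems by auto
  next
    case (Cons y zs)
    have "tact H B h (x # xs) = dsum h (\<lambda>a b. image_mset ((#) (ac a x)) (tact H B b xs))"
      by (simp add: Cons psum_def)
    moreover have "dsum h (\<lambda>a b. image_mset ((#) (ac a x)) (tact H B b xs)) \<in> fsums (Suc (length xs))"
      by (rule fsums_psum) (use Cons.IH in \<open>auto simp: fsums_def\<close>)
    ultimately show ?thesis using Cons.prems by (simp add: fsums_def)
  qed
qed auto

text \<open>The counterpart of \<open>face_face_last\<close> for left multiplication. For j = 0 it
  is associativity of the braided left multiplication, which is the second hexagon.\<close>

lemma face_face_0: assumes f: "f \<in> multilin B n" and j: "j \<le> Suc n"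
  shows "face (Suc n) (Suc j) (face n 0 f) = face (Suc n) 0 (face n j f)"
proof
  note m = multilin_ml[OF f]
  fix xs
  show "face (Suc n) (Suc j) (face n 0 f) xs = face (Suc n) 0 (face n j f) xs"
  proof (cases "length xs = Suc (Suc n)")
    case True
    then obtain a ys where xs: "xs = a # ys" and l: "length ys = Suc n" by (cases xs) auto
    have R: "face (Suc n) 0 (face n j f) xs = rsum (\<lambda>s t. ac t a * face n j (A s f) ys)"
      by (simp add: xs face_0 l A_face[OF f])
    consider "j = 0" | "0 < j" "j \<le> n" | "j = Suc n" using j by linarith
    then show ?thesis
    proof cases
      case 1
      obtain e zs where ys: "ys = e # zs" and lz: "length zs = n" using l by (cases ys) auto
      have "face (Suc n) (Suc j) (face n 0 f) xs = rsum (\<lambda>s t. ac t (a * e) * A s f zs)"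
        by (simp add: xs ys 1 face_contract contract_0 lz face_0)
      also have "\<dots> = rsum (\<lambda>s t. dsum t (\<lambda>c d. ac c a * ac d e * A s f zs))"
        by (simp add: act_prod psum_mult_right)
      also have "\<dots> = rsum (\<lambda>s t. rsum (\<lambda>s' t'. ac t' a * ac t e * A (s * s') f zs))"
        by (rule rsum_hex2[of bs]) (intro klins klin_A m)+
      also have "\<dots> = rsum (\<lambda>s' t'. rsum (\<lambda>s t. ac t' a * ac t e * A (s * s') f zs))" by (rule psum_swap)
      also have "\<dots> = rsum (\<lambda>s t. ac t a * face n j (A s f) ys)"
        by (simp add: 1 ys face_0 lz A_mult[OF m] psum_mult_left mult.assoc)
      finally show ?thesis using R by simp
    next
      case 2
      then obtain k where j: "j = Suc k" by (cases j) auto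
      have "face (Suc n) (Suc j) (face n 0 f) xs = face n 0 f (a # contract k ys)"
        using 2 l by (simp add: xs face_contract contract_Suc j)
      also have "\<dots> = rsum (\<lambda>s t. ac t a * A s f (contract k ys))"
        by (rule face_0) (use 2 l in \<open>simp add: length_contract j\<close>)
      finally show ?thesis using R 2 l by (simp add: j face_contract)
    next
      case 3
      then show ?thesis using face_face_last[OF f, of 0] by simp
    qed
  qed (simp add: face_len)
qed

lemma reg_smult: assumes u: "u \<in> fsums 2"
  shows "tclass (scalars B) 2 u \<odot>\<^bsub>reg_mod H B\<^esub> a = ev (\<lambda>us. rsum (\<lambda>s t. ac t (us ! 0) * ac s a * us ! 1)) u"
proof -
  let ?T = "ev (\<lambda>us. rsum (\<lambda>s t. ac t (us ! 0) * ac s a * us ! 1))"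
  have "tclass (scalars B) 2 u \<odot>\<^bsub>reg_mod H B\<^esub> a = the_elem (?T ` tclass (scalars B) 2 u)"
    by (simp add: reg_mod_def psum_def)
  also have "\<dots> = ?T u"
  proof (rule the_elem_tclass[OF u])
    fix q assume "(u, q) \<in> tens_rel (scalars B) 2"
    then have "?T u = ?T q"
    proof (rule tens_rel_sum_eq)
      fix xs ys :: "'b list" and c d assume "length xs + 1 + length ys = 2"
      then consider y where "xs = []" "ys = [y]" | x where "xs = [x]" "ys = []" by (cases xs; cases ys) auto
      then show "rsum (\<lambda>s t. ac t ((xs @ (c + d) # ys) ! 0) * ac s a * (xs @ (c + d) # ys) ! 1) =
        rsum (\<lambda>s t. ac t ((xs @ c # ys) ! 0) * ac s a * (xs @ c # ys) ! 1) + rsum (\<lambda>s t. ac t ((xs @ d # ys) ! 0) * ac s a * (xs @ d # ys) ! 1)"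
        by cases (simp_all add: klin_add[OF klin_act[OF klin_id]] distrib_left distrib_right psum_add)
    next
      fix xs ys :: "'b list" and c d e assume "e \<in> scalars B" "length xs + 2 + length ys = 2"
      then show "rsum (\<lambda>s t. ac t ((xs @ (c * e) # d # ys) ! 0) * ac s a * (xs @ (c * e) # d # ys) ! 1) =
        rsum (\<lambda>s t. ac t ((xs @ c # (e * d) # ys) ! 0) * ac s a * (xs @ c # (e * d) # ys) ! 1)"
        by (auto simp: scalars_def bs_mult klin_scale[OF klin_act[OF klin_id]])
    qed
    then show "?T q = ?T u" by simp
  qed
  finally show ?thesis .
qed

lemma reg_simps: "carrier (reg_mod H B) = UNIV" "\<zero>\<^bsub>reg_mod H B\<^esub> = 0" "x \<oplus>\<^bsub>reg_mod H B\<^esub> y = x + y"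
  by (simp_all add: reg_mod_def)

end

section \<open>Balanced maps; action and differential of the bar resolution\<close>

context rel_alg begin

text \<open>Balancing as equality of two neighbouring contractions, the form that is compatible with
  \<open>TA_contract\<close> and with the faces.\<close>

lemma BE_contract: assumes G: "G \<in> BE n" and l: "i + 2 < length Z" "Z ! Suc i \<in> E"
  shows "G (contract i Z) = G (contract (Suc i) Z)"
proof -
  define us where "us = take i Z" define vs where "vs = drop (i + 3) Z"
  have Z: "Z = us @ Z ! i # Z ! Suc i # Z ! Suc (Suc i) # vs"
    using l by (simp add: us_def vs_def Cons_nth_drop_Suc numeral_3_eq_3)
  have i: "length us = i" using l by (simp add: us_def)
  have "contract i Z = us @ (Z ! i * Z ! Suc i) # Z ! Suc (Suc i) # vs"
    by (subst Z, simp only: i[symmetric], rule contract_mid)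
  moreover have "contract (Suc i) Z = us @ Z ! i # (Z ! Suc i * Z ! Suc (Suc i)) # vs"
    by (subst Z) (use contract_mid[of "us @ [Z ! i]" "Z ! Suc i" "Z ! Suc (Suc i)" vs] i in simp)
  ultimately show ?thesis using BE_bal[OF G l(2)] by simp
qed

lemma BE_I: assumes "G \<in> multilin B n"
  and "\<And>i Z. length Z = Suc n ==> i + 2 < length Z ==> Z ! Suc i \<in> E ==> G (contract i Z) = G (contract (Suc i) Z)"
  shows "G \<in> BE n"
  unfolding BE_def
proof (intro CollectI conjI allI impI assms(1))
  fix xs ys :: "'b list" and a b e assume e: "e \<in> E" and l: "length xs + 2 + length ys = n"
  let ?Z = "xs @ a # e # b # ys"
  have "contract (length xs) ?Z = xs @ (a * e) # b # ys" by (rule contract_mid)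
  moreover have "contract (Suc (length xs)) ?Z = xs @ a # (e * b) # ys"
    using contract_mid[of "xs @ [a]" e b ys] by simp
  moreover have "G (contract (length xs) ?Z) = G (contract (Suc (length xs)) ?Z)"
    by (rule assms(2)) (use e l in \<open>auto simp: nth_append\<close>)
  ultimately show "G (xs @ (a * e) # b # ys) = G (xs @ a # (e * b) # ys)" by simp
qed

lemma BE_addsub: "addsub (BE n)"
  using addsubD[OF addsub_multilin] by (auto simp: addsub_def BE_def)

lemma BE_psum: "(\<And>a b. g a b \<in> BE n) ==> (\<lambda>xs. psum zs (\<lambda>a b. g a b xs)) \<in> BE n"
proof -
  assume "\<And>a b. g a b \<in> BE n"
  then have "psum zs g \<in> BE n" by (intro addsub_psum BE_addsub)
  moreover have "psum zs g = (\<lambda>xs. psum zs (\<lambda>a b. g a b xs))" by (rule ext) (simp add: psum_fun_apply)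
  ultimately show ?thesis by simp
qed

lemma BE_TA: assumes G: "G \<in> BE n" shows "(\<lambda>xs. TA G s xs) \<in> BE n"
proof (rule BE_I)
  note m = multilin_ml[OF BE_multilin[OF G]]
  show "(\<lambda>xs. TA G s xs) \<in> multilin B n"
  proof (rule multilinI[OF ml_TA[OF m]])
    fix xs :: "'b list" assume "length xs \<noteq> n"
    then have "TA G s xs = TA (\<lambda>_. 0) s xs" by (intro TA_cong_len) (simp add: multilin_len[OF BE_multilin[OF G]])
    then show "TA G s xs = 0" by simp
  qed
  fix i and Z :: "'b list" assume l: "length Z = Suc n" "i + 2 < length Z" "Z ! Suc i \<in> E"
  have "TA G s (contract i Z) = TA (\<lambda>ys. G (contract i ys)) s Z" by (rule TA_contract[OF m]) (use l in simp)
  also have "\<dots> = TA (\<lambda>ys. G (contract (Suc i) ys)) s Z"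
    by (intro TA_cong_E BE_contract[OF G]) (use l in auto)
  also have "\<dots> = TA G s (contract (Suc i) Z)" by (rule TA_contract[OF m, symmetric]) (use l in simp)
  finally show "TA G s (contract i Z) = TA G s (contract (Suc i) Z)" .
qed

lemma lr_multilin: assumes G: "G \<in> multilin B (Suc (Suc n))" shows "(\<lambda>ys. G (lr c c' ys)) \<in> multilin B (Suc (Suc n))"
proof -
  note m = multilin_ml[OF G]
  have *: "(\<lambda>ys. if length ys = Suc (Suc n) then G (lr c c' ys) else 0) \<in> multilin B (Suc (Suc n))"
  proof (rule ml_guardI)
    fix us vs :: "'b list" assume l: "Suc (length us + length vs) = Suc (Suc n)"
    then consider vs' v where "us = []" "vs = vs' @ [v]" | u us' where "us = u # us'" "vs = []"
       | u us' vs' v where "us = u # us'" "vs = vs' @ [v]"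
      by (cases us; cases vs rule: rev_cases) auto
    then show "klin bs bs (\<lambda>a. G (lr c c' (us @ a # vs)))"
    proof cases
      case 1
      then show ?thesis by (simp add: lr_eq) (intro klins m)
    next
      case 2
      have "lr c c' (us @ a # vs) = (c * u) # us' @ [a * c']" for a using 2 lr_eq[of c u us' a c'] by simp
      then show ?thesis by simp (intro klins m)
    next
      case 3
      have "lr c c' (us @ a # vs) = (c * u) # us' @ a # vs' @ [v * c']" for a using 3 lr_eq[of c u "us' @ a # vs'" v c'] by simp
      then show ?thesis by simp (intro klins m)
    qed
  qed
  have z: "G (lr c c' ys) = 0" if "length ys \<noteq> Suc (Suc n)" for ys
  proof (rule multilin_len[OF G])
    show "length (lr c c' ys) \<noteq> Suc (Suc n)"
      using that length_lr[of ys c c'] by (cases "ys = []") (auto simp: lmult_def rmult_def)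
  qed
  have "(\<lambda>ys. G (lr c c' ys)) = (\<lambda>ys. if length ys = Suc (Suc n) then G (lr c c' ys) else 0)"
  proof
    fix ys show "G (lr c c' ys) = (if length ys = Suc (Suc n) then G (lr c c' ys) else 0)"
      by (cases "length ys = Suc (Suc n)") (simp_all only: z if_True if_False simp_thms)
  qed
  then show ?thesis using * by (simp only:)
qed

lemma lr_BE: assumes G: "G \<in> BE (Suc (Suc n))" shows "(\<lambda>ys. G (lr c c' ys)) \<in> BE (Suc (Suc n))"
proof (rule BE_I)
  show "(\<lambda>ys. G (lr c c' ys)) \<in> multilin B (Suc (Suc n))" by (rule lr_multilin[OF BE_multilin[OF G]])
  fix i and Z :: "'b list" assume l: "length Z = Suc (Suc (Suc n))" "i + 2 < length Z" "Z ! Suc i \<in> E"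
  obtain b z b' where Z: "Z = b # z @ [b']" "length z = Suc n" using l(1) by (rule list2E)
  have "G (contract i (lr c c' Z)) = G (contract (Suc i) (lr c c' Z))"
  proof (rule BE_contract[OF G])
    show "i + 2 < length (lr c c' Z)" using l length_lr[of Z c c'] Z by auto
    show "lr c c' Z ! Suc i \<in> E" using l Z by (auto simp: lr_eq nth_append)
  qed
  then show "G (lr c c' (contract i Z)) = G (lr c c' (contract (Suc i) Z))" using l by (simp add: lr_contract)
qed

text \<open>The transpose of the right action: \<open>gact G us\<close> is G composed with the
  action of the pure tensor \<open>us\<close>. Identities in the bar resolution are proved as
  identities between such functions.\<close>

definition gact :: "('b list => 'b) => 'b list => 'b list => 'b" where
  "gact G us xs = rsum (\<lambda>s t. TA (\<lambda>ys. G (lr (ac t (us ! 0)) (us ! 1) ys)) s xs)"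

lemma gact_BE: assumes G: "G \<in> BE (Suc (Suc n))" shows "gact G us \<in> BE (Suc (Suc n))"
  unfolding gact_def[abs_def] by (intro BE_psum BE_TA lr_BE G)

lemma gact_multilin: assumes G: "G \<in> BE (Suc (Suc n))" and l: "length xs = Suc (Suc n)"
  shows "(\<lambda>us. if length us = 2 then gact G us xs else 0) \<in> multilin B 2"
proof (rule ml_guardI)
  note m = multilin_ml[OF BE_multilin[OF G]]
  fix us vs :: "'b list" assume "Suc (length us + length vs) = 2"
  then consider v where "us = []" "vs = [v]" | u where "us = [u]" "vs = []" by (cases us; cases vs) auto
  then show "klin bs bs (\<lambda>a. gact G (us @ a # vs) xs)"
  proof cases
    case 1
    have "gact G (us @ a # vs) xs = rsum (\<lambda>s t. TA (\<lambda>ys. G ((ac t a * hd ys) # tl (rmult ys v))) s xs)" for a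
      unfolding gact_def
    proof (intro psum_cong TA_cong_len arg_cong[of _ _ G])
      fix ys :: "'b list" and t assume "length ys = length xs"
      then obtain b z b' where ys: "ys = b # z @ [b']" using l list2E[of ys n] by metis
      show "lr (ac t ((us @ a # vs) ! 0)) ((us @ a # vs) ! 1) ys = (ac t a * hd ys) # tl (rmult ys v)"
        by (simp add: 1 ys lr_eq) (simp add: rmult_def butlast_append)
    qed
    then show ?thesis by simp (intro klins m)
  next
    case 2
    have "gact G (us @ a # vs) xs = rsum (\<lambda>s t. TA (\<lambda>ys. G (butlast (lmult (ac t u) ys) @ [last ys * a])) s xs)" for a
      unfolding gact_def
    proof (intro psum_cong TA_cong_len arg_cong[of _ _ G])
      fix ys :: "'b list" and t assume "length ys = length xs"
      then obtain b z b' where ys: "ys = b # z @ [b']" using l list2E[of ys n] by metis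
      show "lr (ac t ((us @ a # vs) ! 0)) ((us @ a # vs) ! 1) ys = butlast (lmult (ac t u) ys) @ [last ys * a]"
        by (simp add: 2 ys lr_eq) (simp add: lmult_def butlast_append)
    qed
    then show ?thesis by simp (intro klins m)
  qed
qed

lemma bar_act_fsums: assumes "p \<in> fsums (Suc (Suc n))" shows "bar_act H B p u \<in> fsums (Suc (Suc n))"
proof -
  have "{#lr c c' ys#} \<in> fsums (Suc (Suc n))" if "xs \<in># p" "ys \<in># tact H B s xs" for xs ys s c c'
    using that assms tact_length[OF that(2)] length_lr[of ys c c'] by (cases "ys = []") (auto simp: fsums_def)
  then show ?thesis
    unfolding bar_act_def psum_def[symmetric] by (intro fsums_sum_mset fsums_psum)
qed

lemma ev_bar_act: assumes G: "G \<in> BE (Suc (Suc n))" and p: "p \<in> fsums (Suc (Suc n))"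
  shows "ev G (bar_act H B p u) = ev (\<lambda>xs. ev (\<lambda>us. gact G us xs) u) p"
proof -
  have "ev G (bar_act H B p u) = ev (\<lambda>xs. ev (\<lambda>us. rsum (\<lambda>s t. \<Sum>ys\<in>#tact H B s xs. G (lr (ac t (us ! 0)) (us ! 1) ys))) u) p"
    unfolding bar_act_def psum_def[symmetric] ev_sum_mset sum_mset_psum by simp
  also have "\<dots> = ev (\<lambda>xs. ev (\<lambda>us. gact G us xs) u) p"
  proof (rule ev_cong[OF p])
    fix xs :: "'b list" assume "length xs = Suc (Suc n)"
    then have "xs \<noteq> []" by auto
    then show "ev (\<lambda>us. rsum (\<lambda>s t. \<Sum>ys\<in>#tact H B s xs. G (lr (ac t (us ! 0)) (us ! 1) ys))) u = ev (\<lambda>us. gact G us xs) u"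
      by (simp add: gact_def TA_eq_tact multilin_ml[OF lr_multilin[OF BE_multilin[OF G]]])
  qed
  finally show ?thesis .
qed

lemma ev_swap: "ev (\<lambda>xs. ev (\<lambda>us. f us xs) u) p = ev (\<lambda>us. ev (\<lambda>xs. f us xs) p) u"
  by (rule sum_mset.swap)

lemma sc_BE: "G \<in> multilin B n ==> G \<in> sc.BE n"
  unfolding sc.BE_def
  by (auto simp: scalars_def bs_mult klin_scale[OF ml_slot[OF multilin_ml klin_id]] klin_scale[OF ml_slot3[OF multilin_ml klin_id]])

lemma ev_scalars: "G \<in> multilin B n ==> (p, q) \<in> tens_rel (scalars B) n ==> ev G p = ev G q"
  by (rule sc.ev_BE[OF sc_BE])

text \<open>The two arguments are exchanged one after the other: for fixed \<open>us\<close> the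
  function \<open>gact G us\<close> is balanced in the bar tensor, and for fixed \<open>xs\<close>
  it is bilinear in \<open>us\<close>.\<close>

lemma bar_act_rel:
  assumes p: "(p, p') \<in> tens_rel E (Suc (Suc n))" and u: "(u, u') \<in> tens_rel (scalars B) 2"
  shows "(bar_act H B p u, bar_act H B p' u') \<in> tens_rel E (Suc (Suc n))"
proof (rule tens_rel_separate)
  note fp = tens_rel_fsums[OF p] and fu = tens_rel_fsums[OF u]
  show "bar_act H B p u \<in> fsums (Suc (Suc n))" "bar_act H B p' u' \<in> fsums (Suc (Suc n))" using fp by (auto intro: bar_act_fsums)
  fix G assume G: "G \<in> BE (Suc (Suc n))"
  have "ev G (bar_act H B p u) = ev (\<lambda>us. ev (gact G us) p) u"
    using fp by (simp add: ev_bar_act[OF G]) (rule ev_swap)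
  also have "\<dots> = ev (\<lambda>us. ev (gact G us) p') u" by (simp add: ev_BE[OF gact_BE[OF G] p])
  also have "\<dots> = ev (\<lambda>xs. ev (\<lambda>us. gact G us xs) u) p'" by (rule ev_swap)
  also have "\<dots> = ev (\<lambda>xs. ev (\<lambda>us. gact G us xs) u') p'"
  proof (rule ev_cong[OF conjunct2[OF fp]])
    fix xs :: "'b list" assume l: "length xs = Suc (Suc n)"
    have "ev (\<lambda>us. gact G us xs) u = ev (\<lambda>us. if length us = 2 then gact G us xs else 0) u"
      by (rule ev_cong[of _ 2]) (use fu in auto)
    also have "\<dots> = ev (\<lambda>us. if length us = 2 then gact G us xs else 0) u'"
      by (rule ev_scalars[OF gact_multilin[OF G l] u])
    also have "\<dots> = ev (\<lambda>us. gact G us xs) u'"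
      by (rule ev_cong[of _ 2]) (use fu in auto)
    finally show "ev (\<lambda>us. gact G us xs) u = ev (\<lambda>us. gact G us xs) u'" .
  qed
  also have "\<dots> = ev G (bar_act H B p' u')" using fp by (simp add: ev_bar_act[OF G])
  finally show "ev G (bar_act H B p u) = ev G (bar_act H B p' u')" .
qed

abbreviation "bar' n \<equiv> bar H B E n"
abbreviation "cl n p \<equiv> tclass E (Suc (Suc n)) p"
abbreviation "cl2 u \<equiv> tclass (scalars B) 2 u"

lemma bar_simps: "carrier (bar' n) = tens E (Suc (Suc n))" "\<zero>\<^bsub>bar' n\<^esub> = cl n {#}"
  by (simp_all add: bar_def)

lemma bar_smult: assumes "p \<in> fsums (Suc (Suc n))" "u \<in> fsums 2"
  shows "cl2 u \<odot>\<^bsub>bar' n\<^esub> cl n p = cl n (bar_act H B p u)"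
proof -
  have "cl2 u \<odot>\<^bsub>bar' n\<^esub> cl n p = (\<Union>u\<in>cl2 u. \<Union>p\<in>cl n p. cl n (bar_act H B p u))" by (simp add: bar_def)
  also have "\<dots> = (\<Union>u\<in>cl2 u. cl n (bar_act H B p u))"
  proof (rule SUP_cong[OF HOL.refl])
    fix v assume "v \<in> cl2 u"
    then have "v \<in> fsums 2" using tens_rel_fsums by (auto simp: tclass_mem)
    then show "(\<Union>p\<in>cl n p. cl n (bar_act H B p v)) = cl n (bar_act H B p v)"
      by (intro UN_tclass assms tclass_eq[symmetric] bar_act_rel tens_rel.refl)
  qed
  also have "\<dots> = cl n (bar_act H B p u)"
    by (intro UN_tclass assms tclass_eq[symmetric] bar_act_rel tens_rel.refl)
  finally show ?thesis .
qed

lemma bar_add: assumes "p \<in> fsums (Suc (Suc n))" "q \<in> fsums (Suc (Suc n))"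
  shows "cl n p \<oplus>\<^bsub>bar' n\<^esub> cl n q = cl n (p + q)"
proof -
  have "cl n p \<oplus>\<^bsub>bar' n\<^esub> cl n q = (\<Union>p\<in>cl n p. \<Union>q\<in>cl n q. cl n (p + q))" by (simp add: bar_def)
  also have "\<dots> = (\<Union>p\<in>cl n p. cl n (p + q))"
  proof (rule SUP_cong[OF HOL.refl])
    fix v assume "v \<in> cl n p"
    then have "v \<in> fsums (Suc (Suc n))" using tens_rel_fsums by (auto simp: tclass_mem)
    then show "(\<Union>q\<in>cl n q. cl n (v + q)) = cl n (v + q)"
      by (intro UN_tclass assms tclass_eq[symmetric] tens_rel_add tens_rel.refl)
  qed
  also have "\<dots> = cl n (p + q)"
    by (intro UN_tclass assms tclass_eq[symmetric] tens_rel_add tens_rel.refl)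
  finally show ?thesis .
qed

definition bdiff :: "nat => 'b list multiset => 'b list multiset" where
  "bdiff n p = (\<Sum>xs\<in>#p. \<Sum>i\<le>Suc n. {# lmult (signed i 1) (contract i xs) #})"

text \<open>The transpose of the bar differential. The index \<open>Suc i\<close> leaves out face 0
  and the range stops before the last face, so only multiplications of neighbouring entries occur
  and nothing is multiplied onto the value of G.\<close>

definition dG :: "nat => ('b list => 'b) => 'b list => 'b" where
  "dG n G = (\<Sum>i\<le>Suc n. signed i (face (Suc (Suc n)) (Suc i) G))"

lemma dG_eval: "length xs = Suc (Suc (Suc n)) ==> dG n G xs = (\<Sum>i\<le>Suc n. signed i (G (contract i xs)))"
  unfolding dG_def sum_fun_apply signed_apply by (intro sum.cong HOL.refl) (simp add: face_contract)

text \<open>Each inner face is balanced on its own. Away from the merged pair this is balancing of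
  G; where the two contractions meet, at i = j, it is associativity of B.\<close>

lemma dG_BE: assumes G: "G \<in> BE (Suc (Suc n))" shows "dG n G \<in> BE (Suc (Suc (Suc n)))"
  unfolding dG_def
proof (intro addsub_sum addsubD(5)[OF BE_addsub] BE_addsub)
  fix i assume i: "i \<in> {..Suc n}"
  show "face (Suc (Suc n)) (Suc i) G \<in> BE (Suc (Suc (Suc n)))"
  proof (rule BE_I[OF face_multilin[OF BE_multilin[OF G]]])
    fix j and Z :: "'b list" assume l: "length Z = Suc (Suc (Suc (Suc n)))" "j + 2 < length Z" "Z ! Suc j \<in> E"
    have F: "face (Suc (Suc n)) (Suc i) G (contract k Z) = G (contract i (contract k Z))" if "Suc k < length Z" for k
      by (rule face_contract) (use i l that in \<open>auto simp: length_contract\<close>)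
    consider "i < j" | "i = j" | "j < i" by linarith
    then have "G (contract i (contract j Z)) = G (contract i (contract (Suc j) Z))"
    proof cases
      case 1
      then obtain k where j: "j = Suc k" "i \<le> k" by (cases j) auto
      have "G (contract k (contract i Z)) = G (contract (Suc k) (contract i Z))"
      proof (rule BE_contract[OF G])
        show "k + 2 < length (contract i Z)" using l j by (simp add: length_contract)
        show "contract i Z ! Suc k \<in> E" using l(2,3) j by (auto simp: contract_def nth_append min_def nth_Cons')
      qed
      then show ?thesis using l j by (simp add: contract_contract)
    next
      case 2
      then show ?thesis using l by (simp add: contract_contract)
    next
      case 3
      have "G (contract j (contract (Suc i) Z)) = G (contract (Suc j) (contract (Suc i) Z))"
      proof (rule BE_contract[OF G])
        show "j + 2 < length (contract (Suc i) Z)" using l 3 i by (simp add: length_contract)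
        show "contract (Suc i) Z ! Suc j \<in> E" using l 3 by (auto simp: contract_def nth_append min_def)
      qed
      then show ?thesis using l 3 i by (simp add: contract_contract)
    qed
    then show "face (Suc (Suc n)) (Suc i) G (contract j Z) = face (Suc (Suc n)) (Suc i) G (contract (Suc j) Z)"
      using l by (simp add: F)
  qed
qed

lemma bdiff_fsums: assumes "p \<in> fsums (Suc (Suc (Suc n)))" shows "bdiff n p \<in> fsums (Suc (Suc n))"
  unfolding bdiff_def
proof (intro fsums_sum_mset fsums_sum)
  fix xs i assume "xs \<in># p" "i \<in> {..Suc n}"
  then have "length (contract i xs) = Suc (Suc n)" using assms by (subst length_contract) (auto simp: fsums_def)
  then show "{#lmult (signed i 1) (contract i xs)#} \<in> fsums (Suc (Suc n))"
    using length_lmult[of "contract i xs"] by (cases "contract i xs = []") auto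
qed

lemma ev_bdiff: assumes G: "G \<in> BE (Suc (Suc n))" and p: "p \<in> fsums (Suc (Suc (Suc n)))"
  shows "ev G (bdiff n p) = ev (dG n G) p"
proof -
  have "ev G (bdiff n p) = ev (\<lambda>xs. \<Sum>i\<le>Suc n. G (lmult (signed i 1) (contract i xs))) p"
    unfolding bdiff_def ev_sum_mset ev_sum by (simp only: image_mset_single sum_mset.singleton)
  also have "\<dots> = ev (dG n G) p"
  proof (rule ev_cong[OF p])
    fix xs :: "'b list" assume l: "length xs = Suc (Suc (Suc n))"
    have "G (lmult (signed i 1) (contract i xs)) = signed i (G (contract i xs))" if "i \<le> Suc n" for i
    proof -
      have "contract i xs \<noteq> []" using length_contract[of i xs] l that by auto
      then obtain y ys where "contract i xs = y # ys" by (cases "contract i xs") auto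
      moreover have "G ((- y) # ys) = - G (y # ys)"
        using klin_scale[OF ml_slot0[OF multilin_ml[OF BE_multilin[OF G]] klin_id], of "-1" y ys] by simp
      ultimately show ?thesis by (simp add: lmult_def signed_def)
    qed
    then show "(\<Sum>i\<le>Suc n. G (lmult (signed i 1) (contract i xs))) = dG n G xs"
      unfolding dG_eval[OF l] by (intro sum.cong) auto
  qed
  finally show ?thesis .
qed

lemma bar_diff_class: assumes p: "p \<in> fsums (Suc (Suc (Suc n)))"
  shows "bar_diff E n (cl (Suc n) p) = cl n (bdiff n p)"
proof -
  have "bar_diff E n (cl (Suc n) p) = (\<Union>p\<in>cl (Suc n) p. cl n (bdiff n p))" by (simp add: bar_diff_def bdiff_def)
  also have "\<dots> = cl n (bdiff n p)"
  proof (rule UN_tclass[OF p], rule tclass_eq[symmetric], rule tens_rel_separate)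
    fix q assume q: "(p, q) \<in> tens_rel E (Suc (Suc (Suc n)))"
    note fq = tens_rel_fsums[OF q]
    show "bdiff n p \<in> fsums (Suc (Suc n))" "bdiff n q \<in> fsums (Suc (Suc n))" using fq by (auto intro: bdiff_fsums)
    show "ev G (bdiff n p) = ev G (bdiff n q)" if "G \<in> BE (Suc (Suc n))" for G
      using fq ev_BE[OF dG_BE[OF that] q] by (simp add: ev_bdiff[OF that])
  qed
  finally show ?thesis .
qed

text \<open>Merging inner neighbours commutes with multiplying the outer entries and with the
  diagonal action.\<close>

lemma dG_gact: assumes G: "G \<in> BE (Suc (Suc n))" and l: "length xs = Suc (Suc (Suc n))"
  shows "gact (dG n G) us xs = dG n (gact G us) xs"
proof -
  note mG = BE_multilin[OF G]
  have "gact (dG n G) us xs = rsum (\<lambda>s t. TA (\<lambda>ys. \<Sum>i\<le>Suc n. signed i (G (lr (ac t (us ! 0)) (us ! 1) (contract i ys)))) s xs)"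
    unfolding gact_def
  proof (intro psum_cong TA_cong_len)
    fix t and ys :: "'b list" assume ys: "length ys = length xs"
    then have "ys \<noteq> []" using l by auto
    then have "dG n G (lr (ac t (us ! 0)) (us ! 1) ys) = (\<Sum>i\<le>Suc n. signed i (G (contract i (lr (ac t (us ! 0)) (us ! 1) ys))))"
      by (intro dG_eval) (use ys l in \<open>simp add: length_lr\<close>)
    also have "\<dots> = (\<Sum>i\<le>Suc n. signed i (G (lr (ac t (us ! 0)) (us ! 1) (contract i ys))))"
      by (intro sum.cong HOL.refl) (use ys l in \<open>simp add: lr_contract\<close>)
    finally show "dG n G (lr (ac t (us ! 0)) (us ! 1) ys) = (\<Sum>i\<le>Suc n. signed i (G (lr (ac t (us ! 0)) (us ! 1) (contract i ys))))" .
  qed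
  also have "\<dots> = (\<Sum>i\<le>Suc n. signed i (gact G us (contract i xs)))"
  proof -
    have TAs: "TA (\<lambda>ys. \<Sum>i\<le>k. signed i (g i ys)) s xs = (\<Sum>i\<le>k. signed i (TA (g i) s xs))" for g :: "nat => 'b list => 'b" and s k
    proof -
      have TAn: "TA (\<lambda>ys. signed i (g ys)) s xs = signed i (TA g s xs)" for g i
        using TA_klin[of "\<lambda>x. - x" g s xs] by (simp add: signed_def klin_def VB.scale_minus_right)
      show ?thesis by (induction k) (simp_all add: TA_add TAn)
    qed
    have ps: "psum R (\<lambda>s t. \<Sum>i\<le>k. signed i (h i s t)) = (\<Sum>i\<le>k. signed i (psum R (h i)))" for R :: "('h \<times> 'h) list" and h :: "nat => 'h => 'h => 'b" and k
      by (induction k) (simp_all add: psum_add psum_signed)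
    show ?thesis unfolding TAs ps gact_def
      by (intro sum.cong HOL.refl arg_cong[where f="signed _"] psum_cong TA_contract[symmetric, OF multilin_ml[OF lr_multilin[OF mG]]])
         (use l in simp)
  qed
  also have "\<dots> = dG n (gact G us) xs" by (rule dG_eval[OF l, symmetric])
  finally show ?thesis .
qed

lemma bar_diff_hom: "bar_diff E n \<in> right_hom (env_alg H B) (bar' (Suc n)) (bar' n)"
  unfolding right_hom_def bar_simps
proof (intro CollectI conjI ballI funcsetI)
  fix X assume "X \<in> tens E (Suc (Suc (Suc n)))"
  then obtain p where p: "p \<in> fsums (Suc (Suc (Suc n)))" and X: "X = cl (Suc n) p" by (rule tensE)
  show "bar_diff E n X \<in> tens E (Suc (Suc n))" unfolding X bar_diff_class[OF p] by (intro tclass_in_tens bdiff_fsums p)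
  {
    fix Y assume "Y \<in> tens E (Suc (Suc (Suc n)))"
    then obtain q where q: "q \<in> fsums (Suc (Suc (Suc n)))" and Y: "Y = cl (Suc n) q" by (rule tensE)
    have "bdiff n (p + q) = bdiff n p + bdiff n q" by (simp add: bdiff_def)
    then show "bar_diff E n (X \<oplus>\<^bsub>bar' (Suc n)\<^esub> Y) = bar_diff E n X \<oplus>\<^bsub>bar' n\<^esub> bar_diff E n Y"
      using p q by (simp add: X Y bar_add bar_diff_class bdiff_fsums)
  }
  fix U assume "U \<in> carrier (env_alg H B)"
  then obtain u where u: "u \<in> fsums 2" and U: "U = cl2 u" by (auto simp: env_alg_def elim: tensE)
  have "(bdiff n (bar_act H B p u), bar_act H B (bdiff n p) u) \<in> tens_rel E (Suc (Suc n))"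
  proof (rule tens_rel_separate)
    fix G assume G: "G \<in> BE (Suc (Suc n))"
    have "ev G (bdiff n (bar_act H B p u)) = ev (\<lambda>xs. ev (\<lambda>us. gact (dG n G) us xs) u) p"
      by (simp add: ev_bdiff[OF G] bar_act_fsums p ev_bar_act[OF dG_BE[OF G]])
    also have "\<dots> = ev (\<lambda>xs. ev (\<lambda>us. dG n (gact G us) xs) u) p"
      by (rule ev_cong[OF p]) (simp add: dG_gact[OF G])
    also have "\<dots> = ev (\<lambda>us. ev (gact G us) (bdiff n p)) u"
      by (subst ev_swap) (simp add: ev_bdiff[OF gact_BE[OF G] p])
    also have "\<dots> = ev G (bar_act H B (bdiff n p) u)"
      by (subst ev_swap) (simp add: ev_bar_act[OF G bdiff_fsums[OF p]])
    finally show "ev G (bdiff n (bar_act H B p u)) = ev G (bar_act H B (bdiff n p) u)" .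
  qed (intro bdiff_fsums bar_act_fsums p)+
  then show "bar_diff E n (U \<odot>\<^bsub>bar' (Suc n)\<^esub> X) = U \<odot>\<^bsub>bar' n\<^esub> bar_diff E n X"
    using p u by (simp add: U X bar_smult bar_diff_class bar_act_fsums bdiff_fsums tclass_eq)
qed

end

section \<open>Equivariant maps on the bar resolution\<close>

lemma right_hom_comp: "F \<in> right_hom R M N ==> F' \<in> right_hom R L M ==> (\<lambda>x. F (F' x)) \<in> right_hom R L N"
  by (auto simp: right_hom_def Pi_iff)

context rel_alg begin

text \<open>The functions on lists that correspond to module maps from the bar term to B.
  Equivariance is imposed for pure tensors of the enveloping algebra; additivity extends it to all
  of it.\<close>

definition HomG :: "nat => ('b list => 'b) set" where
  "HomG n = {G \<in> BE (Suc (Suc n)). \<forall>c c' xs. length xs = Suc (Suc n) \<longrightarrow>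
     gact G [c, c'] xs = rsum (\<lambda>s t. ac t c * ac s (G xs) * c')}"

text \<open>The inverse of restriction: the tensor b, x, b' is sent to the braided product of b with
  f(x), times b'. Written with the two outer faces, it is governed by the face identities.\<close>

definition ext :: "nat => ('b list => 'b) => 'b list => 'b" where
  "ext n f = face (Suc n) (Suc (Suc n)) (face n 0 f)"

definition rho :: "nat => ('b list => 'b) => 'b list => 'b" where
  "rho n G x = (if length x = n then G (1 # x @ [1]) else 0)"

lemma ext_multilin: "f \<in> multilin B n ==> ext n f \<in> multilin B (Suc (Suc n))"
  unfolding ext_def by (intro face_multilin)

lemma ext_eval0: "length z = n ==> ext n f (b # z @ [b']) = face n 0 f (b # z) * b'"
  unfolding ext_def using face_last[of "b # z" "Suc n" "face n 0 f" b'] by simp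

lemma ext_eval: "length z = n ==> ext n f (b # z @ [b']) = rsum (\<lambda>s t. ac t b * A s f z) * b'"
  by (simp add: ext_eval0 face_0)

lemma A_ext: "f \<in> multilin B n ==> A h (ext n f) = ext n (A h f)"
  unfolding ext_def by (simp add: A_face face_multilin)

text \<open>The inner faces of \<open>ext n f\<close> are all the faces of f, the outer ones
  included: what the outer faces of f multiply by is absorbed into a or b'.\<close>

lemma ext_face: assumes f: "f \<in> multilin B n" and i: "i \<le> Suc n" and l: "length x = Suc n"
  shows "face (Suc (Suc n)) (Suc i) (ext n f) (a # x @ [b']) = rsum (\<lambda>s t. ac t a * face n i (A s f) x) * b'"
proof -
  have "face (Suc (Suc n)) (Suc i) (ext n f) = face (Suc (Suc n)) (Suc (Suc (Suc n))) (face (Suc n) (Suc i) (face n 0 f))"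
    unfolding ext_def by (rule face_face_last) (use face_multilin[OF f] i in auto)
  also have "face (Suc n) (Suc i) (face n 0 f) = face (Suc n) 0 (face n i f)" by (rule face_face_0[OF f i])
  finally show ?thesis
    using face_last[of "a # x" "Suc (Suc n)" "face (Suc n) 0 (face n i f)" b'] l by (simp add: face_0 A_face[OF f])
qed

text \<open>Balancing at an inner entry is the relative condition on f, by \<open>ext_face\<close>.
  Equivariance combines associativity of braided left multiplication with the first hexagon, which
  turns two copies of R into the coproduct of one leg and so into \<open>act_eval\<close>.\<close>

lemma ext_HomG: assumes f: "f \<in> RC n" shows "ext n f \<in> HomG n"
  unfolding HomG_def
proof (intro CollectI conjI allI impI)
  note mf = RC_multilin[OF f]
  note m = multilin_ml[OF mf]
  show "ext n f \<in> BE (Suc (Suc n))"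
  proof (rule BE_I[OF ext_multilin[OF mf]])
    fix i and Z :: "'b list" assume l: "length Z = Suc (Suc (Suc n))" "i + 2 < length Z" "Z ! Suc i \<in> E"
    obtain a x b' where Z: "Z = a # x @ [b']" and lx: "length x = Suc n" using l(1) by (rule list2E)
    have xi: "x ! i \<in> E" using l lx by (simp add: Z nth_append)
    have i: "i \<le> n" using l by simp
    have C: "ext n f (contract k Z) = face (Suc (Suc n)) (Suc k) (ext n f) Z" if "k \<le> Suc n" for k
      by (rule face_contract[symmetric]) (use l that in auto)
    have "ext n f (contract i Z) = rsum (\<lambda>s t. ac t a * face n i (A s f) x) * b'"
      using C[of i] i ext_face[OF mf _ lx, of i a b'] by (simp add: Z)
    also have "\<dots> = rsum (\<lambda>s t. ac t a * face n (Suc i) (A s f) x) * b'"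
      by (simp add: RC_face[OF RC_A[OF f] i lx xi])
    also have "\<dots> = ext n f (contract (Suc i) Z)"
      using C[of "Suc i"] i ext_face[OF mf _ lx, of "Suc i" a b'] by (simp add: Z)
    finally show "ext n f (contract i Z) = ext n f (contract (Suc i) Z)" .
  qed
  fix c c' and xs :: "'b list" assume l: "length xs = Suc (Suc n)"
  have lr: "ext n f (lr (ac t c) c' ys) = rsum (\<lambda>s' t'. ac (t' * t) c * A s' (ext n f) ys * c')" if ly: "length ys = Suc (Suc n)" for t ys
  proof -
    obtain y z y' where ys: "ys = y # z @ [y']" and lz: "length z = n" using ly by (rule list2E)
    have "ext n f (lr (ac t c) c' ys) = face n 0 f (contract 0 (ac t c # y # z)) * (y' * c')"
      by (simp only: ys lr_eq ext_eval0[OF lz] contract_0)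
    also have "face n 0 f (contract 0 (ac t c # y # z)) = face (Suc n) (Suc 0) (face n 0 f) (ac t c # y # z)"
      by (rule face_contract[symmetric]) (use lz in auto)
    also have "\<dots> = rsum (\<lambda>s' t'. ac t' (ac t c) * A s' (face n 0 f) (y # z))"
      by (simp add: face_face_0[OF mf] face_0 lz)
    finally show ?thesis
      by (simp add: ys A_ext[OF mf] ext_eval0 lz A_face[OF mf] psum_mult_right act_mult mult.assoc)
  qed
  note me = multilin_ml[OF ext_multilin[OF mf]]
  have "gact (ext n f) [c, c'] xs = rsum (\<lambda>s t. TA (\<lambda>ys. rsum (\<lambda>s' t'. ac (t' * t) c * A s' (ext n f) ys * c')) s xs)"
    unfolding gact_def by (intro psum_cong TA_cong_len) (simp add: lr l)
  also have "\<dots> = rsum (\<lambda>s t. rsum (\<lambda>s' t'. ac (t' * t) c * TA (A s' (ext n f)) s xs * c'))"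
    by (simp add: TA_psum TA_mult_left TA_mult_right)
  also have "\<dots> = rsum (\<lambda>s' t'. rsum (\<lambda>s t. ac (t' * t) c * TA (A s' (ext n f)) s xs * c'))"
    by (rule psum_swap)
  also have "\<dots> = rsum (\<lambda>s t. dsum s (\<lambda>a b. ac t c * TA (A a (ext n f)) b xs * c'))"
    by (rule rsum_hex1[of bs, symmetric]) (intro klins klin_A ml_A me)+
  also have "\<dots> = rsum (\<lambda>s t. ac t c * ac s (ext n f xs) * c')"
    by (simp add: act_eval[OF me] psum_mult_left psum_mult_right)
  finally show "gact (ext n f) [c, c'] xs = rsum (\<lambda>s t. ac t c * ac s (ext n f xs) * c')" .
qed

lemma HomG_BE: "G \<in> HomG n ==> G \<in> BE (Suc (Suc n))" by (simp add: HomG_def)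
lemma HomG_gact: "G \<in> HomG n ==> length xs = Suc (Suc n) ==> gact G [c, c'] xs = rsum (\<lambda>s t. ac t c * ac s (G xs) * c')"
  by (simp add: HomG_def)

lemma rho_multilin: assumes G: "G \<in> BE (Suc (Suc n))" shows "rho n G \<in> multilin B n"
proof (rule multilinI)
  note m = multilin_ml[OF BE_multilin[OF G]]
  have "rho n G = (\<lambda>x. G (1 # x @ [1]))"
    by (rule ext) (simp add: rho_def multilin_len[OF BE_multilin[OF G]])
  moreover have "ml \<dots>" by (rule ml_mid5[OF m])
  ultimately show "ml (rho n G)" by simp
qed (simp add: rho_def)

lemma gact_units: assumes G: "G \<in> BE (Suc (Suc n))"
  shows "gact G [c, c'] (1 # z @ [1]) = rsum (\<lambda>s t. TA (\<lambda>z. G (ac t c # z @ [c'])) s z)"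
  unfolding gact_def
  by (rule psum_cong, subst TA_units) (simp_all add: multilin_ml[OF lr_multilin[OF BE_multilin[OF G]]] lr_eq)

text \<open>The first hexagon merges the two copies of R, after which the tensor is acted on by s_1
  S(s_2), a counit.\<close>

lemma gact_expand: assumes G: "G \<in> BE (Suc (Suc n))"
  shows "rsum (\<lambda>s' t'. TA (\<lambda>z. gact G [ac t' b, b'] (1 # z @ [1])) (S s') x) = G (b # x @ [b'])"
proof -
  note m = multilin_ml[OF BE_multilin[OF G]]
  have "rsum (\<lambda>s' t'. TA (\<lambda>z. gact G [ac t' b, b'] (1 # z @ [1])) (S s') x) =
      rsum (\<lambda>s' t'. TA (\<lambda>z. rsum (\<lambda>s t. TA (\<lambda>z. G (ac (t * t') b # z @ [b'])) s z)) (S s') x)"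
    by (simp only: gact_units[OF G] act_mult)
  also have "\<dots> = rsum (\<lambda>s' t'. rsum (\<lambda>s t. TA (\<lambda>z. G (ac (t * t') b # z @ [b'])) (s * S s') x))"
    by (simp add: TA_psum TA_mult ml_mid5 m)
  also have "\<dots> = rsum (\<lambda>s t. rsum (\<lambda>s' t'. TA (\<lambda>z. G (ac (t * t') b # z @ [b'])) (s * S s') x))"
    by (rule psum_swap)
  also have "\<dots> = rsum (\<lambda>s t. dsum s (\<lambda>a c. TA (\<lambda>z. G (ac t b # z @ [b'])) (a * S c) x))"
    by (rule rsum_hex1[of bs, symmetric]) (intro klins m)+
  also have "\<dots> = rsum (\<lambda>s t. bs (eps s) (TA (\<lambda>z. G (ac t b # z @ [b'])) 1 x))"
    by (intro psum_cong dsum_antipode2) (intro klins m)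
  also have "\<dots> = TA (\<lambda>z. G (ac 1 b # z @ [b'])) 1 x"
    by (rule rsum_eps1) (intro klins m)
  also have "\<dots> = G (b # x @ [b'])" by (simp add: TA_one ml_mid5 m act_one)
  finally show ?thesis .
qed

text \<open>An equivariant map on the bar resolution is determined by its restriction, because
  \<open>b \<otimes> x \<otimes> b' = (1 \<otimes> S(r\<^sub>j) \<cdot> x \<otimes> 1) (r\<^sup>j \<cdot> b \<otimes> b')\<close>.\<close>

lemma ext_rho: assumes G: "G \<in> HomG n" shows "ext n (rho n G) = G"
proof
  fix xs
  note mG = BE_multilin[OF HomG_BE[OF G]]
  note m = multilin_ml[OF mG] and mr = multilin_ml[OF rho_multilin[OF HomG_BE[OF G]]]
  show "ext n (rho n G) xs = G xs"
  proof (cases "length xs = Suc (Suc n)")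
    case True
    then obtain b x b' where xs: "xs = b # x @ [b']" and l: "length x = n" by (rule list2E)
    have "ext n (rho n G) xs = rsum (\<lambda>s t. dsum s (\<lambda>a c. ac t b * ac a (TA (rho n G) (S c) x) * b'))"
      by (simp add: xs ext_eval l A_eq[OF mr] psum_mult_left psum_mult_right)
    also have "\<dots> = rsum (\<lambda>s t. rsum (\<lambda>s' t'. ac (t * t') b * ac s (TA (rho n G) (S s') x) * b'))"
      by (rule rsum_hex1[of bs]) (intro klins mr)+
    also have "\<dots> = rsum (\<lambda>s' t'. rsum (\<lambda>s t. ac (t * t') b * ac s (TA (rho n G) (S s') x) * b'))"
      by (rule psum_swap)
    also have "\<dots> = rsum (\<lambda>s' t'. TA (\<lambda>z. rsum (\<lambda>s t. ac t (ac t' b) * ac s (rho n G z) * b')) (S s') x)"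
      by (simp add: TA_psum TA_mult_left[symmetric] TA_mult_right[symmetric] TA_act[symmetric] act_mult)
    also have "\<dots> = rsum (\<lambda>s' t'. TA (\<lambda>z. gact G [ac t' b, b'] (1 # z @ [1])) (S s') x)"
      by (intro psum_cong TA_cong_len) (simp add: HomG_gact[OF G] rho_def l)
    also have "\<dots> = G xs" unfolding xs by (rule gact_expand[OF HomG_BE[OF G]])
    finally show ?thesis .
  next
    case False
    then show ?thesis
      using multilin_len[OF mG] multilin_len[OF ext_multilin[OF rho_multilin[OF HomG_BE[OF G]]]] by simp
  qed
qed

text \<open>Every face of a restriction is a contraction of the list with 1 at both ends. For the
  inner faces this is clear; for the outer two it needs equivariance, used as
  \<open>ext n (rho n G) = G\<close>.\<close>

lemma rho_face: assumes G: "G \<in> HomG n" and i: "i \<le> Suc n" and l: "length X = Suc n"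
  shows "face n i (rho n G) X = G (contract i (1 # X @ [1]))"
proof -
  note eG = fun_cong[OF ext_rho[OF G]]
  consider "i = 0" | j where "i = Suc j" "j < n" | "i = Suc n" using i by (cases i) fastforce+
  then show ?thesis
  proof cases
    case 1
    obtain w x where X: "X = w # x" and lx: "length x = n" using l by (cases X) auto
    have "face n 0 (rho n G) (w # x) = ext n (rho n G) (w # x @ [1])" by (simp add: ext_eval0 lx)
    then show ?thesis by (simp add: 1 X eG contract_0)
  next
    case 2
    have "contract i (1 # X @ [1]) = 1 # contract j X @ [1]"
      using 2 l by (simp add: contract_Suc contract_append1)
    then show ?thesis using 2 l by (simp add: face_contract rho_def length_contract)
  next
    case 3
    obtain x e where X: "X = x @ [e]" and lx: "length x = n" using l by (cases X rule: rev_cases) auto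
    have one: "ext n (rho n G) (1 # x @ [e]) = ext n (rho n G) (1 # x @ [1]) * e" by (simp add: ext_eval0 lx)
    have "contract (Suc n) (1 # X @ [1]) = 1 # x @ [e]"
      using contract_mid[of "1 # x" e 1 "[]"] lx by (simp add: X)
    then show ?thesis using one lx by (simp add: 3 X face_last rho_def eG)
  qed
qed

lemma rho_RC: assumes G: "G \<in> HomG n" shows "rho n G \<in> RC n"
  unfolding RC_def
proof (intro CollectI conjI allI impI rho_multilin HomG_BE G)
  fix i and xs :: "'b list" assume i: "i \<le> n" and l: "length xs = Suc n" "xs ! i \<in> E"
  have "G (contract i (1 # xs @ [1])) = G (contract (Suc i) (1 # xs @ [1]))"
    by (rule BE_contract[OF HomG_BE[OF G]]) (use i l in \<open>auto simp: nth_append\<close>)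
  then show "face n i (rho n G) xs = face n (Suc i) (rho n G) xs" using i l by (simp add: rho_face[OF G])
qed

lemma rho_ext: assumes f: "f \<in> RC n" shows "rho n (ext n f) = f"
proof
  fix x
  note m = RC_ml[OF f]
  show "rho n (ext n f) x = f x"
  proof (cases "length x = n")
    case True
    have "rsum (\<lambda>s t. bs (eps t) (A s f x)) = A 1 f x" by (rule rsum_eps2) (intro klin_A m klin_id)
    then show ?thesis using True by (simp add: rho_def ext_eval act_unit bs_mult A_one[OF m])
  qed (simp add: rho_def multilin_len[OF RC_multilin[OF f]])
qed

lemma rho_dG: assumes G: "G \<in> HomG n" shows "rho (Suc n) (dG n G) = D n (rho n G)"
proof
  fix X :: "'b list"
  show "rho (Suc n) (dG n G) X = D n (rho n G) X"
  proof (cases "length X = Suc n")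
    case True
    have "rho (Suc n) (dG n G) X = (\<Sum>i\<le>Suc n. signed i (G (contract i (1 # X @ [1]))))"
      using True by (simp add: rho_def dG_eval del: sum.atMost_Suc)
    also have "\<dots> = D n (rho n G) X"
      unfolding D_def sum_fun_apply signed_apply
      by (intro sum.cong HOL.refl) (simp add: rho_face[OF G _ True])
    finally show ?thesis .
  qed (simp add: rho_def D_def sum_fun_apply signed_apply face_len)
qed

abbreviation "env \<equiv> env_alg H B"
abbreviation "reg \<equiv> reg_mod H B"

lemma env_carrier: "carrier env = tens (scalars B) 2" by (simp add: env_alg_def)

definition gof :: "nat => ('b list multiset set => 'b) => 'b list => 'b" where
  "gof n F xs = (if length xs = Suc (Suc n) then F (cl n {#xs#}) else 0)"

lemma right_hom_add: assumes F: "F \<in> right_hom env (bar' n) reg" and p: "p \<in> fsums (Suc (Suc n))" and q: "q \<in> fsums (Suc (Suc n))"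
  shows "F (cl n (p + q)) = F (cl n p) + F (cl n q)"
proof -
  have "F (cl n p \<oplus>\<^bsub>bar' n\<^esub> cl n q) = F (cl n p) \<oplus>\<^bsub>reg\<^esub> F (cl n q)"
    using F p q unfolding right_hom_def by (auto simp: bar_simps tclass_in_tens)
  then show ?thesis by (simp add: bar_add p q reg_simps)
qed

lemma right_hom_smult: assumes F: "F \<in> right_hom env (bar' n) reg" and p: "p \<in> fsums (Suc (Suc n))" and u: "u \<in> fsums 2"
  shows "F (cl n (bar_act H B p u)) = ev (\<lambda>us. rsum (\<lambda>s t. ac t (us ! 0) * ac s (F (cl n p)) * us ! 1)) u"
proof -
  have "F (cl2 u \<odot>\<^bsub>bar' n\<^esub> cl n p) = cl2 u \<odot>\<^bsub>reg\<^esub> F (cl n p)"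
    using F p u unfolding right_hom_def by (auto simp: bar_simps tclass_in_tens env_carrier)
  then show ?thesis by (simp add: bar_smult p u reg_smult)
qed

lemma right_hom_ev: assumes F: "F \<in> right_hom env (bar' n) reg"
  shows "p \<in> fsums (Suc (Suc n)) ==> F (cl n p) = ev (gof n F) p"
proof (induction p)
  case empty
  then show ?case using right_hom_add[OF F, of "{#}" "{#}"] by simp
next
  case (add xs p)
  then show ?case using right_hom_add[OF F, of "{#xs#}" p] by (simp add: gof_def)
qed

text \<open>The leg of R that acts on 1 becomes a counit and collapses the braiding, leaving right
  multiplication by e. For scalar e this recovers linearity over the field from linearity over the
  enveloping algebra.\<close>

lemma bar_act_one:
  assumes l: "length z = n"
  shows "(bar_act H B {#b # z @ [b']#} {#[1, e]#}, {#b # z @ [b' * e]#}) \<in> tens_rel E (Suc (Suc n))"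
proof (rule tens_rel_separate)
  fix G assume G: "G \<in> BE (Suc (Suc n))"
  let ?xs = "b # z @ [b']"
  note mG = BE_multilin[OF G]
  note m = multilin_ml[OF mG]
  have "ev G (bar_act H B {#?xs#} {#[1, e]#}) = gact G [1, e] ?xs" using l by (simp add: ev_bar_act[OF G])
  also have "\<dots> = rsum (\<lambda>s t. TA (\<lambda>ys. bs (eps t) (G (lr 1 e ys))) s ?xs)"
    unfolding gact_def
  proof (intro psum_cong TA_cong_len)
    fix t and ys :: "'b list" assume "length ys = length ?xs"
    then obtain y w y' where ys: "ys = y # w @ [y']" using l list2E[of ys n] by (metis length_Cons length_append_singleton)
    show "G (lr (ac t ([1, e] ! 0)) ([1, e] ! 1) ys) = bs (eps t) (G (lr 1 e ys))"
      by (simp add: ys lr_eq act_unit bs_mult klin_scale[OF ml_slot0[OF m klin_id]])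
  qed
  also have "\<dots> = rsum (\<lambda>s t. bs (eps t) (TA (\<lambda>ys. G (lr 1 e ys)) s ?xs))"
    by (simp add: TA_klin[symmetric, where L="bs c" for c, OF klin_bs[OF klin_id]] del: TA.simps)
  also have "\<dots> = TA (\<lambda>ys. G (lr 1 e ys)) 1 ?xs"
    by (rule rsum_eps2) (intro klin_TA klin_id multilin_ml[OF lr_multilin[OF mG]])
  also have "\<dots> = G (b # z @ [b' * e])"
    by (subst TA_one[OF multilin_ml[OF lr_multilin[OF mG]]]) (simp add: lr_eq)
  finally show "ev G (bar_act H B {#?xs#} {#[1, e]#}) = ev G {#b # z @ [b' * e]#}" by simp
qed (use l in \<open>auto intro: bar_act_fsums\<close>)

lemma gof_HomG: assumes F: "F \<in> right_hom env (bar' n) reg" shows "gof n F \<in> HomG n"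
proof -
  let ?G = "gof n F"
  have GF: "?G xs = F (cl n {#xs#})" if "length xs = Suc (Suc n)" for xs using that by (simp add: gof_def)
  have Gadd: "?G (xs @ (a + b) # ys) = ?G (xs @ a # ys) + ?G (xs @ b # ys)" if l: "length xs + 1 + length ys = Suc (Suc n)" for xs ys a b
  proof -
    have "cl n {#xs @ (a + b) # ys#} = cl n ({#xs @ a # ys#} + {#xs @ b # ys#})"
      unfolding mset_pair by (rule tclass_eq[OF tens_rel.additive[OF l]])
    then show ?thesis using l right_hom_add[OF F, of "{#xs @ a # ys#}" "{#xs @ b # ys#}"] by (simp add: GF del: union_mset_add_mset_left)
  qed
  have Gbal: "?G (xs @ (a * e) # b # ys) = ?G (xs @ a # (e * b) # ys)" if "e \<in> E" and l: "length xs + 2 + length ys = Suc (Suc n)" for xs ys a b e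
    using tclass_eq[OF tens_rel.balanced[OF that]] l by (simp add: GF)
  \<comment> \<open>Module maps are only additive by definition; acting with 1 tensor c1 shows that
    scalars can be pulled out of the last factor.\<close>
  have Glast: "?G (b # z @ [b' * bs c 1]) = bs c (?G (b # z @ [b']))" if l: "length z = n" for b z b' c
  proof -
    have "?G (b # z @ [b' * bs c 1]) = F (cl n (bar_act H B {#b # z @ [b']#} {#[1, bs c 1]#}))"
      using tclass_eq[OF bar_act_one[OF l]] l by (simp add: GF)
    also have "\<dots> = rsum (\<lambda>s t. bs (eps t) (bs c (ac s (?G (b # z @ [b'])))))"
      using right_hom_smult[OF F, of "{#b # z @ [b']#}" "{#[1, bs c 1]#}"] l
      by (simp add: GF act_unit bs_mult mult.commute)
    also have "\<dots> = bs c (ac 1 (?G (b # z @ [b'])))" by (rule rsum_eps2) (intro klins)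
    finally show ?thesis by (simp add: act_one)
  qed
  \<comment> \<open>A scalar in another slot is first carried to the last factor by
    balancing.\<close>
  have Gscale: "?G (us @ bs c a # vs) = bs c (?G (us @ a # vs))" if l: "length us + 1 + length vs = Suc (Suc n)" for us vs a c
  proof (cases vs rule: rev_cases)
    case Nil
    then obtain b z where us: "us = b # z" "length z = n" using l by (cases us) auto
    show ?thesis using Glast[of z b a c] us by (simp add: Nil bs_mult)
  next
    case (snoc vs' v)
    have "({#us @ a # vs' @ bs c v # []#}, {#us @ bs c a # vs' @ v # []#}) \<in> tens_rel E (Suc (Suc n))"
      by (rule tens_rel_scale_move[OF scalars_E]) (use l snoc in simp)
    then have "?G (us @ bs c a # vs) = ?G (us @ a # vs' @ [bs c v])"
      using l by (simp add: GF snoc tclass_eq)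
    also have "\<dots> = bs c (?G (us @ a # vs))"
    proof -
      obtain b z where bz: "us @ a # vs' = b # z" by (cases "us @ a # vs'") auto
      have lz: "length z = n" using l snoc arg_cong[OF bz, of length] by simp
      have e: "us @ a # vs' @ [w] = b # z @ [w]" for w
        using arg_cong[OF bz, of "\<lambda>x. x @ [w]"] by simp
      show ?thesis unfolding snoc e using Glast[OF lz, of b v c] by (simp add: bs_mult)
    qed
    finally show ?thesis .
  qed
  have BE: "?G \<in> BE (Suc (Suc n))"
    unfolding BE_def multilin_def using Gadd Gbal Gscale by (auto simp: gof_def)
  show ?thesis unfolding HomG_def
  proof (intro CollectI conjI BE allI impI)
    fix c c' and xs :: "'b list" assume l: "length xs = Suc (Suc n)"
    have "gact ?G [c, c'] xs = ev ?G (bar_act H B {#xs#} {#[c, c']#})" using l by (simp add: ev_bar_act[OF BE])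
    also have "\<dots> = F (cl n (bar_act H B {#xs#} {#[c, c']#}))"
      using l by (intro right_hom_ev[OF F, symmetric] bar_act_fsums) simp
    also have "\<dots> = rsum (\<lambda>s t. ac t c * ac s (?G xs) * c')"
      using right_hom_smult[OF F, of "{#xs#}" "{#[c, c']#}"] l by (simp add: GF)
    finally show "gact ?G [c, c'] xs = rsum (\<lambda>s t. ac t c * ac s (?G xs) * c')" .
  qed
qed

text \<open>The inverse of \<open>gof\<close>. The value 0 off the carrier matches the normalisation
  of Hom complexes.\<close>

definition fof :: "nat => ('b list => 'b) => 'b list multiset set => 'b" where
  "fof n G X = (if X \<in> tens E (Suc (Suc n)) then the_elem (ev G ` X) else 0)"

lemma fof_class: assumes G: "G \<in> HomG n" and p: "p \<in> fsums (Suc (Suc n))" shows "fof n G (cl n p) = ev G p"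
  unfolding fof_def using the_elem_tclass[OF p, of E "ev G"] ev_BE[OF HomG_BE[OF G]] p
  by (simp add: tclass_in_tens)

lemma fof_hom: assumes G: "G \<in> HomG n" shows "fof n G \<in> right_hom env (bar' n) reg"
  unfolding right_hom_def bar_simps reg_simps env_carrier
proof (intro CollectI conjI ballI funcsetI)
  fix X assume "X \<in> tens E (Suc (Suc n))"
  then obtain p where p: "p \<in> fsums (Suc (Suc n))" and X: "X = cl n p" by (rule tensE)
  show "fof n G X \<in> UNIV" by simp
  {
    fix Y assume "Y \<in> tens E (Suc (Suc n))"
    then obtain q where q: "q \<in> fsums (Suc (Suc n))" and Y: "Y = cl n q" by (rule tensE)
    show "fof n G (X \<oplus>\<^bsub>bar' n\<^esub> Y) = fof n G X + fof n G Y" using p q by (simp add: X Y bar_add fof_class[OF G])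
  }
  fix U assume "U \<in> tens (scalars B) 2"
  then obtain u where u: "u \<in> fsums 2" and U: "U = cl2 u" by (rule tensE)
  have "ev G (bar_act H B p u) = ev (\<lambda>us. ev (gact G us) p) u"
    using p by (simp add: ev_bar_act[OF HomG_BE[OF G]]) (rule ev_swap)
  also have "\<dots> = ev (\<lambda>us. rsum (\<lambda>s t. ac t (us ! 0) * ac s (ev G p) * us ! 1)) u"
  proof (rule ev_cong[OF u])
    fix us :: "'b list" assume "length us = 2"
    then obtain c c' where us: "us = [c, c']" by (cases us; cases "tl us") auto
    have "ev (gact G us) p = ev (\<lambda>xs. rsum (\<lambda>s t. ac t c * ac s (G xs) * c')) p"
      unfolding us by (rule ev_cong[OF p]) (rule HomG_gact[OF G])
    also have "\<dots> = rsum (\<lambda>s t. ac t c * ac s (ev G p) * c')"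
      by (induction p) (simp_all add: psum_add klin_add[OF klin_act[OF klin_id]] distrib_left distrib_right)
    finally show "ev (gact G us) p = rsum (\<lambda>s t. ac t (us ! 0) * ac s (ev G p) * us ! 1)" by (simp add: us)
  qed
  finally show "fof n G (U \<odot>\<^bsub>bar' n\<^esub> X) = U \<odot>\<^bsub>reg\<^esub> fof n G X"
    using p u by (simp add: X U bar_smult fof_class[OF G] bar_act_fsums reg_smult)
qed

abbreviation "KB \<equiv> Hom_cx H B (bar H B E) (bar_diff E)"

lemma KB_simps: "F \<in> cochains KB n \<longleftrightarrow> F \<in> right_hom env (bar' n) reg \<and> (\<forall>X. X \<notin> tens E (Suc (Suc n)) \<longrightarrow> F X = 0)"
  "cdiff KB n F X = (if X \<in> tens E (Suc (Suc (Suc n))) then F (bar_diff E n X) else 0)"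
  by (simp_all add: Hom_cx_def bar_simps)

lemma restrict_eq: "restrict_bar E n F = rho n (gof n F)"
  by (rule ext) (simp add: restrict_bar_def rho_def gof_def)

lemma restrict_RC: "F \<in> cochains KB n ==> restrict_bar E n F \<in> RC n"
  unfolding restrict_eq by (intro rho_RC gof_HomG) (simp add: KB_simps)

lemma KB_eqI: assumes F: "F \<in> cochains KB n" "F' \<in> cochains KB n" and eq: "gof n F = gof n F'" shows "F = F'"
proof
  fix X show "F X = F' X"
  proof (cases "X \<in> tens E (Suc (Suc n))")
    case True
    then obtain p where "p \<in> fsums (Suc (Suc n))" "X = cl n p" by (rule tensE)
    then show ?thesis using right_hom_ev[of F n p] right_hom_ev[of F' n p] F eq by (simp add: KB_simps)
  qed (use F in \<open>simp add: KB_simps\<close>)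
qed

text \<open>Injective because an equivariant G is recovered by extending its restriction; surjective
  because the extension of a relative cochain descends to tensor classes.\<close>

lemma restrict_bij: "bij_betw (restrict_bar E n) (cochains KB n) (RC n)"
proof (rule bij_betwI')
  fix F F' assume F: "F \<in> cochains KB n" "F' \<in> cochains KB n"
  show "(restrict_bar E n F = restrict_bar E n F') = (F = F')"
  proof
    assume "restrict_bar E n F = restrict_bar E n F'"
    then have "ext n (rho n (gof n F)) = ext n (rho n (gof n F'))" by (simp only: restrict_eq)
    then have "gof n F = gof n F'" using F by (simp add: ext_rho gof_HomG KB_simps)
    then show "F = F'" by (rule KB_eqI[OF F])
  qed simp
next
  fix f assume f: "f \<in> RC n"
  note G = ext_HomG[OF f]
  have "gof n (fof n (ext n f)) = ext n f"
  proof
    fix xs show "gof n (fof n (ext n f)) xs = ext n f xs"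
      by (cases "length xs = Suc (Suc n)") (simp_all add: gof_def fof_class[OF G] multilin_len[OF ext_multilin[OF RC_multilin[OF f]]])
  qed
  then have "restrict_bar E n (fof n (ext n f)) = f" by (simp add: restrict_eq rho_ext[OF f])
  moreover have "fof n (ext n f) \<in> cochains KB n" using fof_hom[OF G] by (simp add: KB_simps) (simp add: fof_def)
  ultimately show "\<exists>F\<in>cochains KB n. f = restrict_bar E n F" by metis
qed (rule restrict_RC)

lemma KB_cdiff: assumes F: "F \<in> cochains KB n" shows "cdiff KB n F \<in> cochains KB (Suc n)"
proof -
  have "(\<lambda>x. F (bar_diff E n x)) \<in> right_hom env (bar' (Suc n)) reg"
    by (rule right_hom_comp[OF _ bar_diff_hom]) (use F in \<open>simp add: KB_simps\<close>)
  moreover have "x \<oplus>\<^bsub>bar' (Suc n)\<^esub> y \<in> tens E (Suc (Suc (Suc n)))"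
    if "x \<in> tens E (Suc (Suc (Suc n)))" "y \<in> tens E (Suc (Suc (Suc n)))" for x y
    using that by (auto simp: bar_add elim!: tensE intro!: tclass_in_tens)
  moreover have "r \<odot>\<^bsub>bar' (Suc n)\<^esub> x \<in> tens E (Suc (Suc (Suc n)))"
    if "x \<in> tens E (Suc (Suc (Suc n)))" "r \<in> carrier env" for x r
    using that by (auto simp: env_carrier bar_smult bar_act_fsums elim!: tensE intro!: tclass_in_tens)
  ultimately have "cdiff KB n F \<in> right_hom env (bar' (Suc n)) reg"
    unfolding right_hom_def bar_simps by (auto simp: KB_simps reg_simps)
  then show ?thesis by (simp add: KB_simps)
qed

lemma restrict_cdiff: assumes F: "F \<in> cochains KB n"
  shows "restrict_bar E (Suc n) (cdiff KB n F) = D n (restrict_bar E n F)"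
proof -
  have h: "F \<in> right_hom env (bar' n) reg" using F by (simp add: KB_simps)
  note G = gof_HomG[OF h]
  have "gof (Suc n) (cdiff KB n F) = dG n (gof n F)"
  proof
    fix xs :: "'b list" show "gof (Suc n) (cdiff KB n F) xs = dG n (gof n F) xs"
    proof (cases "length xs = Suc (Suc (Suc n))")
      case True
      then have "gof (Suc n) (cdiff KB n F) xs = F (cl n (bdiff n {#xs#}))"
        by (simp add: gof_def KB_simps tclass_in_tens bar_diff_class)
      also have "\<dots> = ev (gof n F) (bdiff n {#xs#})" by (rule right_hom_ev[OF h]) (use True in \<open>simp add: bdiff_fsums\<close>)
      finally show ?thesis using True by (simp add: ev_bdiff[OF HomG_BE[OF G]])
    qed (simp add: gof_def multilin_len[OF BE_multilin[OF dG_BE[OF HomG_BE[OF G]]]])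
  qed
  then show ?thesis by (simp add: restrict_eq rho_dG[OF G])
qed

end

section \<open>Projective resolutions\<close>

lemma right_moduleD: assumes "right_module R M"
  shows "abelian_group M" "r \<in> carrier R ==> x \<in> carrier M ==> r \<odot>\<^bsub>M\<^esub> x \<in> carrier M"
    "r \<in> carrier R ==> x \<in> carrier M ==> y \<in> carrier M ==> r \<odot>\<^bsub>M\<^esub> (x \<oplus>\<^bsub>M\<^esub> y) = r \<odot>\<^bsub>M\<^esub> x \<oplus>\<^bsub>M\<^esub> r \<odot>\<^bsub>M\<^esub> y"
    "r \<in> carrier R ==> s \<in> carrier R ==> x \<in> carrier M ==> (r \<oplus>\<^bsub>R\<^esub> s) \<odot>\<^bsub>M\<^esub> x = r \<odot>\<^bsub>M\<^esub> x \<oplus>\<^bsub>M\<^esub> s \<odot>\<^bsub>M\<^esub> x"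
    "r \<in> carrier R ==> s \<in> carrier R ==> x \<in> carrier M ==> (r \<otimes>\<^bsub>R\<^esub> s) \<odot>\<^bsub>M\<^esub> x = s \<odot>\<^bsub>M\<^esub> (r \<odot>\<^bsub>M\<^esub> x)"
  using assms by (auto simp: right_module_def)

lemma right_homD: assumes "f \<in> right_hom R M N"
  shows "x \<in> carrier M ==> f x \<in> carrier N"
    "x \<in> carrier M ==> y \<in> carrier M ==> f (x \<oplus>\<^bsub>M\<^esub> y) = f x \<oplus>\<^bsub>N\<^esub> f y"
    "r \<in> carrier R ==> x \<in> carrier M ==> f (r \<odot>\<^bsub>M\<^esub> x) = r \<odot>\<^bsub>N\<^esub> f x"
  using assms by (auto simp: right_hom_def)

lemma right_homI:
  "(\<And>x. x \<in> carrier M ==> f x \<in> carrier N) ==>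
   (\<And>x y. x \<in> carrier M ==> y \<in> carrier M ==> f (x \<oplus>\<^bsub>M\<^esub> y) = f x \<oplus>\<^bsub>N\<^esub> f y) ==>
   (\<And>r x. r \<in> carrier R ==> x \<in> carrier M ==> f (r \<odot>\<^bsub>M\<^esub> x) = r \<odot>\<^bsub>N\<^esub> f x) ==> f \<in> right_hom R M N"
  by (auto simp: right_hom_def)

lemma additive_zero:
  assumes "abelian_group M" "abelian_group N" "f \<in> carrier M \<rightarrow> carrier N"
    and "\<And>x y. x \<in> carrier M ==> y \<in> carrier M ==> f (x \<oplus>\<^bsub>M\<^esub> y) = f x \<oplus>\<^bsub>N\<^esub> f y"
  shows "f \<zero>\<^bsub>M\<^esub> = \<zero>\<^bsub>N\<^esub>"
proof -
  interpret M: abelian_group M by fact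
  interpret N: abelian_group N by fact
  have "f \<zero>\<^bsub>M\<^esub> \<oplus>\<^bsub>N\<^esub> f \<zero>\<^bsub>M\<^esub> = f \<zero>\<^bsub>M\<^esub>" using assms(4)[OF M.zero_closed M.zero_closed] by simp
  then show ?thesis using assms(3) N.add.l_cancel_one'[of "f \<zero>\<^bsub>M\<^esub>" "f \<zero>\<^bsub>M\<^esub>"] by auto
qed

lemma additive_minus:
  assumes "abelian_group M" "abelian_group N" "f \<in> carrier M \<rightarrow> carrier N"
    and "\<And>x y. x \<in> carrier M ==> y \<in> carrier M ==> f (x \<oplus>\<^bsub>M\<^esub> y) = f x \<oplus>\<^bsub>N\<^esub> f y"
    and x: "x \<in> carrier M"
  shows "f (\<ominus>\<^bsub>M\<^esub> x) = \<ominus>\<^bsub>N\<^esub> f x"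
proof -
  interpret M: abelian_group M by fact
  interpret N: abelian_group N by fact
  have "f (\<ominus>\<^bsub>M\<^esub> x) \<oplus>\<^bsub>N\<^esub> f x = \<zero>\<^bsub>N\<^esub>"
    using assms(4)[of "\<ominus>\<^bsub>M\<^esub> x" x] x by (simp add: M.l_neg additive_zero[OF assms(1-4)])
  then show ?thesis using N.minus_equality assms(3) x by (metis M.a_inv_closed PiE)
qed

lemma additive_finsum:
  assumes "abelian_group M" "abelian_group N" "f \<in> carrier M \<rightarrow> carrier N"
    and "\<And>x y. x \<in> carrier M ==> y \<in> carrier M ==> f (x \<oplus>\<^bsub>M\<^esub> y) = f x \<oplus>\<^bsub>N\<^esub> f y"
    and "finite A" "g \<in> A \<rightarrow> carrier M"
  shows "f (finsum M g A) = finsum N (\<lambda>q. f (g q)) A"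
  using assms(5,6)
proof (induction A)
  case empty
  interpret M: abelian_group M by fact
  interpret N: abelian_group N by fact
  show ?case using additive_zero[OF assms(1-4)] by simp
next
  case (insert a A)
  interpret M: abelian_group M by fact
  interpret N: abelian_group N by fact
  have "(\<lambda>q. f (g q)) \<in> A \<rightarrow> carrier N" "f (g a) \<in> carrier N" using insert.prems assms(3) by auto
  then show ?case using insert by (simp add: M.finsum_insert N.finsum_insert assms(4) Pi_iff)
qed

lemma right_hom_zero: "f \<in> right_hom R M N ==> abelian_group M ==> abelian_group N ==> f \<zero>\<^bsub>M\<^esub> = \<zero>\<^bsub>N\<^esub>"
  by (rule additive_zero) (auto simp: right_hom_def)
lemma right_hom_uminus: "f \<in> right_hom R M N ==> abelian_group M ==> abelian_group N ==> x \<in> carrier M ==> f (\<ominus>\<^bsub>M\<^esub> x) = \<ominus>\<^bsub>N\<^esub> f x"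
  by (rule additive_minus) (auto simp: right_hom_def)
lemma right_hom_minus: assumes "f \<in> right_hom R M N" "abelian_group M" "abelian_group N" "x \<in> carrier M" "y \<in> carrier M"
  shows "f (x \<ominus>\<^bsub>M\<^esub> y) = f x \<ominus>\<^bsub>N\<^esub> f y"
proof -
  interpret M: abelian_group M by fact
  show ?thesis using assms by (simp add: a_minus_def right_homD(2)[OF assms(1)] right_hom_uminus)
qed

lemma right_hom_diff:
  assumes f: "f \<in> right_hom R M N" and g: "g \<in> right_hom R M N" and N: "right_module R N"
  shows "(\<lambda>x. f x \<ominus>\<^bsub>N\<^esub> g x) \<in> right_hom R M N"
proof -
  interpret N: abelian_group N using N by (rule right_moduleD)
  note fD = right_homD[OF f] and gD = right_homD[OF g] and rD = right_moduleD[OF N]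
  have neg: "r \<odot>\<^bsub>N\<^esub> (\<ominus>\<^bsub>N\<^esub> y) = \<ominus>\<^bsub>N\<^esub> (r \<odot>\<^bsub>N\<^esub> y)" if "r \<in> carrier R" "y \<in> carrier N" for r y
    by (rule additive_minus[OF rD(1) rD(1)]) (use that rD in auto)
  show ?thesis
  proof (rule right_homI)
    fix x y assume "x \<in> carrier M" "y \<in> carrier M"
    then show "f (x \<oplus>\<^bsub>M\<^esub> y) \<ominus>\<^bsub>N\<^esub> g (x \<oplus>\<^bsub>M\<^esub> y) = (f x \<ominus>\<^bsub>N\<^esub> g x) \<oplus>\<^bsub>N\<^esub> (f y \<ominus>\<^bsub>N\<^esub> g y)"
      using fD gD by (simp add: a_minus_def N.minus_add N.a_ac)
  next
    fix r x assume "r \<in> carrier R" "x \<in> carrier M"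
    then show "f (r \<odot>\<^bsub>M\<^esub> x) \<ominus>\<^bsub>N\<^esub> g (r \<odot>\<^bsub>M\<^esub> x) = r \<odot>\<^bsub>N\<^esub> (f x \<ominus>\<^bsub>N\<^esub> g x)"
      using fD gD by (simp add: a_minus_def rD(3) neg)
  qed (simp add: fD gD)
qed

text \<open>The lift goes through the free cover: preimages \<open>l q\<close> of the values
  \<open>f q\<close> are chosen and combined with the coordinates \<sigma>.\<close>

lemma projective_lift:
  assumes R0: "\<zero>\<^bsub>R\<^esub> \<in> carrier R" "\<zero>\<^bsub>R\<^esub> \<oplus>\<^bsub>R\<^esub> \<zero>\<^bsub>R\<^esub> = \<zero>\<^bsub>R\<^esub>"
    and M: "projective_right_module R M" and L: "right_module R L" and N: "abelian_group N"
    and f: "f \<in> right_hom R M N" and p: "p \<in> right_hom R L N"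
    and im: "\<And>x. x \<in> carrier M ==> f x \<in> p ` carrier L"
  shows "\<exists>g\<in>right_hom R M L. \<forall>x\<in>carrier M. p (g x) = f x"
proof -
  obtain \<sigma> where rM: "right_module R M"
    and a: "\<forall>x\<in>carrier M. \<forall>q\<in>carrier M. \<sigma> x q \<in> carrier R"
    "\<forall>x\<in>carrier M. finite {q \<in> carrier M. \<sigma> x q \<noteq> \<zero>\<^bsub>R\<^esub>}"
    "\<forall>x\<in>carrier M. \<forall>y\<in>carrier M. \<forall>q\<in>carrier M. \<sigma> (x \<oplus>\<^bsub>M\<^esub> y) q = \<sigma> x q \<oplus>\<^bsub>R\<^esub> \<sigma> y q"
    "\<forall>r\<in>carrier R. \<forall>x\<in>carrier M. \<forall>q\<in>carrier M. \<sigma> (r \<odot>\<^bsub>M\<^esub> x) q = \<sigma> x q \<otimes>\<^bsub>R\<^esub> r"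
    "\<forall>x\<in>carrier M. x = (\<Oplus>\<^bsub>M\<^esub>q\<in>{q \<in> carrier M. \<sigma> x q \<noteq> \<zero>\<^bsub>R\<^esub>}. \<sigma> x q \<odot>\<^bsub>M\<^esub> q)"
    using M unfolding projective_right_module_def by (elim conjE exE) (rule that; assumption)
  note s1 = a(1)[rule_format] and s2 = a(2)[rule_format] and s3 = a(3)[rule_format] and s4 = a(4)[rule_format]
    and s5 = a(5)[THEN bspec]
  interpret M: abelian_group M using rM by (rule right_moduleD)
  interpret L: abelian_group L using L by (rule right_moduleD)
  interpret N: abelian_group N by fact
  note LD = right_moduleD[OF L] and MD = right_moduleD[OF rM]
  have z: "\<zero>\<^bsub>R\<^esub> \<odot>\<^bsub>L\<^esub> y = \<zero>\<^bsub>L\<^esub>" if "y \<in> carrier L" for y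
  proof -
    have "\<zero>\<^bsub>R\<^esub> \<odot>\<^bsub>L\<^esub> y \<oplus>\<^bsub>L\<^esub> \<zero>\<^bsub>R\<^esub> \<odot>\<^bsub>L\<^esub> y = \<zero>\<^bsub>R\<^esub> \<odot>\<^bsub>L\<^esub> y" using LD(4)[OF R0(1) R0(1) that] R0(2) by simp
    then show ?thesis using L.add.l_cancel_one' LD(2)[OF R0(1) that] by metis
  qed
  have rz: "r \<odot>\<^bsub>L\<^esub> \<zero>\<^bsub>L\<^esub> = \<zero>\<^bsub>L\<^esub>" if "r \<in> carrier R" for r
    by (rule additive_zero[OF LD(1) LD(1)]) (use that LD in auto)
  define l where "l q = (SOME y. y \<in> carrier L \<and> p y = f q)" for q
  have l: "l q \<in> carrier L" "p (l q) = f q" if "q \<in> carrier M" for q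
  proof -
    have "\<exists>y. y \<in> carrier L \<and> p y = f q" using im[OF that] by auto
    from someI_ex[OF this] show "l q \<in> carrier L" "p (l q) = f q" by (simp_all add: l_def)
  qed
  define supp where "supp x = {q \<in> carrier M. \<sigma> x q \<noteq> \<zero>\<^bsub>R\<^esub>}" for x
  have supp: "finite (supp x)" "supp x \<subseteq> carrier M" if "x \<in> carrier M" for x using s2[OF that] by (auto simp: supp_def)
  define g where "g x = (\<Oplus>\<^bsub>L\<^esub>q\<in>supp x. \<sigma> x q \<odot>\<^bsub>L\<^esub> l q)" for x
  have tc: "\<sigma> x q \<odot>\<^bsub>L\<^esub> l q \<in> carrier L" if "x \<in> carrier M" "q \<in> carrier M" for x q
    using LD(2)[OF s1[OF that] l(1)[OF that(2)]] .
  \<comment> \<open>Supports vary with x. To compare two of these sums they are extended by zero to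
    a common finite index set.\<close>
  have g: "g x = (\<Oplus>\<^bsub>L\<^esub>q\<in>A. \<sigma> x q \<odot>\<^bsub>L\<^esub> l q)" if "finite A" "supp x \<subseteq> A" "A \<subseteq> carrier M" "x \<in> carrier M" for x A
    unfolding g_def
  proof (rule L.add.finprod_mono_neutral_cong_left[OF that(1,2)])
    show "\<sigma> x i \<odot>\<^bsub>L\<^esub> l i = \<zero>\<^bsub>L\<^esub>" if "i \<in> A - supp x" for i
      using that \<open>A \<subseteq> carrier M\<close> by (auto simp: supp_def z l)
    show "(\<lambda>q. \<sigma> x q \<odot>\<^bsub>L\<^esub> l q) \<in> A \<rightarrow> carrier L" using that tc by auto
  qed simp
  have gh: "g \<in> right_hom R M L"
  proof (rule right_homI)
    fix x assume x: "x \<in> carrier M"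
    show "g x \<in> carrier L" unfolding g_def by (rule L.finsum_closed) (use supp[OF x] x tc in auto)
    {
      fix y assume y: "y \<in> carrier M"
      let ?A = "supp x \<union> supp y \<union> supp (x \<oplus>\<^bsub>M\<^esub> y)"
      have A: "finite ?A" "?A \<subseteq> carrier M" using supp[OF x] supp[OF y] supp[OF M.a_closed[OF x y]] by auto
      have "g (x \<oplus>\<^bsub>M\<^esub> y) = (\<Oplus>\<^bsub>L\<^esub>q\<in>?A. \<sigma> (x \<oplus>\<^bsub>M\<^esub> y) q \<odot>\<^bsub>L\<^esub> l q)" by (rule g) (use A x y in auto)
      also have "\<dots> = (\<Oplus>\<^bsub>L\<^esub>q\<in>?A. \<sigma> x q \<odot>\<^bsub>L\<^esub> l q \<oplus>\<^bsub>L\<^esub> \<sigma> y q \<odot>\<^bsub>L\<^esub> l q)"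
      proof (rule L.finsum_cong'[OF HOL.refl])
        show "(\<lambda>q. \<sigma> x q \<odot>\<^bsub>L\<^esub> l q \<oplus>\<^bsub>L\<^esub> \<sigma> y q \<odot>\<^bsub>L\<^esub> l q) \<in> ?A \<rightarrow> carrier L" using A(2) x y tc by (auto simp: subset_iff)
        fix q assume "q \<in> ?A"
        then have "q \<in> carrier M" using A(2) by auto
        then show "\<sigma> (x \<oplus>\<^bsub>M\<^esub> y) q \<odot>\<^bsub>L\<^esub> l q = \<sigma> x q \<odot>\<^bsub>L\<^esub> l q \<oplus>\<^bsub>L\<^esub> \<sigma> y q \<odot>\<^bsub>L\<^esub> l q"
          using x y by (simp add: s3 LD(4) s1 l)
      qed
      also have "\<dots> = (\<Oplus>\<^bsub>L\<^esub>q\<in>?A. \<sigma> x q \<odot>\<^bsub>L\<^esub> l q) \<oplus>\<^bsub>L\<^esub> (\<Oplus>\<^bsub>L\<^esub>q\<in>?A. \<sigma> y q \<odot>\<^bsub>L\<^esub> l q)"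
        by (rule L.finsum_addf) (use A(2) x y tc in \<open>auto simp: subset_iff\<close>)
      also have "\<dots> = g x \<oplus>\<^bsub>L\<^esub> g y"
        unfolding g[OF A(1) _ A(2) x, OF le_supI1[OF sup_ge1]] g[OF A(1) _ A(2) y, OF le_supI1[OF sup_ge2]] ..
      finally show "g (x \<oplus>\<^bsub>M\<^esub> y) = g x \<oplus>\<^bsub>L\<^esub> g y" .
    }
    fix r assume r: "r \<in> carrier R"
    have rx: "r \<odot>\<^bsub>M\<^esub> x \<in> carrier M" using MD(2)[OF r x] .
    let ?A = "supp x \<union> supp (r \<odot>\<^bsub>M\<^esub> x)"
    have A: "finite ?A" "?A \<subseteq> carrier M" using supp[OF x] supp[OF rx] by auto
    have "g (r \<odot>\<^bsub>M\<^esub> x) = (\<Oplus>\<^bsub>L\<^esub>q\<in>?A. \<sigma> (r \<odot>\<^bsub>M\<^esub> x) q \<odot>\<^bsub>L\<^esub> l q)" by (rule g) (use A rx in auto)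
    also have "\<dots> = (\<Oplus>\<^bsub>L\<^esub>q\<in>?A. r \<odot>\<^bsub>L\<^esub> (\<sigma> x q \<odot>\<^bsub>L\<^esub> l q))"
    proof (rule L.finsum_cong'[OF HOL.refl])
      show "(\<lambda>q. r \<odot>\<^bsub>L\<^esub> (\<sigma> x q \<odot>\<^bsub>L\<^esub> l q)) \<in> ?A \<rightarrow> carrier L" using A(2) x tc LD(2)[OF r] by (auto simp: subset_iff)
      fix q assume "q \<in> ?A"
      then have "q \<in> carrier M" using A(2) by auto
      then show "\<sigma> (r \<odot>\<^bsub>M\<^esub> x) q \<odot>\<^bsub>L\<^esub> l q = r \<odot>\<^bsub>L\<^esub> (\<sigma> x q \<odot>\<^bsub>L\<^esub> l q)"
        using x r by (simp add: s4 LD(5) s1 l)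
    qed
    also have "\<dots> = r \<odot>\<^bsub>L\<^esub> (\<Oplus>\<^bsub>L\<^esub>q\<in>?A. \<sigma> x q \<odot>\<^bsub>L\<^esub> l q)"
      by (rule additive_finsum[OF LD(1) LD(1), symmetric]) (use A x tc LD(2,3)[OF r] in \<open>auto simp: subset_iff\<close>)
    also have "\<dots> = r \<odot>\<^bsub>L\<^esub> g x" unfolding g[OF A(1) sup_ge1 A(2) x] ..
    finally show "g (r \<odot>\<^bsub>M\<^esub> x) = r \<odot>\<^bsub>L\<^esub> g x" .
  qed
  have "p (g x) = f x" if x: "x \<in> carrier M" for x
  proof -
    have "p (g x) = (\<Oplus>\<^bsub>N\<^esub>q\<in>supp x. p (\<sigma> x q \<odot>\<^bsub>L\<^esub> l q))"
      unfolding g_def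
      by (rule additive_finsum[OF LD(1) N]) (use supp[OF x] tc[OF x] right_homD[OF p] in \<open>auto simp: subset_iff\<close>)
    also have "\<dots> = (\<Oplus>\<^bsub>N\<^esub>q\<in>supp x. f (\<sigma> x q \<odot>\<^bsub>M\<^esub> q))"
    proof (rule N.finsum_cong'[OF HOL.refl])
      show "(\<lambda>q. f (\<sigma> x q \<odot>\<^bsub>M\<^esub> q)) \<in> supp x \<rightarrow> carrier N"
        using supp[OF x] x right_homD(1)[OF f] MD(2) s1 by (auto simp: subset_iff)
      fix q assume "q \<in> supp x"
      then have "q \<in> carrier M" using supp(2)[OF x] by auto
      then show "p (\<sigma> x q \<odot>\<^bsub>L\<^esub> l q) = f (\<sigma> x q \<odot>\<^bsub>M\<^esub> q)"
        using x by (simp add: right_homD(3)[OF p] right_homD(3)[OF f] s1 l)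
    qed
    also have "\<dots> = f (\<Oplus>\<^bsub>M\<^esub>q\<in>supp x. \<sigma> x q \<odot>\<^bsub>M\<^esub> q)"
      by (rule additive_finsum[OF MD(1) N, symmetric]) (use supp[OF x] x s1 MD(2) right_homD[OF f] in \<open>auto simp: subset_iff\<close>)
    also have "\<dots> = f x" using s5[OF x] by (simp add: supp_def)
    finally show ?thesis .
  qed
  with gh show ?thesis by blast
qed

locale resolution_pair =
  fixes R :: "'r ring" and M :: "('r, 'm) module"
    and P :: "nat => ('r, 'p) module" and d \<eta> and C :: "nat => ('r, 'c) module" and d' \<eta>'
  assumes R0: "\<zero>\<^bsub>R\<^esub> \<in> carrier R" "\<zero>\<^bsub>R\<^esub> \<oplus>\<^bsub>R\<^esub> \<zero>\<^bsub>R\<^esub> = \<zero>\<^bsub>R\<^esub>"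
    and M: "abelian_group M"
    and P: "projective_resolution R M P d \<eta>" and C: "projective_resolution R M C d' \<eta>'"
begin

lemma Pproj: "projective_right_module R (P n)" using P by (simp add: projective_resolution_def)
lemma Pmod: "right_module R (P n)" using Pproj by (simp add: projective_right_module_def)
lemma Cmod: "right_module R (C n)" using C by (simp add: projective_resolution_def projective_right_module_def)
lemma Pab: "abelian_group (P n)" using Pmod by (rule right_moduleD)
lemma Cab: "abelian_group (C n)" using Cmod by (rule right_moduleD)
lemma d: "d n \<in> right_hom R (P (Suc n)) (P n)" and d': "d' n \<in> right_hom R (C (Suc n)) (C n)"
  and \<eta>: "\<eta> \<in> right_hom R (P 0) M" and \<eta>': "\<eta>' \<in> right_hom R (C 0) M"
  using P C by (simp_all add: projective_resolution_def)
lemma \<eta>'_surj: "\<eta>' ` carrier (C 0) = carrier M" using C by (simp add: projective_resolution_def)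
lemma exact0: "{x \<in> carrier (C 0). \<eta>' x = \<zero>\<^bsub>M\<^esub>} = d' 0 ` carrier (C (Suc 0))" using C by (simp add: projective_resolution_def)
lemma exact: "{x \<in> carrier (C (Suc n)). d' n x = \<zero>\<^bsub>C n\<^esub>} = d' (Suc n) ` carrier (C (Suc (Suc n)))" using C by (simp add: projective_resolution_def)
lemma \<eta>d: "x \<in> carrier (P (Suc 0)) ==> \<eta> (d 0 x) = \<zero>\<^bsub>M\<^esub>" using P by (auto simp: projective_resolution_def)
lemma dd: "x \<in> carrier (P (Suc (Suc n))) ==> d n (d (Suc n) x) = \<zero>\<^bsub>P n\<^esub>"
  using P unfolding projective_resolution_def by blast
lemma d_closed: "x \<in> carrier (P (Suc n)) ==> d n x \<in> carrier (P n)" by (rule right_homD(1)[OF d])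

definition chain_map :: "(nat => 'p => 'c) => bool" where
  "chain_map \<phi> \<longleftrightarrow> (\<forall>n. \<phi> n \<in> right_hom R (P n) (C n)) \<and>
     (\<forall>n. \<forall>x\<in>carrier (P (Suc n)). d' n (\<phi> (Suc n) x) = \<phi> n (d n x)) \<and>
     (\<forall>x\<in>carrier (P 0). \<eta>' (\<phi> 0 x) = \<eta> x)"

lemma chain_map_exists: "\<exists>\<phi>. chain_map \<phi>"
proof -
  \<comment> \<open>The invariant includes that f carries boundaries into the image of
    \<open>d'\<close>, which is the hypothesis of the next lift. Exactness of C re-establishes it
    one degree higher.\<close>
  define Q where "Q n f \<longleftrightarrow> f \<in> right_hom R (P n) (C n) \<and>
     (\<forall>x\<in>carrier (P (Suc n)). f (d n x) \<in> d' n ` carrier (C (Suc n))) \<and> (n = 0 \<longrightarrow> (\<forall>x\<in>carrier (P 0). \<eta>' (f x) = \<eta> x))" for n f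
  have "\<exists>f. Q 0 f"
  proof -
    obtain f where f: "f \<in> right_hom R (P 0) (C 0)" "\<forall>x\<in>carrier (P 0). \<eta>' (f x) = \<eta> x"
      using projective_lift[OF R0 Pproj Cmod M \<eta> \<eta>'] right_homD(1)[OF \<eta>] \<eta>'_surj by auto
    have "f (d 0 x) \<in> d' 0 ` carrier (C (Suc 0))" if "x \<in> carrier (P (Suc 0))" for x
      unfolding exact0[symmetric] using f d_closed[OF that] \<eta>d[OF that] right_homD(1)[OF f(1)] by auto
    then show ?thesis using f unfolding Q_def by auto
  qed
  moreover have "\<exists>g. Q (Suc n) g \<and> (\<forall>x\<in>carrier (P (Suc n)). d' n (g x) = f (d n x))" if "Q n f" for n f
  proof -
    have f: "f \<in> right_hom R (P n) (C n)" "\<And>x. x \<in> carrier (P (Suc n)) ==> f (d n x) \<in> d' n ` carrier (C (Suc n))"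
      using that by (auto simp: Q_def)
    obtain g where g: "g \<in> right_hom R (P (Suc n)) (C (Suc n))" "\<forall>x\<in>carrier (P (Suc n)). d' n (g x) = f (d n x)"
      using projective_lift[OF R0 Pproj Cmod Cab right_hom_comp[OF f(1) d] d' f(2)] by blast
    have "g (d (Suc n) x) \<in> d' (Suc n) ` carrier (C (Suc (Suc n)))" if "x \<in> carrier (P (Suc (Suc n)))" for x
      unfolding exact[symmetric]
      using g(2) d_closed[OF that] dd[OF that] right_homD(1)[OF g(1)] right_hom_zero[OF f(1) Pab Cab] by auto
    then show ?thesis using g unfolding Q_def by auto
  qed
  ultimately have "\<exists>\<phi>. \<forall>n. Q n (\<phi> n) \<and> (\<forall>x\<in>carrier (P (Suc n)). d' n (\<phi> (Suc n) x) = \<phi> n (d n x))"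
    by (rule dependent_nat_choice)
  then show ?thesis unfolding chain_map_def Q_def by blast
qed

lemma chain_homotopy:
  assumes \<phi>: "chain_map \<phi>" and \<psi>: "chain_map \<psi>"
  shows "\<exists>s. (\<forall>n. s n \<in> right_hom R (P n) (C (Suc n))) \<and>
    (\<forall>x\<in>carrier (P 0). d' 0 (s 0 x) = \<phi> 0 x \<ominus>\<^bsub>C 0\<^esub> \<psi> 0 x) \<and>
    (\<forall>n. \<forall>x\<in>carrier (P (Suc n)). d' (Suc n) (s (Suc n) x) = (\<phi> (Suc n) x \<ominus>\<^bsub>C (Suc n)\<^esub> \<psi> (Suc n) x) \<ominus>\<^bsub>C (Suc n)\<^esub> s n (d n x))"
proof -
  have h: "\<phi> n \<in> right_hom R (P n) (C n)" "\<psi> n \<in> right_hom R (P n) (C n)" for n using \<phi> \<psi> by (auto simp: chain_map_def)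
  define \<delta> where "\<delta> n x = \<phi> n x \<ominus>\<^bsub>C n\<^esub> \<psi> n x" for n x
  have \<delta>: "\<delta> n \<in> right_hom R (P n) (C n)" for n unfolding \<delta>_def[abs_def] by (rule right_hom_diff[OF h Cmod])
  have \<delta>d: "d' n (\<delta> (Suc n) x) = \<delta> n (d n x)" if "x \<in> carrier (P (Suc n))" for n x
    unfolding \<delta>_def using \<phi> \<psi> that right_homD(1)[OF h(1) that] right_homD(1)[OF h(2) that]
    by (simp add: right_hom_minus[OF d' Cab Cab] chain_map_def)
  \<comment> \<open>The condition \<open>d' s d = \<delta> d\<close> says that \<delta> minus
    \<open>s d\<close> takes values in the kernel of \<open>d'\<close>, hence by exactness in the
    image where the next s is lifted.\<close>
  define Q where "Q n s \<longleftrightarrow> s \<in> right_hom R (P n) (C (Suc n)) \<and>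
     (\<forall>x\<in>carrier (P (Suc n)). d' n (s (d n x)) = \<delta> n (d n x)) \<and> (n = 0 \<longrightarrow> (\<forall>x\<in>carrier (P 0). d' 0 (s x) = \<delta> 0 x))" for n s
  have "\<exists>s. Q 0 s"
  proof -
    interpret M: abelian_group M by (rule M)
    have "\<delta> 0 x \<in> d' 0 ` carrier (C (Suc 0))" if x: "x \<in> carrier (P 0)" for x
    proof -
      have c: "\<phi> 0 x \<in> carrier (C 0)" "\<psi> 0 x \<in> carrier (C 0)" "\<delta> 0 x \<in> carrier (C 0)"
        using right_homD(1)[OF \<delta> x] right_homD(1)[OF h(1) x] right_homD(1)[OF h(2) x] by auto
      have "\<eta>' (\<delta> 0 x) = \<eta>' (\<phi> 0 x) \<ominus>\<^bsub>M\<^esub> \<eta>' (\<psi> 0 x)"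
        unfolding \<delta>_def by (rule right_hom_minus[OF \<eta>' Cab M c(1,2)])
      also have "\<dots> = \<zero>\<^bsub>M\<^esub>" using \<phi> \<psi> x right_homD(1)[OF \<eta> x] by (simp add: chain_map_def a_minus_def M.r_neg)
      finally show ?thesis unfolding exact0[symmetric] using c by simp
    qed
    then obtain s where "s \<in> right_hom R (P 0) (C (Suc 0))" "\<forall>x\<in>carrier (P 0). d' 0 (s x) = \<delta> 0 x"
      using projective_lift[OF R0 Pproj Cmod Cab \<delta> d'] by blast
    then show ?thesis unfolding Q_def using d_closed by auto
  qed
  moreover have "\<exists>s'. Q (Suc n) s' \<and> (\<forall>x\<in>carrier (P (Suc n)). d' (Suc n) (s' x) = \<delta> (Suc n) x \<ominus>\<^bsub>C (Suc n)\<^esub> s (d n x))" if Q: "Q n s" for n s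
  proof -
    interpret Cn: abelian_group "C n" by (rule Cab)
    interpret CS: abelian_group "C (Suc n)" by (rule Cab)
    have s: "s \<in> right_hom R (P n) (C (Suc n))" and sd: "\<And>x. x \<in> carrier (P (Suc n)) ==> d' n (s (d n x)) = \<delta> n (d n x)"
      using Q by (auto simp: Q_def)
    have e: "(\<lambda>x. \<delta> (Suc n) x \<ominus>\<^bsub>C (Suc n)\<^esub> s (d n x)) \<in> right_hom R (P (Suc n)) (C (Suc n))"
      by (rule right_hom_diff[OF \<delta> right_hom_comp[OF s d] Cmod])
    have "\<delta> (Suc n) x \<ominus>\<^bsub>C (Suc n)\<^esub> s (d n x) \<in> d' (Suc n) ` carrier (C (Suc (Suc n)))" if x: "x \<in> carrier (P (Suc n))" for x
    proof -
      have c: "\<delta> (Suc n) x \<in> carrier (C (Suc n))" "s (d n x) \<in> carrier (C (Suc n))" "\<delta> n (d n x) \<in> carrier (C n)"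
        using right_homD(1)[OF \<delta>] right_homD(1)[OF s] d_closed x by auto
      have "d' n (\<delta> (Suc n) x \<ominus>\<^bsub>C (Suc n)\<^esub> s (d n x)) = \<zero>\<^bsub>C n\<^esub>"
        unfolding right_hom_minus[OF d' Cab Cab c(1,2)] using c x by (simp add: \<delta>d sd a_minus_def Cn.r_neg)
      then show ?thesis unfolding exact[symmetric] using c by simp
    qed
    then obtain s' where s': "s' \<in> right_hom R (P (Suc n)) (C (Suc (Suc n)))"
      "\<forall>x\<in>carrier (P (Suc n)). d' (Suc n) (s' x) = \<delta> (Suc n) x \<ominus>\<^bsub>C (Suc n)\<^esub> s (d n x)"
      using projective_lift[OF R0 Pproj Cmod Cab e d'] by blast
    have "d' (Suc n) (s' (d (Suc n) x)) = \<delta> (Suc n) (d (Suc n) x)" if x: "x \<in> carrier (P (Suc (Suc n)))" for x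
      using s'(2) d_closed[OF x] dd[OF x] right_hom_zero[OF s Pab Cab] right_homD(1)[OF \<delta> d_closed[OF x]]
      by (simp add: a_minus_def)
    then show ?thesis using s' unfolding Q_def by auto
  qed
  ultimately have "\<exists>s. \<forall>n. Q n (s n) \<and> (\<forall>x\<in>carrier (P (Suc n)). d' (Suc n) (s (Suc n) x) = \<delta> (Suc n) x \<ominus>\<^bsub>C (Suc n)\<^esub> s n (d n x))"
    by (rule dependent_nat_choice)
  then obtain s where s': "\<forall>n. Q n (s n) \<and> (\<forall>x\<in>carrier (P (Suc n)). d' (Suc n) (s (Suc n) x) = \<delta> (Suc n) x \<ominus>\<^bsub>C (Suc n)\<^esub> s n (d n x))"
    by (elim exE) (rule that)
  have s: "Q n (s n)" "x \<in> carrier (P (Suc n)) ==> d' (Suc n) (s (Suc n) x) = \<delta> (Suc n) x \<ominus>\<^bsub>C (Suc n)\<^esub> s n (d n x)" for n x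
    using s' by blast+
  show ?thesis
  proof (intro exI[of _ s] conjI allI ballI)
    show "s n \<in> right_hom R (P n) (C (Suc n))" for n using s(1)[of n] unfolding Q_def by (rule conjunct1)
    show "d' 0 (s 0 x) = \<phi> 0 x \<ominus>\<^bsub>C 0\<^esub> \<psi> 0 x" if "x \<in> carrier (P 0)" for x
      using s(1)[of 0] that unfolding Q_def \<delta>_def by blast
    show "d' (Suc n) (s (Suc n) x) = (\<phi> (Suc n) x \<ominus>\<^bsub>C (Suc n)\<^esub> \<psi> (Suc n) x) \<ominus>\<^bsub>C (Suc n)\<^esub> s n (d n x)"
      if "x \<in> carrier (P (Suc n))" for n x
      using s(2)[OF that] unfolding \<delta>_def .
  qed
qed

end

section \<open>Freeness and exactness of the bar resolution over the ground field\<close>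

lemma abelian_group_tens:
  assumes C: "carrier M = tens E (Suc n)" and Z: "\<zero>\<^bsub>M\<^esub> = tclass E (Suc n) {#}"
    and add: "\<And>p q. p \<in> fsums (Suc n) ==> q \<in> fsums (Suc n) ==>
      tclass E (Suc n) p \<oplus>\<^bsub>M\<^esub> tclass E (Suc n) q = tclass E (Suc n) (p + q)"
  shows "abelian_group M"
proof (rule abelian_groupI)
  fix X assume "X \<in> carrier M"
  then obtain p where p: "p \<in> fsums (Suc n)" and X: "X = tclass E (Suc n) p" unfolding C by (rule tensE)
  show "\<zero>\<^bsub>M\<^esub> \<oplus>\<^bsub>M\<^esub> X = X" using p by (simp add: X Z add)
  have "tclass E (Suc n) (tneg p + p) = tclass E (Suc n) {#}"
    using tneg_cancel[OF p] by (intro tclass_eq) (simp add: add.commute)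
  then show "\<exists>y\<in>carrier M. y \<oplus>\<^bsub>M\<^esub> X = \<zero>\<^bsub>M\<^esub>"
    using p by (intro bexI[of _ "tclass E (Suc n) (tneg p)"]) (simp_all add: X Z C add tneg_fsums tclass_in_tens)
  fix Y assume "Y \<in> carrier M"
  then obtain q where q: "q \<in> fsums (Suc n)" and Y: "Y = tclass E (Suc n) q" unfolding C by (rule tensE)
  show "X \<oplus>\<^bsub>M\<^esub> Y \<in> carrier M" using p q by (simp add: X Y C add tclass_in_tens)
  show "X \<oplus>\<^bsub>M\<^esub> Y = Y \<oplus>\<^bsub>M\<^esub> X" using p q by (simp add: X Y add add.commute)
  fix W assume "W \<in> carrier M"
  then obtain r where r: "r \<in> fsums (Suc n)" and W: "W = tclass E (Suc n) r" unfolding C by (rule tensE)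
  show "(X \<oplus>\<^bsub>M\<^esub> Y) \<oplus>\<^bsub>M\<^esub> W = X \<oplus>\<^bsub>M\<^esub> (Y \<oplus>\<^bsub>M\<^esub> W)" using p q r by (simp add: X Y W add add.assoc)
qed (simp add: C Z tclass_in_tens)

text \<open>Q is a free basis with coordinate functions \<tau>. Linearity over R and finiteness of
  supports hold on the generators by duality and spread to sums, hence to all of M by the induction
  principle \<open>span\<close>.\<close>

lemma projective_dual_basis:
  fixes R :: "'r ring" and M :: "('r, 'm) module"
  assumes R: "abelian_group R" and mult: "\<And>r s. r \<in> carrier R ==> s \<in> carrier R ==> r \<otimes>\<^bsub>R\<^esub> s \<in> carrier R"
    and distr: "\<And>r s t. r \<in> carrier R ==> s \<in> carrier R ==> t \<in> carrier R ==> (r \<oplus>\<^bsub>R\<^esub> s) \<otimes>\<^bsub>R\<^esub> t = r \<otimes>\<^bsub>R\<^esub> t \<oplus>\<^bsub>R\<^esub> s \<otimes>\<^bsub>R\<^esub> t"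
    and M: "right_module R M" and Q: "Q \<subseteq> carrier M"
    and \<tau>: "\<And>q x. q \<in> Q ==> x \<in> carrier M ==> \<tau> q x \<in> carrier R"
    and \<tau>_add: "\<And>q x y. q \<in> Q ==> x \<in> carrier M ==> y \<in> carrier M ==> \<tau> q (x \<oplus>\<^bsub>M\<^esub> y) = \<tau> q x \<oplus>\<^bsub>R\<^esub> \<tau> q y"
    and dual: "\<And>q q' r. q \<in> Q ==> q' \<in> Q ==> r \<in> carrier R ==> \<tau> q (r \<odot>\<^bsub>M\<^esub> q') = (if q' = q then r else \<zero>\<^bsub>R\<^esub>)"
    and span: "\<And>X. \<zero>\<^bsub>M\<^esub> \<in> X ==> (\<And>x y. x \<in> X ==> y \<in> X ==> x \<oplus>\<^bsub>M\<^esub> y \<in> X) ==>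
      (\<And>r q. r \<in> carrier R ==> q \<in> Q ==> r \<odot>\<^bsub>M\<^esub> q \<in> X) ==> carrier M \<subseteq> X"
  shows "projective_right_module R M"
proof -
  note MD = right_moduleD[OF M]
  interpret R: abelian_group R by fact
  interpret M: abelian_group M by (rule MD)
  have z: "\<zero>\<^bsub>R\<^esub> \<otimes>\<^bsub>R\<^esub> t = \<zero>\<^bsub>R\<^esub>" if "t \<in> carrier R" for t
    by (rule additive_zero[OF R R, of "\<lambda>r. r \<otimes>\<^bsub>R\<^esub> t"]) (use that mult distr in auto)
  have zM: "\<zero>\<^bsub>R\<^esub> \<odot>\<^bsub>M\<^esub> x = \<zero>\<^bsub>M\<^esub>" if "x \<in> carrier M" for x
    by (rule additive_zero[OF R MD(1), of "\<lambda>r. r \<odot>\<^bsub>M\<^esub> x"]) (use that MD in auto)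
  have rz: "r \<odot>\<^bsub>M\<^esub> \<zero>\<^bsub>M\<^esub> = \<zero>\<^bsub>M\<^esub>" if "r \<in> carrier R" for r
    by (rule additive_zero[OF MD(1) MD(1)]) (use that MD in auto)
  define \<sigma> where "\<sigma> x q = (if q \<in> Q then \<tau> q x else \<zero>\<^bsub>R\<^esub>)" for x q
  define sp where "sp x = {q \<in> carrier M. \<sigma> x q \<noteq> \<zero>\<^bsub>R\<^esub>}" for x
  have \<sigma>C: "\<sigma> x q \<in> carrier R" if "x \<in> carrier M" for x q using \<tau> that by (simp add: \<sigma>_def)
  have \<sigma>_add: "\<sigma> (x \<oplus>\<^bsub>M\<^esub> y) q = \<sigma> x q \<oplus>\<^bsub>R\<^esub> \<sigma> y q" if "x \<in> carrier M" "y \<in> carrier M" for x y q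
    using that \<tau>_add by (simp add: \<sigma>_def)
  have \<sigma>0: "\<sigma> \<zero>\<^bsub>M\<^esub> q = \<zero>\<^bsub>R\<^esub>" for q
    by (rule additive_zero[OF MD(1) R, of "\<lambda>x. \<sigma> x q"]) (auto simp: \<sigma>C \<sigma>_add)
  have \<sigma>q: "\<sigma> (r \<odot>\<^bsub>M\<^esub> q') q = (if q = q' then r else \<zero>\<^bsub>R\<^esub>)" if "r \<in> carrier R" "q' \<in> Q" for r q q'
    using that dual by (auto simp: \<sigma>_def)
  \<comment> \<open>The elements for which the coordinates behave as required; X contains the
    multiples of basis elements and is closed under addition.\<close>
  define X where "X = {x \<in> carrier M. finite (sp x) \<and> x = (\<Oplus>\<^bsub>M\<^esub>q\<in>sp x. \<sigma> x q \<odot>\<^bsub>M\<^esub> q) \<and>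
     (\<forall>r\<in>carrier R. \<forall>q. \<sigma> (r \<odot>\<^bsub>M\<^esub> x) q = \<sigma> x q \<otimes>\<^bsub>R\<^esub> r)}"
  have tc: "\<sigma> x q \<odot>\<^bsub>M\<^esub> q \<in> carrier M" if "x \<in> carrier M" "q \<in> carrier M" for x q using MD(2)[OF \<sigma>C] that by blast
  have sum: "(\<Oplus>\<^bsub>M\<^esub>q\<in>sp x. \<sigma> x q \<odot>\<^bsub>M\<^esub> q) = (\<Oplus>\<^bsub>M\<^esub>q\<in>A. \<sigma> x q \<odot>\<^bsub>M\<^esub> q)" if "finite A" "sp x \<subseteq> A" "A \<subseteq> carrier M" "x \<in> carrier M" for x A
  proof (rule M.add.finprod_mono_neutral_cong_left[OF that(1,2)])
    show "\<sigma> x i \<odot>\<^bsub>M\<^esub> i = \<zero>\<^bsub>M\<^esub>" if "i \<in> A - sp x" for i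
      using that \<open>A \<subseteq> carrier M\<close> by (auto simp: sp_def zM)
    show "(\<lambda>q. \<sigma> x q \<odot>\<^bsub>M\<^esub> q) \<in> A \<rightarrow> carrier M" using that tc by auto
  qed simp
  have "carrier M \<subseteq> X"
  proof (rule span)
    show "\<zero>\<^bsub>M\<^esub> \<in> X" by (simp add: X_def sp_def \<sigma>0 rz z)
  next
    fix x y assume xy: "x \<in> X" "y \<in> X"
    then have c: "x \<in> carrier M" "y \<in> carrier M" and f: "finite (sp x \<union> sp y)"
      and ex: "x = (\<Oplus>\<^bsub>M\<^esub>q\<in>sp x. \<sigma> x q \<odot>\<^bsub>M\<^esub> q)" and ey: "y = (\<Oplus>\<^bsub>M\<^esub>q\<in>sp y. \<sigma> y q \<odot>\<^bsub>M\<^esub> q)"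
      and l: "\<And>r q. r \<in> carrier R ==> \<sigma> (r \<odot>\<^bsub>M\<^esub> x) q = \<sigma> x q \<otimes>\<^bsub>R\<^esub> r" "\<And>r q. r \<in> carrier R ==> \<sigma> (r \<odot>\<^bsub>M\<^esub> y) q = \<sigma> y q \<otimes>\<^bsub>R\<^esub> r"
      by (simp_all add: X_def)
    let ?A = "sp x \<union> sp y"
    have A: "?A \<subseteq> carrier M" by (auto simp: sp_def)
    have sub: "sp (x \<oplus>\<^bsub>M\<^esub> y) \<subseteq> ?A" using c by (auto simp: sp_def \<sigma>_add)
    have "(\<Oplus>\<^bsub>M\<^esub>q\<in>sp (x \<oplus>\<^bsub>M\<^esub> y). \<sigma> (x \<oplus>\<^bsub>M\<^esub> y) q \<odot>\<^bsub>M\<^esub> q) = (\<Oplus>\<^bsub>M\<^esub>q\<in>?A. \<sigma> (x \<oplus>\<^bsub>M\<^esub> y) q \<odot>\<^bsub>M\<^esub> q)"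
      by (rule sum[OF f sub A]) (simp add: c)
    also have "\<dots> = (\<Oplus>\<^bsub>M\<^esub>q\<in>?A. \<sigma> x q \<odot>\<^bsub>M\<^esub> q \<oplus>\<^bsub>M\<^esub> \<sigma> y q \<odot>\<^bsub>M\<^esub> q)"
    proof (rule M.finsum_cong'[OF HOL.refl])
      show "(\<lambda>q. \<sigma> x q \<odot>\<^bsub>M\<^esub> q \<oplus>\<^bsub>M\<^esub> \<sigma> y q \<odot>\<^bsub>M\<^esub> q) \<in> ?A \<rightarrow> carrier M" using A c tc by (auto simp: subset_iff)
      fix q assume "q \<in> ?A"
      then have "q \<in> carrier M" using A by auto
      then show "\<sigma> (x \<oplus>\<^bsub>M\<^esub> y) q \<odot>\<^bsub>M\<^esub> q = \<sigma> x q \<odot>\<^bsub>M\<^esub> q \<oplus>\<^bsub>M\<^esub> \<sigma> y q \<odot>\<^bsub>M\<^esub> q"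
        using c by (simp add: \<sigma>_add MD(4) \<sigma>C)
    qed
    also have "\<dots> = (\<Oplus>\<^bsub>M\<^esub>q\<in>?A. \<sigma> x q \<odot>\<^bsub>M\<^esub> q) \<oplus>\<^bsub>M\<^esub> (\<Oplus>\<^bsub>M\<^esub>q\<in>?A. \<sigma> y q \<odot>\<^bsub>M\<^esub> q)"
      by (rule M.finsum_addf) (use A c tc in \<open>auto simp: subset_iff\<close>)
    also have "\<dots> = x \<oplus>\<^bsub>M\<^esub> y"
      unfolding sum[OF f Un_upper1 A c(1), symmetric] sum[OF f Un_upper2 A c(2), symmetric] ex[symmetric] ey[symmetric] ..
    finally have e: "x \<oplus>\<^bsub>M\<^esub> y = (\<Oplus>\<^bsub>M\<^esub>q\<in>sp (x \<oplus>\<^bsub>M\<^esub> y). \<sigma> (x \<oplus>\<^bsub>M\<^esub> y) q \<odot>\<^bsub>M\<^esub> q)" ..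
    have "\<sigma> (r \<odot>\<^bsub>M\<^esub> (x \<oplus>\<^bsub>M\<^esub> y)) q = \<sigma> (x \<oplus>\<^bsub>M\<^esub> y) q \<otimes>\<^bsub>R\<^esub> r" if "r \<in> carrier R" for r q
      using that c by (simp add: MD(2,3) \<sigma>_add l distr \<sigma>C)
    then show "x \<oplus>\<^bsub>M\<^esub> y \<in> X"
      unfolding X_def using e finite_subset[OF sub f] c by (intro CollectI conjI M.a_closed) blast+
  next
    fix r q' assume r: "r \<in> carrier R" and q: "q' \<in> Q"
    have qM: "q' \<in> carrier M" using q Q by auto
    have sp: "sp (r \<odot>\<^bsub>M\<^esub> q') = (if r = \<zero>\<^bsub>R\<^esub> then {} else {q'})" using qM by (auto simp: sp_def \<sigma>q r q)
    have l: "\<sigma> (s \<odot>\<^bsub>M\<^esub> (r \<odot>\<^bsub>M\<^esub> q')) q = \<sigma> (r \<odot>\<^bsub>M\<^esub> q') q \<otimes>\<^bsub>R\<^esub> s" if "s \<in> carrier R" for s q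
      using that r q qM by (simp add: MD(5)[symmetric] \<sigma>q mult z)
    have "(\<Oplus>\<^bsub>M\<^esub>q\<in>sp (r \<odot>\<^bsub>M\<^esub> q'). \<sigma> (r \<odot>\<^bsub>M\<^esub> q') q \<odot>\<^bsub>M\<^esub> q) = r \<odot>\<^bsub>M\<^esub> q'"
      unfolding sp using r q qM MD(2)[OF r qM] by (simp add: zM \<sigma>q)
    then show "r \<odot>\<^bsub>M\<^esub> q' \<in> X" using l MD(2)[OF r qM] by (simp add: X_def sp)
  qed
  then have X: "finite (sp x)" "x = (\<Oplus>\<^bsub>M\<^esub>q\<in>sp x. \<sigma> x q \<odot>\<^bsub>M\<^esub> q)" "r \<in> carrier R ==> \<sigma> (r \<odot>\<^bsub>M\<^esub> x) q = \<sigma> x q \<otimes>\<^bsub>R\<^esub> r"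
    if "x \<in> carrier M" for x r q
    using that unfolding X_def by blast+
  show ?thesis unfolding projective_right_module_def
    by (intro conjI M exI[of _ \<sigma>] ballI) (simp_all add: \<sigma>C \<sigma>_add X(1)[unfolded sp_def] X(2)[unfolded sp_def, symmetric] X(3))
qed

section \<open>Associativity of the right action on bar terms\<close>

context rel_alg begin

lemma TA_pair: "ml g ==> TA g h [x, y] = dsum h (\<lambda>a b. g [ac a x, ac b y])"
  by (subst TA.simps(2)) (simp add: TA_single ml_Cons del: TA.simps)

lemma ml_rmult: assumes g: "ml g" shows "ml (\<lambda>us. g (rmult us f))"
proof (rule mlI)
  fix us vs :: "'b list"
  show "klin bs bs (\<lambda>a. g (rmult (us @ a # vs) f))"
    by (cases vs rule: rev_cases) (simp_all add: rmult_def butlast_append, (intro klins g)+)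
qed

lemma TA_lmult: assumes g: "ml g" and ys: "ys \<noteq> []"
  shows "TA g h (lmult e ys) = dsum h (\<lambda>a b. TA (\<lambda>us. g (lmult (ac a e) us)) b ys)"
proof -
  obtain y ys' where ys': "ys = y # ys'" using ys by (cases ys) auto
  have "lmult e ys = contract 0 (e # ys)" by (simp add: ys' contract_0 lmult_def)
  then have "TA g h (lmult e ys) = TA (\<lambda>ws. g (contract 0 ws)) h (e # ys)"
    using TA_contract[OF g, of 0 "e # ys" h] ys by simp
  also have "\<dots> = dsum h (\<lambda>a b. TA (\<lambda>us. g (contract 0 (ac a e # us))) b ys)" by (rule TA.simps)
  also have "\<dots> = dsum h (\<lambda>a b. TA (\<lambda>us. g (lmult (ac a e) us)) b ys)"
  proof (intro psum_cong TA_cong_len arg_cong[of _ _ g])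
    fix a and us :: "'b list" assume "length us = length ys"
    then obtain u us' where "us = u # us'" using ys by (cases us) auto
    then show "contract 0 (ac a e # us) = lmult (ac a e) us" by (simp add: contract_0 lmult_def)
  qed
  finally show ?thesis .
qed

lemma TA_rmult: assumes g: "ml g" and ys: "ys \<noteq> []"
  shows "TA g h (rmult ys e) = dsum h (\<lambda>a b. TA (\<lambda>us. g (rmult us (ac b e))) a ys)"
proof -
  obtain zs y where ys': "ys = zs @ [y]" using ys by (cases ys rule: rev_cases) auto
  have "TA g h (rmult ys e) = dsum h (\<lambda>a b. TA (\<lambda>us. TA (\<lambda>vs. g (us @ vs)) b [y * e]) a zs)"
    by (simp add: ys' rmult_def TA_append[OF g] del: TA.simps)
  also have "\<dots> = dsum h (\<lambda>a b. TA (\<lambda>us. dsum b (\<lambda>c d. g (us @ [ac c y * ac d e]))) a zs)"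
  proof -
    have "TA (\<lambda>vs. g (us @ vs)) b [y * e] = dsum b (\<lambda>c d. g (us @ [ac c y * ac d e]))" for us b
      by (subst TA_single[OF ml_prefix[OF g]]) (simp add: act_prod klin_psum[OF ml_slot[OF g klin_id]])
    then show ?thesis by simp
  qed
  also have "\<dots> = dsum h (\<lambda>a b. dsum b (\<lambda>c d. TA (\<lambda>us. g (us @ [ac c y * ac d e])) a zs))"
    by (simp add: TA_psum)
  also have "\<dots> = dsum h (\<lambda>a b. dsum a (\<lambda>c d. TA (\<lambda>us. g (us @ [ac d y * ac b e])) c zs))"
    by (rule dsum_assoc[of bs, symmetric]) (intro klins g)+
  also have "\<dots> = dsum h (\<lambda>a b. TA (\<lambda>us. g (rmult us (ac b e))) a ys)"
  proof -
    have "TA (\<lambda>us. g (rmult us f)) a ys = dsum a (\<lambda>c d. TA (\<lambda>us. g (us @ [ac d y * f])) c zs)" for a f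
    proof -
      have "TA (\<lambda>vs. g (rmult (us @ vs) f)) d [y] = g (us @ [ac d y * f])" for us d
        by (subst TA_single[OF ml_prefix[OF ml_rmult[OF g]]]) (simp add: rmult_def)
      then show ?thesis unfolding ys' by (subst TA_append[OF ml_rmult[OF g]]) simp
    qed
    then show ?thesis by simp
  qed
  finally show ?thesis .
qed

lemma TA_lr: assumes g: "ml g" and ys: "ys \<noteq> []"
  shows "TA g h (lr e e' ys) = dsum h (\<lambda>a b. dsum a (\<lambda>c d. TA (\<lambda>us. g (lr (ac c e) (ac b e') us)) d ys))"
  by (subst TA_rmult[OF g]) (simp add: lmult_def, simp add: TA_lmult[OF ml_rmult[OF g] ys])

lemma klin_lr: assumes g: "ml g" and k: "klin s bs \<psi>"
  shows "klin s bs (\<lambda>x. g (lr (\<psi> x) c' zs))" "klin s bs (\<lambda>x. g (lr c (\<psi> x) zs))"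
proof -
  have "klin s bs (\<lambda>x. g (lr (\<psi> x) c' zs))"
  proof (cases "tl zs")
    case Nil
    then show ?thesis by (simp add: lmult_def rmult_def) (intro klins g k)
  next
    case (Cons y ys)
    have e: "rmult (w # tl zs) c' = w # rmult (tl zs) c'" for w by (simp add: Cons rmult_def)
    show ?thesis unfolding lmult_def e by (intro ml_slot0 g klin_multB k)
  qed
  then show "klin s bs (\<lambda>x. g (lr (\<psi> x) c' zs))" .
  show "klin s bs (\<lambda>x. g (lr c (\<psi> x) zs))" unfolding rmult_def by (intro klins g k)
qed

text \<open>Associativity of the action amounts to quasi-cocommutativity together with the two hexagon axioms.\<close>

lemma gact_act: assumes G: "G \<in> BE (Suc (Suc n))" and l: "length xs = Suc (Suc n)"
  shows "gact (\<lambda>us. if length us = 2 then gact G us xs else 0) [c, c'] [d, d'] = gact (gact G [c, c']) [d, d'] xs"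
proof -
  note mG = BE_multilin[OF G]
  note m = multilin_ml[OF mG]
  note mlr = multilin_ml[OF lr_multilin[OF mG]]
  define g2 where "g2 us = (if length us = 2 then gact G us xs else 0)" for us
  have g2: "g2 \<in> multilin B 2" unfolding g2_def by (rule gact_multilin[OF G l])
  \<comment> \<open>The common normal form of both iterated actions: x acts on the bar tensor, z on
    c, y on d and w on d'. The second hexagon brings the left side into it; the first hexagon and
    quasi-cocommutativity then match the arguments.\<close>
  define \<Phi> where "\<Phi> x y z w = TA (\<lambda>zs. G (lr (ac z c * ac y d) (ac w d' * c') zs)) x xs" for x y z w
  have k: "klin s hs \<psi> ==> klin s bs (\<lambda>v. \<Phi> (\<psi> v) y z w)" "klin s hs \<psi> ==> klin s bs (\<lambda>v. \<Phi> x (\<psi> v) z w)"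
    "klin s hs \<psi> ==> klin s bs (\<lambda>v. \<Phi> x y (\<psi> v) w)" "klin s hs \<psi> ==> klin s bs (\<lambda>v. \<Phi> x y z (\<psi> v))" for s \<psi> x y z w
    unfolding \<Phi>_def by (intro klin_TA mlr | assumption | intro klin_TA_param klin_lr m klins)+
  note kk = k hlin_mult klin_id
  have lrlr: "lr p q (lr p' q' zs) = lr (p * p') (q' * q) zs" if "length zs = Suc (Suc n)" for p q p' q' and zs :: "'b list"
    using that by (rule list2E) (simp add: lr_eq mult.assoc)
  have R1: "gact G [c, c'] (lr f d' ys) = rsum (\<lambda>s' t'. dsum s' (\<lambda>a b. dsum a (\<lambda>a1 b1. TA (\<lambda>zs. G (lr (ac t' c * ac a1 f) (ac b d' * c') zs)) b1 ys)))"
    if ly: "length ys = Suc (Suc n)" for f ys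
  proof -
    have ne: "ys \<noteq> []" using ly by auto
    have "gact G [c, c'] (lr f d' ys) = rsum (\<lambda>s' t'. dsum s' (\<lambda>a b. dsum a (\<lambda>a1 b1. TA (\<lambda>zs. G (lr (ac t' c) c' (lr (ac a1 f) (ac b d') zs))) b1 ys)))"
      unfolding gact_def by (simp add: TA_lr[OF mlr ne])
    also have "\<dots> = rsum (\<lambda>s' t'. dsum s' (\<lambda>a b. dsum a (\<lambda>a1 b1. TA (\<lambda>zs. G (lr (ac t' c * ac a1 f) (ac b d' * c') zs)) b1 ys)))"
      by (intro psum_cong TA_cong_len) (simp add: lrlr ly)
    finally show ?thesis .
  qed
  have "gact (gact G [c, c']) [d, d'] xs = rsum (\<lambda>s t. TA (\<lambda>ys. gact G [c, c'] (lr (ac t d) d' ys)) s xs)"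
    by (subst (1) gact_def) simp
  also have "\<dots> = rsum (\<lambda>s t. TA (\<lambda>ys. rsum (\<lambda>s' t'. dsum s' (\<lambda>a b. dsum a (\<lambda>a1 b1. TA (\<lambda>zs. G (lr (ac t' c * ac a1 (ac t d)) (ac b d' * c') zs)) b1 ys)))) s xs)"
    by (rule psum_cong, rule TA_cong_len, rule R1) (simp add: l)
  also have "\<dots> = rsum (\<lambda>s t. rsum (\<lambda>s' t'. dsum s' (\<lambda>a b. dsum a (\<lambda>a1 b1. \<Phi> (b1 * s) (a1 * t) t' b))))"
    by (simp only: TA_psum \<Phi>_def TA_mult[OF mlr] act_mult)
  finally have R: "gact (gact G [c, c']) [d, d'] xs = rsum (\<lambda>s t. rsum (\<lambda>s' t'. dsum s' (\<lambda>a b. dsum a (\<lambda>a1 b1. \<Phi> (b1 * s) (a1 * t) t' b))))" .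
  have L1: "gact G [ac t' c * ac a d, ac b d' * c'] xs = rsum (\<lambda>s t. dsum t (\<lambda>t1 t2. \<Phi> s (t2 * a) (t1 * t') b))" for t' a b
  proof -
    have "klin bs bs (\<lambda>v. TA (\<lambda>zs. G (lr v w zs)) s xs)" for w s by (intro klin_TA_param klin_lr m klin_id)
    note P = klin_psum[OF this]
    show ?thesis by (simp add: gact_def \<Phi>_def act_prod act_mult P)
  qed
  have ml2: "ml (\<lambda>ys. g2 (lr p q ys))" for p q
    using multilin_ml[OF lr_multilin[OF g2[unfolded numeral_2_eq_2]]] .
  have "gact g2 [c, c'] [d, d'] = rsum (\<lambda>s' t'. dsum s' (\<lambda>a b. g2 (lr (ac t' c) c' [ac a d, ac b d'])))"
    unfolding gact_def by (simp add: TA_pair[OF ml2] del: TA.simps)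
  also have "\<dots> = rsum (\<lambda>s' t'. dsum s' (\<lambda>a b. rsum (\<lambda>s t. dsum t (\<lambda>t1 t2. \<Phi> s (t2 * a) (t1 * t') b))))"
    by (simp add: lmult_def rmult_def g2_def L1)
  also have "\<dots> = rsum (\<lambda>s' t'. dsum s' (\<lambda>a b. rsum (\<lambda>s t. rsum (\<lambda>s'' t''. \<Phi> (s * s'') (t * a) (t'' * t') b))))"
    by (rule psum_cong, rule psum_cong, rule rsum_hex2[of bs]) (intro kk)+
  also have "\<dots> = rsum (\<lambda>s' t'. rsum (\<lambda>s t. dsum s' (\<lambda>a b. rsum (\<lambda>s'' t''. \<Phi> (s * s'') (t * a) (t'' * t') b))))"
    by (rule psum_cong, rule psum_swap)
  also have "\<dots> = rsum (\<lambda>s t. rsum (\<lambda>s' t'. dsum s' (\<lambda>a b. rsum (\<lambda>s'' t''. \<Phi> (s * s'') (t * a) (t'' * t') b))))"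
    by (rule psum_swap)
  also have "\<dots> = rsum (\<lambda>s t. rsum (\<lambda>s'' t''. rsum (\<lambda>s' t'. dsum s' (\<lambda>a b. \<Phi> (s * s'') (t * a) (t'' * t') b))))"
    by (rule psum_cong, subst psum_swap[of "comult H _" "rmatrix H"], rule psum_swap)
  also have "\<dots> = rsum (\<lambda>s t. rsum (\<lambda>s' t'. dsum s' (\<lambda>\<sigma> \<rho>. dsum \<rho> (\<lambda>a b. \<Phi> (s * \<sigma>) (t * a) t' b))))"
    by (rule psum_cong, rule rsum_hex1[of bs, symmetric]) (intro kk klin_psumI[OF vsB] hlin_dsum[OF vsB])+
  also have "\<dots> = rsum (\<lambda>s t. rsum (\<lambda>s' t'. dsum s' (\<lambda>\<rho> b. dsum \<rho> (\<lambda>\<sigma> a. \<Phi> (s * \<sigma>) (t * a) t' b))))"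
    by (rule psum_cong, rule psum_cong, rule dsum_assoc[of bs, symmetric]) (intro kk)+
  also have "\<dots> = rsum (\<lambda>s' t'. rsum (\<lambda>s t. dsum s' (\<lambda>\<rho> b. dsum \<rho> (\<lambda>\<sigma> a. \<Phi> (s * \<sigma>) (t * a) t' b))))"
    by (rule psum_swap)
  also have "\<dots> = rsum (\<lambda>s' t'. dsum s' (\<lambda>\<rho> b. rsum (\<lambda>s t. dsum \<rho> (\<lambda>\<sigma> a. \<Phi> (s * \<sigma>) (t * a) t' b))))"
    by (rule psum_cong, rule psum_swap)
  also have "\<dots> = rsum (\<lambda>s' t'. dsum s' (\<lambda>\<rho> b. dsum \<rho> (\<lambda>a b1. rsum (\<lambda>s t. \<Phi> (b1 * s) (a * t) t' b))))"
    by (rule psum_cong, rule psum_cong, rule rsum_qcomm[of bs]) (intro kk)+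
  also have "\<dots> = rsum (\<lambda>s' t'. rsum (\<lambda>s t. dsum s' (\<lambda>\<rho> b. dsum \<rho> (\<lambda>a b1. \<Phi> (b1 * s) (a * t) t' b))))"
    by (simp only: psum_swap[of _ "rmatrix H" "\<lambda>a b s t. \<Phi> (b * s) (a * t) _ _"] psum_swap[of "comult H _" "rmatrix H"])
  also have "\<dots> = rsum (\<lambda>s t. rsum (\<lambda>s' t'. dsum s' (\<lambda>a b. dsum a (\<lambda>a1 b1. \<Phi> (b1 * s) (a1 * t) t' b))))"
    by (rule psum_swap)
  finally show ?thesis unfolding R g2_def .
qed

text \<open>Up to the congruence, \<open>bar_act H B u v\<close> is the product of the enveloping
  algebra (see \<open>env_mult_rel\<close>), so this is the associativity law of a right module. The
  inner action is the bar action in degree 0 over the ground field.\<close>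

lemma bar_act_assoc: assumes p: "p \<in> fsums (Suc (Suc n))" and u: "u \<in> fsums 2" and v: "v \<in> fsums 2"
  shows "(bar_act H B (bar_act H B p u) v, bar_act H B p (bar_act H B u v)) \<in> tens_rel E (Suc (Suc n))"
proof (rule tens_rel_separate)
  fix G assume G: "G \<in> BE (Suc (Suc n))"
  have "ev G (bar_act H B (bar_act H B p u) v) = ev (\<lambda>vs. ev (gact G vs) (bar_act H B p u)) v"
    by (subst ev_swap) (simp add: ev_bar_act[OF G] bar_act_fsums p)
  also have "\<dots> = ev (\<lambda>xs. ev (\<lambda>vs. ev (\<lambda>us. gact (gact G vs) us xs) u) v) p"
    by (subst ev_swap) (simp add: ev_bar_act[OF gact_BE[OF G] p])
  also have "\<dots> = ev (\<lambda>xs. ev (\<lambda>ws. gact G ws xs) (bar_act H B u v)) p"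
  proof (rule ev_cong[OF p])
    fix xs :: "'b list" assume l: "length xs = Suc (Suc n)"
    define g2 where "g2 us = (if length us = 2 then gact G us xs else 0)" for us
    have g2: "g2 \<in> sc.BE (Suc (Suc 0))"
      unfolding g2_def[abs_def] numeral_2_eq_2[symmetric] by (rule sc_BE[OF gact_multilin[OF G l]])
    note u' = u[unfolded numeral_2_eq_2] and v' = v[unfolded numeral_2_eq_2]
    have "ev (\<lambda>vs. ev (\<lambda>us. gact (gact G vs) us xs) u) v = ev (\<lambda>us. ev (\<lambda>vs. gact (gact G vs) us xs) v) u"
      by (rule ev_swap)
    also have "\<dots> = ev (\<lambda>us. ev (\<lambda>vs. sc.gact g2 vs us) v) u"
    proof (rule ev_cong[OF u], rule ev_cong[OF v])
      fix us vs :: "'b list" assume "length us = 2" "length vs = 2"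
      then obtain c c' d d' where "vs = [c, c']" "us = [d, d']" by (cases us; cases "tl us"; cases vs; cases "tl vs") auto
      then show "gact (gact G vs) us xs = sc.gact g2 vs us"
        using gact_act[OF G l, of c c' d d'] by (simp add: g2_def[abs_def])
    qed
    also have "\<dots> = ev g2 (bar_act H B u v)" by (rule sc.ev_bar_act[OF g2 u', symmetric])
    also have "\<dots> = ev (\<lambda>ws. gact G ws xs) (bar_act H B u v)"
      by (rule ev_cong[OF sc.bar_act_fsums[OF u']]) (simp add: g2_def)
    finally show "ev (\<lambda>vs. ev (\<lambda>us. gact (gact G vs) us xs) u) v = ev (\<lambda>ws. gact G ws xs) (bar_act H B u v)" .
  qed
  also have "\<dots> = ev G (bar_act H B p (bar_act H B u v))"
    by (simp add: ev_bar_act[OF G p])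
  finally show "ev G (bar_act H B (bar_act H B p u) v) = ev G (bar_act H B p (bar_act H B u v))" .
qed (intro bar_act_fsums p)+

end

text \<open>The number of contractions is an explicit parameter, so that splitting off the first
  entry gives the recursion \<open>altc_Cons\<close>. It yields d d = 0 by induction on lists in
  place of cancellation in a double sum.\<close>

definition altc :: "nat => ('a::{ring,monoid_mult} list => 'c::ab_group_add) => 'a list => 'c" where
  "altc k G Z = (\<Sum>i<k. signed i (G (contract i Z)))"

lemma altc_Cons: "altc (Suc k) G (b # c # Z) = G ((b * c) # Z) - altc k (\<lambda>ys. G (b # ys)) (c # Z)"
  by (simp add: altc_def sum.lessThan_Suc_shift contract_0 contract_Suc signed_def sum_negf[symmetric] del: sum.lessThan_Suc cong: if_cong)
     (intro sum.cong HOL.refl, simp)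

lemma altc_altc: "length Z = Suc (Suc k) ==> altc (Suc k) (altc k G) Z = 0"
proof (induction k arbitrary: G Z)
  case 0 then show ?case by (simp add: altc_def signed_def)
next
  case (Suc k)
  obtain b c Z' where Z: "Z = b # c # Z'" and l: "length Z' = Suc k" using Suc.prems by (cases Z; cases "tl Z") auto
  have "altc (Suc k) (\<lambda>ys. altc (Suc k) G (b # ys)) (c # Z') =
      (\<Sum>i<Suc k. signed i (G (contract i ((b * c) # Z')) - altc k (\<lambda>zs. G (b # zs)) (contract i (c # Z'))))"
    unfolding altc_def[of "Suc k" "\<lambda>ys. altc (Suc k) G (b # ys)"]
  proof (intro sum.cong HOL.refl arg_cong[of _ _ "signed _"])
    fix i assume i: "i \<in> {..<Suc k}"
    then have li: "Suc i < length (c # Z')" using l by simp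
    then obtain y ys where y: "contract i (c # Z') = y # ys" using length_contract[OF li] l by (cases "contract i (c # Z')") auto
    have "(b * y) # ys = contract i ((b * c) # Z')" using lmult_contract[OF li, of b] y by (simp add: lmult_def)
    then show "altc (Suc k) G (b # contract i (c # Z')) = G (contract i ((b * c) # Z')) - altc k (\<lambda>zs. G (b # zs)) (contract i (c # Z'))"
      by (simp add: y altc_Cons)
  qed
  also have "\<dots> = altc (Suc k) G ((b * c) # Z') - altc (Suc k) (altc k (\<lambda>zs. G (b # zs))) (c # Z')"
    unfolding altc_def[of "Suc k"] sum_subtractf[symmetric] by (intro sum.cong HOL.refl) (simp add: signed_def)
  also have "altc (Suc k) (altc k (\<lambda>zs. G (b # zs))) (c # Z') = 0" by (rule Suc.IH) (simp add: l)
  finally show ?case unfolding Z altc_Cons[of "Suc k"] by simp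
qed

context braided_mod_alg begin

abbreviation "barB n \<equiv> bar H B (scalars B) n"
abbreviation "cB n p \<equiv> tclass (scalars B) (Suc (Suc n)) p"
abbreviation "c2 u \<equiv> tclass (scalars B) 2 u"
abbreviation "envB \<equiv> env_alg H B"

lemma env_simps: "carrier envB = tens (scalars B) 2" "\<zero>\<^bsub>envB\<^esub> = c2 {#}"
  by (simp_all add: env_alg_def)

lemma op_mult_eq: "op_mult H B b b' = rsum (\<lambda>s t. ac t b' * ac s b)"
  by (simp add: op_mult_def psum_def)

lemma list22E: assumes "length us = 2" obtains x y where "us = [x, y]"
  using assms that by (cases us; cases "tl us") auto

text \<open>The enveloping algebra, as a right module over itself, is the bar term of degree 0. The
  first hexagon matches the two braidings of its product with the diagonal action on the two
  factors.\<close>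

lemma env_mult_rel: assumes u: "u \<in> fsums 2" and v: "v \<in> fsums 2"
  shows "(env_mult H B u v, bar_act H B u v) \<in> tens_rel (scalars B) 2"
  unfolding numeral_2_eq_2
proof (rule sc.tens_rel_separate)
  note u' = u[unfolded numeral_2_eq_2]
  show "env_mult H B u v \<in> fsums (Suc (Suc 0))"
    unfolding env_mult_def psum_def[symmetric] by (intro fsums_sum_mset fsums_psum) simp
  show "bar_act H B u v \<in> fsums (Suc (Suc 0))" by (rule sc.bar_act_fsums[OF u'])
  fix G assume G: "G \<in> sc.BE (Suc (Suc 0))"
  note m = multilin_ml[OF sc.BE_multilin[OF G]]
  have "ev G (env_mult H B u v) = ev (\<lambda>us. ev (\<lambda>vs. rsum (\<lambda>s t. G [op_mult H B (us ! 0) (ac t (vs ! 0)), ac s (us ! 1) * vs ! 1])) v) u"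
    unfolding env_mult_def psum_def[symmetric] ev_sum_mset sum_mset_psum by simp
  also have "\<dots> = ev (\<lambda>us. ev (\<lambda>vs. sc.gact G vs us) v) u"
  proof (rule ev_cong[OF u], rule ev_cong[OF v])
    fix us vs :: "'b list" assume "length us = 2"
    then obtain x y where us: "us = [x, y]" by (rule list22E)
    define d where "d = vs ! 0" define d' where "d' = vs ! 1"
    have "klin bs bs (\<lambda>v. G [v, w])" for w by (rule ml_slot0[OF m klin_id])
    note P = klin_psum[OF this]
    have "rsum (\<lambda>s t. G [op_mult H B x (ac t d), ac s y * d']) = rsum (\<lambda>s t. rsum (\<lambda>s' t'. G [ac (t' * t) d * ac s' x, ac s y * d']))"
      by (simp add: op_mult_eq P act_mult)
    also have "\<dots> = rsum (\<lambda>s' t'. rsum (\<lambda>s t. G [ac (t' * t) d * ac s' x, ac s y * d']))" by (rule psum_swap)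
    also have "\<dots> = rsum (\<lambda>s t. dsum s (\<lambda>a b. G [ac t d * ac a x, ac b y * d']))"
      by (rule rsum_hex1[of bs, symmetric]) (intro klins m)+
    also have "\<dots> = sc.gact G vs [x, y]"
    proof -
      have "TA (\<lambda>ys. G (rmult (lmult p ys) q)) s [x, y] = dsum s (\<lambda>a b. G [p * ac a x, ac b y * q])" for p q s
        by (subst sc.TA_pair[OF multilin_ml[OF sc.lr_multilin[OF sc.BE_multilin[OF G]]]]) (simp add: lmult_def rmult_def)
      then show ?thesis unfolding sc.gact_def d_def d'_def by (simp only:)
    qed
    finally show "rsum (\<lambda>s t. G [op_mult H B (us ! 0) (ac t (vs ! 0)), ac s (us ! 1) * vs ! 1]) = sc.gact G vs us"
      by (simp add: us d_def d'_def)
  qed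
  also have "\<dots> = ev G (bar_act H B u v)" by (rule sc.ev_bar_act[OF G u', symmetric])
  finally show "ev G (env_mult H B u v) = ev G (bar_act H B u v)" .
qed

lemma bar_act_fsums2: "u \<in> fsums 2 ==> bar_act H B u v \<in> fsums 2"
  unfolding numeral_2_eq_2 by (rule sc.bar_act_fsums)

lemma env_mult_class: assumes u: "u \<in> fsums 2" and v: "v \<in> fsums 2"
  shows "c2 u \<otimes>\<^bsub>envB\<^esub> c2 v = c2 (bar_act H B u v)"
proof -
  have ne: "u \<in> c2 u" "v \<in> c2 v" using u v by (simp_all add: tclass_mem tens_rel.refl)
  have e: "c2 (env_mult H B u' v') = c2 (bar_act H B u v)" if "u' \<in> c2 u" "v' \<in> c2 v" for u' v'
  proof -
    have r: "(u, u') \<in> tens_rel (scalars B) 2" "(v, v') \<in> tens_rel (scalars B) 2" using that by (simp_all add: tclass_mem)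
    have "c2 (env_mult H B u' v') = c2 (bar_act H B u' v')"
      by (rule tclass_eq[OF env_mult_rel]) (use r tens_rel_fsums in blast)+
    also have "\<dots> = c2 (bar_act H B u v)"
      by (rule tclass_eq[OF tens_rel.sym]) (use sc.bar_act_rel[OF r(1)[unfolded numeral_2_eq_2] r(2)] in \<open>simp add: numeral_2_eq_2\<close>)
    finally show ?thesis .
  qed
  have "c2 u \<otimes>\<^bsub>envB\<^esub> c2 v = (\<Union>u'\<in>c2 u. \<Union>v'\<in>c2 v. c2 (env_mult H B u' v'))" by (simp add: env_alg_def)
  also have "\<dots> = (\<Union>u'\<in>c2 u. \<Union>v'\<in>c2 v. c2 (bar_act H B u v))" by (intro SUP_cong HOL.refl e)
  also have "\<dots> = c2 (bar_act H B u v)" using ne by auto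
  finally show ?thesis .
qed

lemma env_add: assumes "u \<in> fsums 2" "v \<in> fsums 2" shows "c2 u \<oplus>\<^bsub>envB\<^esub> c2 v = c2 (u + v)"
proof -
  have "c2 u \<oplus>\<^bsub>envB\<^esub> c2 v = c2 u \<oplus>\<^bsub>barB 0\<^esub> c2 v" by (simp add: env_alg_def bar_def numeral_2_eq_2)
  then show ?thesis using sc.bar_add[of u 0 v] assms by (simp add: numeral_2_eq_2)
qed

lemma env_abelian: "abelian_group envB"
  by (rule abelian_group_tens[of _ "scalars B" "Suc 0"]) (simp_all add: env_simps env_add numeral_2_eq_2[symmetric])

end

section \<open>Module axioms and exactness of the bar complex\<close>

context rel_alg begin

lemma bar_act_add: "bar_act H B (p + q) u = bar_act H B p u + bar_act H B q u" "bar_act H B p (u + v) = bar_act H B p u + bar_act H B p v"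
  by (simp_all add: bar_act_def sum_mset.distrib)

lemma bar_act_unit: "p \<in> fsums (Suc (Suc n)) ==> (bar_act H B p {#[1, 1]#}, p) \<in> tens_rel E (Suc (Suc n))"
proof (induction p)
  case empty then show ?case by (simp add: bar_act_def tens_rel.refl)
next
  case (add xs p)
  from add.prems have "length xs = Suc (Suc n)" by simp
  then obtain b z b' where xs: "xs = b # z @ [b']" "length z = n" by (rule list2E)
  have 1: "(bar_act H B {#xs#} {#[1, 1]#}, {#xs#}) \<in> tens_rel E (Suc (Suc n))"
    using bar_act_one[OF xs(2), of b b' 1] by (simp add: xs)
  have 2: "(bar_act H B p {#[1, 1]#}, p) \<in> tens_rel E (Suc (Suc n))" using add by simp
  have e: "add_mset xs p = {#xs#} + p" by simp
  show ?case using tens_rel_add[OF 1 2] unfolding e bar_act_add .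
qed

lemma bar_abelian: "abelian_group (bar' n)"
  by (rule abelian_group_tens[of _ E "Suc n"]) (simp_all add: bar_simps bar_add)

lemma right_module_bar: "right_module env (bar' n)"
  unfolding right_module_def bar_simps env_carrier
proof (intro conjI bar_abelian ballI)
  fix X assume "X \<in> tens E (Suc (Suc n))"
  then obtain p where p: "p \<in> fsums (Suc (Suc n))" and X: "X = cl n p" by (rule tensE)
  have one: "\<one>\<^bsub>env\<^esub> = cl2 {#[1, 1]#}" by (simp add: env_alg_def)
  show "\<one>\<^bsub>env\<^esub> \<odot>\<^bsub>bar' n\<^esub> X = X" using p by (simp add: one X bar_smult tclass_eq[OF bar_act_unit])
  fix U assume "U \<in> tens (scalars B) 2"
  then obtain u where u: "u \<in> fsums 2" and U: "U = cl2 u" by (rule tensE)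
  show "U \<odot>\<^bsub>bar' n\<^esub> X \<in> tens E (Suc (Suc n))" using p u by (simp add: X U bar_smult bar_act_fsums tclass_in_tens)
  {
    fix Y assume "Y \<in> tens E (Suc (Suc n))"
    then obtain q where q: "q \<in> fsums (Suc (Suc n))" and Y: "Y = cl n q" by (rule tensE)
    show "U \<odot>\<^bsub>bar' n\<^esub> (X \<oplus>\<^bsub>bar' n\<^esub> Y) = U \<odot>\<^bsub>bar' n\<^esub> X \<oplus>\<^bsub>bar' n\<^esub> U \<odot>\<^bsub>bar' n\<^esub> Y"
      using p q u by (simp add: X Y U bar_add bar_smult bar_act_fsums bar_act_add)
  }
  fix V assume "V \<in> tens (scalars B) 2"
  then obtain v where v: "v \<in> fsums 2" and V: "V = cl2 v" by (rule tensE)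
  show "(U \<oplus>\<^bsub>env\<^esub> V) \<odot>\<^bsub>bar' n\<^esub> X = U \<odot>\<^bsub>bar' n\<^esub> X \<oplus>\<^bsub>bar' n\<^esub> V \<odot>\<^bsub>bar' n\<^esub> X"
    using p u v by (simp add: X V U env_add bar_add bar_smult bar_act_fsums bar_act_add)
  show "(U \<otimes>\<^bsub>env\<^esub> V) \<odot>\<^bsub>bar' n\<^esub> X = V \<odot>\<^bsub>bar' n\<^esub> (U \<odot>\<^bsub>bar' n\<^esub> X)"
    using p u v by (simp add: X V U env_mult_class bar_smult bar_act_fsums bar_act_fsums2 tclass_eq[OF bar_act_assoc])
qed

lemma dG_altc: "length xs = Suc (Suc (Suc n)) ==> dG n G xs = altc (Suc (Suc n)) G xs"
  by (simp only: dG_eval altc_def lessThan_Suc_atMost)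

lemma bdiff_bdiff: assumes p: "p \<in> fsums (Suc (Suc (Suc (Suc n))))"
  shows "(bdiff n (bdiff (Suc n) p), {#}) \<in> tens_rel E (Suc (Suc n))"
proof (rule tens_rel_separate)
  show "bdiff n (bdiff (Suc n) p) \<in> fsums (Suc (Suc n))" by (intro bdiff_fsums p)
  fix G assume G: "G \<in> BE (Suc (Suc n))"
  have "ev G (bdiff n (bdiff (Suc n) p)) = ev (dG (Suc n) (dG n G)) p"
    by (simp only: ev_bdiff[OF G bdiff_fsums[OF p]] ev_bdiff[OF dG_BE[OF G] p])
  also have "\<dots> = ev (\<lambda>_. 0) p"
  proof (rule ev_cong[OF p])
    fix xs :: "'b list" assume l: "length xs = Suc (Suc (Suc (Suc n)))"
    have "dG (Suc n) (dG n G) xs = altc (Suc (Suc (Suc n))) (altc (Suc (Suc n)) G) xs"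
      unfolding dG_altc[OF l] altc_def[of "Suc (Suc (Suc n))"]
      by (intro sum.cong HOL.refl arg_cong[of _ _ "signed _"] dG_altc) (simp add: length_contract l)
    then show "dG (Suc n) (dG n G) xs = 0" using altc_altc[OF l] by simp
  qed
  finally show "ev G (bdiff n (bdiff (Suc n) p)) = ev G {#}" by simp
qed simp

lemma Cons_BE: assumes G: "G \<in> BE (Suc n)" shows "(\<lambda>ys. G (x # ys)) \<in> BE n"
proof -
  have "(\<lambda>ys. G (x # ys)) \<in> multilin B n"
    by (rule multilinI[OF ml_Cons[OF multilin_ml[OF BE_multilin[OF G]]]]) (simp add: multilin_len[OF BE_multilin[OF G]])
  then show ?thesis using BE_bal[OF G, of _ "x # _"] by (auto simp: BE_def)
qed

text \<open>Prefixing 1 is the contracting homotopy: d(1, x) = x - (1, dx). By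
  \<open>Cons_BE\<close> prefixing respects classes over E, so it suffices that dx vanishes as a
  class.\<close>

lemma bdiff_homotopy: assumes p: "p \<in> fsums (Suc (Suc (Suc n)))" and z: "(bdiff n p, {#}) \<in> tens_rel E (Suc (Suc n))"
  shows "(bdiff (Suc n) (image_mset ((#) 1) p), p) \<in> tens_rel E (Suc (Suc (Suc n)))"
proof (rule tens_rel_separate)
  have p1: "image_mset ((#) 1) p \<in> fsums (Suc (Suc (Suc (Suc n))))" using p by (auto simp: fsums_def)
  show "bdiff (Suc n) (image_mset ((#) 1) p) \<in> fsums (Suc (Suc (Suc n)))" by (rule bdiff_fsums[OF p1])
  fix G assume G: "G \<in> BE (Suc (Suc (Suc n)))"
  have "ev G (bdiff (Suc n) (image_mset ((#) 1) p)) = ev (\<lambda>xs. dG (Suc n) G (1 # xs)) p"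
    by (simp add: ev_bdiff[OF G p1] image_mset.compositionality comp_def)
  also have "\<dots> = ev (\<lambda>xs. G xs - dG n (\<lambda>ys. G (1 # ys)) xs) p"
  proof (rule ev_cong[OF p])
    fix xs :: "'b list" assume l: "length xs = Suc (Suc (Suc n))"
    then obtain x xs' where xs: "xs = x # xs'" by (cases xs) auto
    show "dG (Suc n) G (1 # xs) = G xs - dG n (\<lambda>ys. G (1 # ys)) xs"
      using l by (simp add: dG_altc xs altc_Cons)
  qed
  also have "\<dots> = ev G p - ev (dG n (\<lambda>ys. G (1 # ys))) p" by (induction p) simp_all
  also have "ev (dG n (\<lambda>ys. G (1 # ys))) p = 0"
    using ev_BE[OF Cons_BE[OF G] z] by (simp add: ev_bdiff[OF Cons_BE[OF G] p])
  finally show "ev G (bdiff (Suc n) (image_mset ((#) 1) p)) = ev G p" by simp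
qed (rule p)

lemma bar_exact: "{X \<in> carrier (bar' (Suc n)). bar_diff E n X = \<zero>\<^bsub>bar' n\<^esub>} = bar_diff E (Suc n) ` carrier (bar' (Suc (Suc n)))"
  unfolding bar_simps
proof (intro equalityI subsetI)
  fix X assume "X \<in> {X \<in> tens E (Suc (Suc (Suc n))). bar_diff E n X = cl n {#}}"
  then obtain p where p: "p \<in> fsums (Suc (Suc (Suc n)))" and X: "X = cl (Suc n) p" and z: "bar_diff E n X = cl n {#}" by (auto elim: tensE)
  have "(bdiff n p, {#}) \<in> tens_rel E (Suc (Suc n))"
    using z p by (simp add: X bar_diff_class tclass_eq_iff bdiff_fsums)
  from tclass_eq[OF bdiff_homotopy[OF p this]] have "X = bar_diff E (Suc n) (cl (Suc (Suc n)) (image_mset ((#) 1) p))"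
    using p by (subst bar_diff_class) (auto simp: X fsums_def)
  then show "X \<in> bar_diff E (Suc n) ` tens E (Suc (Suc (Suc (Suc n))))"
    using p by (auto simp: fsums_def intro!: image_eqI[OF _ tclass_in_tens])
next
  fix X assume "X \<in> bar_diff E (Suc n) ` tens E (Suc (Suc (Suc (Suc n))))"
  then obtain p where p: "p \<in> fsums (Suc (Suc (Suc (Suc n))))" and X: "X = bar_diff E (Suc n) (cl (Suc (Suc n)) p)" by (auto elim: tensE)
  show "X \<in> {X \<in> tens E (Suc (Suc (Suc n))). bar_diff E n X = cl n {#}}"
    using p by (simp add: X bar_diff_class bdiff_fsums tclass_in_tens tclass_eq[OF bdiff_bdiff])
qed

end

context braided_mod_alg begin

lemma ml_coef: "ml (\<lambda>ys. bs (coef \<gamma> ys) w)"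
  by (rule mlI) (use coef_klin in \<open>auto simp: klin_def VB.scale_left_distrib\<close>)

text \<open>The coordinate of \<open>b \<otimes> x \<otimes> b' = (1 \<otimes> S(r\<^sub>j) \<cdot> x \<otimes> 1) (r\<^sup>j \<cdot> b \<otimes> b')\<close> at \<open>1 \<otimes> \<gamma> \<otimes> 1\<close>.\<close>

definition kmap :: "'b list => 'b list => 'b list" where
  "kmap \<gamma> xs = [rsum (\<lambda>s t. TA (\<lambda>ys. bs (coef \<gamma> ys) (ac t (hd xs))) (S s) (butlast (tl xs))), last xs]"

lemma kmap_multilin: assumes G: "G \<in> multilin B 2"
  shows "(\<lambda>xs. if length xs = Suc (Suc n) then G (kmap \<gamma> xs) else 0) \<in> multilin B (Suc (Suc n))"
proof (rule ml_guardI)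
  note m = multilin_ml[OF G]
  fix us vs :: "'b list" assume l: "Suc (length us + length vs) = Suc (Suc n)"
  then consider vs' v where "us = []" "vs = vs' @ [v]" | u us' where "us = u # us'" "vs = []"
     | u us' vs' v where "us = u # us'" "vs = vs' @ [v]"
    by (cases us; cases vs rule: rev_cases) auto
  then show "klin bs bs (\<lambda>a. G (kmap \<gamma> (us @ a # vs)))"
  proof cases
    case 1
    then show ?thesis by (simp add: kmap_def) (intro klins m)
  next
    case 2
    then show ?thesis by (simp add: kmap_def) (intro klins m)
  next
    case 3
    have "butlast (us' @ a # vs' @ [v]) = us' @ a # vs'" for a by (simp add: butlast_append)
    then show ?thesis using 3 by (simp add: kmap_def) (intro klins m klin_TA_slot ml_coef)
  qed
qed

lemma ev_kmap: assumes "r \<in> fsums (Suc (Suc n))"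
  shows "ev G (image_mset (kmap \<gamma>) r) = ev (\<lambda>xs. if length xs = Suc (Suc n) then G (kmap \<gamma> xs) else 0) r"
  unfolding image_mset.compositionality comp_def by (rule ev_cong[OF assms]) simp

lemma kmap_fsums: "image_mset (kmap \<gamma>) r \<in> fsums 2"
  by (auto simp: fsums_def kmap_def)

lemma rel2_separate: assumes "p \<in> fsums 2" "q \<in> fsums 2" "\<And>G. G \<in> multilin B 2 ==> ev G p = ev G q"
  shows "(p, q) \<in> tens_rel (scalars B) 2"
  unfolding numeral_2_eq_2 by (rule sc.tens_rel_separate) (use assms sc.BE_multilin in \<open>auto simp: numeral_2_eq_2\<close>)

lemma kmap_rel: assumes r: "(p, q) \<in> tens_rel (scalars B) (Suc (Suc n))"
  shows "(image_mset (kmap \<gamma>) p, image_mset (kmap \<gamma>) q) \<in> tens_rel (scalars B) 2"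
proof (rule rel2_separate[OF kmap_fsums kmap_fsums])
  fix G assume "G \<in> multilin B 2"
  from sc.ev_scalars[OF kmap_multilin[OF this] r] show "ev G (image_mset (kmap \<gamma>) p) = ev G (image_mset (kmap \<gamma>) q)"
    unfolding ev_kmap[OF conjunct1[OF tens_rel_fsums[OF r]]] ev_kmap[OF conjunct2[OF tens_rel_fsums[OF r]]] .
qed

definition tau :: "'b list => 'b list multiset set => 'b list multiset set" where
  "tau \<gamma> X = (\<Union>p\<in>X. c2 (image_mset (kmap \<gamma>) p))"

lemma tau_class: "p \<in> fsums (Suc (Suc n)) ==> tau \<gamma> (cB n p) = c2 (image_mset (kmap \<gamma>) p)"
  unfolding tau_def by (rule UN_tclass) (assumption, rule tclass_eq[OF kmap_rel[OF tens_rel.sym]])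

lemma coef_basis: "length \<gamma> = length \<delta> ==> set \<gamma> \<subseteq> Bas ==> set \<delta> \<subseteq> Bas ==> coef \<gamma> \<delta> = (if \<gamma> = \<delta> then 1 else 0)"
  by (induction \<gamma> \<delta> rule: list_induct2) (auto simp: VB.representation_basis[OF Bas(1)])

text \<open>The coordinate function and the action contribute one copy of R each. The first hexagon
  merges them into S(s_1) s_2, a counit, so the coordinates of a multiple of a basis element are
  those of \<delta>.\<close>

lemma gact_kmap: assumes G: "G \<in> multilin B 2" and l: "length \<delta> = n"
  shows "sc.gact (\<lambda>xs. if length xs = Suc (Suc n) then G (kmap \<gamma> xs) else 0) [c, c'] (1 # \<delta> @ [1]) = bs (coef \<gamma> \<delta>) (G [c, c'])"
proof -
  note m = multilin_ml[OF G]
  let ?Gk = "\<lambda>xs. if length xs = Suc (Suc n) then G (kmap \<gamma> xs) else 0"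
  define F where "F a t = TA (\<lambda>ys. bs (coef \<gamma> ys) (G [ac t c, c'])) a \<delta>" for a t
  have k: "klin s hs \<psi> ==> klin s bs (\<lambda>v. F (\<psi> v) t)" "klin s hs \<psi> ==> klin s bs (\<lambda>v. F a (\<psi> v))" for s \<psi> a t
    unfolding F_def by (intro klin_TA ml_coef | assumption | intro klin_TA_param klin_bs ml_slot0 m klins)+
  have L: "klin bs bs (\<lambda>v. G [v, c'])" by (rule ml_slot0[OF m klin_id])
  have Gk: "?Gk (ac t c # z @ [c']) = rsum (\<lambda>s' t'. TA (\<lambda>ys. bs (coef \<gamma> ys) (G [ac (t' * t) c, c'])) (S s') z)" if "length z = n" for t z
    using that by (simp add: kmap_def klin_psum[OF L] TA_klin[OF L] klin_scale[OF L] act_mult)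
  have "sc.gact ?Gk [c, c'] (1 # \<delta> @ [1]) = rsum (\<lambda>s t. TA (\<lambda>z. ?Gk (ac t c # z @ [c'])) s \<delta>)"
    by (rule sc.gact_units[OF sc.sc_BE[OF kmap_multilin[OF G]]])
  also have "\<dots> = rsum (\<lambda>s t. TA (\<lambda>z. rsum (\<lambda>s' t'. TA (\<lambda>ys. bs (coef \<gamma> ys) (G [ac (t' * t) c, c'])) (S s') z)) s \<delta>)"
    by (rule psum_cong, rule TA_cong_len, rule Gk) (simp add: l)
  also have "\<dots> = rsum (\<lambda>s t. rsum (\<lambda>s' t'. F (S s' * s) (t' * t)))"
    by (simp only: TA_psum TA_mult[OF ml_coef] F_def)
  also have "\<dots> = rsum (\<lambda>s' t'. rsum (\<lambda>s t. F (S s' * s) (t' * t)))" by (rule psum_swap)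
  also have "\<dots> = rsum (\<lambda>s t. dsum s (\<lambda>a b. F (S a * b) t))"
    by (rule rsum_hex1[of bs, symmetric]) (intro k klins)+
  also have "\<dots> = rsum (\<lambda>s t. bs (eps s) (F 1 t))"
    by (rule psum_cong, rule dsum_antipode1) (intro k klins)
  also have "\<dots> = F 1 1" by (rule rsum_eps1) (intro k klins)
  also have "\<dots> = bs (coef \<gamma> \<delta>) (G [c, c'])" by (simp add: F_def TA_one[OF ml_coef] act_one)
  finally show ?thesis .
qed

lemma tau_dual: assumes u: "u \<in> fsums 2" and g: "length \<gamma> = n" "set \<gamma> \<subseteq> Bas" and d: "length \<delta> = n" "set \<delta> \<subseteq> Bas"
  shows "tau \<gamma> (c2 u \<odot>\<^bsub>barB n\<^esub> cB n {#1 # \<delta> @ [1]#}) = (if \<gamma> = \<delta> then c2 u else c2 {#})"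
proof -
  have q: "{#1 # \<delta> @ [1]#} \<in> fsums (Suc (Suc n))" using d by simp
  have "(image_mset (kmap \<gamma>) (bar_act H B {#1 # \<delta> @ [1]#} u), if \<gamma> = \<delta> then u else {#}) \<in> tens_rel (scalars B) 2"
  proof (rule rel2_separate[OF kmap_fsums])
    show "(if \<gamma> = \<delta> then u else {#}) \<in> fsums 2" using u by simp
    fix G assume G: "G \<in> multilin B 2"
    let ?Gk = "\<lambda>xs. if length xs = Suc (Suc n) then G (kmap \<gamma> xs) else 0"
    have "ev G (image_mset (kmap \<gamma>) (bar_act H B {#1 # \<delta> @ [1]#} u)) = ev ?Gk (bar_act H B {#1 # \<delta> @ [1]#} u)"
      by (rule ev_kmap[OF sc.bar_act_fsums[OF q]])
    also have "\<dots> = ev (\<lambda>us. sc.gact ?Gk us (1 # \<delta> @ [1])) u"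
      unfolding sc.ev_bar_act[OF sc.sc_BE[OF kmap_multilin[OF G]] q] by simp
    also have "\<dots> = ev (\<lambda>us. bs (coef \<gamma> \<delta>) (G us)) u"
      by (rule ev_cong[OF u], erule list22E) (simp only: gact_kmap[OF G d(1)])
    also have "\<dots> = ev G (if \<gamma> = \<delta> then u else {#})" using g d by (simp add: coef_basis)
    finally show "ev G (image_mset (kmap \<gamma>) (bar_act H B {#1 # \<delta> @ [1]#} u)) = ev G (if \<gamma> = \<delta> then u else {#})" .
  qed
  from tclass_eq[OF this] show ?thesis
    by (simp add: sc.bar_smult[OF q u] tau_class[OF sc.bar_act_fsums[OF q]])
qed

lemma ml_expand: assumes F: "finite F"
  shows "ml g ==> (\<And>y b. y \<in> set ys ==> rep y b \<noteq> 0 ==> b \<in> F) ==> g ys = (\<Sum>\<gamma>\<in>Lists F (length ys). bs (coef \<gamma> ys) (g \<gamma>))"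
proof (induction ys arbitrary: g)
  case Nil
  have "Lists F 0 = {[]}" by auto
  then show ?case by simp
next
  case (Cons y ys)
  have y: "(\<Sum>b\<in>F. bs (rep y b) b) = y" using Cons.prems(2)[of y] by (intro rep_sum F) auto
  have L: "klin bs bs (\<lambda>v. g (v # ys))" by (rule ml_slot0[OF Cons.prems(1) klin_id])
  have "g (y # ys) = g ((\<Sum>b\<in>F. bs (rep y b) b) # ys)" by (simp add: y)
  also have "\<dots> = (\<Sum>b\<in>F. bs (rep y b) (g (b # ys)))"
    using F by (induction F) (simp_all add: klin_zero[OF L] klin_add[OF L] klin_scale[OF L])
  also have "\<dots> = (\<Sum>b\<in>F. \<Sum>\<gamma>\<in>Lists F (length ys). bs (coef (b # \<gamma>) (y # ys)) (g (b # \<gamma>)))"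
  proof (rule sum.cong[OF HOL.refl])
    fix b
    have "g (b # ys) = (\<Sum>\<gamma>\<in>Lists F (length ys). bs (coef \<gamma> ys) (g (b # \<gamma>)))"
      by (rule Cons.IH[OF ml_Cons[OF Cons.prems(1)]]) (use Cons.prems in auto)
    then show "bs (rep y b) (g (b # ys)) = (\<Sum>\<gamma>\<in>Lists F (length ys). bs (coef (b # \<gamma>) (y # ys)) (g (b # \<gamma>)))"
      by (simp add: VB.scale_sum_right)
  qed
  also have "\<dots> = (\<Sum>\<gamma>\<in>Lists F (length (y # ys)). bs (coef \<gamma> (y # ys)) (g \<gamma>))"
    by (simp only: sum_Lists_Suc[OF F] list.size add_Suc_right add_0_right)
  finally show ?case .
qed

text \<open>Stated as an induction principle, because subgroups generated by a set are not otherwise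
  in use. Tensors are reduced to basis multiples in two stages, \<open>c1\<close> and
  \<open>c2\<close>.\<close>

lemma bar_span:
  assumes X0: "\<zero>\<^bsub>barB n\<^esub> \<in> X" and Xadd: "\<And>x y. x \<in> X ==> y \<in> X ==> x \<oplus>\<^bsub>barB n\<^esub> y \<in> X"
    and Xq: "\<And>u \<gamma>. u \<in> fsums 2 ==> length \<gamma> = n ==> set \<gamma> \<subseteq> Bas ==> c2 u \<odot>\<^bsub>barB n\<^esub> cB n {#1 # \<gamma> @ [1]#} \<in> X"
  shows "carrier (barB n) \<subseteq> X"
proof -
  have add_X: "cB n (p + q) \<in> X" if "cB n p \<in> X" "cB n q \<in> X" "p \<in> fsums (Suc (Suc n))" "q \<in> fsums (Suc (Suc n))" for p q
    using Xadd[OF that(1,2)] that by (simp add: sc.bar_add)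
  have zero: "cB n {#} \<in> X" using X0 by (simp add: sc.bar_simps)
  have sum: "(\<And>i. i \<in> I ==> f i \<in> fsums (Suc (Suc n)) \<and> cB n (f i) \<in> X) ==> cB n (sum f I) \<in> X" for f and I :: "'b list set"
    by (induction I rule: infinite_finite_induct) (auto simp: zero intro!: add_X fsums_sum)
  have sumM: "(\<And>i. i \<in># M ==> f i \<in> fsums (Suc (Suc n)) \<and> cB n (f i) \<in> X) ==> cB n (\<Sum>i\<in>#M. f i) \<in> X" for f and M :: "'b list multiset"
    by (induction M) (auto simp: zero intro!: add_X fsums_sum_mset)
  have psum: "(\<And>s t. f s t \<in> fsums (Suc (Suc n)) \<and> cB n (f s t) \<in> X) ==> cB n (psum R f) \<in> X" for f and R :: "('h \<times> 'h) list"
    by (induction R) (auto simp: zero intro!: add_X fsums_psum)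
  \<comment> \<open>With outer factors 1, expand x in the basis and move the coordinates into the
    first factor of u.\<close>
  have c1: "cB n (bar_act H B {#1 # x @ [1]#} u) \<in> X" if l: "length x = n" and u: "u \<in> fsums 2" for x u
  proof -
    define F where "F = (\<Union>y\<in>set x. {b. rep y b \<noteq> 0})"
    have F: "finite F" unfolding F_def by (intro finite_UN_I finite_set rep_finite)
    have FB: "F \<subseteq> Bas" using VB.representation_ne_zero by (auto simp: F_def)
    define v where "v \<gamma> = image_mset (\<lambda>us. [bs (coef \<gamma> x) (us ! 0), us ! 1]) u" for \<gamma>
    have v: "v \<gamma> \<in> fsums 2" for \<gamma> by (auto simp: v_def fsums_def)
    let ?q = "\<Sum>\<gamma>\<in>Lists F n. bar_act H B {#1 # \<gamma> @ [1]#} (v \<gamma>)"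
    have fx: "{#1 # x @ [1]#} \<in> fsums (Suc (Suc n))" using l by simp
    have f\<gamma>: "bar_act H B {#1 # \<gamma> @ [1]#} (v \<gamma>) \<in> fsums (Suc (Suc n))" if "\<gamma> \<in> Lists F n" for \<gamma>
      using that by (intro sc.bar_act_fsums) simp
    have "(bar_act H B {#1 # x @ [1]#} u, ?q) \<in> tens_rel (scalars B) (Suc (Suc n))"
    proof (rule sc.tens_rel_separate)
      show "bar_act H B {#1 # x @ [1]#} u \<in> fsums (Suc (Suc n))" by (rule sc.bar_act_fsums[OF fx])
      show "?q \<in> fsums (Suc (Suc n))" by (rule fsums_sum[OF f\<gamma>])
      fix G assume G: "G \<in> sc.BE (Suc (Suc n))"
      have "ev G (bar_act H B {#1 # x @ [1]#} u) = ev (\<lambda>us. sc.gact G us (1 # x @ [1])) u"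
        unfolding sc.ev_bar_act[OF G fx] by simp
      also have "\<dots> = ev (\<lambda>us. \<Sum>\<gamma>\<in>Lists F n. sc.gact G [bs (coef \<gamma> x) (us ! 0), us ! 1] (1 # \<gamma> @ [1])) u"
      proof (rule ev_cong[OF u])
        fix us :: "'b list" assume lu: "length us = 2"
        then obtain c c' where us: "us = [c, c']" by (rule list22E)
        have "sc.gact G us (1 # x @ [1]) = (\<Sum>\<gamma>\<in>Lists F (length x). bs (coef \<gamma> x) (sc.gact G us (1 # \<gamma> @ [1])))"
          by (rule ml_expand[OF F ml_mid5[OF multilin_ml[OF sc.BE_multilin[OF sc.gact_BE[OF G]]]]]) (auto simp: F_def)
        also have "\<dots> = (\<Sum>\<gamma>\<in>Lists F n. sc.gact G [bs (coef \<gamma> x) c, c'] (1 # \<gamma> @ [1]))"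
        proof (rule sum.cong)
          fix \<gamma> assume "\<gamma> \<in> Lists F n"
          then have "length (1 # \<gamma> @ [1]) = Suc (Suc n)" by simp
          from klin_scale[OF ml_slot0[OF multilin_ml[OF sc.gact_multilin[OF G this]] klin_id], of "coef \<gamma> x" c "[c']"]
          show "bs (coef \<gamma> x) (sc.gact G us (1 # \<gamma> @ [1])) = sc.gact G [bs (coef \<gamma> x) c, c'] (1 # \<gamma> @ [1])" by (simp add: us)
        qed (simp add: l)
        finally show "sc.gact G us (1 # x @ [1]) = (\<Sum>\<gamma>\<in>Lists F n. sc.gact G [bs (coef \<gamma> x) (us ! 0), us ! 1] (1 # \<gamma> @ [1]))" by (simp add: us)
      qed
      also have "\<dots> = (\<Sum>\<gamma>\<in>Lists F n. ev (\<lambda>us. sc.gact G us (1 # \<gamma> @ [1])) (v \<gamma>))"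
        unfolding v_def image_mset.compositionality comp_def by (induction u) (simp_all add: sum.distrib)
      also have "\<dots> = ev G ?q"
        unfolding ev_sum
      proof (rule sum.cong[OF HOL.refl])
        fix \<gamma> assume "\<gamma> \<in> Lists F n"
        then have "{#1 # \<gamma> @ [1]#} \<in> fsums (Suc (Suc n))" by simp
        from sc.ev_bar_act[OF G this, of "v \<gamma>"]
        show "ev (\<lambda>us. sc.gact G us (1 # \<gamma> @ [1])) (v \<gamma>) = ev G (bar_act H B {#1 # \<gamma> @ [1]#} (v \<gamma>))" by simp
      qed
      finally show "ev G (bar_act H B {#1 # x @ [1]#} u) = ev G ?q" .
    qed
    moreover have "cB n ?q \<in> X"
    proof (rule sum, rule conjI[OF f\<gamma>])
      fix \<gamma> assume "\<gamma> \<in> Lists F n"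
      then show "cB n (bar_act H B {#1 # \<gamma> @ [1]#} (v \<gamma>)) \<in> X" using Xq[OF v, of \<gamma> \<gamma>] FB v by (simp add: sc.bar_smult) blast
    qed
    ultimately show ?thesis by (simp add: tclass_eq)
  qed
  \<comment> \<open>General outer factors are produced by acting on tensors with outer factors 1, as
    in \<open>gact_expand\<close>.\<close>
  have c2: "cB n {#xs#} \<in> X" if "length xs = Suc (Suc n)" for xs
  proof -
    obtain b x b' where xs: "xs = b # x @ [b']" and l: "length x = n" using \<open>length xs = _\<close> by (rule list2E)
    \<comment> \<open>The empty inner tensor is treated apart because \<open>tact\<close> does not
      act by the counit there.\<close>
    let ?q = "if x = [] then bar_act H B {#1 # x @ [1]#} {#[b, b']#} else
      rsum (\<lambda>s t. \<Sum>z\<in>#tact H B (S s) x. bar_act H B {#1 # z @ [1]#} {#[ac t b, b']#})"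
    have fz: "bar_act H B {#1 # z @ [1]#} {#[c, b']#} \<in> fsums (Suc (Suc n))" if "length z = n" for z c
      using that by (intro sc.bar_act_fsums) simp
    have q: "?q \<in> fsums (Suc (Suc n))"
    proof (cases "x = []")
      case True then show ?thesis using fz[OF l] by simp
    next
      case False
      then show ?thesis unfolding if_not_P[OF False] by (intro fsums_psum fsums_sum_mset fz) (simp add: tact_length l)
    qed
    have "({#xs#}, ?q) \<in> tens_rel (scalars B) (Suc (Suc n))"
    proof (rule sc.tens_rel_separate[OF _ q])
      fix G assume G: "G \<in> sc.BE (Suc (Suc n))"
      note mg = ml_mid5[OF multilin_ml[OF sc.BE_multilin[OF sc.gact_BE[OF G]]]]
      have ge: "ev G (bar_act H B {#1 # z @ [1]#} {#[c, b']#}) = sc.gact G [c, b'] (1 # z @ [1])" if "length z = n" for z c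
        using that sc.ev_bar_act[OF G, of "{#1 # z @ [1]#}" "{#[c, b']#}"] by simp
      have "ev G ?q = rsum (\<lambda>s t. TA (\<lambda>z. sc.gact G [ac t b, b'] (1 # z @ [1])) (S s) x)"
      proof (cases "x = []")
        case True
        then have n: "length ([]::'b list) = n" using l by simp
        have "klin bs bs (\<lambda>c. sc.gact G [c, b'] (1 # [] @ [1]))"
          using ml_slot0[OF multilin_ml[OF sc.gact_multilin[OF G, of "1 # [] @ [1]"]] klin_id, of "[b']"] n by simp
        from klin_comp[OF this klin_act_h[OF klin_id, of b]]
        have "rsum (\<lambda>s t. bs (eps s) (sc.gact G [ac t b, b'] (1 # [] @ [1]))) = sc.gact G [ac 1 b, b'] (1 # [] @ [1])"
          by (rule rsum_eps1)
        then show ?thesis using ge[OF n, of b] True by (simp add: eps_S act_one)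
      next
        case False
        have "(\<Sum>z\<in>#tact H B (S s) x. ev G (bar_act H B {#1 # z @ [1]#} {#[c, b']#})) = TA (\<lambda>z. sc.gact G [c, b'] (1 # z @ [1])) (S s) x" for s c
          unfolding TA_eq_tact[OF mg False, symmetric]
          by (intro arg_cong[where f=sum_mset] image_mset_cong ge) (simp add: tact_length l)
        then show ?thesis unfolding if_not_P[OF False] by (simp only: sum_mset_psum ev_sum_mset)
      qed
      then show "ev G {#xs#} = ev G ?q" using sc.gact_expand[OF G, of b b' x] by (simp add: xs)
    qed (simp add: that)
    moreover have "cB n ?q \<in> X"
    proof (cases "x = []")
      case True then show ?thesis using c1[OF l, of "{#[b, b']#}"] by simp
    next
      case False
      show ?thesis unfolding if_not_P[OF False]
      proof (rule psum, rule conjI)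
        fix s t
        show "(\<Sum>z\<in>#tact H B (S s) x. bar_act H B {#1 # z @ [1]#} {#[ac t b, b']#}) \<in> fsums (Suc (Suc n))"
          by (intro fsums_sum_mset fz) (simp add: tact_length l)
        show "cB n (\<Sum>z\<in>#tact H B (S s) x. bar_act H B {#1 # z @ [1]#} {#[ac t b, b']#}) \<in> X"
          by (rule sumM, intro conjI fz c1) (simp_all add: tact_length l)
      qed
    qed
    ultimately show ?thesis by (simp add: tclass_eq)
  qed
  have "cB n p \<in> X" if "p \<in> fsums (Suc (Suc n))" for p
    using that
  proof (induction p)
    case empty show ?case by (rule zero)
  next
    case (add xs p)
    have "cB n ({#xs#} + p) \<in> X" by (rule add_X) (use add c2 in auto)
    then show ?case by simp
  qed
  then show ?thesis by (auto simp: sc.bar_simps elim: tensE)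
qed

end

section \<open>Comparison of resolutions\<close>

lemma klin_diff: fixes f :: "'x::ab_group_add => 'y::ab_group_add"
  assumes "klin s1 s2 f" shows "f (x - y) = f x - f y"
  using klin_add[OF assms, of "x - y" y] by simp

lemma right_hom_cong: assumes f: "f \<in> right_hom R M N" and M: "right_module R M" and e: "\<And>x. x \<in> carrier M ==> g x = f x"
  shows "g \<in> right_hom R M N"
proof -
  interpret M: abelian_group M using M by (rule right_moduleD)
  show ?thesis by (rule right_homI) (simp_all add: e right_homD[OF f] right_moduleD[OF M])
qed

context braided_mod_alg begin

lemma bar_projective: "projective_right_module envB (barB n)"
proof -
  define Q where "Q = {cB n {#1 # \<gamma> @ [1]#} | \<gamma>. length \<gamma> = n \<and> set \<gamma> \<subseteq> Bas}"
  \<comment> \<open>The coordinate functions are indexed by lists and the dual basis by classes, so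
    each class is assigned one of its index lists.\<close>
  define sel where "sel q = (SOME \<gamma>. (length \<gamma> = n \<and> set \<gamma> \<subseteq> Bas) \<and> q = cB n {#1 # \<gamma> @ [1]#})" for q
  have sel: "(length (sel q) = n \<and> set (sel q) \<subseteq> Bas) \<and> q = cB n {#1 # sel q @ [1]#}" if "q \<in> Q" for q
    unfolding sel_def by (rule someI_ex) (use that in \<open>unfold Q_def, blast\<close>)
  show ?thesis
  proof (rule projective_dual_basis[where Q=Q and \<tau>="\<lambda>q. tau (sel q)", OF env_abelian])
    fix r s assume "r \<in> carrier envB" "s \<in> carrier envB"
    then obtain u v where u: "u \<in> fsums 2" "v \<in> fsums 2" and e: "r = c2 u" "s = c2 v" unfolding env_simps by (elim tensE)
    show "r \<otimes>\<^bsub>envB\<^esub> s \<in> carrier envB" using u by (simp add: e env_simps env_mult_class bar_act_fsums2 tclass_in_tens)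
    fix t assume "t \<in> carrier envB"
    then obtain w where w: "w \<in> fsums 2" and t: "t = c2 w" unfolding env_simps by (elim tensE)
    show "(r \<oplus>\<^bsub>envB\<^esub> s) \<otimes>\<^bsub>envB\<^esub> t = r \<otimes>\<^bsub>envB\<^esub> t \<oplus>\<^bsub>envB\<^esub> s \<otimes>\<^bsub>envB\<^esub> t"
      using u w by (simp add: e t env_mult_class env_add bar_act_fsums2 sc.bar_act_add)
  next
    show "right_module envB (barB n)" by (rule sc.right_module_bar)
    show "Q \<subseteq> carrier (barB n)" by (auto simp: Q_def sc.bar_simps intro!: tclass_in_tens)
  next
    fix q X assume "X \<in> carrier (barB n)"
    then obtain p where p: "p \<in> fsums (Suc (Suc n))" and X: "X = cB n p" unfolding sc.bar_simps by (rule tensE)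
    show "tau (sel q) X \<in> carrier envB" using p by (simp add: X tau_class env_simps tclass_in_tens kmap_fsums)
    fix Y assume "Y \<in> carrier (barB n)"
    then obtain p' where p': "p' \<in> fsums (Suc (Suc n))" and Y: "Y = cB n p'" unfolding sc.bar_simps by (rule tensE)
    show "tau (sel q) (X \<oplus>\<^bsub>barB n\<^esub> Y) = tau (sel q) X \<oplus>\<^bsub>envB\<^esub> tau (sel q) Y"
      using p p' by (simp add: X Y sc.bar_add tau_class[of _ n] env_add kmap_fsums)
  next
    fix q q' r assume q: "q \<in> Q" "q' \<in> Q" and "r \<in> carrier envB"
    then obtain u where u: "u \<in> fsums 2" and r: "r = c2 u" unfolding env_simps by (elim tensE)
    have "tau (sel q) (r \<odot>\<^bsub>barB n\<^esub> q') = tau (sel q) (c2 u \<odot>\<^bsub>barB n\<^esub> cB n {#1 # sel q' @ [1]#})"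
      using sel[OF q(2)] r by simp
    also have "\<dots> = (if sel q = sel q' then c2 u else c2 {#})"
      using sel[OF q(1)] sel[OF q(2)] by (intro tau_dual[OF u]) auto
    also have "sel q = sel q' \<longleftrightarrow> q' = q" using sel[OF q(1)] sel[OF q(2)] by metis
    finally show "tau (sel q) (r \<odot>\<^bsub>barB n\<^esub> q') = (if q' = q then r else \<zero>\<^bsub>envB\<^esub>)" by (simp add: r env_simps)
  next
    fix X assume X: "\<zero>\<^bsub>barB n\<^esub> \<in> X" "\<And>x y. x \<in> X ==> y \<in> X ==> x \<oplus>\<^bsub>barB n\<^esub> y \<in> X"
      "\<And>r q. r \<in> carrier envB ==> q \<in> Q ==> r \<odot>\<^bsub>barB n\<^esub> q \<in> X"
    show "carrier (barB n) \<subseteq> X"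
    proof (rule bar_span[OF X(1,2)])
      fix u :: "'b list multiset" and \<gamma> assume "u \<in> fsums 2" "length \<gamma> = n" "set \<gamma> \<subseteq> Bas"
      then show "c2 u \<odot>\<^bsub>barB n\<^esub> cB n {#1 # \<gamma> @ [1]#} \<in> X"
        by (intro X(3)) (auto simp: env_simps Q_def intro: tclass_in_tens)
    qed
  qed
qed

text \<open>The multiplication of B as an equivariant function on lists. The augmentation agrees
  with \<open>fof 0 mulG\<close> on the bar term and inherits its linearity.\<close>

definition mulG :: "'b list => 'b" where
  "mulG xs = (if length xs = 2 then xs ! 0 * xs ! 1 else 0)"

lemma mulG_multilin: "mulG \<in> multilin B 2"
  unfolding mulG_def[abs_def]
proof (rule ml_guardI)
  fix us vs :: "'b list" assume "Suc (length us + length vs) = 2"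
  then consider v where "us = []" "vs = [v]" | u where "us = [u]" "vs = []" by (cases us; cases vs) auto
  then show "klin bs bs (\<lambda>a. (us @ a # vs) ! 0 * (us @ a # vs) ! 1)" by cases (simp_all, (intro klins)+)
qed

lemma mulG_HomG: "mulG \<in> sc.HomG 0"
  unfolding sc.HomG_def
proof (intro CollectI conjI allI impI)
  note m = mulG_multilin[unfolded numeral_2_eq_2]
  show BE: "mulG \<in> sc.BE (Suc (Suc 0))" by (rule sc.sc_BE[OF m])
  fix c c' and xs :: "'b list" assume "length xs = Suc (Suc 0)"
  then have "length xs = 2" by simp
  then obtain x y where xs: "xs = [x, y]" by (rule list22E)
  have "TA (\<lambda>ys. mulG (rmult (lmult p ys) q)) s [x, y] = dsum s (\<lambda>a b. mulG [p * ac a x, ac b y * q])" for p q s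
    by (subst sc.TA_pair[OF multilin_ml[OF sc.lr_multilin[OF m]]]) (simp add: lmult_def rmult_def)
  then have "sc.gact mulG [c, c'] xs = rsum (\<lambda>s t. dsum s (\<lambda>a b. mulG [ac t c * ac a x, ac b y * c']))"
    unfolding sc.gact_def xs by simp
  also have "\<dots> = rsum (\<lambda>s t. ac t c * ac s (mulG xs) * c')"
    by (simp add: mulG_def xs act_prod psum_mult_left psum_mult_right mult.assoc)
  finally show "sc.gact mulG [c, c'] xs = rsum (\<lambda>s t. ac t c * ac s (mulG xs) * c')" .
qed

lemma bar_aug_class: assumes p: "p \<in> fsums 2" shows "bar_aug (c2 p) = ev mulG p"
proof -
  have e: "ev (\<lambda>xs. xs ! 0 * xs ! 1) q = ev mulG q" if "q \<in> fsums 2" for q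
    by (rule ev_cong[OF that]) (simp add: mulG_def)
  have "bar_aug (c2 p) = ev (\<lambda>xs. xs ! 0 * xs ! 1) p"
    unfolding bar_aug_def
  proof (rule the_elem_tclass[OF p])
    fix q assume q: "(p, q) \<in> tens_rel (scalars B) 2"
    then show "ev (\<lambda>xs. xs ! 0 * xs ! 1) q = ev (\<lambda>xs. xs ! 0 * xs ! 1) p"
      using sc.ev_scalars[OF mulG_multilin q] tens_rel_fsums[OF q] by (simp only: e)
  qed
  then show ?thesis using e[OF p] by simp
qed
lemmas bar_aug_cB = bar_aug_class[unfolded numeral_2_eq_2]

lemma bar_aug_hom: "bar_aug \<in> right_hom envB (barB 0) (reg_mod H B)"
proof (rule right_hom_cong[OF sc.fof_hom[OF mulG_HomG] sc.right_module_bar])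
  fix X assume "X \<in> carrier (barB 0)"
  then obtain p where "p \<in> fsums (Suc (Suc 0))" "X = cB 0 p" unfolding sc.bar_simps by (rule tensE)
  then show "bar_aug X = sc.fof 0 mulG X" by (simp add: sc.fof_class[OF mulG_HomG] bar_aug_cB)
qed

text \<open>The contracting homotopy at the end of the complex: d(1, x, y) = (x, y) - (1, xy), so
  prefixing 1 exhibits an element of the kernel of the augmentation as a boundary.\<close>

lemma bar_exact0: "{X \<in> carrier (barB 0). bar_aug X = 0} = bar_diff (scalars B) 0 ` carrier (barB 1)"
  unfolding sc.bar_simps One_nat_def
proof (intro equalityI subsetI)
  fix X assume "X \<in> {X \<in> tens (scalars B) (Suc (Suc 0)). bar_aug X = 0}"
  then obtain p where p: "p \<in> fsums (Suc (Suc 0))" and X: "X = cB 0 p" and z: "ev mulG p = 0"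
    by (auto elim!: tensE simp: bar_aug_cB)
  have p1: "image_mset ((#) 1) p \<in> fsums (Suc (Suc (Suc 0)))" using p by (auto simp: fsums_def)
  have "(sc.bdiff 0 (image_mset ((#) 1) p), p) \<in> tens_rel (scalars B) (Suc (Suc 0))"
  proof (rule sc.tens_rel_separate[OF sc.bdiff_fsums[OF p1] p])
    fix G assume G: "G \<in> sc.BE (Suc (Suc 0))"
    have L: "klin bs bs (\<lambda>v. G [1, v])" by (rule ml_slot1[OF multilin_ml[OF sc.BE_multilin[OF G]] klin_id])
    have "ev G (sc.bdiff 0 (image_mset ((#) 1) p)) = ev (\<lambda>xs. sc.dG 0 G (1 # xs)) p"
      by (simp add: sc.ev_bdiff[OF G p1] image_mset.compositionality comp_def)
    also have "\<dots> = ev (\<lambda>xs. G xs - G [1, mulG xs]) p"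
    proof (rule ev_cong[OF p])
      fix xs :: "'b list" assume "length xs = Suc (Suc 0)"
      then have "length xs = 2" by simp
      then obtain x y where xs: "xs = [x, y]" by (rule list22E)
      show "sc.dG 0 G (1 # xs) = G xs - G [1, mulG xs]" by (simp add: xs sc.dG_altc altc_Cons altc_def[of 0] mulG_def)
    qed
    also have "\<dots> = ev G p - G [1, ev mulG p]"
      by (induction p) (simp_all add: klin_zero[OF L] klin_add[OF L])
    finally show "ev G (sc.bdiff 0 (image_mset ((#) 1) p)) = ev G p" by (simp add: z klin_zero[OF L])
  qed
  from tclass_eq[OF this] show "X \<in> bar_diff (scalars B) 0 ` tens (scalars B) (Suc (Suc (Suc 0)))"
    by (intro image_eqI[OF _ tclass_in_tens[OF p1]]) (simp add: X sc.bar_diff_class[OF p1])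
next
  fix X assume "X \<in> bar_diff (scalars B) 0 ` tens (scalars B) (Suc (Suc (Suc 0)))"
  then obtain p where p: "p \<in> fsums (Suc (Suc (Suc 0)))" and X: "X = cB 0 (sc.bdiff 0 p)" by (auto elim!: tensE simp: sc.bar_diff_class)
  have "ev mulG (sc.bdiff 0 p) = ev (sc.dG 0 mulG) p"
    by (rule sc.ev_bdiff[OF sc.HomG_BE[OF mulG_HomG] p])
  also have "\<dots> = ev (\<lambda>_. 0) p"
  proof (rule ev_cong[OF p])
    fix xs :: "'b list" assume "length xs = Suc (Suc (Suc 0))"
    then obtain x y z where "xs = [x, y, z]" by (cases xs; cases "tl xs"; cases "tl (tl xs)") auto
    then show "sc.dG 0 mulG xs = 0" by (simp add: sc.dG_altc altc_Cons altc_def[of 0] mulG_def mult.assoc)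
  qed
  finally show "X \<in> {X \<in> tens (scalars B) (Suc (Suc 0)). bar_aug X = 0}"
    using p by (simp add: X bar_aug_cB sc.bdiff_fsums tclass_in_tens)
qed

lemma bar_resolution: "projective_resolution envB (reg_mod H B) (bar H B (scalars B)) (bar_diff (scalars B)) bar_aug"
  unfolding projective_resolution_def reg_simps
proof (intro conjI allI bar_projective sc.bar_diff_hom bar_aug_hom bar_exact0 sc.bar_exact)
  have "x \<in> bar_aug ` carrier (barB 0)" for x
    by (rule image_eqI[of _ _ "c2 {#[1, x]#}"]) (simp_all add: bar_aug_class mulG_def sc.bar_simps numeral_2_eq_2[symmetric] tclass_in_tens)
  then show "bar_aug ` carrier (barB 0) = UNIV" by blast
qed

lemma reg_abelian: "abelian_group (reg_mod H B)"
  by (rule abelian_groupI) (auto simp: reg_simps add.assoc add.commute intro: exI[of _ "- _"])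

lemma reg_klin: assumes "U \<in> carrier envB" shows "klin bs bs (\<lambda>a. U \<odot>\<^bsub>reg_mod H B\<^esub> a)"
proof -
  obtain u where u: "u \<in> fsums 2" and U: "U = c2 u" using assms unfolding env_simps by (rule tensE)
  have k: "klin bs bs (\<lambda>a. rsum (\<lambda>s t. ac t (us ! 0) * ac s a * us ! 1))" for us by (intro klins)
  have "klin bs bs (\<lambda>a. ev (\<lambda>us. g us a) u)" if g: "\<And>us. klin bs bs (g us)" for g
  proof (rule klinI)
    show "ev (\<lambda>us. g us (x + y)) u = ev (\<lambda>us. g us x) u + ev (\<lambda>us. g us y) u" for x y
      by (simp add: klin_add[OF g] sum_mset.distrib)
    show "ev (\<lambda>us. g us (bs c x)) u = bs c (ev (\<lambda>us. g us x) u)" for c x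
      by (induction u) (simp_all add: klin_scale[OF g] VB.scale_right_distrib)
  qed
  from this[OF k]
  show ?thesis unfolding U reg_smult[OF u] .
qed

lemma Hom_cx_simps: "f \<in> cochains (Hom_cx H B P d) n \<longleftrightarrow> f \<in> right_hom envB (P n) (reg_mod H B) \<and> (\<forall>x. x \<notin> carrier (P n) \<longrightarrow> f x = 0)"
  "cdiff (Hom_cx H B P d) n f x = (if x \<in> carrier (P (Suc n)) then f (d n x) else 0)"
  by (simp_all add: Hom_cx_def)

lemma Hom_complex: "mod_alg_complex H B (Hom_cx H B P d)"
proof unfold_locales
  let ?K = "Hom_cx H B P d"
  note r = Hom_cx_simps right_hom_def reg_simps
  show "addsub (cochains ?K n)" for n
    unfolding addsub_def by (auto simp: r klin_zero[OF reg_klin] klin_diff[OF reg_klin])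
  show "(\<lambda>x. bs c (f x)) \<in> cochains ?K n" if "f \<in> cochains ?K n" for f c n
    using that by (auto simp: r VB.scale_right_distrib klin_scale[OF reg_klin])
qed (auto simp: fun_eq_iff Hom_cx_simps)

end

section \<open>Pulling cochains back along chain maps\<close>

locale hom_pair = braided_mod_alg H B + resolution_pair "env_alg H B" "reg_mod H B" P d \<eta> C d' \<eta>'
  for H :: "('k::field, 'h::{ring,monoid_mult}) qt_hopf" and B :: "('k, 'h, 'b::{ring,monoid_mult}) hmod_alg"
  and P :: "nat => ('b list multiset set, 'p) module" and d \<eta> and C :: "nat => ('b list multiset set, 'c) module" and d' \<eta>'
begin

abbreviation "KP \<equiv> Hom_cx H B P d"
abbreviation "KC \<equiv> Hom_cx H B C d'"

sublocale kp: mod_alg_complex H B KP by (rule Hom_complex)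
sublocale kc: mod_alg_complex H B KC by (rule Hom_complex)

text \<open>Composition with h, set to 0 off the carrier so as to stay in the Hom complex. The
  degree of the target of h is left free, so that homotopies are covered as well as chain
  maps.\<close>

definition pull :: "nat => ('p => 'c) => ('c => 'b) => 'p => 'b" where
  "pull n h f x = (if x \<in> carrier (P n) then f (h x) else 0)"

lemma pull_simps: "pull n h (f + g) = pull n h f + pull n h g" "pull n h (f - g) = pull n h f - pull n h g"
  "pull n h 0 = 0" "pull n h (\<lambda>x. bs c (f x)) = (\<lambda>x. bs c (pull n h f x))"
  by (auto simp: pull_def fun_eq_iff)

lemma pull_cochain: assumes h: "h \<in> right_hom envB (P n) (C m)" and f: "f \<in> cochains KC m"
  shows "pull n h f \<in> cochains KP n"
proof -
  have "pull n h f \<in> right_hom envB (P n) (reg_mod H B)"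
    by (rule right_hom_cong[OF right_hom_comp[OF _ h] Pmod, of f]) (use f in \<open>simp_all add: Hom_cx_simps pull_def\<close>)
  then show ?thesis by (simp add: Hom_cx_simps pull_def)
qed

lemma chain_mapD: assumes "chain_map \<phi>"
  shows "\<phi> n \<in> right_hom envB (P n) (C n)" "x \<in> carrier (P (Suc n)) ==> d' n (\<phi> (Suc n) x) = \<phi> n (d n x)"
  using assms by (auto simp: chain_map_def)

lemma pull_cdiff: assumes \<phi>: "chain_map \<phi>"
  shows "cdiff KP n (pull n (\<phi> n) f) = pull (Suc n) (\<phi> (Suc n)) (cdiff KC n f)"
proof
  fix x show "cdiff KP n (pull n (\<phi> n) f) x = pull (Suc n) (\<phi> (Suc n)) (cdiff KC n f) x"
    using right_homD(1)[OF chain_mapD(1)[OF \<phi>]] chain_mapD(2)[OF \<phi>] d_closed by (simp add: Hom_cx_simps pull_def)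
qed

lemma pull_cocycle: "chain_map \<phi> ==> f \<in> cocycles KC n ==> pull n (\<phi> n) f \<in> cocycles KP n"
  unfolding cocycles_def by (auto simp: pull_cdiff pull_simps intro: pull_cochain chain_mapD)

lemma pull_coboundary: "chain_map \<phi> ==> f \<in> coboundaries KC n ==> pull n (\<phi> n) f \<in> coboundaries KP n"
  unfolding coboundaries_def by (cases n) (auto simp: pull_simps pull_cdiff[symmetric] intro!: imageI pull_cochain chain_mapD)

text \<open>Since f vanishes on boundaries, applying f to the homotopy identity leaves f \<phi> - f
  \<psi> = (f s) d. In degree 0 the two pullbacks coincide.\<close>

lemma pull_homotopic: assumes \<phi>: "chain_map \<phi>" and \<psi>: "chain_map \<psi>" and f: "f \<in> cocycles KC n"
  shows "pull n (\<phi> n) f - pull n (\<psi> n) f \<in> coboundaries KP n"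
proof -
  obtain s where s: "\<And>n. s n \<in> right_hom envB (P n) (C (Suc n))"
    "\<And>x. x \<in> carrier (P 0) ==> d' 0 (s 0 x) = \<phi> 0 x \<ominus>\<^bsub>C 0\<^esub> \<psi> 0 x"
    "\<And>n x. x \<in> carrier (P (Suc n)) ==> d' (Suc n) (s (Suc n) x) = (\<phi> (Suc n) x \<ominus>\<^bsub>C (Suc n)\<^esub> \<psi> (Suc n) x) \<ominus>\<^bsub>C (Suc n)\<^esub> s n (d n x)"
    using chain_homotopy[OF \<phi> \<psi>] by blast
  have fh: "f \<in> right_hom envB (C n) (reg_mod H B)" and fc: "f \<in> cochains KC n"
    using f by (auto simp: cocycles_def Hom_cx_simps)
  have fz: "f (d' n y) = 0" if "y \<in> carrier (C (Suc n))" for y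
  proof -
    have "cdiff KC n f y = 0" using f by (simp add: cocycles_def)
    then show ?thesis using that by (simp add: Hom_cx_simps)
  qed
  interpret reg: abelian_group "reg_mod H B" by (rule reg_abelian)
  have rm: "a \<ominus>\<^bsub>reg_mod H B\<^esub> b = a - b" for a b
  proof -
    have "\<ominus>\<^bsub>reg_mod H B\<^esub> b = - b" by (rule reg.minus_equality) (simp_all add: reg_simps)
    then show ?thesis by (simp add: a_minus_def reg_simps)
  qed
  have fd: "f (a \<ominus>\<^bsub>C n\<^esub> b) = f a - f b" if "a \<in> carrier (C n)" "b \<in> carrier (C n)" for a b
    using right_hom_minus[OF fh Cab reg_abelian that] by (simp add: rm)
  interpret Cn: abelian_group "C n" by (rule Cab)
  have cl: "\<phi> n x \<in> carrier (C n)" "\<psi> n x \<in> carrier (C n)" if "x \<in> carrier (P n)" for x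
    using right_homD(1)[OF chain_mapD(1)[OF \<phi>] that] right_homD(1)[OF chain_mapD(1)[OF \<psi>] that] by auto
  show ?thesis
  proof (cases n)
    case 0
    have "pull n (\<phi> n) f - pull n (\<psi> n) f = 0"
    proof
      fix x show "(pull n (\<phi> n) f - pull n (\<psi> n) f) x = 0 x"
      proof (cases "x \<in> carrier (P n)")
        case True
        have "f (\<phi> n x) - f (\<psi> n x) = f (d' 0 (s 0 x))"
          using fd[OF cl[OF True]] s(2)[of x] True by (simp add: 0)
        also have "\<dots> = 0" using fz[OF right_homD(1)[OF s(1), of x n]] True by (simp add: 0)
        finally show ?thesis using True by (simp add: pull_def)
      qed (simp add: pull_def)
    qed
    then show ?thesis by (simp add: 0 coboundaries_def)
  next
    case (Suc m)
    have "pull n (\<phi> n) f - pull n (\<psi> n) f = cdiff KP m (pull m (s m) f)"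
    proof
      fix x show "(pull n (\<phi> n) f - pull n (\<psi> n) f) x = cdiff KP m (pull m (s m) f) x"
      proof (cases "x \<in> carrier (P n)")
        case True
        have x: "x \<in> carrier (P (Suc m))" and sx: "s m (d m x) \<in> carrier (C n)" and sn: "s n x \<in> carrier (C (Suc n))"
          using True right_homD(1)[OF s(1) d_closed, of x m] right_homD(1)[OF s(1)] by (auto simp: Suc)
        have "0 = f (d' n (s n x))" using fz[OF sn] by simp
        also have "\<dots> = f (\<phi> n x \<ominus>\<^bsub>C n\<^esub> \<psi> n x \<ominus>\<^bsub>C n\<^esub> s m (d m x))" using s(3)[OF x] by (simp add: Suc)
        also have "\<dots> = f (\<phi> n x) - f (\<psi> n x) - f (s m (d m x))"
          using fd[OF _ sx] fd[OF cl] cl True by simp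
        finally show ?thesis using x d_closed[OF x] True by (simp add: pull_def Hom_cx_simps)
      qed (simp add: pull_def Hom_cx_simps Suc)
    qed
    moreover have "pull m (s m) f \<in> cochains KP m" using pull_cochain[OF s(1)] fc Suc by simp
    ultimately show ?thesis using kp.coboundaryI Suc by simp
  qed
qed

end

text \<open>One equivalence, \<open>diff\<close>, carries both well-definedness and injectivity;
  surjectivity is asked for only up to coboundaries. This suits maps that are inverse to each other
  up to homotopy.\<close>

lemma coh_bij:
  assumes K: "fun_complex s K" and K': "fun_complex s K'"
    and t: "\<And>f. f \<in> cocycles K n ==> t f \<in> cocycles K' n"
    and diff: "\<And>f g. f \<in> cocycles K n ==> g \<in> cocycles K n ==> t f - t g \<in> coboundaries K' n \<longleftrightarrow> f - g \<in> coboundaries K n"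
    and surj: "\<And>g. g \<in> cocycles K' n ==> \<exists>f\<in>cocycles K n. t f - g \<in> coboundaries K' n"
  shows "f \<in> cocycles K n ==> coh_map K' n t (coh_class K n f) = coh_class K' n (t f)"
    and "bij_betw (coh_map K' n t) (coh K n) (coh K' n)"
proof -
  interpret K: fun_complex s K by fact
  interpret K': fun_complex s K' by fact
  have c: "coh_map K' n t (coh_class K n f) = coh_class K' n (t f)" if f: "f \<in> cocycles K n" for f
  proof (rule K.coh_map_class[OF f])
    fix g assume g: "g \<in> cocycles K n" and d: "f - g \<in> coboundaries K n"
    then have "coh_class K' n (t f) = coh_class K' n (t g)" using f by (simp only: K'.class_eq_iff t diff)
    then show "coh_class K' n (t g) = coh_class K' n (t f)" ..
  qed
  then show "f \<in> cocycles K n ==> coh_map K' n t (coh_class K n f) = coh_class K' n (t f)" .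
  show "bij_betw (coh_map K' n t) (coh K n) (coh K' n)"
  proof (rule bij_betwI')
    fix X Y assume "X \<in> coh K n" "Y \<in> coh K n"
    then obtain f g where f: "f \<in> cocycles K n" "g \<in> cocycles K n" and e: "X = coh_class K n f" "Y = coh_class K n g"
      by (elim K.cohE)
    show "(coh_map K' n t X = coh_map K' n t Y) = (X = Y)"
      unfolding e c[OF f(1)] c[OF f(2)] K.class_eq_iff[OF f] K'.class_eq_iff[OF t t, OF f] diff[OF f] ..
  next
    fix X assume "X \<in> coh K n"
    then show "coh_map K' n t X \<in> coh K' n" by (auto elim!: K.cohE simp: c t K'.class_in_coh)
  next
    fix Y assume "Y \<in> coh K' n"
    then obtain g where g: "g \<in> cocycles K' n" and Y: "Y = coh_class K' n g" by (rule K'.cohE)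
    obtain f where f: "f \<in> cocycles K n" and d: "t f - g \<in> coboundaries K' n" using surj[OF g] by blast
    have "Y = coh_map K' n t (coh_class K n f)"
      unfolding c[OF f] Y using K'.class_eq_iff[OF t[OF f] g] d by simp
    then show "\<exists>X\<in>coh K n. Y = coh_map K' n t X" using K.class_in_coh[OF f] by blast
  qed
qed

text \<open>Different comparison maps induce maps that agree on cohomology classes and may differ
  elsewhere. This lets a structure built from one of them serve for all.\<close>

lemma graded_iso_cong:
  assumes g: "graded_algebra H G mul u" and iso: "graded_iso G mul u G' mul' u' \<Theta>"
    and e: "\<And>n x. x \<in> carrier (G n) ==> \<Theta>' n x = \<Theta> n x"
  shows "graded_iso G mul u G' mul' u' \<Theta>'"
proof -
  have Z: "Z_object H (G n)" for n using g by (simp add: graded_algebra_def)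
  then have "abelian_group (G n)" for n by (simp add: Z_object_def)
  then have "\<And>n x y. x \<in> carrier (G n) ==> y \<in> carrier (G n) ==> x \<oplus>\<^bsub>G n\<^esub> y \<in> carrier (G n)"
    by (simp add: abelian_group_def abelian_monoid.a_closed)
  moreover have "\<And>n c x. x \<in> carrier (G n) ==> kscale (G n) c x \<in> carrier (G n)"
    "\<And>n h x. x \<in> carrier (G n) ==> h \<odot>\<^bsub>G n\<^esub> x \<in> carrier (G n)"
    using Z by (simp_all add: Z_object_def)
  moreover have "\<And>m n x y. x \<in> carrier (G m) ==> y \<in> carrier (G n) ==> mul m n x y \<in> carrier (G (m + n))" "u \<in> carrier (G 0)"
    using g by (simp_all add: graded_algebra_def)
  moreover have "bij_betw (\<Theta>' n) (carrier (G n)) (carrier (G' n))" for n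
    using iso e by (subst bij_betw_cong[of _ _ "\<Theta> n"]) (auto simp: graded_iso_def)
  ultimately show ?thesis using iso unfolding graded_iso_def by (simp add: e)
qed

section \<open>The structure on relative cohomology\<close>

context rel_alg begin

sublocale KB: mod_alg_complex H B KB by (rule Hom_complex)

lemma KB_eq_iff: "F \<in> cochains KB n ==> F' \<in> cochains KB n ==> restrict_bar E n F = restrict_bar E n F' \<longleftrightarrow> F = F'"
  using restrict_bij[of n] by (auto simp: bij_betw_def inj_on_def)

lemma restrict_simps: "restrict_bar E n 0 = 0" "restrict_bar E n (F + F') = restrict_bar E n F + restrict_bar E n F'"
  "restrict_bar E n (F - F') = restrict_bar E n F - restrict_bar E n F'"
  "restrict_bar E n (\<lambda>x. bs c (F x)) = (\<lambda>x. bs c (restrict_bar E n F x))"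
  by (auto simp: restrict_bar_def fun_eq_iff)

lemma restrict_zero_iff: "F \<in> cochains KB n ==> restrict_bar E n F = 0 \<longleftrightarrow> F = 0"
  using KB_eq_iff[OF _ addsubD(1)[OF KB.cochains_addsub], of F n] by (simp add: restrict_simps)

lemma restrict_cocycle: "F \<in> cochains KB n ==> restrict_bar E n F \<in> cocycles CE n \<longleftrightarrow> F \<in> cocycles KB n"
  using cocyclesD[of "restrict_bar E n F" n] cocyclesI[OF restrict_RC, of F n] restrict_zero_iff[OF KB_cdiff, of F n]
  by (auto simp: restrict_cdiff[symmetric] cocycles_def[of KB])

lemma restrict_coboundary: assumes F: "F \<in> cochains KB n"
  shows "restrict_bar E n F \<in> coboundaries CE n \<longleftrightarrow> F \<in> coboundaries KB n"
proof
  assume "restrict_bar E n F \<in> coboundaries CE n"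
  then show "F \<in> coboundaries KB n"
  proof (cases rule: coboundaryE)
    case 1 then show ?thesis using restrict_zero_iff[OF F] by (simp add: coboundaries_def)
  next
    case (2 m g)
    obtain G where G: "G \<in> cochains KB m" "g = restrict_bar E m G" using restrict_bij[of m] 2(2) by (auto simp: bij_betw_def)
    have "F = cdiff KB m G"
      using KB_eq_iff[of F "Suc m" "cdiff KB m G"] F KB_cdiff[OF G(1)] 2 G by (simp add: restrict_cdiff)
    then show ?thesis using KB.coboundaryI[OF G(1)] 2(1) by simp
  qed
next
  assume "F \<in> coboundaries KB n"
  then show "restrict_bar E n F \<in> coboundaries CE n"
    by (cases n) (auto simp: coboundaries_def[of KB] restrict_simps restrict_cdiff intro!: D_coboundary restrict_RC addsubD(1)[OF coboundaries_addsub])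
qed

lemma restrict_surj: assumes "g \<in> cocycles CE n" shows "\<exists>F\<in>cocycles KB n. restrict_bar E n F = g"
proof -
  obtain F where "F \<in> cochains KB n" "g = restrict_bar E n F"
    using restrict_bij[of n] cocyclesD(1)[OF assms] by (auto simp: bij_betw_def)
  then show ?thesis using assms restrict_cocycle by blast
qed

lemma relative_structure:
  "\<exists>hact mul u. (\<forall>i. Z_object H (coh_obj B KB hact i)) \<and> graded_algebra H (coh_obj B KB hact) mul u \<and>
     braided_commutative H (coh_obj B KB hact) mul \<and>
     graded_iso (coh_obj B KB hact) mul u HCE (ind_cup H B CE) (coh_class CE 0 unit_cochain) (\<lambda>n. coh_map CE n (restrict_bar E n))"
proof -
  have fc: "fun_complex bs KB" "fun_complex bs CE" by unfold_locales
  have coc: "F \<in> cocycles KB n ==> F \<in> cochains KB n" for F n by (simp add: cocycles_def)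
  note c = addsubD[OF KB.cocycles_addsub]
  have T: "restrict_bar E n F \<in> cocycles CE n" if "F \<in> cocycles KB n" for n F using restrict_cocycle[OF coc[OF that]] that by simp
  have T2: "restrict_bar E n F - restrict_bar E n G \<in> coboundaries CE n \<longleftrightarrow> F - G \<in> coboundaries KB n"
    if "F \<in> cocycles KB n" "G \<in> cocycles KB n" for n F G
    using restrict_coboundary[OF coc[OF c(2)[OF that]]] by (simp only: restrict_simps)
  have T3: "\<exists>F\<in>cocycles KB n. restrict_bar E n F - g \<in> coboundaries CE n" if "g \<in> cocycles CE n" for n g
    using restrict_surj[OF that] addsubD(1)[OF coboundaries_addsub] by force
  note b = coh_bij[OF fc T T2 T3]
  show ?thesis
  proof (rule KB.transport_structure[OF HCE_graded HCE_commutative])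
    show "bij_betw (coh_map CE n (restrict_bar E n)) (coh KB n) (carrier (HCE n))" for n unfolding cob_simps by (rule b(2))
    show "coh_map CE n (restrict_bar E n) (coh_class KB n (f + g)) =
       coh_map CE n (restrict_bar E n) (coh_class KB n f) \<oplus>\<^bsub>HCE n\<^esub> coh_map CE n (restrict_bar E n) (coh_class KB n g)"
      if "f \<in> cocycles KB n" "g \<in> cocycles KB n" for n f g
      using that by (simp only: b(1) c(4) restrict_simps cob_add T)
    show "coh_map CE n (restrict_bar E n) (coh_class KB n (\<lambda>x. bs c (f x))) = kscale (HCE n) c (coh_map CE n (restrict_bar E n) (coh_class KB n f))"
      if "f \<in> cocycles KB n" for n c f
      using that by (simp only: b(1) KB.cocycles_scale restrict_simps cob_scale T)
  qed
qed

end

section \<open>The structure on Ext computed by a projective resolution\<close>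

locale ext_resolution = braided_mod_alg H B
  for H :: "('k::field, 'h::{ring,monoid_mult}) qt_hopf" and B :: "('k, 'h, 'b::{ring,monoid_mult}) hmod_alg" +
  fixes P :: "nat => ('b list multiset set, 'p) module" and d \<eta>
  assumes res: "projective_resolution (env_alg H B) (reg_mod H B) P d \<eta>"
begin

lemma env0: "\<zero>\<^bsub>envB\<^esub> \<in> carrier envB" "\<zero>\<^bsub>envB\<^esub> \<oplus>\<^bsub>envB\<^esub> \<zero>\<^bsub>envB\<^esub> = \<zero>\<^bsub>envB\<^esub>"
  using env_add[of "{#}" "{#}"] by (simp_all add: env_simps tclass_in_tens)

lemma hom_pairI: "projective_resolution envB (reg_mod H B) X \<delta> \<epsilon> ==> projective_resolution envB (reg_mod H B) Y \<delta>' \<epsilon>' ==>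
  hom_pair H B X \<delta> \<epsilon> Y \<delta>' \<epsilon>'"
  by (intro hom_pair.intro resolution_pair.intro env0 reg_abelian braided_mod_alg_axioms)

sublocale BP: hom_pair H B "bar H B (scalars B)" "bar_diff (scalars B)" bar_aug P d \<eta>
  by (rule hom_pairI[OF bar_resolution res])
sublocale PB: hom_pair H B P d \<eta> "bar H B (scalars B)" "bar_diff (scalars B)" bar_aug
  by (rule hom_pairI[OF res bar_resolution])
sublocale BB: hom_pair H B "bar H B (scalars B)" "bar_diff (scalars B)" bar_aug "bar H B (scalars B)" "bar_diff (scalars B)" bar_aug
  by (rule hom_pairI[OF bar_resolution bar_resolution])
sublocale PP: hom_pair H B P d \<eta> P d \<eta>
  by (rule hom_pairI[OF res res])

lemma comparison_iff: "comparison H B P d \<eta> \<phi> \<longleftrightarrow> BP.chain_map \<phi>"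
  by (simp add: comparison_def BP.chain_map_def)

abbreviation "KP \<equiv> Hom_cx H B P d"
abbreviation "KS \<equiv> Hom_cx H B (bar H B (scalars B)) (bar_diff (scalars B))"
abbreviation "CS \<equiv> CE_cx H B (scalars B)"
abbreviation "rS \<equiv> restrict_bar (scalars B)"
abbreviation "GS \<equiv> coh_obj B CS (ind_act H B CS)"

text \<open>The composite of the two chain maps and the identity both cover the identity of B, so
  they are homotopic and have the same effect on classes.\<close>

lemma pull_pull_bar: assumes \<phi>: "BP.chain_map \<phi>" and \<psi>: "PB.chain_map \<psi>" and F: "F \<in> cocycles KS n"
  shows "BP.pull n (\<phi> n) (PB.pull n (\<psi> n) F) - F \<in> coboundaries KS n"
proof -
  have "BB.chain_map (\<lambda>n x. \<psi> n (\<phi> n x))"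
    unfolding BB.chain_map_def
  proof (intro conjI allI ballI)
    show "(\<lambda>x. \<psi> n (\<phi> n x)) \<in> right_hom envB (barB n) (barB n)" for n
      by (rule right_hom_comp[OF PB.chain_mapD(1)[OF \<psi>] BP.chain_mapD(1)[OF \<phi>]])
  qed (use \<phi> \<psi> in \<open>simp_all add: BP.chain_map_def PB.chain_map_def right_homD(1)[OF BP.chain_mapD(1)[OF \<phi>]]\<close>)
  moreover have "BB.chain_map (\<lambda>n x. x)" by (simp add: BB.chain_map_def right_hom_def)
  ultimately have "BB.pull n (\<lambda>x. \<psi> n (\<phi> n x)) F - BB.pull n (\<lambda>x. x) F \<in> coboundaries KS n"
    by (rule BB.pull_homotopic[OF _ _ F])
  moreover have "BB.pull n (\<lambda>x. \<psi> n (\<phi> n x)) F = BP.pull n (\<phi> n) (PB.pull n (\<psi> n) F)"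
    using right_homD(1)[OF BP.chain_mapD(1)[OF \<phi>]] by (auto simp: BB.pull_def BP.pull_def PB.pull_def fun_eq_iff)
  moreover have "BB.pull n (\<lambda>x. x) F = F"
    using F by (auto simp: BB.pull_def fun_eq_iff cocycles_def Hom_cx_simps)
  ultimately show ?thesis by simp
qed

lemma pull_pull_P: assumes \<phi>: "BP.chain_map \<phi>" and \<psi>: "PB.chain_map \<psi>" and F: "F \<in> cocycles KP n"
  shows "PB.pull n (\<psi> n) (BP.pull n (\<phi> n) F) - F \<in> coboundaries KP n"
proof -
  have "PP.chain_map (\<lambda>n x. \<phi> n (\<psi> n x))"
    unfolding PP.chain_map_def
  proof (intro conjI allI ballI)
    show "(\<lambda>x. \<phi> n (\<psi> n x)) \<in> right_hom envB (P n) (P n)" for n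
      by (rule right_hom_comp[OF BP.chain_mapD(1)[OF \<phi>] PB.chain_mapD(1)[OF \<psi>]])
  qed (use \<phi> \<psi> in \<open>simp_all add: BP.chain_map_def PB.chain_map_def right_homD(1)[OF PB.chain_mapD(1)[OF \<psi>]]\<close>)
  moreover have "PP.chain_map (\<lambda>n x. x)" by (simp add: PP.chain_map_def right_hom_def)
  ultimately have "PP.pull n (\<lambda>x. \<phi> n (\<psi> n x)) F - PP.pull n (\<lambda>x. x) F \<in> coboundaries KP n"
    by (rule PP.pull_homotopic[OF _ _ F])
  moreover have "PP.pull n (\<lambda>x. \<phi> n (\<psi> n x)) F = PB.pull n (\<psi> n) (BP.pull n (\<phi> n) F)"
    using right_homD(1)[OF PB.chain_mapD(1)[OF \<psi>]] by (auto simp: PP.pull_def BP.pull_def PB.pull_def fun_eq_iff)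
  moreover have "PP.pull n (\<lambda>x. x) F = F"
    using F by (auto simp: PP.pull_def fun_eq_iff cocycles_def Hom_cx_simps)
  ultimately show ?thesis by simp
qed

text \<open>The two cochains differ only off the carrier, and restriction evaluates on tensor
  classes alone.\<close>

lemma restrict_pull: "rS n (f \<circ> \<phi> n) = rS n (BP.pull n (\<phi> n) f)"
proof
  fix xs show "rS n (f \<circ> \<phi> n) xs = rS n (BP.pull n (\<phi> n) f) xs"
    by (cases "length xs = n") (simp_all add: restrict_bar_def BP.pull_def sc.bar_simps tclass_in_tens)
qed

lemma ext_coh: assumes \<phi>: "BP.chain_map \<phi>"
  shows "f \<in> cocycles KP n ==> coh_map CS n (\<lambda>f. rS n (f \<circ> \<phi> n)) (coh_class KP n f) = coh_class CS n (rS n (f \<circ> \<phi> n))"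
    and "bij_betw (coh_map CS n (\<lambda>f. rS n (f \<circ> \<phi> n))) (coh KP n) (coh CS n)"
    and "f \<in> cocycles KP n ==> rS n (f \<circ> \<phi> n) \<in> cocycles CS n"
proof -
  obtain \<psi> where \<psi>: "PB.chain_map \<psi>" using PB.chain_map_exists by blast
  have fc: "fun_complex bs KP" "fun_complex bs CS" by unfold_locales
  note c = addsubD[OF BP.kc.cocycles_addsub]
  note b = addsubD[OF BP.kc.coboundaries_addsub]
  have coc: "F \<in> cocycles KS n ==> F \<in> cochains KS n" for F n by (simp add: cocycles_def)
  have T: "rS n (f \<circ> \<phi> n) \<in> cocycles CS n" if "f \<in> cocycles KP n" for f n
    unfolding restrict_pull using BP.pull_cocycle[OF \<phi> that] sc.restrict_cocycle coc by blast
  have cob: "BP.pull n (\<phi> n) f \<in> coboundaries KS n \<longleftrightarrow> f \<in> coboundaries KP n" if f: "f \<in> cocycles KP n" for f n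
  proof
    assume "BP.pull n (\<phi> n) f \<in> coboundaries KS n"
    then have "PB.pull n (\<psi> n) (BP.pull n (\<phi> n) f) \<in> coboundaries KP n" by (rule PB.pull_coboundary[OF \<psi>])
    from b(2)[OF this pull_pull_P[OF \<phi> \<psi> f]] show "f \<in> coboundaries KP n" by simp
  qed (rule BP.pull_coboundary[OF \<phi>])
  have T2: "rS n (f \<circ> \<phi> n) - rS n (g \<circ> \<phi> n) \<in> coboundaries CS n \<longleftrightarrow> f - g \<in> coboundaries KP n"
    if f: "f \<in> cocycles KP n" "g \<in> cocycles KP n" for f g n
  proof -
    have "rS n (f \<circ> \<phi> n) - rS n (g \<circ> \<phi> n) = rS n (BP.pull n (\<phi> n) (f - g))"
      by (simp only: restrict_pull BP.pull_simps sc.restrict_simps)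
    then show ?thesis
      using sc.restrict_coboundary[OF coc[OF BP.pull_cocycle[OF \<phi> c(2)[OF f]]]] cob[OF c(2)[OF f]] by simp
  qed
  have T3: "\<exists>f\<in>cocycles KP n. rS n (f \<circ> \<phi> n) - g \<in> coboundaries CS n" if g: "g \<in> cocycles CS n" for g n
  proof -
    obtain F where F: "F \<in> cocycles KS n" "rS n F = g" using sc.restrict_surj[OF g] by blast
    let ?f = "PB.pull n (\<psi> n) F"
    have f: "?f \<in> cocycles KP n" by (rule PB.pull_cocycle[OF \<psi> F(1)])
    have "rS n (?f \<circ> \<phi> n) - g = rS n (BP.pull n (\<phi> n) ?f - F)"
      by (simp only: restrict_pull F(2)[symmetric] sc.restrict_simps)
    moreover have "BP.pull n (\<phi> n) ?f - F \<in> cochains KS n"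
      by (rule coc, rule addsubD(2)[OF sc.KB.cocycles_addsub BP.pull_cocycle[OF \<phi> f] F(1)])
    ultimately show ?thesis using sc.restrict_coboundary pull_pull_bar[OF \<phi> \<psi> F(1)] f by metis
  qed
  show "f \<in> cocycles KP n ==> coh_map CS n (\<lambda>f. rS n (f \<circ> \<phi> n)) (coh_class KP n f) = coh_class CS n (rS n (f \<circ> \<phi> n))"
    "bij_betw (coh_map CS n (\<lambda>f. rS n (f \<circ> \<phi> n))) (coh KP n) (coh CS n)"
    using coh_bij[OF fc T T2 T3] by blast+
  show "f \<in> cocycles KP n ==> rS n (f \<circ> \<phi> n) \<in> cocycles CS n" by (rule T)
qed

text \<open>Any two comparison maps are chain homotopic, so the images of a cocycle differ by a
  coboundary.\<close>

lemma ext_coh_indep: assumes \<phi>: "BP.chain_map \<phi>" "BP.chain_map \<phi>'" and X: "X \<in> coh KP n"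
  shows "coh_map CS n (\<lambda>f. rS n (f \<circ> \<phi>' n)) X = coh_map CS n (\<lambda>f. rS n (f \<circ> \<phi> n)) X"
proof -
  obtain f where f: "f \<in> cocycles KP n" and X: "X = coh_class KP n f" using X by (rule BP.kc.cohE)
  have "rS n (f \<circ> \<phi>' n) - rS n (f \<circ> \<phi> n) = rS n (BP.pull n (\<phi>' n) f - BP.pull n (\<phi> n) f)"
    by (simp only: restrict_pull sc.restrict_simps)
  moreover have "BP.pull n (\<phi>' n) f - BP.pull n (\<phi> n) f \<in> cocycles KS n"
    by (rule addsubD(2)[OF sc.KB.cocycles_addsub BP.pull_cocycle[OF \<phi>(2) f] BP.pull_cocycle[OF \<phi>(1) f]])
  then have "BP.pull n (\<phi>' n) f - BP.pull n (\<phi> n) f \<in> cochains KS n" by (simp add: cocycles_def)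
  ultimately have "rS n (f \<circ> \<phi>' n) - rS n (f \<circ> \<phi> n) \<in> coboundaries CS n"
    using sc.restrict_coboundary BP.pull_homotopic[OF \<phi>(2,1) f] by metis
  then show ?thesis
    unfolding X ext_coh(1)[OF \<phi>(1) f] ext_coh(1)[OF \<phi>(2) f] sc.class_eq_iff[OF ext_coh(3)[OF \<phi>(2) f] ext_coh(3)[OF \<phi>(1) f]] .
qed

lemma ext_structure:
  "(\<exists>\<phi>. comparison H B P d \<eta> \<phi>) \<and>
   (\<exists>hact mul u. (\<forall>i. Z_object H (coh_obj B KP hact i)) \<and> graded_algebra H (coh_obj B KP hact) mul u \<and>
     braided_commutative H (coh_obj B KP hact) mul \<and>
     (\<forall>\<phi>. comparison H B P d \<eta> \<phi> \<longrightarrow>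
       graded_iso (coh_obj B KP hact) mul u GS (ind_cup H B CS) (coh_class CS 0 unit_cochain)
         (\<lambda>n. coh_map CS n (\<lambda>f. rS n (f \<circ> \<phi> n)))))"
proof -
  obtain \<phi> where \<phi>: "BP.chain_map \<phi>" using BP.chain_map_exists by blast
  note e = ext_coh[OF \<phi>] and c = addsubD[OF BP.kc.cocycles_addsub]
  have comp: "rS n ((f + g) \<circ> \<phi> n) = rS n (f \<circ> \<phi> n) + rS n (g \<circ> \<phi> n)"
    "rS n ((\<lambda>x. bs a (f x)) \<circ> \<phi> n) = (\<lambda>x. bs a (rS n (f \<circ> \<phi> n) x))" for n f g a
    by (simp_all only: restrict_pull BP.pull_simps sc.restrict_simps)
  obtain hact mul u where s: "\<forall>i. Z_object H (coh_obj B KP hact i)" "graded_algebra H (coh_obj B KP hact) mul u"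
    "braided_commutative H (coh_obj B KP hact) mul"
    "graded_iso (coh_obj B KP hact) mul u GS (ind_cup H B CS) (coh_class CS 0 unit_cochain) (\<lambda>n. coh_map CS n (\<lambda>f. rS n (f \<circ> \<phi> n)))"
  proof -
    have "\<exists>hact mul u. (\<forall>i. Z_object H (coh_obj B KP hact i)) \<and> graded_algebra H (coh_obj B KP hact) mul u \<and>
      braided_commutative H (coh_obj B KP hact) mul \<and>
      graded_iso (coh_obj B KP hact) mul u GS (ind_cup H B CS) (coh_class CS 0 unit_cochain) (\<lambda>n. coh_map CS n (\<lambda>f. rS n (f \<circ> \<phi> n)))"
    proof (rule BP.kc.transport_structure[OF sc.HCE_graded sc.HCE_commutative])
      show "bij_betw (coh_map CS n (\<lambda>f. rS n (f \<circ> \<phi> n))) (coh KP n) (carrier (GS n))" for n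
        unfolding sc.cob_simps by (rule e(2))
      show "coh_map CS n (\<lambda>f. rS n (f \<circ> \<phi> n)) (coh_class KP n (f + g)) =
         coh_map CS n (\<lambda>f. rS n (f \<circ> \<phi> n)) (coh_class KP n f) \<oplus>\<^bsub>GS n\<^esub> coh_map CS n (\<lambda>f. rS n (f \<circ> \<phi> n)) (coh_class KP n g)"
        if "f \<in> cocycles KP n" "g \<in> cocycles KP n" for n f g
        using that by (simp only: e(1) c(4) comp sc.cob_add e(3))
      show "coh_map CS n (\<lambda>f. rS n (f \<circ> \<phi> n)) (coh_class KP n (\<lambda>x. bs a (f x))) =
          kscale (GS n) a (coh_map CS n (\<lambda>f. rS n (f \<circ> \<phi> n)) (coh_class KP n f))"
        if "f \<in> cocycles KP n" for n a f
        using that by (simp only: e(1) BP.kc.cocycles_scale comp sc.cob_scale e(3))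
    qed
    then show thesis using that by blast
  qed
  have "graded_iso (coh_obj B KP hact) mul u GS (ind_cup H B CS) (coh_class CS 0 unit_cochain) (\<lambda>n. coh_map CS n (\<lambda>f. rS n (f \<circ> \<phi>' n)))"
    if "BP.chain_map \<phi>'" for \<phi>'
    by (rule graded_iso_cong[OF s(2,4)]) (simp add: BP.kc.cob_simps ext_coh_indep[OF \<phi> that])
  then show ?thesis unfolding comparison_iff using \<phi> s(1-3) by blast
qed

end

theorem theorem1p1:
  fixes H :: "('k::field, 'h::{ring,monoid_mult}) qt_hopf"
    and B :: "('k, 'h, 'b::{ring,monoid_mult}) hmod_alg"
  assumes "quasitriangular_hopf_algebra H"
    and "bij (antipode H)"
    and "module_algebra H B"
  shows
    "(\<forall>(P :: nat \<Rightarrow> ('b list multiset set, 'p) module) d \<eta>.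
        projective_resolution (env_alg H B) (reg_mod H B) P d \<eta> \<longrightarrow>
        (\<exists>\<phi>. comparison H B P d \<eta> \<phi>) \<and>
        (\<exists>hact mul u.
           (\<forall>i. Z_object H (coh_obj B (Hom_cx H B P d) hact i)) \<and>
           graded_algebra H (coh_obj B (Hom_cx H B P d) hact) mul u \<and>
           braided_commutative H (coh_obj B (Hom_cx H B P d) hact) mul \<and>
           (\<forall>\<phi>. comparison H B P d \<eta> \<phi> \<longrightarrow>
              graded_iso (coh_obj B (Hom_cx H B P d) hact) mul u
                (coh_obj B (C_cx H B) (ind_act H B (C_cx H B)))
                (ind_cup H B (C_cx H B)) (coh_class (C_cx H B) 0 unit_cochain)
                (\<lambda>n. coh_map (C_cx H B) n (\<lambda>f. restrict_bar (scalars B) n (f \<circ> \<phi> n))))))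
     \<and>
     (\<forall>E. subalgebra_in_Z B E \<longrightarrow>
        (\<exists>hact mul u.
           (\<forall>i. Z_object H (coh_obj B (Hom_cx H B (bar H B E) (bar_diff E)) hact i)) \<and>
           graded_algebra H (coh_obj B (Hom_cx H B (bar H B E) (bar_diff E)) hact) mul u \<and>
           braided_commutative H (coh_obj B (Hom_cx H B (bar H B E) (bar_diff E)) hact) mul \<and>
           graded_iso (coh_obj B (Hom_cx H B (bar H B E) (bar_diff E)) hact) mul u
             (coh_obj B (CE_cx H B E) (ind_act H B (CE_cx H B E)))
             (ind_cup H B (CE_cx H B E)) (coh_class (CE_cx H B E) 0 unit_cochain)
             (\<lambda>n. coh_map (CE_cx H B E) n (restrict_bar E n))))"
proof -
  interpret braided_mod_alg H B by unfold_locales (rule assms)+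
  \<comment> \<open>The absolute cochain complex is rewritten as the relative one over the scalars,
    the form in which the structure on it was obtained.\<close>
  show ?thesis unfolding C_cx_eq
  proof (intro conjI allI impI)
    fix P :: "nat => ('b list multiset set, 'p) module" and d \<eta>
    assume "projective_resolution (env_alg H B) (reg_mod H B) P d \<eta>"
    then interpret ext_resolution H B P d \<eta> by unfold_locales
    show "\<exists>\<phi>. comparison H B P d \<eta> \<phi>" using ext_structure by (rule conjunct1)
    show "\<exists>hact mul u.
           (\<forall>i. Z_object H (coh_obj B (Hom_cx H B P d) hact i)) \<and>
           graded_algebra H (coh_obj B (Hom_cx H B P d) hact) mul u \<and>
           braided_commutative H (coh_obj B (Hom_cx H B P d) hact) mul \<and>
           (\<forall>\<phi>. comparison H B P d \<eta> \<phi> \<longrightarrow>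
              graded_iso (coh_obj B (Hom_cx H B P d) hact) mul u
                (coh_obj B (CE_cx H B (scalars B)) (ind_act H B (CE_cx H B (scalars B))))
                (ind_cup H B (CE_cx H B (scalars B))) (coh_class (CE_cx H B (scalars B)) 0 unit_cochain)
                (\<lambda>n. coh_map (CE_cx H B (scalars B)) n (\<lambda>f. restrict_bar (scalars B) n (f \<circ> \<phi> n))))"
      using ext_structure by (rule conjunct2)
  next
    fix E assume "subalgebra_in_Z B E"
    then interpret rel_alg H B E by unfold_locales
    show "\<exists>hact mul u.
           (\<forall>i. Z_object H (coh_obj B (Hom_cx H B (bar H B E) (bar_diff E)) hact i)) \<and>
           graded_algebra H (coh_obj B (Hom_cx H B (bar H B E) (bar_diff E)) hact) mul u \<and>
           braided_commutative H (coh_obj B (Hom_cx H B (bar H B E) (bar_diff E)) hact) mul \<and>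
           graded_iso (coh_obj B (Hom_cx H B (bar H B E) (bar_diff E)) hact) mul u
             (coh_obj B (CE_cx H B E) (ind_act H B (CE_cx H B E)))
             (ind_cup H B (CE_cx H B E)) (coh_class (CE_cx H B E) 0 unit_cochain)
             (\<lambda>n. coh_map (CE_cx H B E) n (restrict_bar E n))"
      by (rule relative_structure)
  qed
qed

end
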